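(* Let $w$ be a weight structure on a triangulated category $\mathcal C$ with heart $Hw$, and let $t:\mathcal C\to K_{\mathfrak w}(Hw)$ be the weight complex functor. I (Exactness). $t$ is a weakly exact functor. II (Nilpotency). $I(-,-)=\mathrm{Ker}(\mathcal C(-,-)\to K_{\mathfrak w}(Hw)(t(-),t(-)))$ defines an ideal of morphisms of $\mathcal C$. For any $i\le j\in\mathbb Z$ the restriction $I^{[i,j]}$ of $I$ to $\mathcal C^{[i,j]}$ satisfies $(I^{[i,j]})^{j-i+1}=0$. III (Idempotents). If $X\in\mathcal C^b$, $g\in\mathcal C(X,X)$ and $t(g)=t(g\circ g)$, then $t(g)$ can be lifted to an idempotent $g'\in\mathcal C(X,X)$. IV (Filtration). If $X\in\mathcal C^{w\le i}$ (resp. $X\in\mathcal C^{w\ge i}$) for some $i\in\mathbb Z$, then $t(X)\in K_{\mathfrak w}(Hw)^{\le i}$ (resp. $t(X)\in K_{\mathfrak w}(Hw)^{\ge i}$), i.e. it is homotopy equivalent to a complex concentrated in degrees $\le i$ (resp. $\ge i$). If $X$ is bounded from above, i.e. $X\in \mathcal C^-$ (resp. from below, i.e. $X\in\mathcal C^+$), then the converse implication is valid also. V (Conservativity). If $w$ is non-degenerate, then $t$ is conservative on $\mathcal C^+$ and on $\mathcal C^-$. VI. If $X,Y\in\mathcal C^{[0,1]}$ then $t(X)\cong t(Y)$ implies $X\cong Y$. VII. Let $X\in\mathcal C^{w\ge a}$ for some $a\in\mathbb Z$, and consider the homomorphism $t_*:\mathcal C(X,X')\to K_{\mathfrak w}(Hw)(t(X),t(X'))$.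 Then: 1. If $X'\in\mathcal C^{w\le a}$ then $t_*$ is bijective. 2. If $X'\in\mathcal C^{w\le a+1}$ then $t_*$ is surjective.
   Context: For classes of objects, $D\perp E$ means $\mathcal C(X,Y)=0$ for all $X\in D$, $Y\in E$. A weight structure $w$ on a triangulated category $\mathcal C$ is a pair of subclasses $\mathcal C^{w\le 0},\mathcal C^{w\ge 0}\subset\mathrm{Obj}\,\mathcal C$ such that: (i) both are additive and Karoubi-closed in $\mathcal C$ (contain all retracts of their objects); (ii) $\mathcal C^{w\ge 0}\subset \mathcal C^{w\ge 0}[1]$ and $\mathcal C^{w\le 0}[1]\subset \mathcal C^{w\le 0}$; (iii) $\mathcal C^{w\ge 0}\perp\mathcal C^{w\le 0}[1]$; (iv) for every $X$ there is a distinguished triangle $B[-1]\to X\to A\to B$ with $A\in\mathcal C^{w\le 0}$, $B\in\mathcal C^{w\ge 0}$ (a weight decomposition). Put $\mathcal C^{w\ge l}=\mathcal C^{w\ge 0}[-l]$, $\mathcal C^{w\le l}=\mathcal C^{w\le 0}[-l]$, $\mathcal C^{[j,i]}=\mathcal C^{w\ge j}\cap\mathcal C^{w\le i}$, $\mathcal C^-=\bigcup_i\mathcal C^{w\le i}$, $\mathcal C^+=\bigcup_i\mathcal C^{w\ge i}$, $\mathcal C^b=\mathcal C^+\cap\mathcal C^-$. The heart $Hw$ is the full subcategory with objects $\mathcal C^{w=0}=\mathcal C^{w\ge 0}\cap\mathcal C^{w\le 0}$. $w$ is non-degenerate if $\bigcap_l\mathcal C^{w\ge l}=\bigcap_l\mathcal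 C^{w\le l}=\{0\}$. Weight complex: for each $k$ choose a weight decomposition $X[k]\to X^{w\le k}\xrightarrow{f^k}X^{w\ge k+1}\to X[k+1]$ of $X[k]$. There are unique morphisms $X^{w\le k}[-1]\to X^{w\le k-1}$, $X^{w\ge k+1}[-1]\to X^{w\ge k}$ compatible with these triangles and $\mathrm{id}_X$, and there are $X^k\in\mathcal C^{w=0}$ and distinguished triangles $X^{w\le k}[-1]\to X^{w\le k-1}\xrightarrow{c^k}X^k\xrightarrow{d^k}X^{w\le k}$ and $X^k[-1]\xrightarrow{x^k}X^{w\ge k+1}[-1]\to X^{w\ge k}\xrightarrow{y^k}X^k$ with $c^k=y^k\circ f^{k-1}$, $x^k=(f^k\circ d^k)[-1]$ (a weight Postnikov tower). Then $t(X)=(X^i,h^i)$ with $h^i=c^{i+1}\circ d^i$; $t(g)$ for $g:X\to X'$ is the class of the morphism given by any extension of $g$ to a morphism of weight Postnikov towers. This is a well-defined functor $t:\mathcal C\to K_{\mathfrak w}(Hw)$. For an additive category $A$, $K(A)$ is the homotopy category of cohomological complexes; $Z(X,Y)\subset K(A)(X,Y)$ consists of the morphisms presentable as $(s^{i+1}\circ d^i_X+d^{i-1}_Y\circ t^i)_i$ for some $s^i,t^i\in A(X^i,Y^{i-1})$. $K_{\mathfrak w}(A)$ is $K(A)/Z$ with isomorphic objects (homotopy equivalent complexes) identified, with the obvious shift. A triangle $X\to Y\to Z\to X[1]$ in $K_{\mathfrak w}(A)$ is called distinguished if any two of its sides can be lifted to two sides of some distinguished triangle in $K(A)$. An additive functor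 $\mathcal C\to K_{\mathfrak w}(A)$ on a triangulated $\mathcal C$ is weakly exact if it commutes with shifts and sends distinguished triangles to distinguished triangles. A class of morphisms is a (two-sided) ideal if it is closed under sums and differences in each morphism group, finite direct sums, and compositions with arbitrary morphisms; the power $I^n$ is formed by compositions of $n$ elements of $I$. *)

theory Defs
  imports "HOL-Algebra.Coset"
begin

section \<open>Additive categories\<close>

text \<open>A category is given by its objects, its morphism sets and its operations. The morphism sets
  need not be disjoint; all axioms are relativised to them.\<close>

record ('o, 'm) cat =
  Obj :: "'o set"
  Hom :: "'o \<Rightarrow> 'o \<Rightarrow> 'm set"
  Ident :: "'o \<Rightarrow> 'm"
  Comp :: "'m \<Rightarrow> 'm \<Rightarrow> 'm"  (infixl "\<cdot>\<index>" 75)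
  Zer :: "'o \<Rightarrow> 'o \<Rightarrow> 'm"
  Plus :: "'m \<Rightarrow> 'm \<Rightarrow> 'm"  (infixl "\<boxplus>\<index>" 65)

definition hom_group :: "('o, 'm, 'z) cat_scheme \<Rightarrow> 'o \<Rightarrow> 'o \<Rightarrow> 'm monoid" where
  "hom_group C X Y = \<lparr>carrier = Hom C X Y, monoid.mult = Plus C, one = Zer C X Y\<rparr>"

definition neg :: "('o, 'm, 'z) cat_scheme \<Rightarrow> 'o \<Rightarrow> 'o \<Rightarrow> 'm \<Rightarrow> 'm" where
  "neg C X Y f = inv\<^bsub>hom_group C X Y\<^esub> f"

locale category =
  fixes C :: "('o, 'm, 'z) cat_scheme" (structure)
  assumes ident_in: "X \<in> Obj C \<Longrightarrow> Ident C X \<in> Hom C X X"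
    and comp_in: "\<lbrakk>X \<in> Obj C; Y \<in> Obj C; Z \<in> Obj C; f \<in> Hom C X Y; g \<in> Hom C Y Z\<rbrakk>
      \<Longrightarrow> g \<cdot> f \<in> Hom C X Z"
    and comp_assoc: "\<lbrakk>X \<in> Obj C; Y \<in> Obj C; Z \<in> Obj C; W \<in> Obj C;
        f \<in> Hom C X Y; g \<in> Hom C Y Z; h \<in> Hom C Z W\<rbrakk> \<Longrightarrow> h \<cdot> g \<cdot> f = h \<cdot> (g \<cdot> f)"
    and comp_ident: "\<lbrakk>X \<in> Obj C; Y \<in> Obj C; f \<in> Hom C X Y\<rbrakk> \<Longrightarrow> f \<cdot> Ident C X = f"
    and ident_comp: "\<lbrakk>X \<in> Obj C; Y \<in> Obj C; f \<in> Hom C X Y\<rbrakk> \<Longrightarrow> Ident C Y \<cdot> f = f"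

locale preadditive_category = category +
  assumes hom_comm_group: "\<lbrakk>X \<in> Obj C; Y \<in> Obj C\<rbrakk> \<Longrightarrow> comm_group (hom_group C X Y)"
    and comp_plus: "\<lbrakk>X \<in> Obj C; Y \<in> Obj C; Z \<in> Obj C;
        f \<in> Hom C X Y; f' \<in> Hom C X Y; g \<in> Hom C Y Z\<rbrakk>
      \<Longrightarrow> g \<cdot> (f \<boxplus> f') = (g \<cdot> f) \<boxplus> (g \<cdot> f')"
    and plus_comp: "\<lbrakk>X \<in> Obj C; Y \<in> Obj C; Z \<in> Obj C;
        f \<in> Hom C X Y; g \<in> Hom C Y Z; g' \<in> Hom C Y Z\<rbrakk>
      \<Longrightarrow> (g \<boxplus> g') \<cdot> f = (g \<cdot> f) \<boxplus> (g' \<cdot> f)"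

definition is_iso :: "('o, 'm, 'z) cat_scheme \<Rightarrow> 'o \<Rightarrow> 'o \<Rightarrow> 'm \<Rightarrow> bool" where
  "is_iso C X Y f \<longleftrightarrow> f \<in> Hom C X Y \<and>
     (\<exists>g \<in> Hom C Y X. g \<cdot>\<^bsub>C\<^esub> f = Ident C X \<and> f \<cdot>\<^bsub>C\<^esub> g = Ident C Y)"

definition isomorphic :: "('o, 'm, 'z) cat_scheme \<Rightarrow> 'o \<Rightarrow> 'o \<Rightarrow> bool" where
  "isomorphic C X Y \<longleftrightarrow> X \<in> Obj C \<and> Y \<in> Obj C \<and> (\<exists>f. is_iso C X Y f)"

definition zero_object :: "('o, 'm, 'z) cat_scheme \<Rightarrow> 'o \<Rightarrow> bool" where
  "zero_object C Z \<longleftrightarrow> Z \<in> Obj C \<and>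
     (\<forall>X \<in> Obj C. (\<exists>!f. f \<in> Hom C X Z) \<and> (\<exists>!f. f \<in> Hom C Z X))"

definition biproduct ::
  "('o, 'm, 'z) cat_scheme \<Rightarrow> 'o \<Rightarrow> 'o \<Rightarrow> 'o \<Rightarrow> 'm \<Rightarrow> 'm \<Rightarrow> 'm \<Rightarrow> 'm \<Rightarrow> bool" where
  "biproduct C X Y S e1 e2 p1 p2 \<longleftrightarrow> S \<in> Obj C \<and>
     e1 \<in> Hom C X S \<and> e2 \<in> Hom C Y S \<and> p1 \<in> Hom C S X \<and> p2 \<in> Hom C S Y \<and>
     p1 \<cdot>\<^bsub>C\<^esub> e1 = Ident C X \<and> p2 \<cdot>\<^bsub>C\<^esub> e2 = Ident C Y \<and>
     p1 \<cdot>\<^bsub>C\<^esub> e2 = Zer C Y X \<and> p2 \<cdot>\<^bsub>C\<^esub> e1 = Zer C X Y \<and>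
     (e1 \<cdot>\<^bsub>C\<^esub> p1) \<boxplus>\<^bsub>C\<^esub> (e2 \<cdot>\<^bsub>C\<^esub> p2) = Ident C S"

locale additive_category = preadditive_category +
  assumes zero_object_exists: "\<exists>Z. zero_object C Z"
    and biproduct_exists: "\<lbrakk>X \<in> Obj C; Y \<in> Obj C\<rbrakk> \<Longrightarrow> \<exists>S e1 e2 p1 p2. biproduct C X Y S e1 e2 p1 p2"

definition full_subcat :: "('o, 'm, 'z) cat_scheme \<Rightarrow> 'o set \<Rightarrow> ('o, 'm) cat" where
  "full_subcat C D = \<lparr>Obj = D, Hom = Hom C, Ident = Ident C, Comp = Comp C, Zer = Zer C, Plus = Plus C\<rparr>"

text \<open>Functors act on a morphism together with its source and target, since morphism sets may
  overlap.\<close>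

definition additive_functor :: "('o, 'm, 'y) cat_scheme \<Rightarrow> ('p, 'n, 'z) cat_scheme \<Rightarrow>
    ('o \<Rightarrow> 'p) \<Rightarrow> ('o \<Rightarrow> 'o \<Rightarrow> 'm \<Rightarrow> 'n) \<Rightarrow> bool" where
  "additive_functor C D FO FM \<longleftrightarrow>
     (\<forall>X \<in> Obj C. FO X \<in> Obj D \<and> FM X X (Ident C X) = Ident D (FO X)) \<and>
     (\<forall>X \<in> Obj C. \<forall>Y \<in> Obj C. FM X Y \<in> hom (hom_group C X Y) (hom_group D (FO X) (FO Y))) \<and>
     (\<forall>X \<in> Obj C. \<forall>Y \<in> Obj C. \<forall>Z \<in> Obj C. \<forall>f \<in> Hom C X Y. \<forall>g \<in> Hom C Y Z.
        FM X Z (g \<cdot>\<^bsub>C\<^esub> f) = FM Y Z g \<cdot>\<^bsub>D\<^esub> FM X Y f)"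

definition conservative_on :: "('o, 'm, 'y) cat_scheme \<Rightarrow> ('p, 'n, 'z) cat_scheme \<Rightarrow>
    ('o \<Rightarrow> 'p) \<Rightarrow> ('o \<Rightarrow> 'o \<Rightarrow> 'm \<Rightarrow> 'n) \<Rightarrow> 'o set \<Rightarrow> bool" where
  "conservative_on C D FO FM S \<longleftrightarrow>
     (\<forall>X \<in> S. \<forall>Y \<in> S. \<forall>f \<in> Hom C X Y. is_iso D (FO X) (FO Y) (FM X Y f) \<longrightarrow> is_iso C X Y f)"

section \<open>Ideals of morphisms\<close>

definition mor_ideal :: "('o, 'm, 'z) cat_scheme \<Rightarrow> ('o \<Rightarrow> 'o \<Rightarrow> 'm set) \<Rightarrow> bool" where
  "mor_ideal C I \<longleftrightarrow>
     (\<forall>X \<in> Obj C. \<forall>Y \<in> Obj C. subgroup (I X Y) (hom_group C X Y)) \<and>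
     (\<forall>X \<in> Obj C. \<forall>Y \<in> Obj C. \<forall>Z \<in> Obj C.
        (\<forall>f \<in> I X Y. \<forall>g \<in> Hom C Y Z. g \<cdot>\<^bsub>C\<^esub> f \<in> I X Z) \<and>
        (\<forall>f \<in> Hom C X Y. \<forall>g \<in> I Y Z. g \<cdot>\<^bsub>C\<^esub> f \<in> I X Z)) \<and>
     (\<forall>X \<in> Obj C. \<forall>Y \<in> Obj C. \<forall>X' \<in> Obj C. \<forall>Y' \<in> Obj C. \<forall>f \<in> I X Y. \<forall>f' \<in> I X' Y'.
        \<forall>S e1 e2 p1 p2 S' e1' e2' p1' p2'.
          biproduct C X X' S e1 e2 p1 p2 \<longrightarrow> biproduct C Y Y' S' e1' e2' p1' p2' \<longrightarrow>
          (e1' \<cdot>\<^bsub>C\<^esub> f \<cdot>\<^bsub>C\<^esub> p1) \<boxplus>\<^bsub>C\<^esub> (e2' \<cdot>\<^bsub>C\<^esub> f' \<cdot>\<^bsub>C\<^esub> p2) \<in> I S S')"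

primrec mor_power :: "('o, 'm, 'z) cat_scheme \<Rightarrow> ('o \<Rightarrow> 'o \<Rightarrow> 'm set) \<Rightarrow> nat \<Rightarrow> 'o \<Rightarrow> 'o \<Rightarrow> 'm set" where
  "mor_power C I 0 X Z = (if X = Z then {Ident C X} else {})"
| "mor_power C I (Suc n) X Z =
     {g \<cdot>\<^bsub>C\<^esub> f | g f Y. Y \<in> Obj C \<and> f \<in> mor_power C I n X Y \<and> g \<in> I Y Z}"

section \<open>Triangulated categories\<close>

text \<open>The shift is a strict automorphism of the category, recorded through all its integer powers:
  \<open>ShO C n X\<close> and \<open>ShM C n f\<close> stand for $X[n]$ and $f[n]$.\<close>

record ('o, 'm) shift_cat = "('o, 'm) cat" +
  ShO :: "int \<Rightarrow> 'o \<Rightarrow> 'o"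
  ShM :: "int \<Rightarrow> 'm \<Rightarrow> 'm"

locale additive_shift_category = additive_category C
  for C :: "('o, 'm, 'z) shift_cat_scheme" (structure) +
  assumes shO_in: "X \<in> Obj C \<Longrightarrow> ShO C n X \<in> Obj C"
    and shM_in: "\<lbrakk>X \<in> Obj C; Y \<in> Obj C; f \<in> Hom C X Y\<rbrakk> \<Longrightarrow> ShM C n f \<in> Hom C (ShO C n X) (ShO C n Y)"
    and shM_ident: "X \<in> Obj C \<Longrightarrow> ShM C n (Ident C X) = Ident C (ShO C n X)"
    and shM_comp: "\<lbrakk>X \<in> Obj C; Y \<in> Obj C; Z \<in> Obj C; f \<in> Hom C X Y; g \<in> Hom C Y Z\<rbrakk>
      \<Longrightarrow> ShM C n (g \<cdot> f) = ShM C n g \<cdot> ShM C n f"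
    and shM_plus: "\<lbrakk>X \<in> Obj C; Y \<in> Obj C; f \<in> Hom C X Y; g \<in> Hom C X Y\<rbrakk>
      \<Longrightarrow> ShM C n (f \<boxplus> g) = ShM C n f \<boxplus> ShM C n g"
    and shO_zero: "X \<in> Obj C \<Longrightarrow> ShO C 0 X = X"
    and shM_zero: "\<lbrakk>X \<in> Obj C; Y \<in> Obj C; f \<in> Hom C X Y\<rbrakk> \<Longrightarrow> ShM C 0 f = f"
    and shO_add: "X \<in> Obj C \<Longrightarrow> ShO C m (ShO C n X) = ShO C (m + n) X"
    and shM_add: "\<lbrakk>X \<in> Obj C; Y \<in> Obj C; f \<in> Hom C X Y\<rbrakk> \<Longrightarrow> ShM C m (ShM C n f) = ShM C (m + n) f"

text \<open>\<open>(X, Y, Z, f, g, h)\<close> is the triangle $X \to Y \to Z \to X[1]$ with maps $f, g, h$.\<close>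

type_synonym ('o, 'm) triangle = "'o \<times> 'o \<times> 'o \<times> 'm \<times> 'm \<times> 'm"

definition is_triangle :: "('o, 'm, 'z) shift_cat_scheme \<Rightarrow> ('o, 'm) triangle \<Rightarrow> bool" where
  "is_triangle C = (\<lambda>(X, Y, Z, f, g, h). X \<in> Obj C \<and> Y \<in> Obj C \<and> Z \<in> Obj C \<and>
     f \<in> Hom C X Y \<and> g \<in> Hom C Y Z \<and> h \<in> Hom C Z (ShO C 1 X))"

definition triangle_iso ::
  "('o, 'm, 'z) shift_cat_scheme \<Rightarrow> ('o, 'm) triangle \<Rightarrow> ('o, 'm) triangle \<Rightarrow> bool" where
  "triangle_iso C = (\<lambda>(X, Y, Z, f, g, h) (X', Y', Z', f', g', h').
     is_triangle C (X, Y, Z, f, g, h) \<and> is_triangle C (X', Y', Z', f', g', h') \<and>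
     (\<exists>u v w. is_iso C X X' u \<and> is_iso C Y Y' v \<and> is_iso C Z Z' w \<and>
        v \<cdot>\<^bsub>C\<^esub> f = f' \<cdot>\<^bsub>C\<^esub> u \<and> w \<cdot>\<^bsub>C\<^esub> g = g' \<cdot>\<^bsub>C\<^esub> v \<and> ShM C 1 u \<cdot>\<^bsub>C\<^esub> h = h' \<cdot>\<^bsub>C\<^esub> w))"

record ('o, 'm) tri_cat = "('o, 'm) shift_cat" +
  Dist :: "('o, 'm) triangle set"

locale triangulated_category = additive_shift_category C
  for C :: "('o, 'm, 'z) tri_cat_scheme" (structure) +
  assumes dist_triangle: "T \<in> Dist C \<Longrightarrow> is_triangle C T"
    and TR1_iso: "\<lbrakk>T \<in> Dist C; triangle_iso C T T'\<rbrakk> \<Longrightarrow> T' \<in> Dist C"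
    and TR1_ident: "\<lbrakk>X \<in> Obj C; zero_object C Z\<rbrakk>
      \<Longrightarrow> (X, X, Z, Ident C X, Zer C X Z, Zer C Z (ShO C 1 X)) \<in> Dist C"
    and TR1_cone: "\<lbrakk>X \<in> Obj C; Y \<in> Obj C; f \<in> Hom C X Y\<rbrakk> \<Longrightarrow> \<exists>Z g h. (X, Y, Z, f, g, h) \<in> Dist C"
    and TR2: "is_triangle C (X, Y, Z, f, g, h) \<Longrightarrow> (X, Y, Z, f, g, h) \<in> Dist C \<longleftrightarrow>
      (Y, Z, ShO C 1 X, g, h, neg C (ShO C 1 X) (ShO C 1 Y) (ShM C 1 f)) \<in> Dist C"
    and TR3: "\<lbrakk>(X, Y, Z, f, g, h) \<in> Dist C; (X', Y', Z', f', g', h') \<in> Dist C;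
        u \<in> Hom C X X'; v \<in> Hom C Y Y'; v \<cdot> f = f' \<cdot> u\<rbrakk>
      \<Longrightarrow> \<exists>w \<in> Hom C Z Z'. w \<cdot> g = g' \<cdot> v \<and> ShM C 1 u \<cdot> h = h' \<cdot> w"
    and TR4: "\<lbrakk>(X, Y, Z', f, f2, f3) \<in> Dist C; (Y, Z, X', g, g2, g3) \<in> Dist C;
        (X, Z, Y', g \<cdot> f, k2, k3) \<in> Dist C\<rbrakk>
      \<Longrightarrow> \<exists>u v. (Z', Y', X', u, v, ShM C 1 f2 \<cdot> g3) \<in> Dist C \<and>
        u \<cdot> f2 = k2 \<cdot> g \<and> k3 \<cdot> u = f3 \<and> v \<cdot> k2 = g2 \<and> g3 \<cdot> v = ShM C 1 f \<cdot> k3"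

text \<open>Applied with \<open>D\<close> the category \<open>Kw A\<close> below, whose distinguished triangles are the weak ones,
  this is weak exactness. In \<open>Kw A\<close> isomorphic objects count as the same, so commuting with the shift
  means a natural isomorphism $F(X[1]) \cong F(X)[1]$.\<close>

definition exact_functor :: "('o, 'm, 'y) tri_cat_scheme \<Rightarrow> ('p, 'n, 'z) tri_cat_scheme \<Rightarrow>
    ('o \<Rightarrow> 'p) \<Rightarrow> ('o \<Rightarrow> 'o \<Rightarrow> 'm \<Rightarrow> 'n) \<Rightarrow> bool" where
  "exact_functor C D FO FM \<longleftrightarrow> additive_functor C D FO FM \<and>
     (\<exists>\<theta>. (\<forall>X \<in> Obj C. is_iso D (FO (ShO C 1 X)) (ShO D 1 (FO X)) (\<theta> X)) \<and>
          (\<forall>X \<in> Obj C. \<forall>Y \<in> Obj C. \<forall>f \<in> Hom C X Y.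
             \<theta> Y \<cdot>\<^bsub>D\<^esub> FM (ShO C 1 X) (ShO C 1 Y) (ShM C 1 f) = ShM D 1 (FM X Y f) \<cdot>\<^bsub>D\<^esub> \<theta> X) \<and>
          (\<forall>X Y Z f g h. (X, Y, Z, f, g, h) \<in> Dist C \<longrightarrow>
             (FO X, FO Y, FO Z, FM X Y f, FM Y Z g, \<theta> X \<cdot>\<^bsub>D\<^esub> FM Z (ShO C 1 X) h) \<in> Dist D))"

section \<open>Quotients by ideals\<close>

text \<open>A morphism of the quotient is a coset, tagged with its source and target.\<close>

definition quot_class :: "('o, 'm, 'z) cat_scheme \<Rightarrow> ('o \<Rightarrow> 'o \<Rightarrow> 'm set) \<Rightarrow>
    'o \<Rightarrow> 'o \<Rightarrow> 'm \<Rightarrow> 'o \<times> 'o \<times> 'm set" where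
  "quot_class C I X Y f = (X, Y, I X Y #>\<^bsub>hom_group C X Y\<^esub> f)"

definition quot_cat :: "('o, 'm, 'z) shift_cat_scheme \<Rightarrow> ('o \<Rightarrow> 'o \<Rightarrow> 'm set) \<Rightarrow>
    ('o, 'o \<times> 'o \<times> 'm set) shift_cat" where
  "quot_cat C I = \<lparr>
     Obj = Obj C,
     Hom = (\<lambda>X Y. quot_class C I X Y ` Hom C X Y),
     Ident = (\<lambda>X. quot_class C I X X (Ident C X)),
     Comp = (\<lambda>(Y', Z, G) (X, Y, F). (X, Z, \<Union>g\<in>G. \<Union>f\<in>F. I X Z #>\<^bsub>hom_group C X Z\<^esub> (g \<cdot>\<^bsub>C\<^esub> f))),
     Zer = (\<lambda>X Y. quot_class C I X Y (Zer C X Y)),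
     Plus = (\<lambda>(X, Y, F) (X', Y', G). (X, Y, F <#>\<^bsub>hom_group C X Y\<^esub> G)),
     ShO = ShO C,
     ShM = (\<lambda>n (X, Y, F). (ShO C n X, ShO C n Y, ShM C n ` F))\<rparr>"

section \<open>Complexes and their homotopy categories\<close>

record ('o, 'm) cpx =
  cob :: "int \<Rightarrow> 'o"
  cdf :: "int \<Rightarrow> 'm"

text \<open>\<open>complexes A\<close> is the category of cohomological complexes, with
  $X[n]^i = X^{i+n}$ and $d_{X[n]} = (-1)^n d_X$.\<close>

definition complexes :: "('o, 'm, 'z) cat_scheme \<Rightarrow> (('o, 'm) cpx, int \<Rightarrow> 'm) shift_cat" where
  "complexes A = \<lparr>
     Obj = {X. \<forall>i. cob X i \<in> Obj A \<and> cdf X i \<in> Hom A (cob X i) (cob X (i + 1)) \<and>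
                 cdf X (i + 1) \<cdot>\<^bsub>A\<^esub> cdf X i = Zer A (cob X i) (cob X (i + 2))},
     Hom = (\<lambda>X Y. {f. \<forall>i. f i \<in> Hom A (cob X i) (cob Y i) \<and>
                 f (i + 1) \<cdot>\<^bsub>A\<^esub> cdf X i = cdf Y i \<cdot>\<^bsub>A\<^esub> f i}),
     Ident = (\<lambda>X i. Ident A (cob X i)),
     Comp = (\<lambda>g f i. g i \<cdot>\<^bsub>A\<^esub> f i),
     Zer = (\<lambda>X Y i. Zer A (cob X i) (cob Y i)),
     Plus = (\<lambda>f g i. f i \<boxplus>\<^bsub>A\<^esub> g i),
     ShO = (\<lambda>n X. \<lparr>cob = (\<lambda>i. cob X (i + n)),
                  cdf = (\<lambda>i. if even n then cdf X (i + n)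
                             else neg A (cob X (i + n)) (cob X (i + n + 1)) (cdf X (i + n)))\<rparr>),
     ShM = (\<lambda>n f i. f (i + n))\<rparr>"

definition homotopies :: "('o, 'm, 'z) cat_scheme \<Rightarrow> ('o, 'm) cpx \<Rightarrow> ('o, 'm) cpx \<Rightarrow> (int \<Rightarrow> 'm) set" where
  "homotopies A X Y = {s. \<forall>i. s i \<in> Hom A (cob X i) (cob Y (i - 1))}"

definition st_map :: "('o, 'm, 'z) cat_scheme \<Rightarrow> ('o, 'm) cpx \<Rightarrow> ('o, 'm) cpx \<Rightarrow>
    (int \<Rightarrow> 'm) \<Rightarrow> (int \<Rightarrow> 'm) \<Rightarrow> int \<Rightarrow> 'm" where
  "st_map A X Y s t = (\<lambda>i. (s (i + 1) \<cdot>\<^bsub>A\<^esub> cdf X i) \<boxplus>\<^bsub>A\<^esub> (cdf Y (i - 1) \<cdot>\<^bsub>A\<^esub> t i))"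

definition null_homotopic :: "('o, 'm, 'z) cat_scheme \<Rightarrow> ('o, 'm) cpx \<Rightarrow> ('o, 'm) cpx \<Rightarrow> (int \<Rightarrow> 'm) set" where
  "null_homotopic A X Y = {f \<in> Hom (complexes A) X Y. \<exists>s \<in> homotopies A X Y. f = st_map A X Y s s}"

type_synonym ('o, 'm) kmor = "('o, 'm) cpx \<times> ('o, 'm) cpx \<times> (int \<Rightarrow> 'm) set"

definition hclass :: "('o, 'm, 'z) cat_scheme \<Rightarrow> ('o, 'm) cpx \<Rightarrow> ('o, 'm) cpx \<Rightarrow> (int \<Rightarrow> 'm) \<Rightarrow> ('o, 'm) kmor" where
  "hclass A = quot_class (complexes A) (null_homotopic A)"

definition htp_cat :: "('o, 'm, 'z) cat_scheme \<Rightarrow> (('o, 'm) cpx, ('o, 'm) kmor) shift_cat" where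
  "htp_cat A = quot_cat (complexes A) (null_homotopic A)"

text \<open>The cone of \<open>\<phi>\<close> is any complex \<open>Z\<close> whose terms are direct sums
  $Z^i = X^{i+1} \oplus Y^i$ with differential $(x, y) \mapsto (-d x, \phi x + d y)$.\<close>

definition cone_triangle :: "('o, 'm, 'z) cat_scheme \<Rightarrow> (('o, 'm) cpx, ('o, 'm) kmor) triangle \<Rightarrow> bool" where
  "cone_triangle A T \<longleftrightarrow> (\<exists>X Y Z \<phi> e1 e2 p1 p2.
     X \<in> Obj (complexes A) \<and> Y \<in> Obj (complexes A) \<and> Z \<in> Obj (complexes A) \<and>
     \<phi> \<in> Hom (complexes A) X Y \<and>
     (\<forall>i. biproduct A (cob X (i + 1)) (cob Y i) (cob Z i) (e1 i) (e2 i) (p1 i) (p2 i) \<and>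
          cdf Z i =
            (e1 (i + 1) \<cdot>\<^bsub>A\<^esub> neg A (cob X (i + 1)) (cob X (i + 2)) (cdf X (i + 1)) \<cdot>\<^bsub>A\<^esub> p1 i)
            \<boxplus>\<^bsub>A\<^esub> (e2 (i + 1) \<cdot>\<^bsub>A\<^esub> \<phi> (i + 1) \<cdot>\<^bsub>A\<^esub> p1 i)
            \<boxplus>\<^bsub>A\<^esub> (e2 (i + 1) \<cdot>\<^bsub>A\<^esub> cdf Y i \<cdot>\<^bsub>A\<^esub> p2 i)) \<and>
     T = (X, Y, Z, hclass A X Y \<phi>, hclass A Y Z e2, hclass A Z (ShO (complexes A) 1 X) p1))"

definition Kcat :: "('o, 'm, 'z) cat_scheme \<Rightarrow> (('o, 'm) cpx, ('o, 'm) kmor) tri_cat" where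
  "Kcat A = shift_cat.extend (htp_cat A)
     (tri_cat.fields {T. \<exists>T'. cone_triangle A T' \<and> triangle_iso (htp_cat A) T' T})"

definition Zideal :: "('o, 'm, 'z) cat_scheme \<Rightarrow> ('o, 'm) cpx \<Rightarrow> ('o, 'm) cpx \<Rightarrow> ('o, 'm) kmor set" where
  "Zideal A X Y = {hclass A X Y f | f. f \<in> Hom (complexes A) X Y \<and>
     (\<exists>s \<in> homotopies A X Y. \<exists>t \<in> homotopies A X Y. f = st_map A X Y s t)}"

type_synonym ('o, 'm) kwmor = "('o, 'm) cpx \<times> ('o, 'm) cpx \<times> ('o, 'm) kmor set"

text \<open>Objects of \<open>Kw A\<close> are kept as complexes instead of being identified along homotopy
  equivalences; all statements about them below are invariant under isomorphism.\<close>

definition wclass :: "('o, 'm, 'z) cat_scheme \<Rightarrow> ('o, 'm) cpx \<Rightarrow> ('o, 'm) cpx \<Rightarrow> ('o, 'm) kmor \<Rightarrow> ('o, 'm) kwmor" where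
  "wclass A = quot_class (Kcat A) (Zideal A)"

definition weak_dist :: "('o, 'm, 'z) cat_scheme \<Rightarrow> (('o, 'm) cpx, ('o, 'm) kwmor) triangle set" where
  "weak_dist A = {(X, Y, Z, f, g, h). is_triangle (quot_cat (Kcat A) (Zideal A)) (X, Y, Z, f, g, h) \<and>
     (\<exists>F G H. (X, Y, Z, F, G, H) \<in> Dist (Kcat A) \<and> wclass A X Y F = f \<and> wclass A Y Z G = g) \<and>
     (\<exists>F G H. (X, Y, Z, F, G, H) \<in> Dist (Kcat A) \<and>
        wclass A Y Z G = g \<and> wclass A Z (ShO (Kcat A) 1 X) H = h) \<and>
     (\<exists>F G H. (X, Y, Z, F, G, H) \<in> Dist (Kcat A) \<and>
        wclass A X Y F = f \<and> wclass A Z (ShO (Kcat A) 1 X) H = h)}"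

definition Kw :: "('o, 'm, 'z) cat_scheme \<Rightarrow> (('o, 'm) cpx, ('o, 'm) kwmor) tri_cat" where
  "Kw A = shift_cat.extend (quot_cat (Kcat A) (Zideal A)) (tri_cat.fields (weak_dist A))"

definition Kw_le :: "('o, 'm, 'z) cat_scheme \<Rightarrow> int \<Rightarrow> ('o, 'm) cpx set" where
  "Kw_le A i = {X. \<exists>Y. isomorphic (Kcat A) X Y \<and> (\<forall>k > i. zero_object A (cob Y k))}"

definition Kw_ge :: "('o, 'm, 'z) cat_scheme \<Rightarrow> int \<Rightarrow> ('o, 'm) cpx set" where
  "Kw_ge A i = {X. \<exists>Y. isomorphic (Kcat A) X Y \<and> (\<forall>k < i. zero_object A (cob Y k))}"

section \<open>Weight structures\<close>

definition additive_class :: "('o, 'm, 'z) cat_scheme \<Rightarrow> 'o set \<Rightarrow> bool" where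
  "additive_class C D \<longleftrightarrow> D \<subseteq> Obj C \<and> (\<exists>Z \<in> D. zero_object C Z) \<and>
     (\<forall>X \<in> D. \<forall>Y \<in> D. \<forall>S e1 e2 p1 p2. biproduct C X Y S e1 e2 p1 p2 \<longrightarrow> S \<in> D)"

definition Karoubi_closed :: "('o, 'm, 'z) cat_scheme \<Rightarrow> 'o set \<Rightarrow> bool" where
  "Karoubi_closed C D \<longleftrightarrow> (\<forall>X \<in> D. \<forall>Y \<in> Obj C.
     (\<exists>e \<in> Hom C Y X. \<exists>p \<in> Hom C X Y. p \<cdot>\<^bsub>C\<^esub> e = Ident C Y) \<longrightarrow> Y \<in> D)"

definition orthogonal :: "('o, 'm, 'z) cat_scheme \<Rightarrow> 'o set \<Rightarrow> 'o set \<Rightarrow> bool" where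
  "orthogonal C D E \<longleftrightarrow> (\<forall>X \<in> D. \<forall>Y \<in> E. Hom C X Y = {Zer C X Y})"

text \<open>A weight structure is the pair \<open>w\<close> of the classes $C^{w\le 0}$ and $C^{w\ge 0}$.\<close>

definition w_le :: "('o, 'm, 'z) shift_cat_scheme \<Rightarrow> 'o set \<times> 'o set \<Rightarrow> int \<Rightarrow> 'o set" where
  "w_le C w l = ShO C (- l) ` fst w"

definition w_ge :: "('o, 'm, 'z) shift_cat_scheme \<Rightarrow> 'o set \<times> 'o set \<Rightarrow> int \<Rightarrow> 'o set" where
  "w_ge C w l = ShO C (- l) ` snd w"

locale weight_structure = triangulated_category C
  for C :: "('o, 'm, 'z) tri_cat_scheme" (structure) and w :: "'o set \<times> 'o set" +
  assumes le_additive: "additive_class C (fst w)"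
    and ge_additive: "additive_class C (snd w)"
    and le_Karoubi: "Karoubi_closed C (fst w)"
    and ge_Karoubi: "Karoubi_closed C (snd w)"
    and ge_shift: "snd w \<subseteq> ShO C 1 ` snd w"
    and le_shift: "ShO C 1 ` fst w \<subseteq> fst w"
    and orthogonality: "orthogonal C (snd w) (ShO C 1 ` fst w)"
    and weight_decomposition: "X \<in> Obj C \<Longrightarrow>
      \<exists>A \<in> fst w. \<exists>B \<in> snd w. \<exists>u v v'. (ShO C (- 1) B, X, A, u, v, v') \<in> Dist C"

definition w_interval :: "('o, 'm, 'z) shift_cat_scheme \<Rightarrow> 'o set \<times> 'o set \<Rightarrow> int \<Rightarrow> int \<Rightarrow> 'o set" where
  "w_interval C w j i = w_ge C w j \<inter> w_le C w i"

definition w_minus :: "('o, 'm, 'z) shift_cat_scheme \<Rightarrow> 'o set \<times> 'o set \<Rightarrow> 'o set" where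
  "w_minus C w = (\<Union>i. w_le C w i)"

definition w_plus :: "('o, 'm, 'z) shift_cat_scheme \<Rightarrow> 'o set \<times> 'o set \<Rightarrow> 'o set" where
  "w_plus C w = (\<Union>i. w_ge C w i)"

definition w_bounded :: "('o, 'm, 'z) shift_cat_scheme \<Rightarrow> 'o set \<times> 'o set \<Rightarrow> 'o set" where
  "w_bounded C w = w_plus C w \<inter> w_minus C w"

definition heart :: "('o, 'm, 'z) shift_cat_scheme \<Rightarrow> 'o set \<times> 'o set \<Rightarrow> ('o, 'm) cat" where
  "heart C w = full_subcat C (snd w \<inter> fst w)"

definition non_degenerate :: "('o, 'm, 'z) shift_cat_scheme \<Rightarrow> 'o set \<times> 'o set \<Rightarrow> bool" where
  "non_degenerate C w \<longleftrightarrow> (\<Inter>l. w_ge C w l) = {Z. zero_object C Z} \<and>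
     (\<Inter>l. w_le C w l) = {Z. zero_object C Z}"

section \<open>The weight complex\<close>

text \<open>The data of a weight Postnikov tower of \<open>X\<close>. The indices follow the usual notation:
  \<open>t_le k\<close> is $X^{w\le k}$, \<open>t_ge k\<close> is $X^{w\ge k}$ and \<open>t_gr k\<close> is $X^k$; the maps are
  $X[k] \xrightarrow{a^k} X^{w\le k} \xrightarrow{f^k} X^{w\ge k+1} \xrightarrow{b^k} X[k+1]$,
  $\alpha^k : X^{w\le k}[-1] \to X^{w\le k-1}$, $\beta^k : X^{w\ge k+1}[-1] \to X^{w\ge k}$,
  and $c^k, d^k, x^k, y^k$.\<close>

record ('o, 'm) tower =
  t_le :: "int \<Rightarrow> 'o"
  t_ge :: "int \<Rightarrow> 'o"
  t_gr :: "int \<Rightarrow> 'o"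
  t_a :: "int \<Rightarrow> 'm"
  t_f :: "int \<Rightarrow> 'm"
  t_b :: "int \<Rightarrow> 'm"
  t_alpha :: "int \<Rightarrow> 'm"
  t_beta :: "int \<Rightarrow> 'm"
  t_c :: "int \<Rightarrow> 'm"
  t_d :: "int \<Rightarrow> 'm"
  t_x :: "int \<Rightarrow> 'm"
  t_y :: "int \<Rightarrow> 'm"

text \<open>By orthogonality $\alpha^k$ and $\beta^k$ are determined by their compatibility with the maps
  from and to the shifts of \<open>X\<close>. The middle square, for the distinguished triangle
  $(a^k[-1], -f^k[-1], b^k[-1])$, then commutes automatically:
  $f^{k-1} \alpha^k = - \beta^k f^k[-1]$. With this sign the octahedral axiom yields the
  two triangles below exactly as written.\<close>

definition weight_tower :: "('o, 'm, 'z) tri_cat_scheme \<Rightarrow> 'o set \<times> 'o set \<Rightarrow> 'o \<Rightarrow>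
    ('o, 'm) tower \<Rightarrow> bool" where
  "weight_tower C w X T \<longleftrightarrow> (\<forall>k.
     t_le T k \<in> fst w \<and> t_ge T k \<in> snd w \<and> t_gr T k \<in> Obj (heart C w) \<and>
     (ShO C k X, t_le T k, t_ge T (k + 1), t_a T k, t_f T k, t_b T k) \<in> Dist C \<and>
     t_alpha T k \<in> Hom C (ShO C (- 1) (t_le T k)) (t_le T (k - 1)) \<and>
     t_alpha T k \<cdot>\<^bsub>C\<^esub> ShM C (- 1) (t_a T k) = t_a T (k - 1) \<and>
     t_beta T k \<in> Hom C (ShO C (- 1) (t_ge T (k + 1))) (t_ge T k) \<and>
     t_b T (k - 1) \<cdot>\<^bsub>C\<^esub> t_beta T k = ShM C (- 1) (t_b T k) \<and>
     (ShO C (- 1) (t_le T k), t_le T (k - 1), t_gr T k, t_alpha T k, t_c T k, t_d T k) \<in> Dist C \<and>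
     (ShO C (- 1) (t_gr T k), ShO C (- 1) (t_ge T (k + 1)), t_ge T k,
        t_x T k, t_beta T k, t_y T k) \<in> Dist C \<and>
     t_c T k = t_y T k \<cdot>\<^bsub>C\<^esub> t_f T (k - 1) \<and>
     t_x T k = ShM C (- 1) (t_f T k \<cdot>\<^bsub>C\<^esub> t_d T k))"

definition tower_complex :: "('o, 'm, 'z) cat_scheme \<Rightarrow> ('o, 'm) tower \<Rightarrow> ('o, 'm) cpx" where
  "tower_complex C T = \<lparr>cob = t_gr T, cdf = (\<lambda>i. t_c T (i + 1) \<cdot>\<^bsub>C\<^esub> t_d T i)\<rparr>"

text \<open>Extensions of \<open>g : X \<rightarrow> X'\<close> to towers \<open>T\<close>, \<open>T'\<close> of \<open>X\<close>, \<open>X'\<close>; \<open>g_gr\<close> is the resulting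
  morphism of complexes. Compatibility with $y^k$ is not demanded: the conditions on a tower do not
  relate $y^k$ to $d^k$ (if \<open>X\<close> lies in the heart and is its own $X^{w\le 0}$ and $X^{w\ge 0}$,
  then $d^0$ and $y^0$ are arbitrary isomorphisms), so an extension that also respects $y^k$ need not
  exist. Every extension which does respect $y^k$ is covered, and the class of \<open>g_gr\<close> does not depend
  on the extension.\<close>

definition tower_extension :: "('o, 'm, 'z) tri_cat_scheme \<Rightarrow> 'o \<Rightarrow> 'o \<Rightarrow>
    ('o, 'm) tower \<Rightarrow> ('o, 'm) tower \<Rightarrow> 'm \<Rightarrow>
    (int \<Rightarrow> 'm) \<Rightarrow> (int \<Rightarrow> 'm) \<Rightarrow> (int \<Rightarrow> 'm) \<Rightarrow> bool" where
  "tower_extension C X X' T T' g g_le g_ge g_gr \<longleftrightarrow> g \<in> Hom C X X' \<and> (\<forall>k.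
     g_le k \<in> Hom C (t_le T k) (t_le T' k) \<and>
     g_ge k \<in> Hom C (t_ge T k) (t_ge T' k) \<and>
     g_gr k \<in> Hom C (t_gr T k) (t_gr T' k) \<and>
     g_le k \<cdot>\<^bsub>C\<^esub> t_a T k = t_a T' k \<cdot>\<^bsub>C\<^esub> ShM C k g \<and>
     g_ge (k + 1) \<cdot>\<^bsub>C\<^esub> t_f T k = t_f T' k \<cdot>\<^bsub>C\<^esub> g_le k \<and>
     ShM C (k + 1) g \<cdot>\<^bsub>C\<^esub> t_b T k = t_b T' k \<cdot>\<^bsub>C\<^esub> g_ge (k + 1) \<and>
     g_le (k - 1) \<cdot>\<^bsub>C\<^esub> t_alpha T k = t_alpha T' k \<cdot>\<^bsub>C\<^esub> ShM C (- 1) (g_le k) \<and>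
     g_ge k \<cdot>\<^bsub>C\<^esub> t_beta T k = t_beta T' k \<cdot>\<^bsub>C\<^esub> ShM C (- 1) (g_ge (k + 1)) \<and>
     g_gr k \<cdot>\<^bsub>C\<^esub> t_c T k = t_c T' k \<cdot>\<^bsub>C\<^esub> g_le (k - 1) \<and>
     g_le k \<cdot>\<^bsub>C\<^esub> t_d T k = t_d T' k \<cdot>\<^bsub>C\<^esub> g_gr k \<and>
     ShM C (- 1) (g_ge (k + 1)) \<cdot>\<^bsub>C\<^esub> t_x T k = t_x T' k \<cdot>\<^bsub>C\<^esub> ShM C (- 1) (g_gr k))"

text \<open>The weight complex functor determined by a choice \<open>P\<close> of a tower for every object.\<close>

definition wc_obj :: "('o, 'm, 'z) tri_cat_scheme \<Rightarrow> ('o \<Rightarrow> ('o, 'm) tower) \<Rightarrow> 'o \<Rightarrow> ('o, 'm) cpx" where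
  "wc_obj C P X = tower_complex C (P X)"

definition wc_mor :: "('o, 'm, 'z) tri_cat_scheme \<Rightarrow> 'o set \<times> 'o set \<Rightarrow> ('o \<Rightarrow> ('o, 'm) tower) \<Rightarrow>
    'o \<Rightarrow> 'o \<Rightarrow> 'm \<Rightarrow> ('o, 'm) kwmor" where
  "wc_mor C w P X X' g = (THE \<Phi>. \<exists>g_le g_ge g_gr. tower_extension C X X' (P X) (P X') g g_le g_ge g_gr \<and>
     \<Phi> = wclass (heart C w) (wc_obj C P X) (wc_obj C P X')
           (hclass (heart C w) (wc_obj C P X) (wc_obj C P X') g_gr))"

definition wc_kernel :: "('o, 'm, 'z) tri_cat_scheme \<Rightarrow> 'o set \<times> 'o set \<Rightarrow> ('o \<Rightarrow> ('o, 'm) tower) \<Rightarrow>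
    'o \<Rightarrow> 'o \<Rightarrow> 'm set" where
  "wc_kernel C w P X X' = kernel (hom_group C X X')
     (hom_group (Kw (heart C w)) (wc_obj C P X) (wc_obj C P X')) (wc_mor C w P X X')"

end

theory Submission
  imports Defs
begin

text \<open>A tower of \<open>X\<close> is normalised by choosing $y^k$ with $d^k y^k = a^k b^{k-1}$, which the octahedral axiom
  allows. A chain map $\varphi$ between the weight complexes then comes from $g : X \to X'$ exactly when
  $d'^k \varphi^k y^k = a'^k g[k] b^{k-1}$ for all $k$. By orthogonality the chain maps coming from $0$ are the
  maps $s d + d t$, so $t$ is well defined, and $t(g) = 0$ if and only if $a'^k g[k] b^{k-1} = 0$ for all $k$.
  From this criterion, each factor in the kernel of $t$ raises by one the bound up to which a composite is killed by
  the maps $a^k$, hence the kernel is nilpotent on objects of bounded weight, idempotents lift, and the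
  statements on weights and on \<open>t\<^sub>*\<close> follow.

  For exactness, the $3 \times 3$ lemma applied to towers of $X$ and $Z$ yields, for a distinguished triangle
  $X \to Y \to Z \to X[1]$, a tower of $Y$ with distinguished triangles $X^k \to Y^k \to Z^k$, whose connecting maps vanish
  by orthogonality. So the complex of $Y$ is a cone of a map from that of $Z$, shifted by $-1$, to that of $X$. Applied to the triangle
  and its two rotations, this lifts any two of the three sides. Compositions of two maps of the form
  $s d + d t$ are null-homotopic, so isomorphisms modulo such maps are homotopy equivalences.\<close>

section \<open>Typed arrows\<close>

text \<open>Replacing $y^k$ leaves the complex alone, since its differential is $c^{k+1} d^k$. The
  obstacle behind exactness is that completions of morphisms of triangles are not unique:
  decompositions of the $Y[k]$ produced separately from those of $X[k]$ and $Z[k]$ need not fit into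
  one tower. So a single level of $Y$, in degree 0, is built from the decompositions in degree 0.
  The cones of the connecting maps on the $X^{w<=k}$ then dictate all lower levels, those on the
  $X^{w>=k}$ all higher ones, and the two families are arranged to share level 0. The connecting
  chain map found in this way is not compared with $t$ of the connecting morphism; this is why every
  pair of sides needs its own application. Statements about bounds are proved on towers adapted to
  the object: the identity of $X$ induces a homotopy equivalence between the complexes of any two
  towers of $X$. Idempotents are lifted by Newton iteration for $p^2 = p$, where the new error is a
  multiple of the square of the old one and so lies deeper in the powers of the kernel.\<close>

text \<open>Morphism sets of a category may overlap, so a morphism is carried along with its source and target.\<close>

datatype ('o, 'm) arrow = Arrow (src: 'o) (tgt: 'o) (mor: 'm)

definition arr :: "('o, 'm, 'z) cat_scheme \<Rightarrow> ('o, 'm) arrow \<Rightarrow> bool" where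
  "arr C f \<longleftrightarrow> src f \<in> Obj C \<and> tgt f \<in> Obj C \<and> mor f \<in> Hom C (src f) (tgt f)"

definition acomp :: "('o, 'm, 'z) cat_scheme \<Rightarrow> ('o, 'm) arrow \<Rightarrow> ('o, 'm) arrow \<Rightarrow> ('o, 'm) arrow"
  (infixr "\<odot>\<index>" 75)
  where "g \<odot>\<^bsub>C\<^esub> f = Arrow (src f) (tgt g) (Comp C (mor g) (mor f))"

definition aplus :: "('o, 'm, 'z) cat_scheme \<Rightarrow> ('o, 'm) arrow \<Rightarrow> ('o, 'm) arrow \<Rightarrow> ('o, 'm) arrow"
  (infixr "\<oplus>\<index>" 65)
  where "f \<oplus>\<^bsub>C\<^esub> g = Arrow (src f) (tgt f) (Plus C (mor f) (mor g))"

definition aneg :: "('o, 'm, 'z) cat_scheme \<Rightarrow> ('o, 'm) arrow \<Rightarrow> ('o, 'm) arrow"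
  ("\<ominus>\<index> _" [81] 80)
  where "\<ominus>\<^bsub>C\<^esub> f = Arrow (src f) (tgt f) (neg C (src f) (tgt f) (mor f))"

definition aid :: "('o, 'm, 'z) cat_scheme \<Rightarrow> 'o \<Rightarrow> ('o, 'm) arrow" where
  "aid C X = Arrow X X (Ident C X)"

definition azero :: "('o, 'm, 'z) cat_scheme \<Rightarrow> 'o \<Rightarrow> 'o \<Rightarrow> ('o, 'm) arrow" where
  "azero C X Y = Arrow X Y (Zer C X Y)"

abbreviation in_hom :: "('o, 'm) arrow \<Rightarrow> ('o, 'm, 'z) cat_scheme \<Rightarrow> 'o \<Rightarrow> 'o \<Rightarrow> bool"
  ("\<guillemotleft>_ :\<^bsub>_\<^esub> _ \<rightarrow> _\<guillemotright>")
  where "\<guillemotleft>f :\<^bsub>C\<^esub> X \<rightarrow> Y\<guillemotright> \<equiv> arr C f \<and> src f = X \<and> tgt f = Y \<and> X \<in> Obj C \<and> Y \<in> Obj C"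

lemma arrow_selectors [simp]:
  "src (g \<odot>\<^bsub>C\<^esub> f) = src f" "tgt (g \<odot>\<^bsub>C\<^esub> f) = tgt g"
  "src (f \<oplus>\<^bsub>C\<^esub> g) = src f" "tgt (f \<oplus>\<^bsub>C\<^esub> g) = tgt f"
  "src (\<ominus>\<^bsub>C\<^esub> f) = src f" "tgt (\<ominus>\<^bsub>C\<^esub> f) = tgt f"
  "src (aid C X) = X" "tgt (aid C X) = X"
  "src (azero C X Y) = X" "tgt (azero C X Y) = Y"
  by (simp_all add: acomp_def aplus_def aneg_def aid_def azero_def)

lemma arrow_mor:
  "mor (g \<odot>\<^bsub>C\<^esub> f) = Comp C (mor g) (mor f)" "mor (f \<oplus>\<^bsub>C\<^esub> g) = Plus C (mor f) (mor g)"
  "mor (\<ominus>\<^bsub>C\<^esub> f) = neg C (src f) (tgt f) (mor f)"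
  "mor (aid C X) = Ident C X" "mor (azero C X Y) = Zer C X Y"
  by (simp_all add: acomp_def aplus_def aneg_def aid_def azero_def)

lemma arrow_eqI: "\<lbrakk>src f = src g; tgt f = tgt g; mor f = mor g\<rbrakk> \<Longrightarrow> f = g"
  by (simp add: arrow.expand)

lemma arrD: "arr C f \<Longrightarrow> src f \<in> Obj C" "arr C f \<Longrightarrow> tgt f \<in> Obj C" "arr C f \<Longrightarrow> mor f \<in> Hom C (src f) (tgt f)"
  by (simp_all add: arr_def)

lemma arr_Arrow: "arr C (Arrow X Y f) \<longleftrightarrow> f \<in> Hom C X Y \<and> X \<in> Obj C \<and> Y \<in> Obj C"
  by (auto simp add: arr_def)

lemma mor_in_Hom: "\<guillemotleft>f :\<^bsub>C\<^esub> X \<rightarrow> Y\<guillemotright> \<Longrightarrow> mor f \<in> Hom C X Y"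
  by (auto simp add: arr_def)

lemma Arrow_mor: "\<lbrakk>src f = X; tgt f = Y\<rbrakk> \<Longrightarrow> Arrow X Y (mor f) = f"
  by (auto simp: arrow.expand)

context category
begin

lemma arr_aid [simp]: "X \<in> Obj C \<Longrightarrow> arr C (aid C X)"
  by (simp add: arr_def arrow_mor ident_in)

lemma arr_acomp [simp]: "\<lbrakk>arr C g; arr C f; src g = tgt f\<rbrakk> \<Longrightarrow> arr C (g \<odot> f)"
  by (auto simp add: arr_def arrow_mor intro: comp_in)

lemma acomp_assoc [simp]:
  "\<lbrakk>arr C h; arr C g; arr C f; src h = tgt g; src g = tgt f\<rbrakk> \<Longrightarrow> (h \<odot> g) \<odot> f = h \<odot> g \<odot> f"
  by (rule arrow_eqI) (simp_all add: arrow_mor arr_def comp_assoc[of "src f" "src g" "src h" "tgt h"])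

lemma acomp_aid [simp]: "\<lbrakk>arr C f; src f = X\<rbrakk> \<Longrightarrow> f \<odot> aid C X = f"
  by (rule arrow_eqI) (auto simp add: arrow_mor arr_def comp_ident)

lemma aid_acomp [simp]: "\<lbrakk>arr C f; tgt f = X\<rbrakk> \<Longrightarrow> aid C X \<odot> f = f"
  by (rule arrow_eqI) (auto simp add: arrow_mor arr_def ident_comp)

text \<open>Composites are kept nested to the right, so an equation $p q = r$ is not visible inside
  $p q x$. This form attaches the tail $x$; most diagram chases below are instances of it.\<close>

lemma acomp_eq: "\<lbrakk>p \<odot> q = r; arr C p; arr C q; arr C x; src p = tgt q; src q = tgt x\<rbrakk> \<Longrightarrow> p \<odot> q \<odot> x = r \<odot> x"
  by (metis acomp_assoc)

end

context preadditive_category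
begin

lemma hom_comm_group_arr: "arr C f \<Longrightarrow> comm_group (hom_group C (src f) (tgt f))"
  by (simp add: arr_def hom_comm_group)

lemma arr_azero [simp]: "\<lbrakk>X \<in> Obj C; Y \<in> Obj C\<rbrakk> \<Longrightarrow> arr C (azero C X Y)"
proof -
  assume *: "X \<in> Obj C" "Y \<in> Obj C"
  interpret G: comm_group "hom_group C X Y" using * by (rule hom_comm_group)
  show ?thesis using G.one_closed * by (simp add: arr_def arrow_mor hom_group_def)
qed

lemma arr_aplus [simp]: "\<lbrakk>arr C f; arr C g; src f = src g; tgt f = tgt g\<rbrakk> \<Longrightarrow> arr C (f \<oplus> g)"
proof -
  assume *: "arr C f" "arr C g" "src f = src g" "tgt f = tgt g"
  interpret G: comm_group "hom_group C (src f) (tgt f)" using * by (intro hom_comm_group_arr)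
  show ?thesis using G.m_closed[of "mor f" "mor g"] * by (simp add: arr_def arrow_mor hom_group_def)
qed

lemma arr_aneg [simp]: "arr C f \<Longrightarrow> arr C (\<ominus> f)"
proof -
  assume *: "arr C f"
  interpret G: comm_group "hom_group C (src f) (tgt f)" using * by (intro hom_comm_group_arr)
  show ?thesis using G.inv_closed[of "mor f"] * by (simp add: arr_def arrow_mor hom_group_def neg_def)
qed

lemma aplus_assoc [simp]:
  "\<lbrakk>arr C f; arr C g; arr C h; src f = src g; tgt f = tgt g; src g = src h; tgt g = tgt h\<rbrakk> \<Longrightarrow>
    (f \<oplus> g) \<oplus> h = f \<oplus> g \<oplus> h"
proof -
  assume *: "arr C f" "arr C g" "arr C h" "src f = src g" "tgt f = tgt g" "src g = src h" "tgt g = tgt h"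
  interpret G: comm_group "hom_group C (src h) (tgt h)" using * by (intro hom_comm_group_arr)
  show ?thesis using G.m_assoc[of "mor f" "mor g" "mor h"] *
    by (intro arrow_eqI) (simp_all add: arr_def arrow_mor hom_group_def)
qed

lemma aplus_comm:
  "\<lbrakk>arr C f; arr C g; src f = src g; tgt f = tgt g\<rbrakk> \<Longrightarrow> f \<oplus> g = g \<oplus> f"
proof -
  assume *: "arr C f" "arr C g" "src f = src g" "tgt f = tgt g"
  interpret G: comm_group "hom_group C (src g) (tgt g)" using * by (intro hom_comm_group_arr)
  show ?thesis using G.m_comm[of "mor f" "mor g"] *
    by (intro arrow_eqI) (simp_all add: arr_def arrow_mor hom_group_def)
qed

lemma aplus_left_comm:
  "\<lbrakk>arr C f; arr C g; arr C h; src f = src g; tgt f = tgt g; src g = src h; tgt g = tgt h\<rbrakk> \<Longrightarrow>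
    f \<oplus> g \<oplus> h = g \<oplus> f \<oplus> h"
  by (metis aplus_assoc aplus_comm)

lemmas aplus_ac = aplus_comm aplus_left_comm

lemma aplus_azero [simp]:
  "\<lbrakk>arr C f; src f = X; tgt f = Y\<rbrakk> \<Longrightarrow> f \<oplus> azero C X Y = f"
  "\<lbrakk>arr C f; src f = X; tgt f = Y\<rbrakk> \<Longrightarrow> azero C X Y \<oplus> f = f"
proof -
  assume *: "arr C f" "src f = X" "tgt f = Y"
  interpret G: comm_group "hom_group C (src f) (tgt f)" using * by (intro hom_comm_group_arr)
  show "f \<oplus> azero C X Y = f" using G.r_one[of "mor f"] *
    by (intro arrow_eqI) (auto simp add: arr_def arrow_mor hom_group_def)
  show "azero C X Y \<oplus> f = f" using G.l_one[of "mor f"] *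
    by (intro arrow_eqI) (auto simp add: arr_def arrow_mor hom_group_def)
qed

lemma aplus_aneg [simp]:
  "arr C f \<Longrightarrow> f \<oplus> \<ominus> f = azero C (src f) (tgt f)" "arr C f \<Longrightarrow> \<ominus> f \<oplus> f = azero C (src f) (tgt f)"
proof -
  assume *: "arr C f"
  interpret G: comm_group "hom_group C (src f) (tgt f)" using * by (intro hom_comm_group_arr)
  show "f \<oplus> \<ominus> f = azero C (src f) (tgt f)" using G.r_inv[of "mor f"] *
    by (intro arrow_eqI) (auto simp add: arr_def arrow_mor hom_group_def neg_def)
  show "\<ominus> f \<oplus> f = azero C (src f) (tgt f)" using G.l_inv[of "mor f"] *
    by (intro arrow_eqI) (auto simp add: arr_def arrow_mor hom_group_def neg_def)
qed

lemma aplus_cancel: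
  "\<lbrakk>arr C f; arr C g; arr C h; src f = src g; tgt f = tgt g; src h = src g; tgt h = tgt g\<rbrakk> \<Longrightarrow>
    f \<oplus> g = f \<oplus> h \<longleftrightarrow> g = h"
  by (metis aplus_assoc aplus_azero(2) aplus_aneg(2) arr_aneg arrow_selectors(5,6))

lemma aplus_aneg_cancel [simp]:
  "\<lbrakk>arr C f; arr C g; src f = src g; tgt f = tgt g\<rbrakk> \<Longrightarrow> f \<oplus> \<ominus> f \<oplus> g = g"
  "\<lbrakk>arr C f; arr C g; src f = src g; tgt f = tgt g\<rbrakk> \<Longrightarrow> \<ominus> f \<oplus> f \<oplus> g = g"
  by (simp_all flip: aplus_assoc)

lemma aneg_unique:
  "\<lbrakk>arr C f; arr C g; src f = src g; tgt f = tgt g; f \<oplus> g = azero C (src f) (tgt f)\<rbrakk> \<Longrightarrow> g = \<ominus> f"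
  using aplus_cancel[of f g "\<ominus> f"] by simp

lemma aneg_aneg [simp]: "arr C f \<Longrightarrow> \<ominus> (\<ominus> f) = f"
  by (rule aneg_unique[symmetric]) simp_all

lemma aneg_azero [simp]: "\<lbrakk>X \<in> Obj C; Y \<in> Obj C\<rbrakk> \<Longrightarrow> \<ominus> (azero C X Y) = azero C X Y"
  by (rule aneg_unique[symmetric]) simp_all

lemma aneg_aplus [simp]:
  "\<lbrakk>arr C f; arr C g; src f = src g; tgt f = tgt g\<rbrakk> \<Longrightarrow> \<ominus> (f \<oplus> g) = \<ominus> f \<oplus> \<ominus> g"
proof -
  assume *: "arr C f" "arr C g" "src f = src g" "tgt f = tgt g"
  have "(f \<oplus> g) \<oplus> (\<ominus> f \<oplus> \<ominus> g) = f \<oplus> \<ominus> f \<oplus> g \<oplus> \<ominus> g"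
    using * by (simp add: aplus_left_comm[of g "\<ominus> f"] del: aplus_aneg_cancel aplus_aneg)
  also have "\<dots> = azero C (src f) (tgt f)" using * by simp
  finally show ?thesis using * by (intro aneg_unique[symmetric]) simp_all
qed

lemma acomp_aplus [simp]:
  "\<lbrakk>arr C h; arr C f; arr C g; src f = src g; tgt f = tgt g; src h = tgt f\<rbrakk> \<Longrightarrow>
    h \<odot> (f \<oplus> g) = h \<odot> f \<oplus> h \<odot> g"
  by (rule arrow_eqI) (auto simp add: arr_def arrow_mor comp_plus)

lemma aplus_acomp [simp]:
  "\<lbrakk>arr C h; arr C f; arr C g; src f = src g; tgt f = tgt g; src f = tgt h\<rbrakk> \<Longrightarrow>
    (f \<oplus> g) \<odot> h = f \<odot> h \<oplus> g \<odot> h"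
  by (rule arrow_eqI) (auto simp add: arr_def arrow_mor plus_comp)

lemma aplus_idem: "\<lbrakk>arr C f; f \<oplus> f = f\<rbrakk> \<Longrightarrow> f = azero C (src f) (tgt f)"
  using aplus_cancel[of f f "azero C (src f) (tgt f)"] arrD(1,2)[of C f] by simp

lemma acomp_azero [simp]:
  "\<lbrakk>arr C f; src f = Y; X \<in> Obj C\<rbrakk> \<Longrightarrow> f \<odot> azero C X Y = azero C X (tgt f)"
  "\<lbrakk>arr C f; tgt f = Y; Z \<in> Obj C\<rbrakk> \<Longrightarrow> azero C Y Z \<odot> f = azero C (src f) Z"
proof -
  assume *: "arr C f" "src f = Y" "X \<in> Obj C"
  then have [simp]: "Y \<in> Obj C" by (auto dest: arrD)
  have "azero C X Y \<oplus> azero C X Y = azero C X Y" using * by simp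
  then have "f \<odot> azero C X Y \<oplus> f \<odot> azero C X Y = f \<odot> azero C X Y" using *
    by (metis acomp_aplus arr_azero arrow_selectors(10) \<open>Y \<in> Obj C\<close>)
  then show "f \<odot> azero C X Y = azero C X (tgt f)" using * aplus_idem[of "f \<odot> azero C X Y"] by simp
next
  assume *: "arr C f" "tgt f = Y" "Z \<in> Obj C"
  then have [simp]: "Y \<in> Obj C" by (auto dest: arrD)
  have "azero C Y Z \<oplus> azero C Y Z = azero C Y Z" using * by simp
  then have "azero C Y Z \<odot> f \<oplus> azero C Y Z \<odot> f = azero C Y Z \<odot> f" using *
    by (metis aplus_acomp arr_azero arrow_selectors(9) \<open>Y \<in> Obj C\<close>)
  then show "azero C Y Z \<odot> f = azero C (src f) Z" using * aplus_idem[of "azero C Y Z \<odot> f"] by simp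
qed

lemma acomp_aneg [simp]:
  "\<lbrakk>arr C g; arr C f; src g = tgt f\<rbrakk> \<Longrightarrow> g \<odot> \<ominus> f = \<ominus> (g \<odot> f)"
  "\<lbrakk>arr C g; arr C f; src g = tgt f\<rbrakk> \<Longrightarrow> \<ominus> g \<odot> f = \<ominus> (g \<odot> f)"
proof -
  assume *: "arr C g" "arr C f" "src g = tgt f"
  then have o: "src f \<in> Obj C" "tgt f \<in> Obj C" "tgt g \<in> Obj C" by (auto dest: arrD)
  have "g \<odot> f \<oplus> g \<odot> \<ominus> f = g \<odot> (f \<oplus> \<ominus> f)" using * by (simp del: aplus_aneg)
  then show "g \<odot> \<ominus> f = \<ominus> (g \<odot> f)" using * o by (intro aneg_unique) simp_all
  have "g \<odot> f \<oplus> (\<ominus> g) \<odot> f = (g \<oplus> \<ominus> g) \<odot> f" using * by (simp del: aplus_aneg)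
  then show "\<ominus> g \<odot> f = \<ominus> (g \<odot> f)" using * o by (intro aneg_unique) simp_all
qed

lemma aneg_eq_iff: "\<lbrakk>arr C f; arr C g\<rbrakk> \<Longrightarrow> \<ominus> f = \<ominus> g \<longleftrightarrow> f = g"
  by (metis aneg_aneg)

lemma aneg_eq_zero_iff [simp]:
  "\<lbrakk>arr C f; src f = X; tgt f = Y\<rbrakk> \<Longrightarrow> \<ominus> f = azero C X Y \<longleftrightarrow> f = azero C X Y"
  by (metis aneg_aneg aneg_azero arrD(1,2))

lemma diff_eq_zero_iff:
  "\<lbrakk>arr C f; arr C g; src f = src g; tgt f = tgt g\<rbrakk> \<Longrightarrow> f \<oplus> \<ominus> g = azero C (src f) (tgt f) \<longleftrightarrow> f = g"
  by (metis aplus_aneg(1) aplus_azero(1) aplus_aneg(2) aplus_assoc arr_aneg arrow_selectors(5,6) aplus_azero(2))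

lemma eq_plus_diff:
  "\<lbrakk>arr C f; arr C g; src f = src g; tgt f = tgt g\<rbrakk> \<Longrightarrow> f = g \<oplus> (f \<oplus> \<ominus> g)"
  using aplus_left_comm[of g f "\<ominus> g"] by simp

text \<open>An arrow into or out of $Z$ is its composite with the identity of $Z$, so it vanishes
  once that identity does. The criterion is an equation, hence passes to shifts and to the heart,
  whose identities and zeros are those of the whole category.\<close>

lemma zero_object_iff: "zero_object C Z \<longleftrightarrow> Z \<in> Obj C \<and> aid C Z = azero C Z Z"
proof
  assume *: "zero_object C Z"
  then have Z: "Z \<in> Obj C" by (simp add: zero_object_def)
  have "mor (aid C Z) \<in> Hom C Z Z" "mor (azero C Z Z) \<in> Hom C Z Z"
    using Z by (auto intro!: mor_in_Hom)
  then have "mor (aid C Z) = mor (azero C Z Z)" using * Z unfolding zero_object_def by blast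
  then show "Z \<in> Obj C \<and> aid C Z = azero C Z Z" using Z by (auto intro: arrow_eqI)
next
  assume *: "Z \<in> Obj C \<and> aid C Z = azero C Z Z"
  have 1: "f = azero C (src f) Z" if "arr C f" "tgt f = Z" for f
    using * that aid_acomp[of f Z] acomp_azero(2)[of f Z Z] by (auto simp del: aid_acomp acomp_azero)
  have 2: "f = azero C Z (tgt f)" if "arr C f" "src f = Z" for f
    using * that acomp_aid[of f Z] acomp_azero(1)[of f Z Z] by (auto simp del: acomp_aid acomp_azero)
  have "\<exists>!f. f \<in> Hom C X Z" if "X \<in> Obj C" for X
  proof (rule ex1I[of _ "Zer C X Z"])
    show "Zer C X Z \<in> Hom C X Z" using * that mor_in_Hom[of C "azero C X Z" X Z] by (simp add: arrow_mor)
    show "f = Zer C X Z" if "f \<in> Hom C X Z" for f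
      using 1[of "Arrow X Z f"] that \<open>X \<in> Obj C\<close> * by (simp add: arr_def azero_def)
  qed
  moreover have "\<exists>!f. f \<in> Hom C Z X" if "X \<in> Obj C" for X
  proof (rule ex1I[of _ "Zer C Z X"])
    show "Zer C Z X \<in> Hom C Z X" using * that mor_in_Hom[of C "azero C Z X" Z X] by (simp add: arrow_mor)
    show "f = Zer C Z X" if "f \<in> Hom C Z X" for f
      using 2[of "Arrow Z X f"] that \<open>X \<in> Obj C\<close> * by (simp add: arr_def azero_def)
  qed
  ultimately show "zero_object C Z" using * by (simp add: zero_object_def)
qed

lemma arr_to_zero: "\<lbrakk>arr C f; zero_object C (tgt f)\<rbrakk> \<Longrightarrow> f = azero C (src f) (tgt f)"
  using aid_acomp[of f "tgt f"] acomp_azero(2)[of f "tgt f" "tgt f"] by (auto simp: zero_object_iff simp del: aid_acomp acomp_azero)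

lemma arr_from_zero: "\<lbrakk>arr C f; zero_object C (src f)\<rbrakk> \<Longrightarrow> f = azero C (src f) (tgt f)"
  using acomp_aid[of f "src f"] acomp_azero(1)[of f "src f" "src f"] by (auto simp: zero_object_iff simp del: acomp_aid acomp_azero)

definition aiso :: "('a, 'b) arrow \<Rightarrow> bool" where
  "aiso f \<longleftrightarrow> arr C f \<and> (\<exists>g. \<guillemotleft>g :\<^bsub>C\<^esub> tgt f \<rightarrow> src f\<guillemotright> \<and> g \<odot> f = aid C (src f) \<and> f \<odot> g = aid C (tgt f))"

lemma aisoI: "\<lbrakk>arr C f; arr C g; src g = tgt f; tgt g = src f; g \<odot> f = aid C (src f); f \<odot> g = aid C (tgt f)\<rbrakk> \<Longrightarrow> aiso f"
  unfolding aiso_def by (metis arrD(1,2))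

lemma aisoE:
  assumes "aiso f"
  obtains g where "\<guillemotleft>g :\<^bsub>C\<^esub> tgt f \<rightarrow> src f\<guillemotright>" "g \<odot> f = aid C (src f)" "f \<odot> g = aid C (tgt f)"
  using assms unfolding aiso_def by blast

lemma aiso_arr: "aiso f \<Longrightarrow> arr C f"
  by (simp add: aiso_def)

lemma is_iso_iff: "\<lbrakk>X \<in> Obj C; Y \<in> Obj C\<rbrakk> \<Longrightarrow> is_iso C X Y f \<longleftrightarrow> aiso (Arrow X Y f)"
proof
  assume o: "X \<in> Obj C" "Y \<in> Obj C"
  show "aiso (Arrow X Y f)" if iso: "is_iso C X Y f"
  proof -
    from iso obtain g where g: "f \<in> Hom C X Y" "g \<in> Hom C Y X" "g \<cdot> f = Ident C X" "f \<cdot> g = Ident C Y"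
      unfolding is_iso_def by auto
    show ?thesis
      by (rule aisoI[of _ "Arrow Y X g"]) (use o g in \<open>auto simp: arr_def acomp_def aid_def\<close>)
  qed
  show "is_iso C X Y f" if "aiso (Arrow X Y f)"
    using that o by (auto simp: aiso_def is_iso_def acomp_def aid_def arr_def)
qed

lemma aiso_aid: "X \<in> Obj C \<Longrightarrow> aiso (aid C X)"
  by (rule aisoI[of _ "aid C X"]) auto

lemma aiso_aneg_aid: "X \<in> Obj C \<Longrightarrow> aiso (\<ominus> (aid C X))"
  by (rule aisoI[of _ "\<ominus> (aid C X)"]) auto

lemma aiso_acomp:
  assumes "aiso g" "aiso f" "src g = tgt f"
  shows "aiso (g \<odot> f)"
proof -
  obtain g' where g': "\<guillemotleft>g' :\<^bsub>C\<^esub> tgt g \<rightarrow> src g\<guillemotright>" "g' \<odot> g = aid C (src g)" "g \<odot> g' = aid C (tgt g)" using assms(1) by (rule aisoE)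
  obtain f' where f': "\<guillemotleft>f' :\<^bsub>C\<^esub> tgt f \<rightarrow> src f\<guillemotright>" "f' \<odot> f = aid C (src f)" "f \<odot> f' = aid C (tgt f)" using assms(2) by (rule aisoE)
  note [simp] = assms(3) assms(1,2)[THEN aiso_arr] acomp_eq[OF g'(2)] acomp_eq[OF f'(3)]
  show ?thesis by (rule aisoI[of _ "f' \<odot> g'"]) (use g' f' in auto)
qed

text \<open>The usual $g = g f h = h$. It serves where a left and a right inverse come from
  unrelated lifts.\<close>

lemma aiso_left_right:
  assumes "arr C f" "arr C g" "arr C h" "src g = tgt f" "tgt g = src f" "src h = tgt f" "tgt h = src f"
    "g \<odot> f = aid C (src f)" "f \<odot> h = aid C (tgt f)"
  shows "aiso f"
proof -
  have "g = g \<odot> (f \<odot> h)" unfolding assms(9) using assms(1,2,4) by simp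
  also have "\<dots> = (g \<odot> f) \<odot> h" using assms(1-7) by simp
  also have "\<dots> = h" unfolding assms(8) using assms(3,7) by simp
  finally have "h \<odot> f = aid C (src f)" using assms(8) by blast
  then show ?thesis by (rule aisoI[OF assms(1,3,6,7) _ assms(9)])
qed

end

text \<open>Typed form of \<open>biproduct\<close>; the sum is not an argument but is read off as
  the common target of the two injections.\<close>

definition abiproduct :: "('o, 'm, 'z) cat_scheme \<Rightarrow> ('o, 'm) arrow \<Rightarrow> ('o, 'm) arrow \<Rightarrow> ('o, 'm) arrow \<Rightarrow> ('o, 'm) arrow \<Rightarrow> bool" where
  "abiproduct C e1 e2 p1 p2 \<longleftrightarrow> arr C e1 \<and> arr C e2 \<and> arr C p1 \<and> arr C p2 \<and>
    tgt e1 = tgt e2 \<and> src p1 = tgt e2 \<and> src p2 = tgt e2 \<and> tgt p1 = src e1 \<and> tgt p2 = src e2 \<and>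
    p1 \<odot>\<^bsub>C\<^esub> e1 = aid C (src e1) \<and> p2 \<odot>\<^bsub>C\<^esub> e2 = aid C (src e2) \<and>
    p1 \<odot>\<^bsub>C\<^esub> e2 = azero C (src e2) (src e1) \<and> p2 \<odot>\<^bsub>C\<^esub> e1 = azero C (src e1) (src e2) \<and>
    (e1 \<odot>\<^bsub>C\<^esub> p1) \<oplus>\<^bsub>C\<^esub> (e2 \<odot>\<^bsub>C\<^esub> p2) = aid C (tgt e2)"

lemma abiproduct_iff:
  "\<lbrakk>X \<in> Obj C; Y \<in> Obj C\<rbrakk> \<Longrightarrow> biproduct C X Y S e1 e2 p1 p2 \<longleftrightarrow>
    abiproduct C (Arrow X S e1) (Arrow Y S e2) (Arrow S X p1) (Arrow S Y p2)"
  unfolding biproduct_def abiproduct_def arr_def acomp_def aid_def azero_def aplus_def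
  apply (simp only: arrow.sel arrow.inject simp_thms)
  apply (intro iffI; elim conjE; intro conjI; assumption)
  done

section \<open>Distinguished triangles\<close>

definition ash :: "('o, 'm, 'z) shift_cat_scheme \<Rightarrow> int \<Rightarrow> ('o, 'm) arrow \<Rightarrow> ('o, 'm) arrow" where
  "ash C n f = Arrow (ShO C n (src f)) (ShO C n (tgt f)) (ShM C n (mor f))"

lemma ash_selectors [simp]: "src (ash C n f) = ShO C n (src f)" "tgt (ash C n f) = ShO C n (tgt f)"
  by (simp_all add: ash_def)

context additive_shift_category
begin

lemma arr_ash [simp]: "arr C f \<Longrightarrow> arr C (ash C n f)"
  by (simp add: arr_def ash_def shO_in shM_in)

lemmas [simp] = shO_in shO_zero shO_add

lemma shO_add0 [simp]: "\<lbrakk>m + n = 0; X \<in> Obj C\<rbrakk> \<Longrightarrow> ShO C m (ShO C n X) = X"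
  by simp

lemma ash_acomp [simp]: "\<lbrakk>arr C g; arr C f; src g = tgt f\<rbrakk> \<Longrightarrow> ash C n (g \<odot> f) = ash C n g \<odot> ash C n f"
  by (auto simp add: ash_def acomp_def arr_def shM_comp)

lemma ash_aplus [simp]:
  "\<lbrakk>arr C g; arr C f; src g = src f; tgt g = tgt f\<rbrakk> \<Longrightarrow> ash C n (g \<oplus> f) = ash C n g \<oplus> ash C n f"
  by (auto simp add: ash_def aplus_def arr_def shM_plus)

lemma ash_aid [simp]: "X \<in> Obj C \<Longrightarrow> ash C n (aid C X) = aid C (ShO C n X)"
  by (simp add: ash_def aid_def shM_ident)

lemma ash_azero [simp]: "\<lbrakk>X \<in> Obj C; Y \<in> Obj C\<rbrakk> \<Longrightarrow> ash C n (azero C X Y) = azero C (ShO C n X) (ShO C n Y)"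
  using aplus_idem[of "ash C n (azero C X Y)"] ash_aplus[of "azero C X Y" "azero C X Y" n, symmetric] by simp

lemma ash_aneg [simp]: "arr C f \<Longrightarrow> ash C n (\<ominus> f) = \<ominus> (ash C n f)"
proof -
  assume f: "arr C f"
  have "ash C n f \<oplus> ash C n (\<ominus> f) = ash C n (f \<oplus> \<ominus> f)" using f ash_aplus[of f "\<ominus> f"] by (simp del: aplus_aneg)
  then show ?thesis using f arrD(1,2)[OF f] by (intro aneg_unique) simp_all
qed

lemma ash_zero [simp]: "arr C f \<Longrightarrow> ash C 0 f = f"
  by (auto simp add: ash_def arr_def shM_zero intro: arrow_eqI)

lemma ash_ash [simp]: "arr C f \<Longrightarrow> ash C m (ash C n f) = ash C (m + n) f"
  by (auto simp add: ash_def arr_def shM_add intro: arrow_eqI)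

lemma ash_inj: "\<lbrakk>arr C f; arr C g\<rbrakk> \<Longrightarrow> ash C n f = ash C n g \<longleftrightarrow> f = g"
proof
  assume *: "arr C f" "arr C g" "ash C n f = ash C n g"
  have "ash C (-n) (ash C n f) = ash C (-n) (ash C n g)" by (simp only: *(3))
  then show "f = g" using *(1,2) by simp
qed simp

lemma ash_eq_zero_iff:
  "\<lbrakk>arr C f; X \<in> Obj C; Y \<in> Obj C; src f = X; tgt f = Y\<rbrakk> \<Longrightarrow> ash C n f = azero C (ShO C n X) (ShO C n Y) \<longleftrightarrow> f = azero C X Y"
  using ash_inj[of f "azero C X Y" n] by simp

lemma zero_object_ShO: "zero_object C Z \<Longrightarrow> zero_object C (ShO C n Z)"
  unfolding zero_object_iff by (metis ash_aid ash_azero shO_in)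

end

section \<open>Rotations, signs, shifts and completions of distinguished triangles\<close>

context triangulated_category
begin

definition tri :: "('o, 'm) arrow \<Rightarrow> ('o, 'm) arrow \<Rightarrow> ('o, 'm) arrow \<Rightarrow> bool" where
  "tri f g h \<longleftrightarrow> arr C f \<and> arr C g \<and> arr C h \<and> src g = tgt f \<and> src h = tgt g \<and> tgt h = ShO C 1 (src f) \<and>
     (src f, tgt f, tgt g, mor f, mor g, mor h) \<in> Dist C"

lemma triD:
  assumes "tri f g h"
  shows "arr C f" "arr C g" "arr C h" "src g = tgt f" "src h = tgt g" "tgt h = ShO C 1 (src f)"
    "src f \<in> Obj C" "tgt f \<in> Obj C" "tgt g \<in> Obj C"
  using assms by (auto simp: tri_def arr_def)

lemma tri_Dist: "(X, Y, Z, f, g, h) \<in> Dist C \<Longrightarrow> tri (Arrow X Y f) (Arrow Y Z g) (Arrow Z (ShO C 1 X) h)"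
  using dist_triangle[of "(X, Y, Z, f, g, h)"] by (auto simp: tri_def is_triangle_def arr_Arrow)

lemma Dist_iff_tri: "(X, Y, Z, f, g, h) \<in> Dist C \<longleftrightarrow> tri (Arrow X Y f) (Arrow Y Z g) (Arrow Z (ShO C 1 X) h)"
  using tri_Dist by (auto simp: tri_def)

lemma tri_rotate_iff:
  assumes "arr C f" "arr C g" "arr C h" "src g = tgt f" "src h = tgt g" "tgt h = ShO C 1 (src f)"
  shows "tri f g h \<longleftrightarrow> tri g h (\<ominus> (ash C 1 f))"
proof -
  have "is_triangle C (src f, tgt f, tgt g, mor f, mor g, mor h)"
    using assms by (auto simp: is_triangle_def arr_def)
  from TR2[OF this] show ?thesis
    using assms arr_aneg[OF arr_ash[of f 1]] by (auto simp add: tri_def arrow_mor ash_def)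
qed

lemma tri_rotate: "tri f g h \<Longrightarrow> tri g h (\<ominus> (ash C 1 f))"
  using tri_rotate_iff[of f g h] by (simp add: triD)

lemma tri_rotate_back:
  assumes "tri f g h"
  shows "tri (\<ominus> (ash C (-1) h)) f g"
  using assms triD[OF assms] by (subst tri_rotate_iff) simp_all

lemma tri_isomorphic:
  assumes "tri f g h" "aiso u" "aiso v" "aiso w" "arr C f'" "arr C g'" "arr C h'"
    "src u = src f" "src v = tgt f" "src w = tgt g" "tgt u = src f'" "tgt v = tgt f'" "tgt v = src g'"
    "tgt w = tgt g'" "src h' = tgt g'" "tgt h' = ShO C 1 (src f')"
    "v \<odot> f = f' \<odot> u" "w \<odot> g = g' \<odot> v" "ash C 1 u \<odot> h = h' \<odot> w"
  shows "tri f' g' h'"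
proof -
  note d = triD[OF assms(1)]
  have iso: "is_iso C (src u) (tgt u) (mor u)" "is_iso C (src v) (tgt v) (mor v)" "is_iso C (src w) (tgt w) (mor w)"
    using assms(2-4)[THEN aiso_arr] assms(2-4) by (simp_all add: is_iso_iff arrD Arrow_mor)
  have *: "(src f, tgt f, tgt g, mor f, mor g, mor h) \<in> Dist C" using assms(1) by (simp add: tri_def)
  have eqs: "mor (v \<odot> f) = mor (f' \<odot> u)" "mor (w \<odot> g) = mor (g' \<odot> v)" "mor (ash C 1 u \<odot> h) = mor (h' \<odot> w)"
    unfolding assms by simp_all
  have "triangle_iso C (src f, tgt f, tgt g, mor f, mor g, mor h) (src f', tgt f', tgt g', mor f', mor g', mor h')"
    unfolding triangle_iso_def prod.case
  proof (intro conjI exI)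
    show "is_triangle C (src f, tgt f, tgt g, mor f, mor g, mor h)" by (rule dist_triangle[OF *])
    show "is_triangle C (src f', tgt f', tgt g', mor f', mor g', mor h')"
      using assms by (auto simp: is_triangle_def arr_def)
  qed (use iso eqs[unfolded arrow_mor] assms(8-16) in \<open>simp_all add: ash_def\<close>)
  from TR1_iso[OF * this] show ?thesis using assms by (simp add: tri_def)
qed

text \<open>Signs may be changed on two maps at a time: the isomorphism of triangles is $-1$ on the
  middle object and the identity on the others.\<close>

lemma tri_neg12:
  assumes "tri f g h"
  shows "tri (\<ominus> f) (\<ominus> g) h"
  by (rule tri_isomorphic[of f g h "aid C (src f)" "\<ominus> (aid C (tgt f))" "aid C (tgt g)"])
    (use assms triD[OF assms] in \<open>simp_all add: aiso_aid aiso_aneg_aid\<close>)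

lemma tri_neg23:
  assumes "tri f g h"
  shows "tri f (\<ominus> g) (\<ominus> h)"
  by (rule tri_isomorphic[of f g h "aid C (src f)" "aid C (tgt f)" "\<ominus> (aid C (tgt g))"])
    (use assms triD[OF assms] in \<open>simp_all add: aiso_aid aiso_aneg_aid\<close>)

lemma tri_neg13:
  assumes "tri f g h"
  shows "tri (\<ominus> f) g (\<ominus> h)"
  using tri_neg23[OF tri_neg12[OF assms]] triD[OF assms] by simp

lemma tri_shift1:
  assumes "tri f g h"
  shows "tri (\<ominus> (ash C 1 f)) (ash C 1 g) (ash C 1 h)"
  using tri_neg23[OF tri_rotate[OF tri_rotate[OF tri_rotate[OF assms]]]] triD[OF assms] by simp

text \<open>Three backward rotations put a sign on each of the three maps, and two of these signs
  are then removed together.\<close>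

lemma tri_shift_m1:
  assumes "tri f g h"
  shows "tri (\<ominus> (ash C (-1) f)) (ash C (-1) g) (ash C (-1) h)"
  using tri_neg12[OF tri_rotate_back[OF tri_rotate_back[OF tri_rotate_back[OF assms]]]]
    tri_neg23[OF tri_rotate_back[OF tri_rotate_back[OF tri_rotate_back[OF assms]]]] triD[OF assms] 
    tri_neg13[OF tri_rotate_back[OF tri_rotate_back[OF tri_rotate_back[OF assms]]]] by simp

definition sgn_arr :: "int \<Rightarrow> ('o, 'm) arrow \<Rightarrow> ('o, 'm) arrow" where
  "sgn_arr n f = (if even n then f else \<ominus> f)"

lemma sgn_arr_simps [simp]:
  "src (sgn_arr n f) = src f" "tgt (sgn_arr n f) = tgt f" "arr C f \<Longrightarrow> arr C (sgn_arr n f)"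
  by (simp_all add: sgn_arr_def)

lemma sgn_arr_suc: "arr C f \<Longrightarrow> sgn_arr (n + 1) f = \<ominus> (sgn_arr n f)" "arr C f \<Longrightarrow> sgn_arr (n - 1) f = \<ominus> (sgn_arr n f)"
  by (simp_all add: sgn_arr_def)

lemma ash_sgn_arr: "arr C f \<Longrightarrow> ash C m (sgn_arr n f) = sgn_arr n (ash C m f)"
  by (simp add: sgn_arr_def)

text \<open>Each shift by one costs a sign, which is always collected on the first map; the
  induction runs in both directions from $n = 0$.\<close>

lemma tri_shift:
  assumes "tri f g h"
  shows "tri (sgn_arr n (ash C n f)) (ash C n g) (ash C n h)"
proof (induction n rule: int_induct[where k=0])
  case base
  then show ?case using assms triD[OF assms] by (simp add: sgn_arr_def)
next
  case (step1 i)
  then show ?case using tri_shift1[of "sgn_arr i (ash C i f)" "ash C i g" "ash C i h"] triD[OF assms]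
    by (simp add: sgn_arr_suc ash_sgn_arr add.commute[of 1 i])
next
  case (step2 i)
  then show ?case using tri_shift_m1[of "sgn_arr i (ash C i f)" "ash C i g" "ash C i h"] triD[OF assms]
    by (simp add: sgn_arr_suc ash_sgn_arr)
qed

lemma tri_cone: "arr C f \<Longrightarrow> \<exists>g h. tri f g h"
proof -
  assume f: "arr C f"
  then obtain Z g h where "(src f, tgt f, Z, mor f, g, h) \<in> Dist C" using TR1_cone[of "src f" "tgt f" "mor f"] by (auto simp: arr_def)
  then show ?thesis using tri_Dist[of "src f" "tgt f" Z "mor f" g h] by (auto simp: Arrow_mor)
qed

lemma tri_fiber: "arr C g \<Longrightarrow> \<exists>f h. tri f g h"
  using tri_cone tri_rotate_back by blast

lemma tri_cocone: "\<lbrakk>arr C h; X \<in> Obj C; tgt h = ShO C 1 X\<rbrakk> \<Longrightarrow> \<exists>f g. tri f g h"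
proof -
  assume h: "arr C h" "X \<in> Obj C" "tgt h = ShO C 1 X"
  then obtain f g where "tri f g h" using tri_fiber[of h] tri_rotate_back tri_fiber by (metis tri_cone)
  then show ?thesis by blast
qed

lemma tri_fill3:
  assumes "tri f g h" "tri f' g' h'" "arr C u" "arr C v" "src u = src f" "tgt u = src f'" "src v = tgt f" "tgt v = tgt f'"
    "v \<odot> f = f' \<odot> u"
  shows "\<exists>w. \<guillemotleft>w :\<^bsub>C\<^esub> tgt g \<rightarrow> tgt g'\<guillemotright> \<and> w \<odot> g = g' \<odot> v \<and> ash C 1 u \<odot> h = h' \<odot> w"
proof -
  have 1: "(src f, tgt f, tgt g, mor f, mor g, mor h) \<in> Dist C" "(src f', tgt f', tgt g', mor f', mor g', mor h') \<in> Dist C"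
    using assms by (auto simp: tri_def)
  have 2: "mor u \<in> Hom C (src f) (src f')" "mor v \<in> Hom C (tgt f) (tgt f')" using assms by (auto simp: arr_def)
  have 3: "mor v \<cdot> mor f = mor f' \<cdot> mor u" using arg_cong[OF assms(9), of mor] by (simp add: arrow_mor)
  from TR3[OF 1 2 3] obtain w where w: "w \<in> Hom C (tgt g) (tgt g')" "w \<cdot> mor g = mor g' \<cdot> mor v"
    "ShM C 1 (mor u) \<cdot> mor h = mor h' \<cdot> w" by blast
  then show ?thesis using assms triD[OF assms(1)] triD[OF assms(2)]
    by (intro exI[of _ "Arrow (tgt g) (tgt g') w"]) (auto simp: arr_Arrow acomp_def ash_def)
qed

text \<open>Rotation turns the missing first component into a third one. What the completion axiom
  then gives is a map of the shifted first terms, which is shifted back.\<close>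

lemma tri_fill1:
  assumes "tri f g h" "tri f' g' h'" "arr C v" "arr C w" "src v = tgt f" "tgt v = tgt f'" "src w = tgt g" "tgt w = tgt g'"
    "w \<odot> g = g' \<odot> v"
  shows "\<exists>u. \<guillemotleft>u :\<^bsub>C\<^esub> src f \<rightarrow> src f'\<guillemotright> \<and> v \<odot> f = f' \<odot> u \<and> ash C 1 u \<odot> h = h' \<odot> w"
proof -
  note d = triD[OF assms(1)] triD[OF assms(2)]
  from tri_fill3[OF tri_rotate[OF assms(1)] tri_rotate[OF assms(2)], of v w] assms d
  obtain u1 where u1: "\<guillemotleft>u1 :\<^bsub>C\<^esub> ShO C 1 (src f) \<rightarrow> ShO C 1 (src f')\<guillemotright>" "u1 \<odot> h = h' \<odot> w"
    "ash C 1 v \<odot> \<ominus> (ash C 1 f) = \<ominus> (ash C 1 f') \<odot> u1" by auto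
  define u where "u = ash C (-1) u1"
  have u: "\<guillemotleft>u :\<^bsub>C\<^esub> src f \<rightarrow> src f'\<guillemotright>" "ash C 1 u = u1" using u1 d by (auto simp: u_def)
  have "ash C 1 (v \<odot> f) = ash C 1 (f' \<odot> u)" using u1 d assms u by (simp add: aneg_eq_iff)
  then have "v \<odot> f = f' \<odot> u" using u d assms by (subst (asm) ash_inj) auto
  then show ?thesis using u u1 by blast
qed

lemma tri_fill2:
  assumes "tri f g h" "tri f' g' h'" "arr C u" "arr C w" "src u = src f" "tgt u = src f'" "src w = tgt g" "tgt w = tgt g'"
    "ash C 1 u \<odot> h = h' \<odot> w"
  shows "\<exists>v. \<guillemotleft>v :\<^bsub>C\<^esub> tgt f \<rightarrow> tgt f'\<guillemotright> \<and> v \<odot> f = f' \<odot> u \<and> w \<odot> g = g' \<odot> v"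
proof -
  note d = triD[OF assms(1)] triD[OF assms(2)]
  from tri_fill1[OF tri_rotate[OF assms(1)] tri_rotate[OF assms(2)], of w "ash C 1 u"] assms d
  obtain v where v: "\<guillemotleft>v :\<^bsub>C\<^esub> tgt f \<rightarrow> tgt f'\<guillemotright>" "w \<odot> g = g' \<odot> v"
    "ash C 1 v \<odot> \<ominus> (ash C 1 f) = \<ominus> (ash C 1 f') \<odot> ash C 1 u" by auto
  have "ash C 1 (v \<odot> f) = ash C 1 (f' \<odot> u)" using v d assms by (simp add: aneg_eq_iff)
  then have "v \<odot> f = f' \<odot> u" using v d assms by (subst (asm) ash_inj) auto
  then show ?thesis using v by blast
qed

lemma tri_id: "\<lbrakk>X \<in> Obj C; zero_object C Z\<rbrakk> \<Longrightarrow> tri (aid C X) (azero C X Z) (azero C Z (ShO C 1 X))"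
  using TR1_ident[of X Z] by (auto simp: Dist_iff_tri aid_def azero_def)

lemma tri_comp_zero:
  assumes "tri f g h"
  shows "g \<odot> f = azero C (src f) (tgt g)" "h \<odot> g = azero C (tgt f) (ShO C 1 (src f))"
    "ash C 1 f \<odot> h = azero C (tgt g) (ShO C 1 (tgt f))"
proof -
  have *: "g \<odot> f = azero C (src f) (tgt g)" if t: "tri f g h" for f g h
  proof -
    note d = triD[OF t]
    obtain Z where Z: "zero_object C Z" using zero_object_exists by blast
    then have "Z \<in> Obj C" by (simp add: zero_object_def)
    obtain w where "\<guillemotleft>w :\<^bsub>C\<^esub> Z \<rightarrow> tgt g\<guillemotright>" "w \<odot> azero C (src f) Z = g \<odot> f"
      using tri_fill3[OF tri_id[of "src f" Z, OF _ Z] t, of "aid C (src f)" f] d \<open>Z \<in> Obj C\<close> by auto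
    then show ?thesis using d by simp
  qed
  note d = triD[OF assms]
  show "g \<odot> f = azero C (src f) (tgt g)" "h \<odot> g = azero C (tgt f) (ShO C 1 (src f))"
    using *[OF assms] *[OF tri_rotate[OF assms]] d by auto
  show "ash C 1 f \<odot> h = azero C (tgt g) (ShO C 1 (tgt f))"
    using *[OF tri_rotate[OF tri_rotate[OF assms]]] d by simp
qed

text \<open>$f$ is a weak kernel of $g$: the arrow $u$ and the zero map form a commutative square
  from the triangle of an identity to the given one, and the completed first component is the lift.
  It is in general not unique.\<close>

lemma tri_lift2:
  assumes "tri f g h" "arr C u" "tgt u = tgt f" "g \<odot> u = azero C (src u) (tgt g)"
  shows "\<exists>v. \<guillemotleft>v :\<^bsub>C\<^esub> src u \<rightarrow> src f\<guillemotright> \<and> u = f \<odot> v"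
proof -
  note d = triD[OF assms(1)]
  obtain Z where Z: "zero_object C Z" using zero_object_exists by blast
  then have [simp]: "Z \<in> Obj C" by (simp add: zero_object_def)
  have [simp]: "src u \<in> Obj C" using assms arrD by blast
  obtain v where v: "\<guillemotleft>v :\<^bsub>C\<^esub> src u \<rightarrow> src f\<guillemotright>" "u \<odot> aid C (src u) = f \<odot> v"
    using tri_fill1[OF tri_id[of "src u" Z, OF _ Z] assms(1), of u "azero C Z (tgt g)"] d assms by auto
  show ?thesis using v(1) v(2)[symmetric] acomp_aid[OF assms(2) refl] aid_acomp[OF assms(2) refl] by metis
qed

text \<open>$g$ is a weak cokernel of $f$, by comparison with a triangle whose middle map is the
  identity of the target of $u$. The lifts and extensions at the other corners follow from these two
  by rotation.\<close>

lemma tri_ext2: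
  assumes "tri f g h" "arr C u" "src u = tgt f" "u \<odot> f = azero C (src f) (tgt u)"
  shows "\<exists>v. \<guillemotleft>v :\<^bsub>C\<^esub> tgt g \<rightarrow> tgt u\<guillemotright> \<and> u = v \<odot> g"
proof -
  note d = triD[OF assms(1)]
  obtain Z where Z: "zero_object C Z" using zero_object_exists by blast
  have [simp]: "Z \<in> Obj C" "zero_object C (ShO C (-1) Z)" using Z by (simp add: zero_object_iff, rule zero_object_ShO)
  have [simp]: "tgt u \<in> Obj C" using assms arrD by blast
  have t: "tri (azero C (ShO C (-1) Z) (tgt u)) (aid C (tgt u)) (azero C (tgt u) Z)"
    using tri_rotate_back[OF tri_id[of "tgt u" Z]] Z by simp
  obtain v where v: "\<guillemotleft>v :\<^bsub>C\<^esub> tgt g \<rightarrow> tgt u\<guillemotright>" "v \<odot> g = aid C (tgt u) \<odot> u"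
    using tri_fill3[OF assms(1) t, of "azero C (src f) (ShO C (-1) Z)" u] d assms by auto
  show ?thesis using v(1) v(2)[symmetric] acomp_aid[OF assms(2) refl] aid_acomp[OF assms(2) refl] by metis
qed

lemma tri_lift3:
  assumes "tri f g h" "arr C u" "tgt u = tgt g" "h \<odot> u = azero C (src u) (ShO C 1 (src f))"
  shows "\<exists>v. \<guillemotleft>v :\<^bsub>C\<^esub> src u \<rightarrow> tgt f\<guillemotright> \<and> u = g \<odot> v"
  using tri_lift2[OF tri_rotate[OF assms(1)], of u] assms triD[OF assms(1)] by simp

lemma tri_ext3:
  assumes "tri f g h" "arr C u" "src u = tgt g" "u \<odot> g = azero C (tgt f) (tgt u)"
  shows "\<exists>v. \<guillemotleft>v :\<^bsub>C\<^esub> ShO C 1 (src f) \<rightarrow> tgt u\<guillemotright> \<and> u = v \<odot> h"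
  using tri_ext2[OF tri_rotate[OF assms(1)], of u] assms triD[OF assms(1)] by simp

lemma tri_lift1:
  assumes "tri f g h" "arr C u" "tgt u = src f" "f \<odot> u = azero C (src u) (tgt f)"
  shows "\<exists>v. \<guillemotleft>v :\<^bsub>C\<^esub> src u \<rightarrow> ShO C (-1) (tgt g)\<guillemotright> \<and> u = ash C (-1) h \<odot> v"
proof -
  note d = triD[OF assms(1)]
  have "\<exists>v. \<guillemotleft>v :\<^bsub>C\<^esub> src u \<rightarrow> ShO C (-1) (tgt g)\<guillemotright> \<and> u = \<ominus> (ash C (-1) h) \<odot> v"
    using tri_lift2[OF tri_rotate_back[OF assms(1)], of u] assms(2-4) d by simp
  then obtain v where v: "\<guillemotleft>v :\<^bsub>C\<^esub> src u \<rightarrow> ShO C (-1) (tgt g)\<guillemotright>" "u = \<ominus> (ash C (-1) h) \<odot> v"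
    by blast
  have "u = ash C (-1) h \<odot> \<ominus> v" by (subst v(2)) (use v(1) d in simp)
  then show ?thesis using v(1) by (intro exI[of _ "\<ominus> v"]) simp
qed

lemma tri_ext1:
  assumes "tri f g h" "arr C u" "src u = src f" "u \<odot> ash C (-1) h = azero C (ShO C (-1) (tgt g)) (tgt u)"
  shows "\<exists>v. \<guillemotleft>v :\<^bsub>C\<^esub> tgt f \<rightarrow> tgt u\<guillemotright> \<and> u = v \<odot> f"
  using tri_ext2[OF tri_rotate_back[OF assms(1)], of u] assms(2-4) triD[OF assms(1)] arrD(2)[OF assms(2)] by simp

lemma tri_ext2_diff:
  assumes "tri f g h" "arr C u" "arr C u'" "src u = tgt f" "src u' = tgt f" "tgt u = tgt u'" "u \<odot> f = u' \<odot> f"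
  shows "\<exists>v. \<guillemotleft>v :\<^bsub>C\<^esub> tgt g \<rightarrow> tgt u\<guillemotright> \<and> u = u' \<oplus> v \<odot> g"
proof -
  note d = triD[OF assms(1)]
  have "(u \<oplus> \<ominus> u') \<odot> f = azero C (src f) (tgt u)" using assms(2-7) d by simp
  then obtain v where v: "\<guillemotleft>v :\<^bsub>C\<^esub> tgt g \<rightarrow> tgt u\<guillemotright>" "u \<oplus> \<ominus> u' = v \<odot> g"
    using tri_ext2[OF assms(1), of "u \<oplus> \<ominus> u'"] assms(2-6) by (simp del: acomp_aplus aplus_acomp) blast
  then show ?thesis using eq_plus_diff[of u u', unfolded v(2)] assms(2-6) by (intro exI[of _ v]) simp
qed

lemma tri_lift2_diff:
  assumes "tri f g h" "arr C u" "arr C u'" "tgt u = tgt f" "tgt u' = tgt f" "src u = src u'" "g \<odot> u = g \<odot> u'"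
  shows "\<exists>v. \<guillemotleft>v :\<^bsub>C\<^esub> src u \<rightarrow> src f\<guillemotright> \<and> u = u' \<oplus> f \<odot> v"
proof -
  note d = triD[OF assms(1)]
  have "g \<odot> (u \<oplus> \<ominus> u') = azero C (src u) (tgt g)" using assms(2-7) d by simp
  then obtain v where v: "\<guillemotleft>v :\<^bsub>C\<^esub> src u \<rightarrow> src f\<guillemotright>" "u \<oplus> \<ominus> u' = f \<odot> v"
    using tri_lift2[OF assms(1), of "u \<oplus> \<ominus> u'"] assms(2-6) by (simp del: acomp_aplus aplus_acomp) blast
  then show ?thesis using eq_plus_diff[of u u', unfolded v(2)] assms(2-6) by (intro exI[of _ v]) simp
qed

lemma tri_octahedron:
  assumes "tri f f2 f3" "tri g g2 g3" "tri (g \<odot> f) k2 k3" "src g = tgt f"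
  shows "\<exists>u v. tri u v (ash C 1 f2 \<odot> g3) \<and> \<guillemotleft>u :\<^bsub>C\<^esub> tgt f2 \<rightarrow> tgt k2\<guillemotright> \<and> \<guillemotleft>v :\<^bsub>C\<^esub> tgt k2 \<rightarrow> tgt g2\<guillemotright> \<and>
    u \<odot> f2 = k2 \<odot> g \<and> k3 \<odot> u = f3 \<and> v \<odot> k2 = g2 \<and> g3 \<odot> v = ash C 1 f \<odot> k3"
proof -
  note d = triD[OF assms(1)] triD[OF assms(2)] triD[OF assms(3)]
  have 1: "(src f, tgt f, tgt f2, mor f, mor f2, mor f3) \<in> Dist C" "(tgt f, tgt g, tgt g2, mor g, mor g2, mor g3) \<in> Dist C"
   "(src f, tgt g, tgt k2, mor g \<cdot> mor f, mor k2, mor k3) \<in> Dist C"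
    using assms by (auto simp: tri_def arrow_mor)
  from TR4[OF 1] obtain u v where uv: "(tgt f2, tgt k2, tgt g2, u, v, ShM C 1 (mor f2) \<cdot> mor g3) \<in> Dist C"
    "u \<cdot> mor f2 = mor k2 \<cdot> mor g" "mor k3 \<cdot> u = mor f3" "v \<cdot> mor k2 = mor g2" "mor g3 \<cdot> v = ShM C 1 (mor f) \<cdot> mor k3" by blast
  note t = tri_Dist[OF uv(1)]
  have "Arrow (tgt g2) (ShO C 1 (tgt f2)) (ShM C 1 (mor f2) \<cdot> mor g3) = ash C 1 f2 \<odot> g3"
    by (rule arrow_eqI) (use d assms in \<open>auto simp: ash_def arrow_mor\<close>)
  then show ?thesis using t triD[OF t] uv d assms
    by (intro exI[of _ "Arrow (tgt f2) (tgt k2) u"] exI[of _ "Arrow (tgt k2) (tgt g2) v"])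
      (auto intro!: arrow_eqI simp: ash_def arrow_mor)
qed

text \<open>If the third object is zero, so are the second and third map; then the identity of the
  target lifts through $f$ and the identity of the source extends along $f$.\<close>

lemma tri_zero_iso:
  assumes "tri f g h" "zero_object C (tgt g)"
  shows "aiso f"
proof -
  note d = triD[OF assms(1)]
  have g0: "g = azero C (tgt f) (tgt g)" "h = azero C (tgt g) (ShO C 1 (src f))"
    using arr_to_zero[of g] arr_from_zero[of h] assms d by auto
  obtain r where r: "\<guillemotleft>r :\<^bsub>C\<^esub> tgt f \<rightarrow> src f\<guillemotright>" "aid C (tgt f) = f \<odot> r"
    using tri_lift2[OF assms(1), of "aid C (tgt f)"] d g0 by auto
  have "ash C (-1) h = azero C (ShO C (-1) (tgt g)) (src f)" using d by (subst g0(2)) simp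
  then obtain l where l: "\<guillemotleft>l :\<^bsub>C\<^esub> tgt f \<rightarrow> src f\<guillemotright>" "aid C (src f) = l \<odot> f"
    using tri_ext1[OF assms(1), of "aid C (src f)"] d by auto
  show ?thesis by (rule aiso_left_right[of f l r]) (use r l d in auto)
qed

end

context preadditive_category
begin

lemma in_hom_from_zero: "\<lbrakk>\<guillemotleft>f :\<^bsub>C\<^esub> X \<rightarrow> Y\<guillemotright>; zero_object C X\<rbrakk> \<Longrightarrow> f = azero C X Y"
  using arr_from_zero by blast

lemma in_hom_to_zero: "\<lbrakk>\<guillemotleft>f :\<^bsub>C\<^esub> X \<rightarrow> Y\<guillemotright>; zero_object C Y\<rbrakk> \<Longrightarrow> f = azero C X Y"
  using arr_to_zero by blast

end

context additive_shift_category
begin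

lemma shift_commute_1 [simp]: "ShO C (1 + k) X = ShO C (k + 1) X" "ash C (1 + k) f = ash C (k + 1) f"
  by (simp_all only: add.commute)

end

section \<open>Extensions and lifts along triangles when certain morphism groups vanish; two forms
  of the octahedron\<close>

context triangulated_category
begin

lemma tri_ext3_diff:
  assumes "tri f g h" "arr C u" "arr C u'" "src u = tgt g" "src u' = tgt g" "tgt u = tgt u'" "u \<odot> g = u' \<odot> g"
  shows "\<exists>v. \<guillemotleft>v :\<^bsub>C\<^esub> ShO C 1 (src f) \<rightarrow> tgt u\<guillemotright> \<and> u = u' \<oplus> v \<odot> h"
  using tri_ext2_diff[OF tri_rotate[OF assms(1)], of u u'] assms triD[OF assms(1)] by simp

text \<open>Two extensions along $a$ differ by a map that factors through $f$, and the last
  hypothesis kills the other factor. This is how orthogonality yields uniqueness throughout.\<close>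

lemma tri_ext_unique:
  assumes "tri a f b" "arr C u" "arr C u'" "src u = tgt a" "src u' = tgt a" "tgt u = tgt u'" "u \<odot> a = u' \<odot> a"
    "\<And>v. \<guillemotleft>v :\<^bsub>C\<^esub> tgt f \<rightarrow> tgt u\<guillemotright> \<Longrightarrow> v = azero C (tgt f) (tgt u)"
  shows "u = u'"
proof -
  note d = triD[OF assms(1)]
  obtain v where v: "\<guillemotleft>v :\<^bsub>C\<^esub> tgt f \<rightarrow> tgt u\<guillemotright>" "u = u' \<oplus> v \<odot> f"
    using tri_ext2_diff[OF assms(1-7)] by blast
  have "v = azero C (tgt f) (tgt u)" using assms(8)[OF v(1)] .
  then have "v \<odot> f = azero C (src f) (tgt u)" using d v(1) by simp
  then show ?thesis using v(2) assms(3-6) d by simp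
qed

lemma tri_lift_unique:
  assumes "tri a f b" "arr C u" "arr C u'" "tgt u = tgt f" "tgt u' = tgt f" "src u = src u'" "b \<odot> u = b \<odot> u'"
    "\<And>v. \<guillemotleft>v :\<^bsub>C\<^esub> src u \<rightarrow> tgt a\<guillemotright> \<Longrightarrow> v = azero C (src u) (tgt a)"
  shows "u = u'"
proof -
  note d = triD[OF assms(1)]
  obtain v where v: "\<guillemotleft>v :\<^bsub>C\<^esub> src u \<rightarrow> tgt a\<guillemotright>" "u = u' \<oplus> f \<odot> v"
    using tri_lift2_diff[OF tri_rotate[OF assms(1)], of u u'] assms(2-7) d by auto
  have "v = azero C (src u) (tgt a)" using assms(8)[OF v(1)] .
  then have "f \<odot> v = azero C (src u) (tgt f)" using d v(1) by simp
  then show ?thesis using v(2) assms(3-6) d by simp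
qed

text \<open>The obstruction to extending $u$ along $a$ is its composite with $b[-1]$, a map out of
  the third object shifted by $-1$.\<close>

lemma tri_ext_exists:
  assumes "tri a f b" "arr C u" "src u = src a"
    "\<And>v. \<guillemotleft>v :\<^bsub>C\<^esub> ShO C (-1) (tgt f) \<rightarrow> tgt u\<guillemotright> \<Longrightarrow> v = azero C (ShO C (-1) (tgt f)) (tgt u)"
  shows "\<exists>v. \<guillemotleft>v :\<^bsub>C\<^esub> tgt a \<rightarrow> tgt u\<guillemotright> \<and> u = v \<odot> a"
proof -
  note d = triD[OF assms(1)]
  have "u \<odot> ash C (-1) b = azero C (ShO C (-1) (tgt f)) (tgt u)"
    by (rule assms(4)) (use assms(2,3) d arrD[OF assms(2)] in simp)
  then show ?thesis using tri_ext1[OF assms(1-3)] by simp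
qed

lemma tri_lift_exists:
  assumes "tri a f b" "arr C u" "tgt u = tgt b"
    "\<And>v. \<guillemotleft>v :\<^bsub>C\<^esub> src u \<rightarrow> ShO C 1 (tgt a)\<guillemotright> \<Longrightarrow> v = azero C (src u) (ShO C 1 (tgt a))"
  shows "\<exists>v. \<guillemotleft>v :\<^bsub>C\<^esub> src u \<rightarrow> tgt f\<guillemotright> \<and> u = b \<odot> v"
proof -
  note d = triD[OF assms(1)]
  have "\<ominus> (ash C 1 a) \<odot> u = azero C (src u) (ShO C 1 (tgt a))"
    by (rule assms(4)) (use assms(2,3) d arrD[OF assms(2)] in simp)
  then show ?thesis using tri_lift2[OF tri_rotate[OF tri_rotate[OF assms(1)]], of u] assms(2,3) d arrD[OF assms(2)] by simp
qed

text \<open>Here the sign sits on the middle map, so that $a[-1]$ and $b[-1]$ occur unsigned, as the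
  compatibility conditions on \<alpha> and \<beta> require.\<close>

lemma tri_shift_m1': "tri f g h \<Longrightarrow> tri (ash C (-1) f) (\<ominus> (ash C (-1) g)) (ash C (-1) h)"
  using tri_neg12[OF tri_shift_m1] by (simp add: triD)

text \<open>Two ways to see the octahedron on $V' \to L' \to L$, where the first map is $a'[-1]$: given the cone of
  $L' \to L$ or the cone of $G' \to G$, it produces the other one.\<close>

lemma octahedron_le:
  assumes t1: "tri a1 f1 b1" and t0: "tri a0 f0 b0" and t: "tri al c d"
    and "src al = ShO C (-1) (tgt a1)" "tgt al = tgt a0" "src a0 = ShO C (-1) (src a1)"
    and al: "al \<odot> ash C (-1) a1 = a0"
  obtains be y where "tri be y (\<ominus> (f1 \<odot> d))" "\<guillemotleft>be :\<^bsub>C\<^esub> ShO C (-1) (tgt f1) \<rightarrow> tgt f0\<guillemotright>" "\<guillemotleft>y :\<^bsub>C\<^esub> tgt f0 \<rightarrow> tgt c\<guillemotright>"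
    "b0 \<odot> be = ash C (-1) b1" "c = y \<odot> f0" "d \<odot> y = a1 \<odot> b0"
proof -
  note d = triD[OF t1] triD[OF t0] triD[OF t]
  have t0': "tri (al \<odot> ash C (-1) a1) f0 b0" using t0 al by simp
  obtain u v where uv: "tri u v (ash C 1 (\<ominus> (ash C (-1) f1)) \<odot> d)" "\<guillemotleft>u :\<^bsub>C\<^esub> ShO C (-1) (tgt f1) \<rightarrow> tgt f0\<guillemotright>" "\<guillemotleft>v :\<^bsub>C\<^esub> tgt f0 \<rightarrow> tgt c\<guillemotright>"
    "b0 \<odot> u = ash C (-1) b1" "v \<odot> f0 = c" "d \<odot> v = ash C 1 (ash C (-1) a1) \<odot> b0"
    using tri_octahedron[OF tri_shift_m1'[OF t1] t t0'] assms(4) d by auto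
  show ?thesis by (rule that[of u v]) (use uv d assms(4-6) in simp_all)
qed

lemma octahedron_ge:
  assumes t1: "tri a1 f1 b1" and t0: "tri a0 f0 b0" and t: "tri be y x"
    and "src be = ShO C (-1) (tgt f1)" "tgt be = tgt f0" "src a0 = ShO C (-1) (src a1)"
    and be: "b0 \<odot> be = ash C (-1) b1"
  obtains al c d where "tri al c d" "\<guillemotleft>al :\<^bsub>C\<^esub> ShO C (-1) (tgt a1) \<rightarrow> tgt a0\<guillemotright>" "\<guillemotleft>d :\<^bsub>C\<^esub> tgt y \<rightarrow> tgt a1\<guillemotright>"
    "c = y \<odot> f0" "d \<odot> y = a1 \<odot> b0" "x = \<ominus> (f1 \<odot> d)" "al \<odot> ash C (-1) a1 = a0"
proof -
  note d = triD[OF t1] triD[OF t0] triD[OF t]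
  \<comment> \<open>The octahedron is applied to \<open>b0\<close> after \<open>be\<close>, which is
    \<open>b1\<close> shifted by $-1$. The three cones are the target of \<open>y\<close>, the
    target of \<open>a0\<close> shifted by 1, and the target of \<open>a1\<close>.\<close>
  have t0': "tri b0 (\<ominus> (ash C 1 a0)) (\<ominus> (ash C 1 f0))" by (rule tri_rotate[OF tri_rotate[OF t0]])
  have t1': "tri (b0 \<odot> be) a1 (\<ominus> f1)"
    using tri_neg13[OF tri_rotate_back[OF t1]] d be by simp
  obtain u v where uv: "tri u v (ash C 1 y \<odot> \<ominus> (ash C 1 f0))" "\<guillemotleft>u :\<^bsub>C\<^esub> tgt y \<rightarrow> tgt a1\<guillemotright>" "\<guillemotleft>v :\<^bsub>C\<^esub> tgt a1 \<rightarrow> ShO C 1 (tgt a0)\<guillemotright>"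
    "u \<odot> y = a1 \<odot> b0" "\<ominus> f1 \<odot> u = x" "v \<odot> a1 = \<ominus> (ash C 1 a0)"
    using tri_octahedron[OF t t0' t1'] assms(4-6) d by auto
  have "tri (y \<odot> f0) u v" using uv(1) by (subst tri_rotate_iff) (use uv(2,3) d assms(4-6) in auto)
  then have t2: "tri (\<ominus> (ash C (-1) v)) (y \<odot> f0) u" by (rule tri_rotate_back)
  have "ash C (-1) (v \<odot> a1) = \<ominus> a0" unfolding uv(6) using d by simp
  then have "\<ominus> (ash C (-1) v) \<odot> ash C (-1) a1 = a0" using uv(2,3) d by simp
  then show ?thesis using t2 uv d assms(4-6) by (intro that[of "\<ominus> (ash C (-1) v)" "y \<odot> f0" u]) simp_all
qed

end

section \<open>Weight structures\<close>

context weight_structure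
begin

lemma fst_w_obj: "X \<in> fst w \<Longrightarrow> X \<in> Obj C" and snd_w_obj: "X \<in> snd w \<Longrightarrow> X \<in> Obj C"
  using le_additive ge_additive by (auto simp: additive_class_def)

lemma fst_w_shift:
  assumes "X \<in> fst w" "0 \<le> n"
  shows "ShO C n X \<in> fst w"
  using assms(2)
proof (induction n rule: int_ge_induct)
  case base
  then show ?case using assms by (simp add: fst_w_obj)
next
  case (step i)
  then have "ShO C 1 (ShO C i X) \<in> fst w" using le_shift by blast
  then show ?case using assms by (simp add: fst_w_obj)
qed

lemma snd_w_shift:
  assumes "X \<in> snd w" "n \<le> 0"
  shows "ShO C n X \<in> snd w"
  using assms(2)
proof (induction n rule: int_le_induct)
  case base
  then show ?case using assms by (simp add: snd_w_obj)
next
  case (step i)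
  then obtain Y where Y: "Y \<in> snd w" "ShO C i X = ShO C 1 Y" using ge_shift by blast
  have "ShO C (i - 1) X = ShO C (-1) (ShO C i X)" using assms by (simp add: snd_w_obj)
  also have "\<dots> = Y" unfolding Y(2) using Y(1) by (simp add: snd_w_obj)
  finally show ?case using Y(1) by simp
qed

text \<open>Shifting by $m$ brings the source into $C^{w>=0}$ and the target into $C^{w<=0}[1]$. In
  the calls below the two integers are weights: the source has weights at least $m$, the target has
  weights at most $n$, and $n < m$.\<close>

lemma orth:
  assumes "\<guillemotleft>f :\<^bsub>C\<^esub> X \<rightarrow> Y\<guillemotright>" "ShO C m X \<in> snd w" "ShO C n Y \<in> fst w" "n < m"
  shows "f = azero C X Y"
proof -
  have o: "X \<in> Obj C" "Y \<in> Obj C" using assms(1) by auto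
  have "ShO C (m - n - 1) (ShO C n Y) \<in> fst w" by (rule fst_w_shift) (use assms(3,4) in simp_all)
  then have "ShO C (m - 1) Y \<in> fst w" using o by (simp add: algebra_simps)
  then have "ShO C 1 (ShO C (m - 1) Y) \<in> ShO C 1 ` fst w" by (rule imageI)
  then have "ShO C m Y \<in> ShO C 1 ` fst w" using o by simp
  then have "Hom C (ShO C m X) (ShO C m Y) = {Zer C (ShO C m X) (ShO C m Y)}"
    using orthogonality assms(2) by (auto simp: orthogonal_def)
  then have "mor (ash C m f) = Zer C (ShO C m X) (ShO C m Y)"
    using mor_in_Hom[of C "ash C m f" "ShO C m X" "ShO C m Y"] assms(1) by auto
  then have "ash C m f = azero C (ShO C m X) (ShO C m Y)" using assms(1) by (intro arrow_eqI) (auto simp: arrow_mor)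
  then show ?thesis using ash_eq_zero_iff assms(1) by auto
qed

lemma fst_w_retract: "\<lbrakk>\<guillemotleft>e :\<^bsub>C\<^esub> Y \<rightarrow> X\<guillemotright>; \<guillemotleft>p :\<^bsub>C\<^esub> X \<rightarrow> Y\<guillemotright>; p \<odot> e = aid C Y; X \<in> fst w\<rbrakk> \<Longrightarrow> Y \<in> fst w"
  using le_Karoubi unfolding Karoubi_closed_def
  by (metis arrow_mor(1,4) mor_in_Hom)

lemma snd_w_retract: "\<lbrakk>\<guillemotleft>e :\<^bsub>C\<^esub> Y \<rightarrow> X\<guillemotright>; \<guillemotleft>p :\<^bsub>C\<^esub> X \<rightarrow> Y\<guillemotright>; p \<odot> e = aid C Y; X \<in> snd w\<rbrakk> \<Longrightarrow> Y \<in> snd w"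
  using ge_Karoubi unfolding Karoubi_closed_def
  by (metis arrow_mor(1,4) mor_in_Hom)

lemma weight_dec:
  assumes "X \<in> Obj C"
  shows "\<exists>a f b. tri a f b \<and> src a = X \<and> tgt a \<in> fst w \<and> tgt f \<in> snd w"
proof -
  from weight_decomposition[OF assms] obtain A B u v v' where *: "A \<in> fst w" "B \<in> snd w" "(ShO C (- 1) B, X, A, u, v, v') \<in> Dist C"
    by blast
  have B: "B \<in> Obj C" using * snd_w_obj by blast
  from tri_rotate[OF tri_Dist[OF *(3)]] show ?thesis using * B by fastforce
qed

text \<open>In a weight decomposition of $X[-1]$, with terms $A$ and $B$, the map $X -> A[1]$
  vanishes by hypothesis. So the identity of $X$ lifts to $B$, and $X$ is a retract of $B$.\<close>

lemma snd_w_charact: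
  assumes "X \<in> Obj C" "\<And>f L. \<lbrakk>L \<in> fst w; \<guillemotleft>f :\<^bsub>C\<^esub> X \<rightarrow> ShO C 1 L\<guillemotright>\<rbrakk> \<Longrightarrow> f = azero C X (ShO C 1 L)"
  shows "X \<in> snd w"
proof -
  obtain a f b where t: "tri a f b" "src a = ShO C (-1) X" "tgt a \<in> fst w" "tgt f \<in> snd w"
    using weight_dec[of "ShO C (-1) X"] assms(1) by auto
  note d = triD[OF t(1)]
  have t1: "tri b (\<ominus> (ash C 1 a)) (\<ominus> (ash C 1 f))" by (rule tri_rotate[OF tri_rotate[OF t(1)]])
  have "\<ominus> (ash C 1 a) = azero C X (ShO C 1 (tgt a))" by (rule assms(2)[OF t(3)]) (use d t assms(1) in simp)
  then have "\<exists>v. \<guillemotleft>v :\<^bsub>C\<^esub> X \<rightarrow> src b\<guillemotright> \<and> aid C X = b \<odot> v"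
    using tri_lift2[OF t1, of "aid C X"] assms(1) d t by simp
  then obtain v where "\<guillemotleft>v :\<^bsub>C\<^esub> X \<rightarrow> src b\<guillemotright>" "aid C X = b \<odot> v" by blast
  then show ?thesis using snd_w_retract[of v X "tgt f" b] d t assms(1) by simp
qed

lemma fst_w_charact:
  assumes "X \<in> Obj C" "\<And>f G. \<lbrakk>G \<in> snd w; \<guillemotleft>f :\<^bsub>C\<^esub> ShO C (-1) G \<rightarrow> X\<guillemotright>\<rbrakk> \<Longrightarrow> f = azero C (ShO C (-1) G) X"
  shows "X \<in> fst w"
proof -
  obtain a f b where t: "tri a f b" "src a = X" "tgt a \<in> fst w" "tgt f \<in> snd w"
    using weight_dec[of X] assms(1) by auto
  note d = triD[OF t(1)]
  have "ash C (-1) b = azero C (ShO C (-1) (tgt f)) X" by (rule assms(2)[OF t(4)]) (use d t assms(1) in simp)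
  then have "\<exists>v. \<guillemotleft>v :\<^bsub>C\<^esub> tgt a \<rightarrow> X\<guillemotright> \<and> aid C X = v \<odot> a"
    using tri_ext1[OF t(1), of "aid C X"] assms(1) d t by simp
  then obtain v where "\<guillemotleft>v :\<^bsub>C\<^esub> tgt a \<rightarrow> X\<guillemotright>" "aid C X = v \<odot> a" by blast
  then show ?thesis using fst_w_retract[of a X "tgt a" v] d t assms(1) by simp
qed

text \<open>A map from the middle term to $L[1]$ vanishes on the first term, hence factors through
  the third, where it vanishes as well.\<close>

lemma snd_w_extension:
  assumes t: "tri f g h" and "src f \<in> snd w" "tgt g \<in> snd w"
  shows "tgt f \<in> snd w"
proof (rule snd_w_charact)
  note d = triD[OF t]
  show "tgt f \<in> Obj C" by (rule d)
  fix u L assume u: "L \<in> fst w" "\<guillemotleft>u :\<^bsub>C\<^esub> tgt f \<rightarrow> ShO C 1 L\<guillemotright>"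
  have L: "L \<in> Obj C" using u(1) by (rule fst_w_obj)
  have "u \<odot> f = azero C (src f) (tgt u)"
    by (rule orth[of _ _ _ 0 "-1"]) (use assms(2) u fst_w_obj[OF u(1)] d in simp_all)
  then obtain v where v: "\<guillemotleft>v :\<^bsub>C\<^esub> tgt g \<rightarrow> tgt u\<guillemotright>" "u = v \<odot> g" using tri_ext2[OF t, of u] u by blast
  have "v = azero C (tgt g) (ShO C 1 L)"
    by (rule orth[of _ _ _ 0 "-1"]) (use assms(3) u fst_w_obj[OF u(1)] d v(1) in simp_all)
  then show "u = azero C (tgt f) (ShO C 1 L)" using v(2) d L by simp
qed

lemma fst_w_extension:
  assumes t: "tri f g h" and "src f \<in> fst w" "tgt g \<in> fst w"
  shows "tgt f \<in> fst w"
proof (rule fst_w_charact)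
  note d = triD[OF t]
  show "tgt f \<in> Obj C" by (rule d)
  fix u G assume u: "G \<in> snd w" "\<guillemotleft>u :\<^bsub>C\<^esub> ShO C (-1) G \<rightarrow> tgt f\<guillemotright>"
  have G: "G \<in> Obj C" using u(1) by (rule snd_w_obj)
  have "g \<odot> u = azero C (src u) (tgt g)"
    by (rule orth[of _ _ _ 1 0]) (use assms(3) u snd_w_obj[OF u(1)] d in simp_all)
  then obtain v where v: "\<guillemotleft>v :\<^bsub>C\<^esub> src u \<rightarrow> src f\<guillemotright>" "u = f \<odot> v" using tri_lift2[OF t, of u] u by blast
  have "v = azero C (ShO C (-1) G) (src f)"
    by (rule orth[of _ _ _ 1 0]) (use assms(2) u snd_w_obj[OF u(1)] d v(1) in simp_all)
  then show "u = azero C (ShO C (-1) G) (tgt f)" using v(2) d G by simp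
qed

lemma zero_object_weights: "zero_object C Z \<Longrightarrow> Z \<in> fst w" "zero_object C Z \<Longrightarrow> Z \<in> snd w"
proof -
  assume Z: "zero_object C Z"
  have "Z \<in> Obj C" using Z by (simp add: zero_object_iff)
  then show "Z \<in> snd w"
  proof (rule snd_w_charact)
    show "f = azero C Z (ShO C 1 L)" if "\<guillemotleft>f :\<^bsub>C\<^esub> Z \<rightarrow> ShO C 1 L\<guillemotright>" for f L by (rule in_hom_from_zero[OF that Z])
  qed
  show "Z \<in> fst w"
  proof (rule fst_w_charact[OF \<open>Z \<in> Obj C\<close>])
    show "f = azero C (ShO C (-1) G) Z" if "\<guillemotleft>f :\<^bsub>C\<^esub> ShO C (-1) G \<rightarrow> Z\<guillemotright>" for f G by (rule in_hom_to_zero[OF that Z])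
  qed
qed

lemma w_le_iff: "X \<in> w_le C w l \<longleftrightarrow> X \<in> Obj C \<and> ShO C l X \<in> fst w"
  unfolding w_le_def by (auto simp: fst_w_obj intro!: image_eqI[of _ _ "ShO C l X"])

lemma w_ge_iff: "X \<in> w_ge C w l \<longleftrightarrow> X \<in> Obj C \<and> ShO C l X \<in> snd w"
  unfolding w_ge_def by (auto simp: snd_w_obj intro!: image_eqI[of _ _ "ShO C l X"])

lemma w_le_mono: "\<lbrakk>X \<in> w_le C w l; l \<le> m\<rbrakk> \<Longrightarrow> X \<in> w_le C w m"
  using fst_w_shift[of "ShO C l X" "m - l"] by (auto simp: w_le_iff)

lemma w_ge_antimono: "\<lbrakk>X \<in> w_ge C w l; m \<le> l\<rbrakk> \<Longrightarrow> X \<in> w_ge C w m"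
  using snd_w_shift[of "ShO C l X" "m - l"] by (auto simp: w_ge_iff)

end

section \<open>Towers\<close>

text \<open>Typed counterpart of \<open>tower\<close>. In place of $x^k$ the rotated triangle is
  used, which starts with \<beta>^k and $y^k$ and whose third map is $-f^k d^k$.\<close>

record ('o, 'm) atower =
  tL :: "int \<Rightarrow> 'o"
  tG :: "int \<Rightarrow> 'o"
  tH :: "int \<Rightarrow> 'o"
  ta :: "int \<Rightarrow> ('o, 'm) arrow"
  tf :: "int \<Rightarrow> ('o, 'm) arrow"
  tb :: "int \<Rightarrow> ('o, 'm) arrow"
  tal :: "int \<Rightarrow> ('o, 'm) arrow"
  tbe :: "int \<Rightarrow> ('o, 'm) arrow"
  tc :: "int \<Rightarrow> ('o, 'm) arrow"
  td :: "int \<Rightarrow> ('o, 'm) arrow"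
  ty :: "int \<Rightarrow> ('o, 'm) arrow"

context weight_structure
begin

text \<open>In contrast to a weight tower, the maps $y^k$ and $d^k$ are required to fit together:
  $d^k y^k = a^k b^{k-1}$. This makes the notion self-dual.\<close>

definition gtower :: "'o \<Rightarrow> ('o, 'm) atower \<Rightarrow> bool" where
  "gtower X T \<longleftrightarrow> X \<in> Obj C \<and> (\<forall>k.
     tL T k \<in> fst w \<and> tG T k \<in> snd w \<and> tH T k \<in> fst w \<and> tH T k \<in> snd w \<and>
     \<guillemotleft>ta T k :\<^bsub>C\<^esub> ShO C k X \<rightarrow> tL T k\<guillemotright> \<and> \<guillemotleft>tf T k :\<^bsub>C\<^esub> tL T k \<rightarrow> tG T (k + 1)\<guillemotright> \<and>
     \<guillemotleft>tb T k :\<^bsub>C\<^esub> tG T (k + 1) \<rightarrow> ShO C (k + 1) X\<guillemotright> \<and> tri (ta T k) (tf T k) (tb T k) \<and>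
     \<guillemotleft>tal T k :\<^bsub>C\<^esub> ShO C (-1) (tL T k) \<rightarrow> tL T (k - 1)\<guillemotright> \<and> \<guillemotleft>tc T k :\<^bsub>C\<^esub> tL T (k - 1) \<rightarrow> tH T k\<guillemotright> \<and>
     \<guillemotleft>td T k :\<^bsub>C\<^esub> tH T k \<rightarrow> tL T k\<guillemotright> \<and> tri (tal T k) (tc T k) (td T k) \<and>
     \<guillemotleft>tbe T k :\<^bsub>C\<^esub> ShO C (-1) (tG T (k + 1)) \<rightarrow> tG T k\<guillemotright> \<and> \<guillemotleft>ty T k :\<^bsub>C\<^esub> tG T k \<rightarrow> tH T k\<guillemotright> \<and>
     tri (tbe T k) (ty T k) (\<ominus> (tf T k \<odot> td T k)) \<and>
     tal T k \<odot> ash C (-1) (ta T k) = ta T (k - 1) \<and> tb T (k - 1) \<odot> tbe T k = ash C (-1) (tb T k) \<and>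
     tc T k = ty T k \<odot> tf T (k - 1) \<and> td T k \<odot> ty T k = ta T k \<odot> tb T (k - 1))"

lemma gtowerD:
  assumes "gtower X T"
  shows "X \<in> Obj C" "tL T k \<in> fst w" "tG T k \<in> snd w" "tH T k \<in> fst w" "tH T k \<in> snd w"
     "tL T k \<in> Obj C" "tG T k \<in> Obj C" "tH T k \<in> Obj C"
  using assms fst_w_obj[of "tL T k"] snd_w_obj[of "tG T k"] snd_w_obj[of "tH T k"] unfolding gtower_def by blast+

lemma gtower_hom:
  assumes "gtower X T"
  shows "\<guillemotleft>ta T k :\<^bsub>C\<^esub> ShO C k X \<rightarrow> tL T k\<guillemotright>" "\<guillemotleft>tf T k :\<^bsub>C\<^esub> tL T k \<rightarrow> tG T (k + 1)\<guillemotright>"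
     "\<guillemotleft>tb T k :\<^bsub>C\<^esub> tG T (k + 1) \<rightarrow> ShO C (k + 1) X\<guillemotright>"
     "\<guillemotleft>tal T k :\<^bsub>C\<^esub> ShO C (-1) (tL T k) \<rightarrow> tL T (k - 1)\<guillemotright>" "\<guillemotleft>tc T k :\<^bsub>C\<^esub> tL T (k - 1) \<rightarrow> tH T k\<guillemotright>"
     "\<guillemotleft>td T k :\<^bsub>C\<^esub> tH T k \<rightarrow> tL T k\<guillemotright>" "\<guillemotleft>tbe T k :\<^bsub>C\<^esub> ShO C (-1) (tG T (k + 1)) \<rightarrow> tG T k\<guillemotright>" "\<guillemotleft>ty T k :\<^bsub>C\<^esub> tG T k \<rightarrow> tH T k\<guillemotright>"
  using assms unfolding gtower_def by blast+

lemma gtower_tri: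
  assumes "gtower X T"
  shows "tri (ta T k) (tf T k) (tb T k)" "tri (tal T k) (tc T k) (td T k)" "tri (tbe T k) (ty T k) (\<ominus> (tf T k \<odot> td T k))"
  using assms unfolding gtower_def by blast+

lemma gtower_eq:
  assumes "gtower X T"
  shows "tal T k \<odot> ash C (-1) (ta T k) = ta T (k - 1)" "tb T (k - 1) \<odot> tbe T k = ash C (-1) (tb T k)"
     "tc T k = ty T k \<odot> tf T (k - 1)" "td T k \<odot> ty T k = ta T k \<odot> tb T (k - 1)"
  using assms unfolding gtower_def by blast+

definition th :: "('o, 'm) atower \<Rightarrow> int \<Rightarrow> ('o, 'm) arrow" where
  "th T k = tc T (k + 1) \<odot> td T k"

text \<open>All vanishings come from consecutive maps of triangles. The two that matter later are
  $d^{k+1} h^k = 0$, from $d c = 0$, and $h^k y^k = y^{k+1} f^k a^k b^{k-1} = 0$, from $f a = 0$: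
  maps of the form $s h + h' t$ become invisible between $d'$ and $y$.\<close>

lemma gtower_comp:
  assumes "gtower X T"
  shows "tc T k \<odot> ta T (k - 1) = azero C (ShO C (k - 1) X) (tH T k)"
    "td T k \<odot> tc T k = azero C (tL T (k - 1)) (tL T k)"
    "tf T k \<odot> ta T k = azero C (ShO C k X) (tG T (k + 1))"
    "tb T k \<odot> tf T k = azero C (tL T k) (ShO C (k + 1) X)"
    "\<guillemotleft>th T k :\<^bsub>C\<^esub> tH T k \<rightarrow> tH T (k + 1)\<guillemotright>"
    "td T (k + 1) \<odot> th T k = azero C (tH T k) (tL T (k + 1))"
    "th T k \<odot> ty T k = azero C (tG T k) (tH T (k + 1))"
    "th T (k + 1) \<odot> th T k = azero C (tH T k) (tH T (k + 2))"
proof -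
  note [simp] = gtower_hom[OF assms] gtowerD[OF assms]
  have fa: "tf T k \<odot> ta T k = azero C (ShO C k X) (tG T (k + 1))" for k
    using tri_comp_zero(1)[OF gtower_tri(1)[OF assms, of k]] by simp
  have dc: "td T k \<odot> tc T k = azero C (tL T (k - 1)) (tL T k)" for k
    using tri_comp_zero(2)[OF gtower_tri(2)[OF assms, of k]] by simp
  have ca: "tc T k \<odot> ta T (k - 1) = azero C (ShO C (k - 1) X) (tH T k)" for k
    using fa[of "k - 1"] by (simp add: gtower_eq(3)[OF assms])
  show "tc T k \<odot> ta T (k - 1) = azero C (ShO C (k - 1) X) (tH T k)" by (rule ca)
  show "td T k \<odot> tc T k = azero C (tL T (k - 1)) (tL T k)" by (rule dc)
  show "tf T k \<odot> ta T k = azero C (ShO C k X) (tG T (k + 1))" by (rule fa)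
  show "tb T k \<odot> tf T k = azero C (tL T k) (ShO C (k + 1) X)"
    using tri_comp_zero(2)[OF gtower_tri(1)[OF assms, of k]] by simp
  show th: "\<guillemotleft>th T k :\<^bsub>C\<^esub> tH T k \<rightarrow> tH T (k + 1)\<guillemotright>" by (simp add: th_def)
  show dh: "td T (k + 1) \<odot> th T k = azero C (tH T k) (tL T (k + 1))"
    using acomp_eq[OF dc[of "k + 1"], of "td T k"] by (simp add: th_def)
  have "ty T (k + 1) \<odot> (tf T k \<odot> (ta T k \<odot> tb T (k - 1))) = azero C (tG T k) (tH T (k + 1))"
    using acomp_eq[OF fa[of k], of "tb T (k - 1)"] by simp
  then show "th T k \<odot> ty T k = azero C (tG T k) (tH T (k + 1))"
    by (simp add: th_def gtower_eq(3)[OF assms, of "k + 1"] gtower_eq(4)[OF assms])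
  define x where "x = tc T (k + 2)"
  have x: "\<guillemotleft>x :\<^bsub>C\<^esub> tL T (k + 1) \<rightarrow> tH T (k + 2)\<guillemotright>" "th T (k + 1) = x \<odot> td T (k + 1)"
    using gtower_hom(5)[OF assms, of "k + 2"] by (simp_all add: x_def th_def add.commute[of 1] add.commute[of 2])
  have "th T (k + 1) \<odot> th T k = x \<odot> (td T (k + 1) \<odot> th T k)"
    unfolding x(2) using th x(1) by simp
  then show "th T (k + 1) \<odot> th T k = azero C (tH T k) (tH T (k + 2))" using x(1) by (simp add: dh)
qed

text \<open>Orthogonality extends $a^{k-1}$ along $a^k[-1]$ to \<alpha>^k, and the octahedron
  supplies \<beta>^k and $y^k$. The term $X^k$ lies in both classes, being an extension of
  $X^{w<=k}$ by $X^{w<=k-1}$ and of $X^{w>=k+1}$ by $X^{w>=k}$.\<close>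

lemma gtower_exists:
  assumes X: "X \<in> Obj C" and t: "\<And>k. tri (a k) (f k) (b k)"
    and "\<And>k. src (a k) = ShO C k X" "\<And>k. tgt (a k) \<in> fst w" "\<And>k. tgt (f k) \<in> snd w"
  obtains T where "gtower X T" "ta T = a" "tf T = f" "tb T = b" "\<And>k. tL T k = tgt (a k)" "\<And>k. tG T k = tgt (f (k - 1))"
proof -
  note d = triD[OF t]
  note [simp] = d assms(3) X
  have "\<exists>al be c d y. tri al c d \<and> tri be y (\<ominus> (f k \<odot> d)) \<and> \<guillemotleft>al :\<^bsub>C\<^esub> ShO C (-1) (tgt (a k)) \<rightarrow> tgt (a (k - 1))\<guillemotright> \<and>
    \<guillemotleft>be :\<^bsub>C\<^esub> ShO C (-1) (tgt (f k)) \<rightarrow> tgt (f (k - 1))\<guillemotright> \<and> \<guillemotleft>y :\<^bsub>C\<^esub> tgt (f (k - 1)) \<rightarrow> tgt c\<guillemotright> \<and>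
    al \<odot> ash C (-1) (a k) = a (k - 1) \<and> b (k - 1) \<odot> be = ash C (-1) (b k) \<and> c = y \<odot> f (k - 1) \<and> d \<odot> y = a k \<odot> b (k - 1) \<and>
    tgt c \<in> fst w \<and> tgt c \<in> snd w" for k
  proof -
    have "\<exists>v. \<guillemotleft>v :\<^bsub>C\<^esub> tgt (ash C (-1) (a k)) \<rightarrow> tgt (a (k - 1))\<guillemotright> \<and> a (k - 1) = v \<odot> ash C (-1) (a k)"
      by (rule tri_ext_exists[OF tri_shift_m1'[OF t[of k]]])
        (simp_all, rule orth[of _ _ _ 2 0], use assms(4,5) fst_w_obj in simp_all)
    then obtain al where "\<guillemotleft>al :\<^bsub>C\<^esub> tgt (ash C (-1) (a k)) \<rightarrow> tgt (a (k - 1))\<guillemotright>" and al2: "a (k - 1) = al \<odot> ash C (-1) (a k)"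
      by blast
    then have al: "\<guillemotleft>al :\<^bsub>C\<^esub> ShO C (-1) (tgt (a k)) \<rightarrow> tgt (a (k - 1))\<guillemotright>" by simp
    obtain c d where t2: "tri al c d" using tri_cone al by blast
    note d2 = triD[OF t2]
    have p: "src al = ShO C (-1) (tgt (a k))" "tgt al = tgt (a (k - 1))" "src (a (k - 1)) = ShO C (-1) (src (a k))" using al by simp_all
    obtain be y where y: "tri be y (\<ominus> (f k \<odot> d))" "\<guillemotleft>be :\<^bsub>C\<^esub> ShO C (-1) (tgt (f k)) \<rightarrow> tgt (f (k - 1))\<guillemotright>"
      "\<guillemotleft>y :\<^bsub>C\<^esub> tgt (f (k - 1)) \<rightarrow> tgt c\<guillemotright>"
      "b (k - 1) \<odot> be = ash C (-1) (b k)" "c = y \<odot> f (k - 1)" "d \<odot> y = a k \<odot> b (k - 1)"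
      by (rule octahedron_le[OF t[of k] t[of "k - 1"] t2 p al2[symmetric]])
    have "tgt c \<in> fst w" using fst_w_extension[OF tri_rotate[OF t2]] d2 al assms(4) by simp
    moreover have "tgt c \<in> snd w" using snd_w_extension[OF tri_rotate[OF y(1)]] y(2,3) d2 al assms(5) by simp
    ultimately show ?thesis using t2 al al2[symmetric] y by blast
  qed
  then obtain al be c d y where *: "\<And>k. tri (al k) (c k) (d k)" "\<And>k. tri (be k) (y k) (\<ominus> (f k \<odot> d k))"
    "\<And>k. \<guillemotleft>al k :\<^bsub>C\<^esub> ShO C (-1) (tgt (a k)) \<rightarrow> tgt (a (k - 1))\<guillemotright>"
    "\<And>k. \<guillemotleft>be k :\<^bsub>C\<^esub> ShO C (-1) (tgt (f k)) \<rightarrow> tgt (f (k - 1))\<guillemotright>" "\<And>k. \<guillemotleft>y k :\<^bsub>C\<^esub> tgt (f (k - 1)) \<rightarrow> tgt (c k)\<guillemotright>"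
    "\<And>k. al k \<odot> ash C (-1) (a k) = a (k - 1)" "\<And>k. b (k - 1) \<odot> be k = ash C (-1) (b k)" "\<And>k. c k = y k \<odot> f (k - 1)"
    "\<And>k. d k \<odot> y k = a k \<odot> b (k - 1)"
    "\<And>k. tgt (c k) \<in> fst w" "\<And>k. tgt (c k) \<in> snd w" by metis
  define T where "T = \<lparr>tL = \<lambda>k. tgt (a k), tG = \<lambda>k. tgt (f (k - 1)), tH = \<lambda>k. tgt (c k), ta = a, tf = f, tb = b,
    tal = al, tbe = be, tc = c, td = d, ty = y\<rparr>"
  have "gtower X T"
    unfolding gtower_def
    using * t triD[OF *(1)] triD[OF *(2)] assms(4,5) by (simp add: T_def add.commute[of 1])
  then show ?thesis by (rule that) (simp_all add: T_def)
qed

text \<open>For $k < i$ the object $X[k+1]$ lies in $C^{w>=0}$, so $X[k] -> 0 -> X[k+1]$ is a weight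
  decomposition of $X[k]$.\<close>

lemma gtower_le_exists:
  assumes "X \<in> w_ge C w i"
  obtains T where "gtower X T" "\<And>k. k < i \<Longrightarrow> zero_object C (tL T k)"
proof -
  have X: "X \<in> Obj C" "ShO C i X \<in> snd w" using assms by (auto simp: w_ge_iff)
  obtain Z where Z: "zero_object C Z" using zero_object_exists by blast
  have "\<exists>a f b. tri a f b \<and> src a = ShO C k X \<and> tgt a \<in> fst w \<and> tgt f \<in> snd w \<and> (k < i \<longrightarrow> zero_object C (tgt a))" for k
  proof (cases "k < i")
    case True
    have "ShO C (k + 1) X \<in> snd w" using w_ge_antimono[OF assms, of "k + 1"] True by (simp add: w_ge_iff)
    then show ?thesis using tri_rotate[OF tri_id[OF _ Z, of "ShO C k X"]] X Z zero_object_weights[OF Z] zero_object_iff[of Z]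
      by (intro exI[of _ "azero C (ShO C k X) Z"] exI[of _ "azero C Z (ShO C 1 (ShO C k X))"]
          exI[of _ "\<ominus> (ash C 1 (aid C (ShO C k X)))"]) auto
  next
    case False
    then show ?thesis using weight_dec[of "ShO C k X"] X by auto
  qed
  then obtain a f b where *: "\<And>k. tri (a k) (f k) (b k)" "\<And>k. src (a k) = ShO C k X" "\<And>k. tgt (a k) \<in> fst w" "\<And>k. tgt (f k) \<in> snd w"
    "\<And>k. k < i \<Longrightarrow> zero_object C (tgt (a k))" by metis
  obtain T where T: "gtower X T" "\<And>k. tL T k = tgt (a k)" using gtower_exists[OF X(1) *(1-4)] by metis
  show ?thesis by (rule that[OF T(1)]) (simp add: T(2) *(5))
qed

text \<open>For $k \<ge> i$ the object $X[k]$ lies in $C^{w<=0}$ and is its own left part. The zero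
  object is then $X^{w>=k+1}$, whence the strict bound on the index of \<open>tG\<close>.\<close>

lemma gtower_ge_exists:
  assumes "X \<in> w_le C w i"
  obtains T where "gtower X T" "\<And>k. k > i \<Longrightarrow> zero_object C (tG T k)"
proof -
  have X: "X \<in> Obj C" "ShO C i X \<in> fst w" using assms by (auto simp: w_le_iff)
  obtain Z where Z: "zero_object C Z" using zero_object_exists by blast
  have "\<exists>a f b. tri a f b \<and> src a = ShO C k X \<and> tgt a \<in> fst w \<and> tgt f \<in> snd w \<and> (i \<le> k \<longrightarrow> zero_object C (tgt f))" for k
  proof (cases "i \<le> k")
    case True
    have "ShO C k X \<in> fst w" using w_le_mono[OF assms, of k] True by (simp add: w_le_iff)
    then show ?thesis using tri_id[OF _ Z, of "ShO C k X"] X Z zero_object_weights[OF Z]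
      by (intro exI[of _ "aid C (ShO C k X)"] exI[of _ "azero C (ShO C k X) Z"] exI) auto
  next
    case False
    then show ?thesis using weight_dec[of "ShO C k X"] X by auto
  qed
  then obtain a f b where *: "\<And>k. tri (a k) (f k) (b k)" "\<And>k. src (a k) = ShO C k X" "\<And>k. tgt (a k) \<in> fst w" "\<And>k. tgt (f k) \<in> snd w"
    "\<And>k. i \<le> k \<Longrightarrow> zero_object C (tgt (f k))" by metis
  obtain T where T: "gtower X T" "\<And>k. tG T k = tgt (f (k - 1))" using gtower_exists[OF X(1) *(1-4)] by metis
  show ?thesis by (rule that[OF T(1)]) (simp add: T(2) *(5))
qed

lemma gtower_zero_H:
  assumes "gtower X T"
  shows "\<lbrakk>zero_object C (tL T k); zero_object C (tL T (k - 1))\<rbrakk> \<Longrightarrow> zero_object C (tH T k)"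
    "\<lbrakk>zero_object C (tG T k); zero_object C (tG T (k + 1))\<rbrakk> \<Longrightarrow> zero_object C (tH T k)"
proof -
  note [simp] = gtower_hom[OF assms] gtowerD[OF assms]
  have *: "zero_object C (tgt g)" if t: "tri f g h" "zero_object C (src h')" "src h' = tgt f" "zero_object C Y" "tgt h = Y" for f g h h' Y
  proof -
    note d = triD[OF t(1)]
    have z: "g = azero C (tgt f) (tgt g)" "h = azero C (tgt g) Y" by (rule in_hom_from_zero in_hom_to_zero; use d t in simp)+
    have "h \<odot> aid C (tgt g) = azero C (tgt g) (ShO C 1 (src f))" using z(2) d t(5) by simp
    then obtain v where v: "\<guillemotleft>v :\<^bsub>C\<^esub> tgt g \<rightarrow> tgt f\<guillemotright>" "aid C (tgt g) = g \<odot> v"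
      using tri_lift3[OF t(1), of "aid C (tgt g)"] d by (simp del: acomp_aid) blast
    have "g \<odot> v = azero C (tgt f) (tgt g) \<odot> v" using arg_cong[OF z(1), of "\<lambda>x. x \<odot> v"] .
    also have "\<dots> = azero C (tgt g) (tgt g)" using v(1) d by simp
    finally show ?thesis using v(2) d by (simp add: zero_object_iff)
  qed
  show "zero_object C (tH T k)" if "zero_object C (tL T k)" "zero_object C (tL T (k - 1))"
    using *[OF gtower_tri(2)[OF assms, of k], of "ta T (k - 1)" ] *[OF gtower_tri(2)[OF assms, of k], of "tc T k" "tL T k"] that by simp
  show "zero_object C (tH T k)" if "zero_object C (tG T k)" "zero_object C (tG T (k + 1))"
    using *[OF gtower_tri(3)[OF assms, of k], of "ty T k" "tG T (k + 1)"] that by simp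
qed

end

section \<open>Morphisms of towers\<close>

context weight_structure
begin

text \<open>The compatibility with \<beta> is a consequence, by orthogonality: see
  \<open>tmap_beta\<close>.\<close>

definition tmap :: "('o, 'm) atower \<Rightarrow> ('o, 'm) atower \<Rightarrow> ('o, 'm) arrow \<Rightarrow> (int \<Rightarrow> ('o, 'm) arrow) \<Rightarrow>
    (int \<Rightarrow> ('o, 'm) arrow) \<Rightarrow> (int \<Rightarrow> ('o, 'm) arrow) \<Rightarrow> bool" where
  "tmap T T' g l r \<phi> \<longleftrightarrow> (\<forall>k.
     \<guillemotleft>l k :\<^bsub>C\<^esub> tL T k \<rightarrow> tL T' k\<guillemotright> \<and> \<guillemotleft>r k :\<^bsub>C\<^esub> tG T k \<rightarrow> tG T' k\<guillemotright> \<and> \<guillemotleft>\<phi> k :\<^bsub>C\<^esub> tH T k \<rightarrow> tH T' k\<guillemotright> \<and>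
     l k \<odot> ta T k = ta T' k \<odot> ash C k g \<and> r (k + 1) \<odot> tf T k = tf T' k \<odot> l k \<and>
     ash C (k + 1) g \<odot> tb T k = tb T' k \<odot> r (k + 1) \<and> l (k - 1) \<odot> tal T k = tal T' k \<odot> ash C (-1) (l k) \<and>
     \<phi> k \<odot> tc T k = tc T' k \<odot> l (k - 1) \<and> l k \<odot> td T k = td T' k \<odot> \<phi> k)"

text \<open>The relation speaks of $g$ and \<phi> only, not of maps between the $X^{w<=k}$ or the
  $X^{w>=k}$. So it is visibly additive in the pair, and chain maps from different extensions of one
  $g$ can be compared. The two sides of the last equation are maps $X^{w>=k} -> X'^{w<=k}$.\<close>

definition trel :: "('o, 'm) atower \<Rightarrow> ('o, 'm) atower \<Rightarrow> ('o, 'm) arrow \<Rightarrow> (int \<Rightarrow> ('o, 'm) arrow) \<Rightarrow> bool" where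
  "trel T T' g \<phi> \<longleftrightarrow> (\<forall>k. \<guillemotleft>\<phi> k :\<^bsub>C\<^esub> tH T k \<rightarrow> tH T' k\<guillemotright> \<and> \<phi> (k + 1) \<odot> th T k = th T' k \<odot> \<phi> k \<and>
     td T' k \<odot> \<phi> k \<odot> ty T k = ta T' k \<odot> ash C k g \<odot> tb T (k - 1))"

text \<open>The condition that defines $Z$, on components in \<open>C\<close>, before any category
  of complexes is set up.\<close>

definition znull :: "('o, 'm) atower \<Rightarrow> ('o, 'm) atower \<Rightarrow> (int \<Rightarrow> ('o, 'm) arrow) \<Rightarrow> bool" where
  "znull T T' \<epsilon> \<longleftrightarrow> (\<exists>s t. \<forall>k. \<guillemotleft>s k :\<^bsub>C\<^esub> tH T k \<rightarrow> tH T' (k - 1)\<guillemotright> \<and> \<guillemotleft>t k :\<^bsub>C\<^esub> tH T k \<rightarrow> tH T' (k - 1)\<guillemotright> \<and>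
     \<epsilon> k = s (k + 1) \<odot> th T k \<oplus> th T' (k - 1) \<odot> t k)"

lemma tmap_exists:
  assumes T: "gtower X T" and T': "gtower X' T'" and g: "\<guillemotleft>g :\<^bsub>C\<^esub> X \<rightarrow> X'\<guillemotright>"
  obtains l r \<phi> where "tmap T T' g l r \<phi>"
proof -
  note [simp] = gtower_hom[OF T] gtowerD[OF T] gtower_hom[OF T'] gtowerD[OF T'] g
  have "\<exists>l R. \<guillemotleft>l :\<^bsub>C\<^esub> tL T k \<rightarrow> tL T' k\<guillemotright> \<and> l \<odot> ta T k = ta T' k \<odot> ash C k g \<and>
      \<guillemotleft>R :\<^bsub>C\<^esub> tG T (k + 1) \<rightarrow> tG T' (k + 1)\<guillemotright> \<and> R \<odot> tf T k = tf T' k \<odot> l \<and> ash C (k + 1) g \<odot> tb T k = tb T' k \<odot> R" for k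
  proof -
    \<comment> \<open>The numbers 1 and 0 in the call of \<open>orth\<close> are the weights of the
      obstruction: it runs from $X^{w>=k+1}[-1]$ to $X'^{w<=k}$.\<close>
    have "\<exists>v. \<guillemotleft>v :\<^bsub>C\<^esub> tgt (ta T k) \<rightarrow> tgt (ta T' k \<odot> ash C k g)\<guillemotright> \<and> ta T' k \<odot> ash C k g = v \<odot> ta T k"
      by (rule tri_ext_exists[OF gtower_tri(1)[OF T]]) (simp_all, rule orth[of _ _ _ 1 0], simp_all)
    then obtain l where l: "\<guillemotleft>l :\<^bsub>C\<^esub> tL T k \<rightarrow> tL T' k\<guillemotright>" "l \<odot> ta T k = ta T' k \<odot> ash C k g" by auto
    have "\<exists>w. \<guillemotleft>w :\<^bsub>C\<^esub> tgt (tf T k) \<rightarrow> tgt (tf T' k)\<guillemotright> \<and> w \<odot> tf T k = tf T' k \<odot> l \<and>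
      ash C 1 (ash C k g) \<odot> tb T k = tb T' k \<odot> w"
      by (rule tri_fill3[OF gtower_tri(1)[OF T] gtower_tri(1)[OF T']]) (use l in simp_all)
    then obtain R where "\<guillemotleft>R :\<^bsub>C\<^esub> tG T (k + 1) \<rightarrow> tG T' (k + 1)\<guillemotright>" "R \<odot> tf T k = tf T' k \<odot> l"
      "ash C (k + 1) g \<odot> tb T k = tb T' k \<odot> R" by auto
    then show ?thesis using l by blast
  qed
  then obtain l R where lR: "\<And>k. \<guillemotleft>l k :\<^bsub>C\<^esub> tL T k \<rightarrow> tL T' k\<guillemotright>" "\<And>k. l k \<odot> ta T k = ta T' k \<odot> ash C k g"
      "\<And>k. \<guillemotleft>R k :\<^bsub>C\<^esub> tG T (k + 1) \<rightarrow> tG T' (k + 1)\<guillemotright>" "\<And>k. R k \<odot> tf T k = tf T' k \<odot> l k"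
      "\<And>k. ash C (k + 1) g \<odot> tb T k = tb T' k \<odot> R k" by metis
  note [simp] = lR(1)
  have la: "ash C (-1) (l k) \<odot> ash C (-1) (ta T k) = ash C (-1) (ta T' k) \<odot> ash C (k - 1) g" for k
    using arg_cong[OF lR(2)[of k], of "ash C (-1)"] by simp
  \<comment> \<open>Both composites restrict to the same map along $a^k[-1]$, and a map from
    $X^{w>=k+1}[-1]$ to $X'^{w<=k-1}$ is zero, so the extension is unique.\<close>
  have al: "l (k - 1) \<odot> tal T k = tal T' k \<odot> ash C (-1) (l k)" for k
  proof (rule tri_ext_unique[OF tri_shift_m1'[OF gtower_tri(1)[OF T, of k]]])
    show "(l (k - 1) \<odot> tal T k) \<odot> ash C (-1) (ta T k) = (tal T' k \<odot> ash C (-1) (l k)) \<odot> ash C (-1) (ta T k)"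
      using acomp_eq[OF gtower_eq(1)[OF T', of k], of "ash C (k - 1) g"]
      by (simp add: gtower_eq(1)[OF T] lR(2) la)
  qed (simp_all, rule orth[of _ _ _ 1 0], simp_all)
  have "\<exists>\<phi>. \<guillemotleft>\<phi> :\<^bsub>C\<^esub> tH T k \<rightarrow> tH T' k\<guillemotright> \<and> \<phi> \<odot> tc T k = tc T' k \<odot> l (k - 1) \<and> l k \<odot> td T k = td T' k \<odot> \<phi>" for k
    using tri_fill3[OF gtower_tri(2)[OF T, of k] gtower_tri(2)[OF T', of k], of "ash C (-1) (l k)" "l (k - 1)"] al[of k] by simp
  then obtain \<phi> where \<phi>: "\<And>k. \<guillemotleft>\<phi> k :\<^bsub>C\<^esub> tH T k \<rightarrow> tH T' k\<guillemotright>" "\<And>k. \<phi> k \<odot> tc T k = tc T' k \<odot> l (k - 1)"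
    "\<And>k. l k \<odot> td T k = td T' k \<odot> \<phi> k" by metis
  have "tmap T T' g l (\<lambda>k. R (k - 1)) \<phi>"
    unfolding tmap_def using lR lR(3)[of "k - 1" for k] al \<phi> by simp
  then show ?thesis by (rule that)
qed

lemma tmap_hom:
  assumes "tmap T T' g l r \<phi>"
  shows "\<guillemotleft>l k :\<^bsub>C\<^esub> tL T k \<rightarrow> tL T' k\<guillemotright>" "\<guillemotleft>r k :\<^bsub>C\<^esub> tG T k \<rightarrow> tG T' k\<guillemotright>" "\<guillemotleft>\<phi> k :\<^bsub>C\<^esub> tH T k \<rightarrow> tH T' k\<guillemotright>"
  using assms unfolding tmap_def by blast+

lemma tmap_eq:
  assumes "tmap T T' g l r \<phi>"
  shows "l k \<odot> ta T k = ta T' k \<odot> ash C k g" "r (k + 1) \<odot> tf T k = tf T' k \<odot> l k"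
     "ash C (k + 1) g \<odot> tb T k = tb T' k \<odot> r (k + 1)" "l (k - 1) \<odot> tal T k = tal T' k \<odot> ash C (-1) (l k)"
     "\<phi> k \<odot> tc T k = tc T' k \<odot> l (k - 1)" "l k \<odot> td T k = td T' k \<odot> \<phi> k"
  using assms unfolding tmap_def by blast+

text \<open>Both sides agree after composition with $b'^{k-1}$, and a map from $X^{w>=k+1}[-1]$ to
  $X'^{w<=k-1}$ is zero, so the lift is unique.\<close>

lemma tmap_beta:
  assumes T: "gtower X T" and T': "gtower X' T'" and g: "\<guillemotleft>g :\<^bsub>C\<^esub> X \<rightarrow> X'\<guillemotright>" and e: "tmap T T' g l r \<phi>"
  shows "r k \<odot> tbe T k = tbe T' k \<odot> ash C (-1) (r (k + 1))"
proof (rule tri_lift_unique[OF gtower_tri(1)[OF T', of "k - 1"]])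
  note [simp] = gtower_hom[OF T] gtowerD[OF T] gtower_hom[OF T'] gtowerD[OF T'] g tmap_hom[OF e]
  have 1: "tb T' (k - 1) \<odot> r k = ash C k g \<odot> tb T (k - 1)" using tmap_eq(3)[OF e, of "k - 1"] by simp
  have "tb T' (k - 1) \<odot> r k \<odot> tbe T k = ash C k g \<odot> ash C (-1) (tb T k)"
    using acomp_eq[OF 1, of "tbe T k"] by (simp add: gtower_eq(2)[OF T])
  also have "\<dots> = ash C (-1) (tb T' k) \<odot> ash C (-1) (r (k + 1))"
    using arg_cong[OF tmap_eq(3)[OF e, of k], of "ash C (-1)"] by simp
  also have "\<dots> = tb T' (k - 1) \<odot> tbe T' k \<odot> ash C (-1) (r (k + 1))"
    using acomp_eq[OF gtower_eq(2)[OF T', of k], of "ash C (-1) (r (k + 1))"] by simp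
  finally show "tb T' (k - 1) \<odot> (r k \<odot> tbe T k) = tb T' (k - 1) \<odot> (tbe T' k \<odot> ash C (-1) (r (k + 1)))" .
  show "v = azero C (src (r k \<odot> tbe T k)) (tgt (ta T' (k - 1)))" if "\<guillemotleft>v :\<^bsub>C\<^esub> src (r k \<odot> tbe T k) \<rightarrow> tgt (ta T' (k - 1))\<guillemotright>" for v
    by (rule orth[OF that, of 1 0]) simp_all
qed (simp_all add: gtower_hom[OF T] gtowerD[OF T] gtower_hom[OF T'] gtowerD[OF T'] tmap_hom[OF e])

lemma trelD:
  assumes "trel T T' g \<phi>"
  shows "\<guillemotleft>\<phi> k :\<^bsub>C\<^esub> tH T k \<rightarrow> tH T' k\<guillemotright>" "\<phi> (k + 1) \<odot> th T k = th T' k \<odot> \<phi> k"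
    "td T' k \<odot> \<phi> k \<odot> ty T k = ta T' k \<odot> ash C k g \<odot> tb T (k - 1)"
  using assms unfolding trel_def by blast+

lemma tmap_trel:
  assumes T: "gtower X T" and T': "gtower X' T'" and g: "\<guillemotleft>g :\<^bsub>C\<^esub> X \<rightarrow> X'\<guillemotright>" and e: "tmap T T' g l r \<phi>"
  shows "trel T T' g \<phi>"
proof -
  note [simp] = gtower_hom[OF T] gtowerD[OF T] gtower_hom[OF T'] gtowerD[OF T'] g tmap_hom[OF e]
  have "\<phi> (k + 1) \<odot> th T k = th T' k \<odot> \<phi> k" for k
  proof -
    have "\<phi> (k + 1) \<odot> th T k = tc T' (k + 1) \<odot> l k \<odot> td T k"
      using acomp_eq[OF tmap_eq(5)[OF e, of "k + 1"], of "td T k"] by (simp add: th_def)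
    also have "\<dots> = th T' k \<odot> \<phi> k" by (simp add: tmap_eq(6)[OF e] th_def)
    finally show ?thesis .
  qed
  moreover have "td T' k \<odot> \<phi> k \<odot> ty T k = ta T' k \<odot> ash C k g \<odot> tb T (k - 1)" for k
  proof -
    have "td T' k \<odot> \<phi> k \<odot> ty T k = l k \<odot> td T k \<odot> ty T k"
      using acomp_eq[OF tmap_eq(6)[OF e, of k], of "ty T k"] by simp
    also have "\<dots> = l k \<odot> ta T k \<odot> tb T (k - 1)" by (simp add: gtower_eq(4)[OF T])
    also have "\<dots> = ta T' k \<odot> ash C k g \<odot> tb T (k - 1)"
      using acomp_eq[OF tmap_eq(1)[OF e, of k], of "tb T (k - 1)"] by simp
    finally show ?thesis .
  qed
  ultimately show ?thesis unfolding trel_def by simp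
qed

lemma trel_exists:
  assumes "gtower X T" "gtower X' T'" "\<guillemotleft>g :\<^bsub>C\<^esub> X \<rightarrow> X'\<guillemotright>"
  obtains \<phi> where "trel T T' g \<phi>"
  using tmap_exists[OF assms] tmap_trel[OF assms] by metis

text \<open>The key uniqueness statement: a chain map which represents the zero morphism is of the form $s h + h' t$,
  where $s$ and $t$ need not agree.\<close>

lemma trel_zero_znull:
  assumes T: "gtower X T" and T': "gtower X' T'" and e: "trel T T' (azero C X X') \<epsilon>"
  shows "znull T T' \<epsilon>"
proof -
  note [simp] = gtower_hom[OF T] gtowerD[OF T] gtower_hom[OF T'] gtowerD[OF T'] trelD(1)[OF e]
    gtower_comp(5)[OF T] gtower_comp(5)[OF T']
  have "\<exists>s t. \<guillemotleft>s :\<^bsub>C\<^esub> tH T (k + 1) \<rightarrow> tH T' k\<guillemotright> \<and> \<guillemotleft>t :\<^bsub>C\<^esub> tH T k \<rightarrow> tH T' (k - 1)\<guillemotright> \<and>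
     \<epsilon> k = s \<odot> th T k \<oplus> th T' (k - 1) \<odot> t" for k
  proof -
    \<comment> \<open>Since $d' \<epsilon> y = 0$, the map $\<epsilon> y$ lifts through $c'$ to some
      $r$ with values in $X'^{w<=k-1}$. By weights, $r$ descends along $y$ to the heart term and the
      result lifts along $d'^{k-1}$; this produces $t$.\<close>
    have "td T' k \<odot> \<epsilon> k \<odot> ty T k = azero C (tG T k) (tL T' k)" by (simp add: trelD(3)[OF e])
    then have "\<exists>v. \<guillemotleft>v :\<^bsub>C\<^esub> src (\<epsilon> k \<odot> ty T k) \<rightarrow> tgt (tal T' k)\<guillemotright> \<and> \<epsilon> k \<odot> ty T k = tc T' k \<odot> v"
      by (intro tri_lift3[OF gtower_tri(2)[OF T', of k]]) simp_all
    then obtain r where r: "\<guillemotleft>r :\<^bsub>C\<^esub> tG T k \<rightarrow> tL T' (k - 1)\<guillemotright>" "\<epsilon> k \<odot> ty T k = tc T' k \<odot> r" by auto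
    have "r \<odot> tbe T k = azero C (src (tbe T k)) (tgt r)" by (rule orth[of _ _ _ 1 0]) (use r(1) in simp_all)
    then have "\<exists>v. \<guillemotleft>v :\<^bsub>C\<^esub> tgt (ty T k) \<rightarrow> tgt r\<guillemotright> \<and> r = v \<odot> ty T k"
      by (intro tri_ext2[OF gtower_tri(3)[OF T, of k]]) (use r(1) in simp_all)
    then obtain v where v: "\<guillemotleft>v :\<^bsub>C\<^esub> tH T k \<rightarrow> tL T' (k - 1)\<guillemotright>" "r = v \<odot> ty T k" using r(1) by auto
    have "\<exists>t. \<guillemotleft>t :\<^bsub>C\<^esub> src v \<rightarrow> tgt (tc T' (k - 1))\<guillemotright> \<and> v = td T' (k - 1) \<odot> t"
    proof (rule tri_lift_exists[OF gtower_tri(2)[OF T', of "k - 1"]])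
      show "x = azero C (src v) (ShO C 1 (tgt (tal T' (k - 1))))" if "\<guillemotleft>x :\<^bsub>C\<^esub> src v \<rightarrow> ShO C 1 (tgt (tal T' (k - 1)))\<guillemotright>" for x
        by (rule orth[OF that, of 0 "-1"]) (use v(1) in simp_all)
    qed (use v(1) in simp_all)
    then obtain t where t: "\<guillemotleft>t :\<^bsub>C\<^esub> tH T k \<rightarrow> tH T' (k - 1)\<guillemotright>" "v = td T' (k - 1) \<odot> t" using v(1) by auto
    have ty: "\<epsilon> k \<odot> ty T k = (th T' (k - 1) \<odot> t) \<odot> ty T k"
      unfolding r(2) v(2) t(2) th_def using t(1) by simp
    \<comment> \<open>The remainder $\<epsilon> - h' t$ vanishes on $y$, so it factors through the
      third map $-f d$. The other factor descends along $y^{k+1}$, and $c^{k+1} = y^{k+1} f^k$ turns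
      it into a multiple of $h$. As $s$ and $t$ come from separate factorisations, nothing relates
      them.\<close>
    have "\<exists>s. \<guillemotleft>s :\<^bsub>C\<^esub> ShO C 1 (src (tbe T k)) \<rightarrow> tgt (\<epsilon> k)\<guillemotright> \<and>
        \<epsilon> k = th T' (k - 1) \<odot> t \<oplus> s \<odot> \<ominus> (tf T k \<odot> td T k)"
      by (rule tri_ext3_diff[OF gtower_tri(3)[OF T, of k]]) (use t(1) ty in simp_all)
    then obtain s where s: "\<guillemotleft>s :\<^bsub>C\<^esub> tG T (k + 1) \<rightarrow> tH T' k\<guillemotright>" "\<epsilon> k = th T' (k - 1) \<odot> t \<oplus> s \<odot> \<ominus> (tf T k \<odot> td T k)" by auto
    have "s \<odot> tbe T (k + 1) = azero C (src (tbe T (k + 1))) (tgt s)" by (rule orth[of _ _ _ 1 0]) (use s(1) in simp_all)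
    then have "\<exists>v. \<guillemotleft>v :\<^bsub>C\<^esub> tgt (ty T (k + 1)) \<rightarrow> tgt s\<guillemotright> \<and> s = v \<odot> ty T (k + 1)"
      by (intro tri_ext2[OF gtower_tri(3)[OF T, of "k + 1"]]) (use s(1) in simp_all)
    then obtain s' where s': "\<guillemotleft>s' :\<^bsub>C\<^esub> tH T (k + 1) \<rightarrow> tH T' k\<guillemotright>" "s = s' \<odot> ty T (k + 1)" using s(1) by auto
    have "s \<odot> \<ominus> (tf T k \<odot> td T k) = \<ominus> s' \<odot> th T k"
      unfolding s'(2) th_def using s'(1) by (simp add: gtower_eq(3)[OF T, of "k + 1"])
    then have "\<epsilon> k = \<ominus> s' \<odot> th T k \<oplus> th T' (k - 1) \<odot> t"
      unfolding s(2) using s'(1) t(1) aplus_comm[of "th T' (k - 1) \<odot> t" "\<ominus> s' \<odot> th T k"] by simp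
    then show ?thesis using s'(1) t(1) by (intro exI[of _ "\<ominus> s'"] exI[of _ t]) simp
  qed
  then obtain s t where st: "\<And>k. \<guillemotleft>s k :\<^bsub>C\<^esub> tH T (k + 1) \<rightarrow> tH T' k\<guillemotright>" "\<And>k. \<guillemotleft>t k :\<^bsub>C\<^esub> tH T k \<rightarrow> tH T' (k - 1)\<guillemotright>"
     "\<And>k. \<epsilon> k = s k \<odot> th T k \<oplus> th T' (k - 1) \<odot> t k" by metis
  show ?thesis unfolding znull_def
    using st(1)[of "k - 1" for k] st(2,3) by (intro exI[of _ "\<lambda>k. s (k - 1)"] exI[of _ t] allI) simp
qed

text \<open>$d' h' = 0$ removes the summand with $t$ and $h y = 0$ the one with $s$. In the third
  clause a chain map stands between \<epsilon> and $y$; it commutes with the differentials, so the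
  same cancellation works. This clause is what composition needs.\<close>

lemma znull_annihilates:
  assumes T: "gtower X T" and T': "gtower X' T'" and e: "znull T T' \<epsilon>"
  shows "\<guillemotleft>\<epsilon> k :\<^bsub>C\<^esub> tH T k \<rightarrow> tH T' k\<guillemotright>" "td T' k \<odot> \<epsilon> k \<odot> ty T k = azero C (tG T k) (tL T' k)"
    "\<lbrakk>trel S T g \<phi>; gtower Y S\<rbrakk> \<Longrightarrow> td T' k \<odot> \<epsilon> k \<odot> \<phi> k \<odot> ty S k = azero C (tG S k) (tL T' k)"
proof -
  note [simp] = gtower_hom[OF T] gtowerD[OF T] gtower_hom[OF T'] gtowerD[OF T']
    gtower_comp(5)[OF T] gtower_comp(5)[OF T']
  obtain s t where st: "\<And>k. \<guillemotleft>s k :\<^bsub>C\<^esub> tH T k \<rightarrow> tH T' (k - 1)\<guillemotright>" "\<And>k. \<guillemotleft>t k :\<^bsub>C\<^esub> tH T k \<rightarrow> tH T' (k - 1)\<guillemotright>"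
     "\<And>k. \<epsilon> k = s (k + 1) \<odot> th T k \<oplus> th T' (k - 1) \<odot> t k" using e unfolding znull_def by metis
  note [simp] = st(1,2)
  have dh: "td T' k \<odot> th T' (k - 1) \<odot> x = azero C (src x) (tL T' k)" if "arr C x" "tgt x = tH T' (k - 1)" for x
    using acomp_eq[OF gtower_comp(6)[OF T', of "k - 1"], of x] that by simp
  show "\<guillemotleft>\<epsilon> k :\<^bsub>C\<^esub> tH T k \<rightarrow> tH T' k\<guillemotright>" by (simp add: st(3))
  show "td T' k \<odot> \<epsilon> k \<odot> ty T k = azero C (tG T k) (tL T' k)"
    by (simp add: st(3) dh gtower_comp(7)[OF T])
  assume \<phi>: "trel S T g \<phi>" and S: "gtower Y S"
  note [simp] = trelD(1)[OF \<phi>] gtower_hom[OF S] gtowerD[OF S] gtower_comp(5)[OF S]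
  have "th T k \<odot> \<phi> k \<odot> ty S k = azero C (tG S k) (tH T (k + 1))"
    using acomp_eq[OF trelD(2)[OF \<phi>, of k], of "ty S k"] by (simp add: gtower_comp(7)[OF S])
  then show "td T' k \<odot> \<epsilon> k \<odot> \<phi> k \<odot> ty S k = azero C (tG S k) (tL T' k)"
    by (simp add: st(3) dh)
qed

lemma trel_aplus:
  assumes T: "gtower X T" and T': "gtower X' T'" and e: "trel T T' g \<phi>" "trel T T' g' \<phi>'"
    and g: "\<guillemotleft>g :\<^bsub>C\<^esub> X \<rightarrow> X'\<guillemotright>" "\<guillemotleft>g' :\<^bsub>C\<^esub> X \<rightarrow> X'\<guillemotright>"
  shows "trel T T' (g \<oplus> g') (\<lambda>k. \<phi> k \<oplus> \<phi>' k)"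
proof -
  note [simp] = gtower_hom[OF T] gtowerD[OF T] gtower_hom[OF T'] gtowerD[OF T'] g trelD(1)[OF e(1)] trelD(1)[OF e(2)]
    gtower_comp(5)[OF T] gtower_comp(5)[OF T']
  show ?thesis unfolding trel_def by (simp add: trelD(2,3)[OF e(1)] trelD(2,3)[OF e(2)])
qed

lemma trel_aneg:
  assumes T: "gtower X T" and T': "gtower X' T'" and e: "trel T T' g \<phi>" and g: "\<guillemotleft>g :\<^bsub>C\<^esub> X \<rightarrow> X'\<guillemotright>"
  shows "trel T T' (\<ominus> g) (\<lambda>k. \<ominus> (\<phi> k))"
proof -
  note [simp] = gtower_hom[OF T] gtowerD[OF T] gtower_hom[OF T'] gtowerD[OF T'] g trelD(1)[OF e]
    gtower_comp(5)[OF T] gtower_comp(5)[OF T']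
  show ?thesis unfolding trel_def by (simp add: trelD(2,3)[OF e])
qed

lemma trel_aid:
  assumes T: "gtower X T"
  shows "trel T T (aid C X) (\<lambda>k. aid C (tH T k))"
proof -
  note [simp] = gtower_hom[OF T] gtowerD[OF T] gtower_comp(5)[OF T]
  show ?thesis unfolding trel_def by (simp add: gtower_eq(4)[OF T])
qed

lemma trel_diff_znull:
  assumes T: "gtower X T" and T': "gtower X' T'" and e: "trel T T' g \<phi>" "trel T T' g \<phi>'" and g: "\<guillemotleft>g :\<^bsub>C\<^esub> X \<rightarrow> X'\<guillemotright>"
  shows "znull T T' (\<lambda>k. \<phi> k \<oplus> \<ominus> (\<phi>' k))"
proof -
  have "trel T T' (g \<oplus> \<ominus> g) (\<lambda>k. \<phi> k \<oplus> \<ominus> (\<phi>' k))"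
    by (rule trel_aplus[OF T T' e(1) trel_aneg[OF T T' e(2) g] g]) (use g in simp)
  then show ?thesis using g by (intro trel_zero_znull[OF T T']) simp
qed

text \<open>The condition on $\<phi>'$ concerns $\<phi>' y$ only, whereas $\<phi>' \<phi> y$ occurs
  here. So $\<phi>'$ is replaced by the heart part \<psi> of a true morphism of towers, which
  commutes with $d$. The difference is of the form $s h + h' t$ and is annihilated.\<close>

lemma trel_acomp:
  assumes T: "gtower X T" and T': "gtower X' T'" and T'': "gtower X'' T''"
    and e: "trel T T' g \<phi>" "trel T' T'' g' \<phi>'" and g: "\<guillemotleft>g :\<^bsub>C\<^esub> X \<rightarrow> X'\<guillemotright>" "\<guillemotleft>g' :\<^bsub>C\<^esub> X' \<rightarrow> X''\<guillemotright>"
  shows "trel T T'' (g' \<odot> g) (\<lambda>k. \<phi>' k \<odot> \<phi> k)"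
proof -
  note [simp] = gtower_hom[OF T] gtowerD[OF T] gtower_hom[OF T'] gtowerD[OF T'] gtower_hom[OF T''] gtowerD[OF T''] g
    trelD(1)[OF e(1)] trelD(1)[OF e(2)] gtower_comp(5)[OF T] gtower_comp(5)[OF T'] gtower_comp(5)[OF T'']
  obtain l r \<psi> where x: "tmap T' T'' g' l r \<psi>" using tmap_exists[OF T' T'' g(2)] .
  note [simp] = tmap_hom[OF x]
  have z: "znull T' T'' (\<lambda>k. \<phi>' k \<oplus> \<ominus> (\<psi> k))"
    by (rule trel_diff_znull[OF T' T'' e(2) tmap_trel[OF T' T'' g(2) x] g(2)])
  have "\<phi>' (k + 1) \<odot> \<phi> (k + 1) \<odot> th T k = th T'' k \<odot> \<phi>' k \<odot> \<phi> k" for k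
    using acomp_eq[OF trelD(2)[OF e(2), of k], of "\<phi> k"] by (simp add: trelD(2)[OF e(1)])
  moreover have "td T'' k \<odot> \<phi>' k \<odot> \<phi> k \<odot> ty T k = ta T'' k \<odot> ash C k g' \<odot> ash C k g \<odot> tb T (k - 1)" for k
  proof -
    have 1: "\<phi>' k = \<psi> k \<oplus> (\<phi>' k \<oplus> \<ominus> (\<psi> k))" by (rule eq_plus_diff) simp_all
    have "td T'' k \<odot> \<phi>' k \<odot> \<phi> k \<odot> ty T k = td T'' k \<odot> (\<psi> k \<oplus> (\<phi>' k \<oplus> \<ominus> (\<psi> k))) \<odot> \<phi> k \<odot> ty T k"
      by (subst 1) (rule refl)
    also have "\<dots> = td T'' k \<odot> \<psi> k \<odot> \<phi> k \<odot> ty T k \<oplus> td T'' k \<odot> (\<phi>' k \<oplus> \<ominus> (\<psi> k)) \<odot> \<phi> k \<odot> ty T k"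
      by simp
    also have "\<dots> = td T'' k \<odot> \<psi> k \<odot> \<phi> k \<odot> ty T k"
      unfolding znull_annihilates(3)[OF T' T'' z e(1) T] by simp
    also have "\<dots> = l k \<odot> td T' k \<odot> \<phi> k \<odot> ty T k"
      using acomp_eq[OF tmap_eq(6)[OF x, of k], of "\<phi> k \<odot> ty T k"] by simp
    also have "\<dots> = l k \<odot> ta T' k \<odot> ash C k g \<odot> tb T (k - 1)" by (simp add: trelD(3)[OF e(1)])
    also have "\<dots> = ta T'' k \<odot> ash C k g' \<odot> ash C k g \<odot> tb T (k - 1)"
      using acomp_eq[OF tmap_eq(1)[OF x, of k], of "ash C k g \<odot> tb T (k - 1)"] by simp
    finally show ?thesis .
  qed
  ultimately show ?thesis unfolding trel_def by simp
qed

end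

section \<open>The middle term of a triangle\<close>

context triangulated_category
begin

text \<open>The $3 \times 3$ lemma for the square with sides \<open>alX\<close>, \<open>del'\<close>, \<open>del\<close>, \<open>alZ[-1]\<close>. The columns are the
  cones of \<open>del'\<close> and \<open>del\<close>. The intermediate object \<open>N\<close> is the cone of the diagonal of the square.\<close>

lemma three_by_three:
  assumes X: "tri alX cX dX" and Z: "tri alZ cZ dZ" and D': "tri del' i' p'" and D: "tri del i p"
    and ty: "tgt del' = src alX" "src del' = ShO C (-2) (ShO C 1 (src alZ))" "src del = ShO C (-1) (tgt alZ)" "tgt del = tgt alX"
    and sq: "alX \<odot> del' = del \<odot> ash C (-1) alZ"
  obtains al c d e q t where "tri al c d" "tri e q t"
    "\<guillemotleft>al :\<^bsub>C\<^esub> tgt i' \<rightarrow> tgt i\<guillemotright>" "\<guillemotleft>e :\<^bsub>C\<^esub> tgt cX \<rightarrow> tgt c\<guillemotright>" "\<guillemotleft>q :\<^bsub>C\<^esub> tgt c \<rightarrow> tgt cZ\<guillemotright>"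
    "al \<odot> i' = i \<odot> alX" "p \<odot> al = alZ \<odot> p'" "e \<odot> cX = c \<odot> i" "d \<odot> e = ash C 1 i' \<odot> dX"
    "q \<odot> c = cZ \<odot> p" "dZ \<odot> q = ash C 1 p' \<odot> d" "ash C 1 dX \<odot> t = ash C 2 del' \<odot> dZ"
proof -
  note d = triD[OF X] triD[OF Z] triD[OF D'] triD[OF D]
  note [simp] = d ty
  \<comment> \<open>By the commuting square the diagonal is a composite in two ways, so its cone
    serves in two octahedra: for \<open>alX\<close> after \<open>del'\<close>, and for
    \<open>del\<close> after the shifted \<open>alZ\<close>.\<close>
  obtain jN pN where N: "tri (alX \<odot> del') jN pN" using tri_cone[of "alX \<odot> del'"] by auto
  have N': "tri (del \<odot> ash C (-1) alZ) jN pN" using N sq by simp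
  note [simp] = triD[OF N]
  have tyA: "src alX = tgt del'" "src del = tgt (ash C (-1) alZ)" by simp_all
  obtain u v where uv: "tri u v (ash C 1 i' \<odot> dX)" "\<guillemotleft>u :\<^bsub>C\<^esub> tgt i' \<rightarrow> tgt jN\<guillemotright>" "\<guillemotleft>v :\<^bsub>C\<^esub> tgt jN \<rightarrow> tgt cX\<guillemotright>"
    "u \<odot> i' = jN \<odot> alX" "pN \<odot> u = p'" "v \<odot> jN = cX" "dX \<odot> v = ash C 1 del' \<odot> pN"
    using tri_octahedron[OF D' X N tyA(1)] by blast
  obtain u2 v2 where uv2: "tri u2 v2 (ash C 1 (\<ominus> (ash C (-1) cZ)) \<odot> p)" "\<guillemotleft>u2 :\<^bsub>C\<^esub> tgt (\<ominus> (ash C (-1) cZ)) \<rightarrow> tgt jN\<guillemotright>"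
    "\<guillemotleft>v2 :\<^bsub>C\<^esub> tgt jN \<rightarrow> tgt i\<guillemotright>" "pN \<odot> u2 = ash C (-1) dZ" "v2 \<odot> jN = i" "p \<odot> v2 = ash C 1 (ash C (-1) alZ) \<odot> pN"
    using tri_octahedron[OF tri_shift_m1'[OF Z] D N' tyA(2)] by blast
  note [simp] = uv(2,3) uv2(2,3)
  have t2: "tri v2 (cZ \<odot> p) (ash C 1 u2)"
    using tri_neg23[OF tri_rotate[OF uv2(1)]] by simp
  \<comment> \<open>The required map \<open>al\<close> is the composite of the maps from the cone of
    \<open>del'\<close> to $N$ and from $N$ to the cone of \<open>del\<close>. A third octahedron,
    on this composite, yields the triangle of the cones of the three rows.\<close>
  obtain c d where cd: "tri (v2 \<odot> u) c d" using tri_cone[of "v2 \<odot> u"] by auto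
  note [simp] = triD[OF cd]
  obtain e q where eq: "tri e q (ash C 1 v \<odot> ash C 1 u2)" "\<guillemotleft>e :\<^bsub>C\<^esub> tgt v \<rightarrow> tgt c\<guillemotright>" "\<guillemotleft>q :\<^bsub>C\<^esub> tgt c \<rightarrow> tgt (cZ \<odot> p)\<guillemotright>"
    "e \<odot> v = c \<odot> v2" "d \<odot> e = ash C 1 i' \<odot> dX" "q \<odot> c = cZ \<odot> p" "ash C 1 u2 \<odot> q = ash C 1 u \<odot> d"
    using tri_octahedron[OF uv(1) t2 cd] by auto
  note [simp] = eq(2,3)
  have "e \<odot> cX = c \<odot> i"
    using acomp_eq[OF eq(4), of jN] uv(6) uv2(5) by simp
  moreover have dZ: "dZ = ash C 1 pN \<odot> ash C 1 u2"
    using arg_cong[OF uv2(4), of "ash C 1"] by simp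
  have "dZ \<odot> q = ash C 1 p' \<odot> d"
  proof -
    have "dZ \<odot> q = ash C 1 pN \<odot> ash C 1 u2 \<odot> q" using arg_cong[OF dZ, of "\<lambda>x. x \<odot> q"] by simp
    also have "\<dots> = ash C 1 pN \<odot> ash C 1 u \<odot> d" by (simp add: eq(7))
    also have "\<dots> = ash C 1 (pN \<odot> u) \<odot> d" by simp
    finally show ?thesis by (simp only: uv(5))
  qed
  moreover have "(v2 \<odot> u) \<odot> i' = i \<odot> alX" using acomp_eq[OF uv2(5), of alX] uv(4) by simp
  moreover have "p \<odot> v2 \<odot> u = alZ \<odot> p'" using acomp_eq[OF uv2(6), of u] uv(5) by simp
  \<comment> \<open>This relation records what the third map \<open>t\<close> does after
    \<open>dX\<close>; in degree 0 it allows \<open>t\<close> to be identified with a connecting map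
    chosen beforehand.\<close>
  moreover have "ash C 1 dX \<odot> ash C 1 v \<odot> ash C 1 u2 = ash C 2 del' \<odot> dZ"
  proof -
    have "ash C 1 dX \<odot> ash C 1 v \<odot> ash C 1 u2 = ash C 1 (dX \<odot> v) \<odot> ash C 1 u2" by simp
    also have "\<dots> = ash C 1 (ash C 1 del' \<odot> pN) \<odot> ash C 1 u2" by (simp only: uv(7))
    also have "\<dots> = ash C 2 del' \<odot> ash C 1 pN \<odot> ash C 1 u2" by simp
    finally show ?thesis by (simp only: dZ)
  qed
  ultimately show ?thesis using cd eq uv(6) uv2(5)
    by (intro that[of "v2 \<odot> u" c d e q "ash C 1 v \<odot> ash C 1 u2"]) simp_all
qed

end

section \<open>Connecting maps between towers and the interface for assembling a tower of the middle
  term\<close>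

context weight_structure
begin

definition level :: "'o \<Rightarrow> ('o, 'm) arrow \<Rightarrow> ('o, 'm) arrow \<Rightarrow> ('o, 'm) arrow \<Rightarrow> bool" where
  "level V a f b \<longleftrightarrow> tri a f b \<and> src a = V \<and> tgt a \<in> fst w \<and> tgt f \<in> snd w"

lemma levelD:
  assumes "level V a f b"
  shows "tri a f b" "\<guillemotleft>a :\<^bsub>C\<^esub> V \<rightarrow> tgt a\<guillemotright>" "\<guillemotleft>f :\<^bsub>C\<^esub> tgt a \<rightarrow> tgt f\<guillemotright>" "\<guillemotleft>b :\<^bsub>C\<^esub> tgt f \<rightarrow> ShO C 1 V\<guillemotright>" "tgt a \<in> fst w" "tgt f \<in> snd w"
  using assms triD[of a f b] by (auto simp: level_def)

text \<open>The conditions of \<open>gtower\<close> that tie level $k$ (index 1) to level $k-1$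
  (index 0); the target of \<open>c\<close> is the heart term in degree $k$.\<close>

definition tlink where
  "tlink a1 f1 b1 a0 f0 b0 al be c d y \<longleftrightarrow> tri al c d \<and> tri be y (\<ominus> (f1 \<odot> d)) \<and>
     \<guillemotleft>al :\<^bsub>C\<^esub> ShO C (-1) (tgt a1) \<rightarrow> tgt a0\<guillemotright> \<and> \<guillemotleft>be :\<^bsub>C\<^esub> ShO C (-1) (tgt f1) \<rightarrow> tgt f0\<guillemotright> \<and> \<guillemotleft>y :\<^bsub>C\<^esub> tgt f0 \<rightarrow> tgt c\<guillemotright> \<and>
     \<guillemotleft>d :\<^bsub>C\<^esub> tgt c \<rightarrow> tgt a1\<guillemotright> \<and>
     al \<odot> ash C (-1) a1 = a0 \<and> b0 \<odot> be = ash C (-1) b1 \<and> c = y \<odot> f0 \<and> d \<odot> y = a1 \<odot> b0"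

text \<open>The compatibilities of \<open>e\<close> and \<open>q\<close> with the maps $d$ are asked
  for only after composition with $f$. This suffices because $h^k = y^{k+1} f^k d^k$, and it is all
  that is available at the levels above 0.\<close>

lemma assemble_middle:
  assumes X: "gtower X TX" and Z: "gtower Z TZ" and F: "\<guillemotleft>F :\<^bsub>C\<^esub> X \<rightarrow> Y\<guillemotright>" and G: "\<guillemotleft>G :\<^bsub>C\<^esub> Y \<rightarrow> Z\<guillemotright>"
    and lv: "\<And>k. level (ShO C k Y) (a k) (f k) (b k)"
    and lk: "\<And>k. tlink (a k) (f k) (b k) (a (k - 1)) (f (k - 1)) (b (k - 1)) (al k) (be k) (c k) (d k) (y k)"
    and lam: "\<And>k. \<guillemotleft>\<rho> k :\<^bsub>C\<^esub> tL TX k \<rightarrow> tgt (a k)\<guillemotright>" and mu: "\<And>k. \<guillemotleft>\<mu> k :\<^bsub>C\<^esub> tgt (a k) \<rightarrow> tL TZ k\<guillemotright>"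
    and e: "\<And>k. \<guillemotleft>e k :\<^bsub>C\<^esub> tH TX k \<rightarrow> tgt (c k)\<guillemotright>" and q: "\<And>k. \<guillemotleft>q k :\<^bsub>C\<^esub> tgt (c k) \<rightarrow> tH TZ k\<guillemotright>"
    and eq: "\<And>k. tri (e k) (q k) (t k)"
    and e1: "\<And>k. e k \<odot> tc TX k = c k \<odot> \<rho> (k - 1)" and e2: "\<And>k. f k \<odot> d k \<odot> e k = f k \<odot> \<rho> k \<odot> td TX k"
    and q1: "\<And>k. q k \<odot> c k = tc TZ k \<odot> \<mu> (k - 1)" and q2: "\<And>k. tf TZ k \<odot> td TZ k \<odot> q k = tf TZ k \<odot> \<mu> k \<odot> d k"
    and e3: "\<And>k. d k \<odot> e k \<odot> ty TX k = a k \<odot> ash C k F \<odot> tb TX (k - 1)"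
    and q3: "\<And>k. td TZ k \<odot> q k \<odot> y k = ta TZ k \<odot> ash C k G \<odot> b (k - 1)"
  obtains TY where "gtower Y TY" "trel TX TY F e" "trel TY TZ G q"
proof -
  define T where "T = \<lparr>tL = \<lambda>k. tgt (a k), tG = \<lambda>k. tgt (f (k - 1)), tH = \<lambda>k. tgt (c k), ta = a, tf = f, tb = b,
    tal = al, tbe = be, tc = c, td = d, ty = y\<rparr>"
  have lkD: "tri (al k) (c k) (d k)" "tri (be k) (y k) (\<ominus> (f k \<odot> d k))" "\<guillemotleft>al k :\<^bsub>C\<^esub> ShO C (-1) (tgt (a k)) \<rightarrow> tgt (a (k - 1))\<guillemotright>"
    "\<guillemotleft>be k :\<^bsub>C\<^esub> ShO C (-1) (tgt (f k)) \<rightarrow> tgt (f (k - 1))\<guillemotright>" "\<guillemotleft>y k :\<^bsub>C\<^esub> tgt (f (k - 1)) \<rightarrow> tgt (c k)\<guillemotright>" "\<guillemotleft>d k :\<^bsub>C\<^esub> tgt (c k) \<rightarrow> tgt (a k)\<guillemotright>"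
    "al k \<odot> ash C (-1) (a k) = a (k - 1)" "b (k - 1) \<odot> be k = ash C (-1) (b k)" "c k = y k \<odot> f (k - 1)" "d k \<odot> y k = a k \<odot> b (k - 1)" for k
    using lk[of k] unfolding tlink_def by blast+
  have Y: "Y \<in> Obj C" using F by blast
  have H: "tgt (c k) \<in> fst w" "tgt (c k) \<in> snd w" for k
    using fst_w_extension[OF eq[of k]] snd_w_extension[OF eq[of k]] e[of k] q[of k] gtowerD(4,5)[OF X, of k] gtowerD(4,5)[OF Z, of k] by simp_all
  have c: "\<guillemotleft>c k :\<^bsub>C\<^esub> tgt (a (k - 1)) \<rightarrow> tgt (c k)\<guillemotright>" for k
    using triD[OF lkD(1)[of k]] lkD(3)[of k] by simp
  have T: "gtower Y T"
    unfolding gtower_def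
  proof (intro conjI allI)
    fix k
    show "tal T k \<odot> ash C (-1) (ta T k) = ta T (k - 1)" "tb T (k - 1) \<odot> tbe T k = ash C (-1) (tb T k)"
     "tc T k = ty T k \<odot> tf T (k - 1)" "td T k \<odot> ty T k = ta T k \<odot> tb T (k - 1)"
      using lkD(7-10)[of k] by (simp_all add: T_def)
  qed (use Y H c lkD(1-6) levelD[OF lv] in \<open>simp_all add: T_def\<close>)
  have ar: "arr C (a k)" "src (a k) = ShO C k Y" "tgt (a k) \<in> Obj C" "arr C (f k)" "src (f k) = tgt (a k)" "tgt (f k) \<in> Obj C"
    "arr C (b k)" "src (b k) = tgt (f k)" "tgt (b k) = ShO C (k + 1) Y" "arr C (c k)" "src (c k) = tgt (a (k - 1))" "tgt (c k) \<in> Obj C" for k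
    using levelD[OF lv[of k]] Y c[of k] by simp_all
  note [simp] = gtower_hom[OF X] gtowerD[OF X] gtower_hom[OF Z] gtowerD[OF Z] F G e q lam mu Y ar lkD(3-6)
    gtower_comp(5)[OF X] gtower_comp(5)[OF Z]
  have "e (k + 1) \<odot> th TX k = th T k \<odot> e k" for k
  proof -
    have "e (k + 1) \<odot> th TX k = c (k + 1) \<odot> \<rho> k \<odot> td TX k"
      using acomp_eq[OF e1[of "k + 1"], of "td TX k"] by (simp add: th_def)
    also have "\<dots> = y (k + 1) \<odot> f k \<odot> \<rho> k \<odot> td TX k" using lkD(9)[of "k + 1"] by simp
    also have "\<dots> = y (k + 1) \<odot> f k \<odot> d k \<odot> e k" by (simp only: e2)
    also have "\<dots> = th T k \<odot> e k" using lkD(9)[of "k + 1"] by (simp add: th_def T_def)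
    finally show ?thesis .
  qed
  then have 1: "trel TX T F e" unfolding trel_def using e3 by (simp add: T_def)
  have "q (k + 1) \<odot> th T k = th TZ k \<odot> q k" for k
  proof -
    have "q (k + 1) \<odot> th T k = tc TZ (k + 1) \<odot> \<mu> k \<odot> d k"
      using acomp_eq[OF q1[of "k + 1"], of "d k"] by (simp add: th_def T_def)
    also have "\<dots> = ty TZ (k + 1) \<odot> tf TZ k \<odot> \<mu> k \<odot> d k" by (simp add: gtower_eq(3)[OF Z, of "k + 1"])
    also have "\<dots> = ty TZ (k + 1) \<odot> tf TZ k \<odot> td TZ k \<odot> q k" by (simp only: q2)
    also have "\<dots> = th TZ k \<odot> q k" by (simp add: th_def gtower_eq(3)[OF Z, of "k + 1"])
    finally show ?thesis .
  qed
  then have 2: "trel T TZ G q" unfolding trel_def using q3 by (simp add: T_def)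
  show ?thesis by (rule that[OF T 1 2])
qed

text \<open>Orthogonality extends the connecting map to \<delta>^k and forces its compatibility with
  \<alpha>. The minus sign in the last square is the one in \<open>hs\<close>, by which the first
  maps of consecutive shifts of a triangle differ.\<close>

lemma connecting_le:
  assumes X: "gtower X TX" and Z: "gtower Z TZ" and h: "\<And>k. \<guillemotleft>h k :\<^bsub>C\<^esub> ShO C (k - 1) Z \<rightarrow> ShO C k X\<guillemotright>"
    and hs: "\<And>k. h (k - 1) = \<ominus> (ash C (-1) (h k))"
  obtains \<delta> where "\<And>k. \<guillemotleft>\<delta> k :\<^bsub>C\<^esub> ShO C (-1) (tL TZ k) \<rightarrow> tL TX k\<guillemotright>" "\<And>k. ta TX k \<odot> h k = \<delta> k \<odot> ash C (-1) (ta TZ k)"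
    "\<And>k. tal TX k \<odot> \<ominus> (ash C (-1) (\<delta> k)) = \<delta> (k - 1) \<odot> ash C (-1) (tal TZ k)"
proof -
  note [simp] = gtower_hom[OF X] gtowerD[OF X] gtower_hom[OF Z] gtowerD[OF Z] h
  have "\<exists>v. \<guillemotleft>v :\<^bsub>C\<^esub> tgt (ash C (-1) (ta TZ k)) \<rightarrow> tgt (ta TX k \<odot> h k)\<guillemotright> \<and> ta TX k \<odot> h k = v \<odot> ash C (-1) (ta TZ k)" for k
    by (rule tri_ext_exists[OF tri_shift_m1'[OF gtower_tri(1)[OF Z]]]) (simp_all, rule orth[of _ _ _ 2 0], simp_all)
  then have "\<exists>v. \<guillemotleft>v :\<^bsub>C\<^esub> ShO C (-1) (tL TZ k) \<rightarrow> tL TX k\<guillemotright> \<and> ta TX k \<odot> h k = v \<odot> ash C (-1) (ta TZ k)" for k by simp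
  then obtain \<delta> where \<delta>: "\<And>k. \<guillemotleft>\<delta> k :\<^bsub>C\<^esub> ShO C (-1) (tL TZ k) \<rightarrow> tL TX k\<guillemotright>"
    "\<And>k. ta TX k \<odot> h k = \<delta> k \<odot> ash C (-1) (ta TZ k)" by metis
  note [simp] = \<delta>(1)
  have "tal TX k \<odot> \<ominus> (ash C (-1) (\<delta> k)) = \<delta> (k - 1) \<odot> ash C (-1) (tal TZ k)" for k
  proof (rule tri_ext_unique[OF tri_shift_m1'[OF tri_shift_m1'[OF gtower_tri(1)[OF Z, of k]]]])
    have 1: "ash C (-1) (\<delta> k) \<odot> ash C (-2) (ta TZ k) = ash C (-1) (ta TX k) \<odot> ash C (-1) (h k)"
      using arg_cong[OF \<delta>(2)[of k], of "ash C (-1)"] by simp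
    have 2: "ash C (-1) (tal TZ k) \<odot> ash C (-2) (ta TZ k) = ash C (-1) (ta TZ (k - 1))"
      using arg_cong[OF gtower_eq(1)[OF Z, of k], of "ash C (-1)"] by simp
    have "(tal TX k \<odot> \<ominus> (ash C (-1) (\<delta> k))) \<odot> ash C (-1) (ash C (-1) (ta TZ k)) = tal TX k \<odot> ash C (-1) (ta TX k) \<odot> h (k - 1)"
      by (simp add: 1 hs[of k])
    also have "\<dots> = ta TX (k - 1) \<odot> h (k - 1)"
      using acomp_eq[OF gtower_eq(1)[OF X, of k], of "h (k - 1)"] by simp
    also have "\<dots> = \<delta> (k - 1) \<odot> ash C (-1) (ta TZ (k - 1))" by (rule \<delta>(2))
    also have "\<dots> = (\<delta> (k - 1) \<odot> ash C (-1) (tal TZ k)) \<odot> ash C (-1) (ash C (-1) (ta TZ k))"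
      by (simp add: 2)
    finally show "(tal TX k \<odot> \<ominus> (ash C (-1) (\<delta> k))) \<odot> ash C (-1) (ash C (-1) (ta TZ k)) =
      (\<delta> (k - 1) \<odot> ash C (-1) (tal TZ k)) \<odot> ash C (-1) (ash C (-1) (ta TZ k))" .
  qed (simp_all, rule orth[of _ _ _ 2 0], simp_all)
  with \<delta> show ?thesis by (rule that)
qed

text \<open>A difference factors through a map of weights 1 to 0. The lemma serves to recognise the
  connecting map that the $3 \<times> 3$ lemma produces in degree 0 as \<gamma>^1.\<close>

lemma connecting_ge_unique:
  assumes X: "gtower X TX" and Z: "gtower Z TZ"
    and "\<guillemotleft>u :\<^bsub>C\<^esub> ShO C (-1) (tG TZ k) \<rightarrow> tG TX k\<guillemotright>" "\<guillemotleft>v :\<^bsub>C\<^esub> ShO C (-1) (tG TZ k) \<rightarrow> tG TX k\<guillemotright>"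
    "tb TX (k - 1) \<odot> u = tb TX (k - 1) \<odot> v"
  shows "u = v"
proof (rule tri_lift_unique[OF gtower_tri(1)[OF X, of "k - 1"]])
  note [simp] = gtower_hom[OF X] gtowerD[OF X] gtower_hom[OF Z] gtowerD[OF Z]
  show "x = azero C (src u) (tgt (ta TX (k - 1)))" if "\<guillemotleft>x :\<^bsub>C\<^esub> src u \<rightarrow> tgt (ta TX (k - 1))\<guillemotright>" for x
    by (rule orth[OF that, of 1 0]) (use assms(3) in simp_all)
qed (use assms gtower_hom[OF X, of "k - 1"] in simp_all)

text \<open>Dual to \<open>connecting_le\<close>: now the connecting map is lifted along $b$. The
  index of \<gamma>^k is that of $X^{w>=k}$, so it lies over $b^{k-1}$.\<close>

lemma connecting_ge:
  assumes X: "gtower X TX" and Z: "gtower Z TZ" and h: "\<And>k. \<guillemotleft>h k :\<^bsub>C\<^esub> ShO C (k - 1) Z \<rightarrow> ShO C k X\<guillemotright>"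
    and hs: "\<And>k. h (k - 1) = \<ominus> (ash C (-1) (h k))"
  obtains \<gamma> where "\<And>k. \<guillemotleft>\<gamma> k :\<^bsub>C\<^esub> ShO C (-1) (tG TZ k) \<rightarrow> tG TX k\<guillemotright>" "\<And>k. h k \<odot> ash C (-1) (tb TZ (k - 1)) = tb TX (k - 1) \<odot> \<gamma> k"
    "\<And>k. tbe TX k \<odot> \<ominus> (ash C (-1) (\<gamma> (k + 1))) = \<gamma> k \<odot> ash C (-1) (tbe TZ k)"
proof -
  note [simp] = gtower_hom[OF X] gtowerD[OF X] gtower_hom[OF Z] gtowerD[OF Z] h
  have "\<exists>v. \<guillemotleft>v :\<^bsub>C\<^esub> src (h k \<odot> ash C (-1) (tb TZ (k - 1))) \<rightarrow> tgt (tf TX (k - 1))\<guillemotright> \<and> h k \<odot> ash C (-1) (tb TZ (k - 1)) = tb TX (k - 1) \<odot> v" for k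
    by (rule tri_lift_exists[OF gtower_tri(1)[OF X]]) (simp_all, rule orth[of _ _ _ 1 "-1"], simp_all)
  then have "\<exists>v. \<guillemotleft>v :\<^bsub>C\<^esub> ShO C (-1) (tG TZ k) \<rightarrow> tG TX k\<guillemotright> \<and> h k \<odot> ash C (-1) (tb TZ (k - 1)) = tb TX (k - 1) \<odot> v" for k by simp
  then obtain \<gamma> where \<gamma>: "\<And>k. \<guillemotleft>\<gamma> k :\<^bsub>C\<^esub> ShO C (-1) (tG TZ k) \<rightarrow> tG TX k\<guillemotright>"
    "\<And>k. h k \<odot> ash C (-1) (tb TZ (k - 1)) = tb TX (k - 1) \<odot> \<gamma> k" by metis
  note [simp] = \<gamma>(1)
  have "tbe TX k \<odot> \<ominus> (ash C (-1) (\<gamma> (k + 1))) = \<gamma> k \<odot> ash C (-1) (tbe TZ k)" for k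
  proof (rule tri_lift_unique[OF gtower_tri(1)[OF X, of "k - 1"]])
    have 1: "ash C (-1) (tb TX k) \<odot> ash C (-1) (\<gamma> (k + 1)) = ash C (-1) (h (k + 1)) \<odot> ash C (-2) (tb TZ k)"
      using arg_cong[OF \<gamma>(2)[of "k + 1"], of "ash C (-1)"] by simp
    have 2: "ash C (-1) (tb TZ (k - 1)) \<odot> ash C (-1) (tbe TZ k) = ash C (-2) (tb TZ k)"
      using arg_cong[OF gtower_eq(2)[OF Z, of k], of "ash C (-1)"] by simp
    have "tb TX (k - 1) \<odot> tbe TX k \<odot> \<ominus> (ash C (-1) (\<gamma> (k + 1))) = \<ominus> (ash C (-1) (tb TX k) \<odot> ash C (-1) (\<gamma> (k + 1)))"
      using acomp_eq[OF gtower_eq(2)[OF X, of k], of "ash C (-1) (\<gamma> (k + 1))"] by simp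
    also have "\<dots> = h k \<odot> ash C (-2) (tb TZ k)"
      unfolding 1 using hs[of "k + 1"] by simp
    also have "\<dots> = tb TX (k - 1) \<odot> \<gamma> k \<odot> ash C (-1) (tbe TZ k)"
      using acomp_eq[OF \<gamma>(2)[of k], of "ash C (-1) (tbe TZ k)"] by (simp add: 2)
    finally show "tb TX (k - 1) \<odot> (tbe TX k \<odot> \<ominus> (ash C (-1) (\<gamma> (k + 1)))) = tb TX (k - 1) \<odot> (\<gamma> k \<odot> ash C (-1) (tbe TZ k))" .
    show "v = azero C (src (tbe TX k \<odot> \<ominus> (ash C (-1) (\<gamma> (k + 1))))) (tgt (ta TX (k - 1)))"
      if "\<guillemotleft>v :\<^bsub>C\<^esub> src (tbe TX k \<odot> \<ominus> (ash C (-1) (\<gamma> (k + 1)))) \<rightarrow> tgt (ta TX (k - 1))\<guillemotright>" for v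
      by (rule orth[OF that, of 2 0]) simp_all
  qed simp_all
  with \<gamma> show ?thesis by (rule that)
qed

end

section \<open>One step down and one step up in the tower of the middle term\<close>

context weight_structure
begin

text \<open>Levels below $0$ are built downwards from the maps $\alpha$, levels above $0$ upwards from the maps
  $\beta$; in both directions the next map is forced to be a composite, which makes it compatible with the
  previous one.\<close>

lemma middle_levels_le:
  assumes X: "gtower X TX" and Z: "gtower Z TZ" and F: "\<guillemotleft>F :\<^bsub>C\<^esub> X \<rightarrow> Y\<guillemotright>" and G: "\<guillemotleft>G :\<^bsub>C\<^esub> Y \<rightarrow> Z\<guillemotright>"
    and D: "\<And>k. tri (\<delta> k) (i k) (p k)" and \<delta>: "\<And>k. \<guillemotleft>\<delta> k :\<^bsub>C\<^esub> ShO C (-1) (tL TZ k) \<rightarrow> tL TX k\<guillemotright>"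
    and eqs: "\<And>k. tri (e k) (q k) (t k)" "\<And>k. \<guillemotleft>e k :\<^bsub>C\<^esub> tH TX k \<rightarrow> tgt (c k)\<guillemotright>" "\<And>k. \<guillemotleft>q k :\<^bsub>C\<^esub> tgt (c k) \<rightarrow> tH TZ k\<guillemotright>"
    and al: "\<And>k. tri (al k) (c k) (d k)" "\<And>k. \<guillemotleft>al k :\<^bsub>C\<^esub> ShO C (-1) (tgt (i k)) \<rightarrow> tgt (i (k - 1))\<guillemotright>"
      "\<And>k. al k \<odot> ash C (-1) (i k) = i (k - 1) \<odot> tal TX k" "\<And>k. p (k - 1) \<odot> al k = tal TZ k \<odot> ash C (-1) (p k)"
    and P_def: "\<And>k a f b. P k (a, f, b) \<longleftrightarrow> level (ShO C k Y) a f b \<and> tgt a = tgt (i k) \<and>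
      i k \<odot> ta TX k = a \<odot> ash C k F \<and> p k \<odot> a = ta TZ k \<odot> ash C k G"
    and x: "P k (a1, f1, b1)"
  shows "\<exists>f0 b0 be y. P (k - 1) (al k \<odot> ash C (-1) a1, f0, b0) \<and>
    tlink a1 f1 b1 (al k \<odot> ash C (-1) a1) f0 b0 (al k) be (c k) (d k) y"
proof -
  have P1: "level (ShO C k Y) a1 f1 b1" "tgt a1 = tgt (i k)" "i k \<odot> ta TX k = a1 \<odot> ash C k F" "p k \<odot> a1 = ta TZ k \<odot> ash C k G"
    using x unfolding P_def by blast+
  note L = levelD[OF P1(1)]
  have iD: "arr C (i k)" "src (i k) = tL TX k" "tgt (i k) \<in> Obj C" "arr C (p k)" "src (p k) = tgt (i k)" "tgt (p k) = tL TZ k" for k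
    using triD[OF D[of k]] \<delta>[of k] gtowerD(6)[OF Z] by simp_all
  have cD: "arr C (c k)" "src (c k) = tgt (i (k - 1))" "arr C (d k)" "src (d k) = tgt (c k)" "tgt (d k) = tgt (i k)"
    "tgt (c k) \<in> Obj C" for k
    using triD[OF al(1)[of k]] al(2)[of k] iD[of k] by simp_all
  note [simp] = gtower_hom[OF X] gtowerD[OF X] gtower_hom[OF Z] gtowerD[OF Z] F G iD al(2) cD \<delta>
  have a1: "arr C a1" "src a1 = ShO C k Y" "tgt a1 = tgt (i k)" using L P1(2) by simp_all
  note [simp] = a1
  have iL: "tgt (i k) \<in> fst w" for k
    using fst_w_extension[OF tri_rotate[OF D[of k]]] by simp
  have H: "tgt (c k) \<in> snd w" for k
    using snd_w_extension[OF eqs(1)[of k]] eqs(2,3)[of k] by simp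
  obtain f0 b0 where t0: "tri (al k \<odot> ash C (-1) a1) f0 b0" using tri_cone[of "al k \<odot> ash C (-1) a1"] by auto
  have ty: "src (al k) = ShO C (-1) (tgt a1)" "tgt (al k) = tgt (al k \<odot> ash C (-1) a1)"
    "src (al k \<odot> ash C (-1) a1) = ShO C (-1) (src a1)" by simp_all
  obtain be y where y: "tri be y (\<ominus> (f1 \<odot> d k))" "\<guillemotleft>be :\<^bsub>C\<^esub> ShO C (-1) (tgt f1) \<rightarrow> tgt f0\<guillemotright>" "\<guillemotleft>y :\<^bsub>C\<^esub> tgt f0 \<rightarrow> tgt (c k)\<guillemotright>"
      "b0 \<odot> be = ash C (-1) b1" "c k = y \<odot> f0" "d k \<odot> y = a1 \<odot> b0"
    by (rule octahedron_le[OF L(1) t0 al(1)[of k] ty refl])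
  \<comment> \<open>The cone of the new map is an extension of the heart term by the target of
    \<open>f1\<close> shifted by $-1$. So the forced composite is again the first map of a weight
    decomposition.\<close>
  have "tgt f0 \<in> snd w"
    using snd_w_extension[OF y(1)] y(2,3) H snd_w_shift[OF L(6), of "-1"] by simp
  moreover have "tlink a1 f1 b1 (al k \<odot> ash C (-1) a1) f0 b0 (al k) be (c k) (d k) y"
    unfolding tlink_def using y(1-4,6) y(5)[symmetric] al(1)[of k] by simp
  moreover have "i (k - 1) \<odot> ta TX (k - 1) = (al k \<odot> ash C (-1) a1) \<odot> ash C (k - 1) F"
  proof -
    have "i (k - 1) \<odot> ta TX (k - 1) = i (k - 1) \<odot> tal TX k \<odot> ash C (-1) (ta TX k)" by (simp add: gtower_eq(1)[OF X])
    also have "\<dots> = al k \<odot> ash C (-1) (i k) \<odot> ash C (-1) (ta TX k)"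
      using acomp_eq[OF al(3)[of k], of "ash C (-1) (ta TX k)"] by simp
    also have "\<dots> = al k \<odot> ash C (-1) (i k \<odot> ta TX k)" by simp
    also have "\<dots> = al k \<odot> ash C (-1) (a1 \<odot> ash C k F)" by (simp only: P1(3))
    finally show ?thesis by simp
  qed
  moreover have "p (k - 1) \<odot> (al k \<odot> ash C (-1) a1) = ta TZ (k - 1) \<odot> ash C (k - 1) G"
  proof -
    have "p (k - 1) \<odot> (al k \<odot> ash C (-1) a1) = tal TZ k \<odot> ash C (-1) (p k \<odot> a1)"
      using acomp_eq[OF al(4)[of k], of "ash C (-1) a1"] by simp
    also have "\<dots> = tal TZ k \<odot> ash C (-1) (ta TZ k) \<odot> ash C (k - 1) G" by (simp add: P1(4))
    also have "\<dots> = ta TZ (k - 1) \<odot> ash C (k - 1) G"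
      using acomp_eq[OF gtower_eq(1)[OF Z, of k], of "ash C (k - 1) G"] by simp
    finally show ?thesis .
  qed
  ultimately have "P (k - 1) (al k \<odot> ash C (-1) a1, f0, b0)"
    unfolding P_def level_def using t0 iL by simp
  then show ?thesis using \<open>tlink a1 f1 b1 (al k \<odot> ash C (-1) a1) f0 b0 (al k) be (c k) (d k) y\<close> by blast
qed

text \<open>Going up, the new $b$ is forced to be the shift of $b_0 \<beta>$, and $a$, $f$ are found
  by completing it to a triangle. Its left part is an extension of $L[1]$, with $L$ the target of
  \<open>a0\<close>, by the heart term, hence of weights at most 0. The equation for
  \<open>x\<close> is kept because on this side the data of the heart terms involve the third map of
  the \<beta>-triangle instead of $d$.\<close>

lemma middle_levels_ge:
  assumes X: "gtower X TX" and Z: "gtower Z TZ" and F: "\<guillemotleft>F :\<^bsub>C\<^esub> X \<rightarrow> Y\<guillemotright>" and G: "\<guillemotleft>G :\<^bsub>C\<^esub> Y \<rightarrow> Z\<guillemotright>"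
    and D: "\<And>k. tri (\<gamma> k) (i k) (p k)" and \<gamma>: "\<And>k. \<guillemotleft>\<gamma> k :\<^bsub>C\<^esub> ShO C (-1) (tG TZ k) \<rightarrow> tG TX k\<guillemotright>"
    and eqs: "\<And>k. tri (e k) (q k) (t k)" "\<And>k. \<guillemotleft>e k :\<^bsub>C\<^esub> tH TX k \<rightarrow> tgt (y k)\<guillemotright>" "\<And>k. \<guillemotleft>q k :\<^bsub>C\<^esub> tgt (y k) \<rightarrow> tH TZ k\<guillemotright>"
    and be: "\<And>k. tri (be k) (y k) (x k)" "\<And>k. \<guillemotleft>be k :\<^bsub>C\<^esub> ShO C (-1) (tgt (i (k + 1))) \<rightarrow> tgt (i k)\<guillemotright>"
      "\<And>k. be k \<odot> ash C (-1) (i (k + 1)) = i k \<odot> tbe TX k" "\<And>k. p k \<odot> be k = tbe TZ k \<odot> ash C (-1) (p (k + 1))"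
    and P_def: "\<And>k a f b. P k (a, f, b) \<longleftrightarrow> level (ShO C k Y) a f b \<and> tgt f = tgt (i (k + 1)) \<and>
      b \<odot> i (k + 1) = ash C (k + 1) F \<odot> tb TX k \<and> tb TZ k \<odot> p (k + 1) = ash C (k + 1) G \<odot> b"
    and x: "P (k - 1) (a0, f0, b0)"
  shows "\<exists>a1 f1 al d. P k (a1, f1, ash C 1 (b0 \<odot> be k)) \<and>
    tlink a1 f1 (ash C 1 (b0 \<odot> be k)) a0 f0 b0 al (be k) (y k \<odot> f0) d (y k) \<and> x k = \<ominus> (f1 \<odot> d)"
proof -
  have P1: "level (ShO C (k - 1) Y) a0 f0 b0" "tgt f0 = tgt (i k)" "b0 \<odot> i k = ash C k F \<odot> tb TX (k - 1)"
    "tb TZ (k - 1) \<odot> p k = ash C k G \<odot> b0"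
    using x unfolding P_def by simp_all
  note L = levelD[OF P1(1)]
  have iD: "arr C (i k)" "src (i k) = tG TX k" "tgt (i k) \<in> Obj C" "arr C (p k)" "src (p k) = tgt (i k)" "tgt (p k) = tG TZ k" for k
    using triD[OF D[of k]] \<gamma>[of k] gtowerD(7)[OF Z] by simp_all
  have yD: "arr C (y k)" "src (y k) = tgt (i k)" "arr C (x k)" "src (x k) = tgt (y k)" "tgt (x k) = tgt (i (k + 1))"
    "tgt (y k) \<in> Obj C" for k
    using triD[OF be(1)[of k]] be(2)[of k] iD[of "k + 1"] by simp_all
  have Y: "Y \<in> Obj C" using F by blast
  note [simp] = gtower_hom[OF X] gtowerD[OF X] gtower_hom[OF Z] gtowerD[OF Z] F G iD be(2) yD \<gamma> Y
  have a0: "arr C b0" "src b0 = tgt (i k)" "tgt b0 = ShO C k Y" "arr C a0" "src a0 = ShO C (k - 1) Y" "tgt a0 \<in> Obj C"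
    "arr C f0" "src f0 = tgt a0" "tgt f0 = tgt (i k)" using L P1(2) by simp_all
  note [simp] = a0
  have iG: "tgt (i k) \<in> snd w" for k
    using snd_w_extension[OF tri_rotate[OF D[of k]]] by simp
  have H: "tgt (y k) \<in> fst w" for k
    using fst_w_extension[OF eqs(1)[of k]] eqs(2,3)[of k] by simp
  define b1 where "b1 = ash C 1 (b0 \<odot> be k)"
  have b1: "arr C b1" "src b1 = tgt (i (k + 1))" "tgt b1 = ShO C (k + 1) Y" "b0 \<odot> be k = ash C (-1) b1" by (simp_all add: b1_def)
  note [simp] = b1(1-3)
  obtain a1 f1 where t1: "tri a1 f1 b1" using tri_cocone[of b1 "ShO C k Y"] by auto
  note d1 = triD[OF t1]
  have a1: "arr C a1" "src a1 = ShO C k Y" "arr C f1" "src f1 = tgt a1" "tgt f1 = tgt (i (k + 1))"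
  proof -
    have "src a1 = ShO C (-1) (ShO C 1 (src a1))" using d1(7) by simp
    also have "\<dots> = ShO C (-1) (ShO C (k + 1) Y)" using d1(6) b1(3) by simp
    finally show "src a1 = ShO C k Y" by simp
  qed (use d1 in simp_all)
  note [simp] = a1
  have ty: "src (be k) = ShO C (-1) (tgt f1)" "tgt (be k) = tgt f0" "src a0 = ShO C (-1) (src a1)" by simp_all
  obtain al c d where c: "tri al c d" "\<guillemotleft>al :\<^bsub>C\<^esub> ShO C (-1) (tgt a1) \<rightarrow> tgt a0\<guillemotright>" "\<guillemotleft>d :\<^bsub>C\<^esub> tgt (y k) \<rightarrow> tgt a1\<guillemotright>"
    "c = y k \<odot> f0" "d \<odot> y k = a1 \<odot> b0" "x k = \<ominus> (f1 \<odot> d)" "al \<odot> ash C (-1) a1 = a0"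
    by (rule octahedron_ge[OF t1 L(1) be(1)[of k] ty b1(4)])
  have "tgt a1 \<in> fst w"
    using fst_w_extension[OF tri_rotate[OF tri_rotate[OF c(1)]]] c(2,3) H fst_w_shift[OF L(5), of 1] triD[OF c(1)] by simp
  moreover have "tlink a1 f1 b1 a0 f0 b0 al (be k) (y k \<odot> f0) d (y k)"
    unfolding tlink_def using c(1-3,5,7) be(1)[of k] b1(4) unfolding c(4,6) by simp
  moreover have "b1 \<odot> i (k + 1) = ash C (k + 1) F \<odot> tb TX k"
  proof -
    have "b1 \<odot> i (k + 1) = ash C 1 (b0 \<odot> be k \<odot> ash C (-1) (i (k + 1)))" by (simp add: b1_def)
    also have "\<dots> = ash C 1 (b0 \<odot> i k \<odot> tbe TX k)" by (simp only: be(3))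
    also have "\<dots> = ash C 1 (ash C k F \<odot> tb TX (k - 1) \<odot> tbe TX k)"
      using acomp_eq[OF P1(3), of "tbe TX k"] by simp
    also have "\<dots> = ash C (k + 1) F \<odot> tb TX k" by (simp only: gtower_eq(2)[OF X]) simp
    finally show ?thesis .
  qed
  moreover have "tb TZ k \<odot> p (k + 1) = ash C (k + 1) G \<odot> b1"
  proof -
    have "tb TZ k \<odot> p (k + 1) = ash C 1 (ash C (-1) (tb TZ k) \<odot> ash C (-1) (p (k + 1)))" by simp
    also have "\<dots> = ash C 1 (tb TZ (k - 1) \<odot> tbe TZ k \<odot> ash C (-1) (p (k + 1)))"
      using acomp_eq[OF gtower_eq(2)[OF Z, of k], of "ash C (-1) (p (k + 1))"] by simp
    also have "\<dots> = ash C 1 (tb TZ (k - 1) \<odot> p k \<odot> be k)" by (simp only: be(4))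
    also have "\<dots> = ash C 1 (ash C k G \<odot> b0 \<odot> be k)" using acomp_eq[OF P1(4), of "be k"] by simp
    also have "\<dots> = ash C (k + 1) G \<odot> b1" by (simp add: b1_def)
    finally show ?thesis .
  qed
  ultimately have "P k (a1, f1, b1)"
    unfolding P_def level_def using t1 iG by simp
  then show ?thesis using \<open>tlink a1 f1 b1 a0 f0 b0 al (be k) (y k \<odot> f0) d (y k)\<close> c(6) unfolding b1_def by blast
qed

end

section \<open>The tower of the middle term of a distinguished triangle\<close>

context weight_structure
begin

text \<open>Besides level 0, the $3 \<times> 3$ lemma is applied in every degree to the
  \<alpha>-triangles and to the \<beta>-triangles of $X$ and $Z$. Each application gives a sequence
  $X^k -> Y^k -> Z^k$ together with the next structure map for $Y$. The tower takes the
  \<alpha>-version for $k \<le> 0$ and the \<beta>-version for $k > 0$.\<close>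

lemma middle_tower:
  assumes t: "tri F G H" and X: "gtower (src F) TX" and Z: "gtower (tgt G) TZ"
  obtains TY e q t where "gtower (tgt F) TY" "trel TX TY F e" "trel TY TZ G q" "\<And>k. tri (e k) (q k) (t k)"
proof -
  define X' Y Z' where "X' = src F" and "Y = tgt F" and "Z' = tgt G"
  note tD = triD[OF t]
  have F: "\<guillemotleft>F :\<^bsub>C\<^esub> X' \<rightarrow> Y\<guillemotright>" and G: "\<guillemotleft>G :\<^bsub>C\<^esub> Y \<rightarrow> Z'\<guillemotright>" and H: "\<guillemotleft>H :\<^bsub>C\<^esub> Z' \<rightarrow> ShO C 1 X'\<guillemotright>"
    using tD by (simp_all add: X'_def Y_def Z'_def)
  have X: "gtower X' TX" and Z: "gtower Z' TZ" using X Z by (simp_all add: X'_def Z'_def)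
  \<comment> \<open>With the sign $(-1)^k$ the triangle shifted by $k$ is distinguished with first
    map $h^k$; it also gives the relation \<open>hs\<close> between consecutive $h^k$.\<close>
  define h where "h k = sgn_arr k (ash C k (\<ominus> (ash C (-1) H)))" for k
  have tk: "tri (h k) (ash C k F) (ash C k G)" for k
    unfolding h_def by (rule tri_shift[OF tri_rotate_back[OF t]])
  have h: "\<guillemotleft>h k :\<^bsub>C\<^esub> ShO C (k - 1) Z' \<rightarrow> ShO C k X'\<guillemotright>" for k
    using F H unfolding h_def by simp
  have hs: "h (k - 1) = \<ominus> (ash C (-1) (h k))" for k
    using H unfolding h_def by (simp add: sgn_arr_suc ash_sgn_arr)
  obtain \<delta> where \<delta>: "\<And>k. \<guillemotleft>\<delta> k :\<^bsub>C\<^esub> ShO C (-1) (tL TZ k) \<rightarrow> tL TX k\<guillemotright>" "\<And>k. ta TX k \<odot> h k = \<delta> k \<odot> ash C (-1) (ta TZ k)"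
    "\<And>k. tal TX k \<odot> \<ominus> (ash C (-1) (\<delta> k)) = \<delta> (k - 1) \<odot> ash C (-1) (tal TZ k)"
    by (rule connecting_le[OF X Z, of h, OF h hs]) blast
  obtain \<gamma> where \<gamma>: "\<And>k. \<guillemotleft>\<gamma> k :\<^bsub>C\<^esub> ShO C (-1) (tG TZ k) \<rightarrow> tG TX k\<guillemotright>" "\<And>k. h k \<odot> ash C (-1) (tb TZ (k - 1)) = tb TX (k - 1) \<odot> \<gamma> k"
    "\<And>k. tbe TX k \<odot> \<ominus> (ash C (-1) (\<gamma> (k + 1))) = \<gamma> k \<odot> ash C (-1) (tbe TZ k)"
    by (rule connecting_ge[OF X Z, of h, OF h hs]) blast
  note [simp] = gtower_hom[OF X] gtowerD[OF X] gtower_hom[OF Z] gtowerD[OF Z] F G h \<delta>(1) \<gamma>(1)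
  have "\<exists>i p. tri (\<delta> k) i p" for k using tri_cone[of "\<delta> k"] by simp
  then obtain iL pL where L: "\<And>k. tri (\<delta> k) (iL k) (pL k)" by metis
  have LD: "arr C (iL k)" "src (iL k) = tL TX k" "tgt (iL k) \<in> Obj C" "arr C (pL k)" "src (pL k) = tgt (iL k)" "tgt (pL k) = tL TZ k" for k
    using triD[OF L[of k]] by simp_all
  note [simp] = LD
  have "\<exists>al c d e q t. tri al c d \<and> tri e q t \<and>
    \<guillemotleft>al :\<^bsub>C\<^esub> ShO C (-1) (tgt (iL k)) \<rightarrow> tgt (iL (k - 1))\<guillemotright> \<and> \<guillemotleft>e :\<^bsub>C\<^esub> tH TX k \<rightarrow> tgt c\<guillemotright> \<and> \<guillemotleft>q :\<^bsub>C\<^esub> tgt c \<rightarrow> tH TZ k\<guillemotright> \<and>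
    al \<odot> ash C (-1) (iL k) = iL (k - 1) \<odot> tal TX k \<and> pL (k - 1) \<odot> al = tal TZ k \<odot> ash C (-1) (pL k) \<and>
    e \<odot> tc TX k = c \<odot> iL (k - 1) \<and> d \<odot> e = iL k \<odot> td TX k \<and>
    q \<odot> c = tc TZ k \<odot> pL (k - 1) \<and> td TZ k \<odot> q = pL k \<odot> d" for k
  proof -
    have ty: "tgt (\<ominus> (ash C (-1) (\<delta> k))) = src (tal TX k)" "src (\<ominus> (ash C (-1) (\<delta> k))) = ShO C (-2) (ShO C 1 (src (tal TZ k)))"
      "src (\<delta> (k - 1)) = ShO C (-1) (tgt (tal TZ k))" "tgt (\<delta> (k - 1)) = tgt (tal TX k)" by simp_all
    show ?thesis
      by (rule three_by_three[OF gtower_tri(2)[OF X, of k] gtower_tri(2)[OF Z, of k] tri_shift_m1[OF L[of k]] L[of "k - 1"] ty \<delta>(3)])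
        (simp, blast)
  qed
  then obtain alL cL dL eL qL tL' where
    LL: "\<And>k. tri (alL k) (cL k) (dL k)" "\<And>k. tri (eL k) (qL k) (tL' k)"
      "\<And>k. \<guillemotleft>alL k :\<^bsub>C\<^esub> ShO C (-1) (tgt (iL k)) \<rightarrow> tgt (iL (k - 1))\<guillemotright>" "\<And>k. \<guillemotleft>eL k :\<^bsub>C\<^esub> tH TX k \<rightarrow> tgt (cL k)\<guillemotright>"
      "\<And>k. \<guillemotleft>qL k :\<^bsub>C\<^esub> tgt (cL k) \<rightarrow> tH TZ k\<guillemotright>"
      "\<And>k. alL k \<odot> ash C (-1) (iL k) = iL (k - 1) \<odot> tal TX k" "\<And>k. pL (k - 1) \<odot> alL k = tal TZ k \<odot> ash C (-1) (pL k)"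
      "\<And>k. eL k \<odot> tc TX k = cL k \<odot> iL (k - 1)" "\<And>k. dL k \<odot> eL k = iL k \<odot> td TX k"
      "\<And>k. qL k \<odot> cL k = tc TZ k \<odot> pL (k - 1)" "\<And>k. td TZ k \<odot> qL k = pL k \<odot> dL k" by metis
  have ty0: "tgt (h 0) = src (ta TX 0)" "src (h 0) = ShO C (-2) (ShO C 1 (src (ta TZ 0)))"
    "src (\<delta> 0) = ShO C (-1) (tgt (ta TZ 0))" "tgt (\<delta> 0) = tgt (ta TX 0)" using h[of 0] by simp_all
  \<comment> \<open>Level 0: the square relating $h^0$ to \<delta>^0 through the weight
    decompositions of $Z$ and $X$. The cones are $Y$, the cone of \<delta>^0 as future $Y^{w<=0}$,
    and the future $Y^{w>=1}$.\<close>
  obtain a0 f0 b0 i0 p0 t0 where z: "tri a0 f0 b0" "tri i0 p0 t0" "\<guillemotleft>a0 :\<^bsub>C\<^esub> tgt (ash C 0 F) \<rightarrow> tgt (iL 0)\<guillemotright>"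
     "\<guillemotleft>i0 :\<^bsub>C\<^esub> tgt (tf TX 0) \<rightarrow> tgt f0\<guillemotright>" "\<guillemotleft>p0 :\<^bsub>C\<^esub> tgt f0 \<rightarrow> tgt (tf TZ 0)\<guillemotright>"
    "a0 \<odot> ash C 0 F = iL 0 \<odot> ta TX 0" "pL 0 \<odot> a0 = ta TZ 0 \<odot> ash C 0 G" "i0 \<odot> tf TX 0 = f0 \<odot> iL 0" "b0 \<odot> i0 = ash C 1 (ash C 0 F) \<odot> tb TX 0"
    "p0 \<odot> f0 = tf TZ 0 \<odot> pL 0" "tb TZ 0 \<odot> p0 = ash C 1 (ash C 0 G) \<odot> b0" "ash C 1 (tb TX 0) \<odot> t0 = ash C 2 (h 0) \<odot> tb TZ 0"
    by (rule three_by_three[OF gtower_tri(1)[OF X, of 0] gtower_tri(1)[OF Z, of 0] tk[of 0] L[of 0] ty0 \<delta>(2)])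
  have z4: "\<guillemotleft>i0 :\<^bsub>C\<^esub> tG TX 1 \<rightarrow> tgt f0\<guillemotright>" "\<guillemotleft>p0 :\<^bsub>C\<^esub> tgt f0 \<rightarrow> tG TZ 1\<guillemotright>" "\<guillemotleft>a0 :\<^bsub>C\<^esub> Y \<rightarrow> tgt (iL 0)\<guillemotright>"
    using z(3-5) gtower_hom(2)[OF X, of 0] gtower_hom(2)[OF Z, of 0] by simp_all
  have t0: "\<guillemotleft>t0 :\<^bsub>C\<^esub> tG TZ 1 \<rightarrow> ShO C 1 (tG TX 1)\<guillemotright>" using triD[OF z(2)] z4 by simp
  \<comment> \<open>Hence \<open>i0\<close> and \<open>p0\<close> may serve as the cone of
    \<gamma>^1. Level 0 then belongs to both families, and the construction downwards and the one
    upwards start from the same data.\<close>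
  have "\<gamma> 1 = \<ominus> (ash C (-1) t0)"
  proof (rule connecting_ge_unique[OF X Z \<gamma>(1)])
    have "tb TX 0 \<odot> ash C (-1) t0 = ash C (-1) (ash C 1 (tb TX 0) \<odot> t0)" using t0 gtower_hom[OF X, of 0] by simp
    also have "\<dots> = ash C (-1) (ash C 2 (h 0) \<odot> tb TZ 0)" by (simp only: z(12))
    also have "\<dots> = ash C 1 (h 0) \<odot> ash C (-1) (tb TZ 0)" using gtower_hom[OF Z, of 0] h[of 0] by simp
    also have "\<dots> = \<ominus> (tb TX 0 \<odot> \<gamma> 1)" using hs[of 1] \<gamma>(2)[of 1] h[of 1] gtower_hom[OF Z, of 0] by simp
    finally show "tb TX (1 - 1) \<odot> \<gamma> 1 = tb TX (1 - 1) \<odot> \<ominus> (ash C (-1) t0)"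
      using t0 gtower_hom[OF X, of 0] \<gamma>(1)[of 1] by simp
  qed (use t0 in simp)
  then have "tri (\<gamma> 1) i0 p0" using tri_rotate_back[OF z(2)] by simp
  then have "\<exists>i p. tri (\<gamma> k) i p \<and> (k = 1 \<longrightarrow> i = i0 \<and> p = p0)" for k using tri_cone[of "\<gamma> k"] by (cases "k = 1") auto
  then obtain iG pG where GG: "\<And>k. tri (\<gamma> k) (iG k) (pG k)" "iG 1 = i0" "pG 1 = p0" by metis
  have GD: "arr C (iG k)" "src (iG k) = tG TX k" "tgt (iG k) \<in> Obj C" "arr C (pG k)" "src (pG k) = tgt (iG k)" "tgt (pG k) = tG TZ k" for k
    using triD[OF GG(1)[of k]] by simp_all
  note [simp] = GD
  have "\<exists>be y x e q t. tri be y x \<and> tri e q t \<and>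
    \<guillemotleft>be :\<^bsub>C\<^esub> ShO C (-1) (tgt (iG (k + 1))) \<rightarrow> tgt (iG k)\<guillemotright> \<and> \<guillemotleft>e :\<^bsub>C\<^esub> tH TX k \<rightarrow> tgt y\<guillemotright> \<and> \<guillemotleft>q :\<^bsub>C\<^esub> tgt y \<rightarrow> tH TZ k\<guillemotright> \<and>
    be \<odot> ash C (-1) (iG (k + 1)) = iG k \<odot> tbe TX k \<and> pG k \<odot> be = tbe TZ k \<odot> ash C (-1) (pG (k + 1)) \<and>
    e \<odot> ty TX k = y \<odot> iG k \<and> x \<odot> e = iG (k + 1) \<odot> \<ominus> (tf TX k \<odot> td TX k) \<and>
    q \<odot> y = ty TZ k \<odot> pG k \<and> \<ominus> (tf TZ k \<odot> td TZ k) \<odot> q = pG (k + 1) \<odot> x" for k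
  proof -
    have ty: "tgt (\<ominus> (ash C (-1) (\<gamma> (k + 1)))) = src (tbe TX k)" "src (\<ominus> (ash C (-1) (\<gamma> (k + 1)))) = ShO C (-2) (ShO C 1 (src (tbe TZ k)))"
      "src (\<gamma> k) = ShO C (-1) (tgt (tbe TZ k))" "tgt (\<gamma> k) = tgt (tbe TX k)" by simp_all
    have s: "ash C 1 (ash C (-1) (iG (k + 1))) = iG (k + 1)" "ash C 1 (ash C (-1) (pG (k + 1))) = pG (k + 1)"
      "tgt (ash C (-1) (iG (k + 1))) = ShO C (-1) (tgt (iG (k + 1)))" "tgt (ty TX k) = tH TX k" "tgt (ty TZ k) = tH TZ k" by simp_all
    show ?thesis
      by (rule three_by_three[OF gtower_tri(3)[OF X, of k] gtower_tri(3)[OF Z, of k] tri_shift_m1[OF GG(1)[of "k + 1"]] GG(1)[of k] ty \<gamma>(3), unfolded s])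
        blast
  qed
  then obtain beG yG xG eG qG tG' where
    LG: "\<And>k. tri (beG k) (yG k) (xG k)" "\<And>k. tri (eG k) (qG k) (tG' k)"
    "\<And>k. \<guillemotleft>beG k :\<^bsub>C\<^esub> ShO C (-1) (tgt (iG (k + 1))) \<rightarrow> tgt (iG k)\<guillemotright>" "\<And>k. \<guillemotleft>eG k :\<^bsub>C\<^esub> tH TX k \<rightarrow> tgt (yG k)\<guillemotright>" "\<And>k. \<guillemotleft>qG k :\<^bsub>C\<^esub> tgt (yG k) \<rightarrow> tH TZ k\<guillemotright>"
    "\<And>k. beG k \<odot> ash C (-1) (iG (k + 1)) = iG k \<odot> tbe TX k" "\<And>k. pG k \<odot> beG k = tbe TZ k \<odot> ash C (-1) (pG (k + 1))"
    "\<And>k. eG k \<odot> ty TX k = yG k \<odot> iG k" "\<And>k. xG k \<odot> eG k = iG (k + 1) \<odot> \<ominus> (tf TX k \<odot> td TX k)"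
    "\<And>k. qG k \<odot> yG k = ty TZ k \<odot> pG k" "\<And>k. \<ominus> (tf TZ k \<odot> td TZ k) \<odot> qG k = pG (k + 1) \<odot> xG k" by metis
  define PL where "PL k v = (case v of (a, f, b) \<Rightarrow> level (ShO C k Y) a f b \<and> tgt a = tgt (iL k) \<and>
      iL k \<odot> ta TX k = a \<odot> ash C k F \<and> pL k \<odot> a = ta TZ k \<odot> ash C k G)" for k v
  define PG where "PG k v = (case v of (a, f, b) \<Rightarrow> level (ShO C k Y) a f b \<and> tgt f = tgt (iG (k + 1)) \<and>
      b \<odot> iG (k + 1) = ash C (k + 1) F \<odot> tb TX k \<and> tb TZ k \<odot> pG (k + 1) = ash C (k + 1) G \<odot> b)" for k v
  have PL: "PL k (a, f, b) \<longleftrightarrow> level (ShO C k Y) a f b \<and> tgt a = tgt (iL k) \<and>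
      iL k \<odot> ta TX k = a \<odot> ash C k F \<and> pL k \<odot> a = ta TZ k \<odot> ash C k G" for k a f b by (simp add: PL_def)
  have PG: "PG k (a, f, b) \<longleftrightarrow> level (ShO C k Y) a f b \<and> tgt f = tgt (iG (k + 1)) \<and>
      b \<odot> iG (k + 1) = ash C (k + 1) F \<odot> tb TX k \<and> tb TZ k \<odot> pG (k + 1) = ash C (k + 1) G \<odot> b" for k a f b by (simp add: PG_def)
  have lv0: "level (ShO C 0 Y) a0 f0 b0"
  proof -
    have "tgt a0 \<in> fst w" using fst_w_extension[OF tri_rotate[OF L[of 0]]] z4 by simp
    moreover have "tgt f0 \<in> snd w" using snd_w_extension[OF z(2)] z4 by simp
    ultimately show ?thesis using z(1) z4 F by (simp add: level_def)
  qed
  have PL0: "PL 0 (a0, f0, b0)" using lv0 z(6,7) z4 by (simp add: PL)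
  have PG0: "PG 0 (a0, f0, b0)" using lv0 z(9,11) z4 GG(2,3) by (simp add: PG)
  define QL where "QL n v v' = (case v of (a1, f1, b1) \<Rightarrow> case v' of (a0, f0, b0) \<Rightarrow>
    \<exists>be y. tlink a1 f1 b1 a0 f0 b0 (alL (- int n)) be (cL (- int n)) (dL (- int n)) y)" for n v v'
  define QG where "QG n v v' = (case v of (a0, f0, b0) \<Rightarrow> case v' of (a1, f1, b1) \<Rightarrow>
    \<exists>al d. tlink a1 f1 b1 a0 f0 b0 al (beG (int n + 1)) (yG (int n + 1) \<odot> f0) d (yG (int n + 1)) \<and> xG (int n + 1) = \<ominus> (f1 \<odot> d))" for n v v'
  \<comment> \<open>Dependent choice in two directions: \<open>xs\<close> runs through the levels
    $-n$ and the later sequence \<open>zs\<close> through the levels $n$, both starting at level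
    0.\<close>
  have "\<exists>xs. \<forall>n. (PL (- int n) (xs n) \<and> (n = 0 \<longrightarrow> xs n = (a0, f0, b0))) \<and> QL n (xs n) (xs (Suc n))"
  proof (rule dependent_nat_choice)
    show "\<exists>x. PL (- int 0) x \<and> (0 = 0 \<longrightarrow> x = (a0, f0, b0))" using PL0 by auto
    fix v n assume v: "PL (- int n) v \<and> (n = 0 \<longrightarrow> v = (a0, f0, b0))"
    obtain a1 f1 b1 where v': "v = (a1, f1, b1)" by (cases v)
    from middle_levels_le[OF X Z F G L \<delta>(1) LL(2,4,5) LL(1,3,6,7) PL, of "- int n" a1 f1 b1] v v'
    obtain a' f' b' be y where *: "PL (- int n - 1) (a', f', b')" "tlink a1 f1 b1 a' f' b' (alL (- int n)) be (cL (- int n)) (dL (- int n)) y" by blast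
    have "- int (Suc n) = - int n - 1" by simp
    then have "PL (- int (Suc n)) (a', f', b')" using *(1) by (simp only:)
    moreover have "QL n v (a', f', b')" using *(2) unfolding QL_def v' by auto
    ultimately show "\<exists>y. (PL (- int (Suc n)) y \<and> (Suc n = 0 \<longrightarrow> y = (a0, f0, b0))) \<and> QL n v y" by blast
  qed
  then obtain xs where xs: "\<And>n. PL (- int n) (xs n)" "xs 0 = (a0, f0, b0)" "\<And>n. QL n (xs n) (xs (Suc n))" by blast
  have "\<exists>xs. \<forall>n. (PG (int n) (xs n) \<and> (n = 0 \<longrightarrow> xs n = (a0, f0, b0))) \<and> QG n (xs n) (xs (Suc n))"
  proof (rule dependent_nat_choice)
    show "\<exists>x. PG (int 0) x \<and> (0 = 0 \<longrightarrow> x = (a0, f0, b0))" using PG0 by auto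
    fix v n assume v: "PG (int n) v \<and> (n = 0 \<longrightarrow> v = (a0, f0, b0))"
    obtain a1 f1 b1 where v': "v = (a1, f1, b1)" by (cases v)
    have v1: "PG (int n + 1 - 1) (a1, f1, b1)" using v v' by simp
    from middle_levels_ge[OF X Z F G GG(1) \<gamma>(1) LG(2,4,5) LG(1,3,6,7) PG v1]
    obtain a' f' b' al d where *: "PG (int n + 1) (a', f', b')"
       "tlink a' f' b' a1 f1 b1 al (beG (int n + 1)) (yG (int n + 1) \<odot> f1) d (yG (int n + 1)) \<and> xG (int n + 1) = \<ominus> (f' \<odot> d)" by blast
    have "int (Suc n) = int n + 1" by simp
    then have "PG (int (Suc n)) (a', f', b')" using *(1) by (simp only:)
    moreover have "QG n v (a', f', b')" using *(2) unfolding QG_def v' by auto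
    ultimately show "\<exists>y. (PG (int (Suc n)) y \<and> (Suc n = 0 \<longrightarrow> y = (a0, f0, b0))) \<and> QG n v y" by blast
  qed
  then obtain zs where zs: "\<And>n. PG (int n) (zs n)" "zs 0 = (a0, f0, b0)" "\<And>n. QG n (zs n) (zs (Suc n))" by blast
  define lv where "lv k = (if k \<le> 0 then xs (nat (- k)) else zs (nat k))" for k
  define a f b where "a k = fst (lv k)" and "f k = fst (snd (lv k))" and "b k = snd (snd (lv k))" for k
  have lv: "lv k = (a k, f k, b k)" for k by (simp add: a_def f_def b_def)
  have PLk: "PL k (a k, f k, b k)" if "k \<le> 0" for k
    using xs(1)[of "nat (- k)"] that unfolding lv[symmetric] by (simp add: lv_def)
  have PGk: "PG k (a k, f k, b k)" if "0 \<le> k" for k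
    using zs(1)[of "nat k"] xs(2) zs(2) that unfolding lv[symmetric] by (cases "k = 0") (simp_all add: lv_def)
  have level: "level (ShO C k Y) (a k) (f k) (b k)" for k
    using PLk[of k] PGk[of k] by (cases "k \<le> 0") (simp_all add: PL PG)
  note lvD = levelD[OF level]
  have ar: "arr C (a k)" "src (a k) = ShO C k Y" "tgt (a k) \<in> Obj C" "arr C (f k)" "src (f k) = tgt (a k)" "tgt (f k) \<in> Obj C"
    "arr C (b k)" "src (b k) = tgt (f k)" "tgt (b k) = ShO C (k + 1) Y" for k
    using lvD[of k] F by simp_all
  note [simp] = ar
  have link_le: "\<exists>be y. tlink (a k) (f k) (b k) (a (k - 1)) (f (k - 1)) (b (k - 1)) (alL k) be (cL k) (dL k) y" if "k \<le> 0" for k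
  proof -
    have "nat (- (k - 1)) = Suc (nat (- k))" using that by simp
    then have "xs (Suc (nat (- k))) = lv (k - 1)" "xs (nat (- k)) = lv k" using that by (simp_all add: lv_def)
    then have "QL (nat (- k)) (lv k) (lv (k - 1))" using xs(3)[of "nat (- k)"] by simp
    then show ?thesis using that unfolding QL_def lv by simp
  qed
  have link_ge: "\<exists>al d. tlink (a k) (f k) (b k) (a (k - 1)) (f (k - 1)) (b (k - 1)) al (beG k) (yG k \<odot> f (k - 1)) d (yG k) \<and>
    xG k = \<ominus> (f k \<odot> d)" if "0 < k" for k
  proof -
    have "zs (nat (k - 1)) = lv (k - 1)" "zs (Suc (nat (k - 1))) = lv k" using that xs(2) zs(2) by (auto simp: lv_def Suc_nat_eq_nat_zadd1)
    then have "QG (nat (k - 1)) (lv (k - 1)) (lv k)" using zs(3)[of "nat (k - 1)"] by simp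
    then show ?thesis using that unfolding QG_def lv by simp
  qed
  \<comment> \<open>For $k \<le> 0$ the map from $X^{w<=k}$ is the one into the cone of \<delta>^k;
    above 0 any completion compatible with the cone of \<gamma>^{k+1} is taken. At $k = 0$ both
    properties hold, which is what joins heart term 1 to level 0.\<close>
  have "\<exists>\<rho>. \<guillemotleft>\<rho> :\<^bsub>C\<^esub> tL TX k \<rightarrow> tgt (a k)\<guillemotright> \<and> (k \<le> 0 \<longrightarrow> \<rho> = iL k) \<and> (0 \<le> k \<longrightarrow> iG (k + 1) \<odot> tf TX k = f k \<odot> \<rho>)" for k
  proof (cases "k \<le> 0")
    case True
    have "i0 \<odot> tf TX 0 = f 0 \<odot> iL 0" using z(8) xs(2) by (simp add: f_def lv_def)
    then show ?thesis using True PLk[OF True] GG(2) by (intro exI[of _ "iL k"]) (auto simp: PL)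
  next
    case False
    then have p: "level (ShO C k Y) (a k) (f k) (b k)" "tgt (f k) = tgt (iG (k + 1))"
      "b k \<odot> iG (k + 1) = ash C (k + 1) F \<odot> tb TX k" using PGk[of k] by (simp_all add: PG)
    from tri_fill2[OF gtower_tri(1)[OF X, of k] lvD(1)[of k], of "ash C k F" "iG (k + 1)"] p False show ?thesis by auto
  qed
  then obtain \<rho> where \<rho>: "\<And>k. \<guillemotleft>\<rho> k :\<^bsub>C\<^esub> tL TX k \<rightarrow> tgt (a k)\<guillemotright>" "\<And>k. k \<le> 0 \<Longrightarrow> \<rho> k = iL k" 
    "\<And>k. 0 \<le> k \<Longrightarrow> iG (k + 1) \<odot> tf TX k = f k \<odot> \<rho> k" by metis
  have "\<exists>\<mu>. \<guillemotleft>\<mu> :\<^bsub>C\<^esub> tgt (a k) \<rightarrow> tL TZ k\<guillemotright> \<and> (k \<le> 0 \<longrightarrow> \<mu> = pL k) \<and> (0 \<le> k \<longrightarrow> pG (k + 1) \<odot> f k = tf TZ k \<odot> \<mu>)" for k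
  proof (cases "k \<le> 0")
    case True
    have "p0 \<odot> f 0 = tf TZ 0 \<odot> pL 0" using z(10) xs(2) by (simp add: f_def lv_def)
    then show ?thesis using True PLk[OF True] GG(3) by (intro exI[of _ "pL k"]) (auto simp: PL)
  next
    case False
    then have p: "level (ShO C k Y) (a k) (f k) (b k)" "tgt (f k) = tgt (iG (k + 1))"
      "tb TZ k \<odot> pG (k + 1) = ash C (k + 1) G \<odot> b k" using PGk[of k] by (simp_all add: PG)
    from tri_fill2[OF lvD(1)[of k] gtower_tri(1)[OF Z, of k], of "ash C k G" "pG (k + 1)"] p False show ?thesis by auto
  qed
  then obtain \<mu> where \<mu>: "\<And>k. \<guillemotleft>\<mu> k :\<^bsub>C\<^esub> tgt (a k) \<rightarrow> tL TZ k\<guillemotright>" "\<And>k. k \<le> 0 \<Longrightarrow> \<mu> k = pL k"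
    "\<And>k. 0 \<le> k \<Longrightarrow> pG (k + 1) \<odot> f k = tf TZ k \<odot> \<mu> k" by metis
  note [simp] = \<rho>(1) \<mu>(1)
  \<comment> \<open>For $k \<le> 0$ the relations with $d$ hold already before $f$ is applied. For
    $k > 0$ they are read off the third maps $-f d$ of the \<beta>-triangles, hence hold only after
    $f$.\<close>
  have "\<exists>al be c d y e q t. tlink (a k) (f k) (b k) (a (k - 1)) (f (k - 1)) (b (k - 1)) al be c d y \<and>
    \<guillemotleft>e :\<^bsub>C\<^esub> tH TX k \<rightarrow> tgt c\<guillemotright> \<and> \<guillemotleft>q :\<^bsub>C\<^esub> tgt c \<rightarrow> tH TZ k\<guillemotright> \<and> tri e q t \<and>
    e \<odot> tc TX k = c \<odot> \<rho> (k - 1) \<and> f k \<odot> d \<odot> e = f k \<odot> \<rho> k \<odot> td TX k \<and>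
    q \<odot> c = tc TZ k \<odot> \<mu> (k - 1) \<and> tf TZ k \<odot> td TZ k \<odot> q = tf TZ k \<odot> \<mu> k \<odot> d \<and>
    d \<odot> e \<odot> ty TX k = a k \<odot> ash C k F \<odot> tb TX (k - 1) \<and> td TZ k \<odot> q \<odot> y = ta TZ k \<odot> ash C k G \<odot> b (k - 1)" for k
  proof (cases "k \<le> 0")
    case True
    from link_le[OF True] obtain be y where l: "tlink (a k) (f k) (b k) (a (k - 1)) (f (k - 1)) (b (k - 1)) (alL k) be (cL k) (dL k) y" by blast
    then have l': "\<guillemotleft>y :\<^bsub>C\<^esub> tgt (f (k - 1)) \<rightarrow> tgt (cL k)\<guillemotright>" "\<guillemotleft>dL k :\<^bsub>C\<^esub> tgt (cL k) \<rightarrow> tgt (a k)\<guillemotright>" "dL k \<odot> y = a k \<odot> b (k - 1)"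
      unfolding tlink_def by blast+
    have p: "tgt (a k) = tgt (iL k)" "iL k \<odot> ta TX k = a k \<odot> ash C k F" "pL k \<odot> a k = ta TZ k \<odot> ash C k G"
      using PLk[OF True] by (simp_all add: PL)
    note [simp] = LL(4,5) l'(1,2)
    have "dL k \<odot> eL k \<odot> ty TX k = iL k \<odot> ta TX k \<odot> tb TX (k - 1)"
      using acomp_eq[OF LL(9)[of k], of "ty TX k"] p(1) by (simp add: gtower_eq(4)[OF X])
    also have "\<dots> = a k \<odot> ash C k F \<odot> tb TX (k - 1)" using acomp_eq[OF p(2), of "tb TX (k - 1)"] by simp
    finally have 1: "dL k \<odot> eL k \<odot> ty TX k = a k \<odot> ash C k F \<odot> tb TX (k - 1)" .
    have "td TZ k \<odot> qL k \<odot> y = pL k \<odot> a k \<odot> b (k - 1)"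
      using acomp_eq[OF LL(11)[of k], of y] l'(3) p(1) by simp
    also have "\<dots> = ta TZ k \<odot> ash C k G \<odot> b (k - 1)" using acomp_eq[OF p(3), of "b (k - 1)"] p(1) by simp
    finally have 2: "td TZ k \<odot> qL k \<odot> y = ta TZ k \<odot> ash C k G \<odot> b (k - 1)" .
    have 3: "f k \<odot> dL k \<odot> eL k = f k \<odot> \<rho> k \<odot> td TX k" "tf TZ k \<odot> td TZ k \<odot> qL k = tf TZ k \<odot> \<mu> k \<odot> dL k"
      using True by (simp_all only: \<rho>(2) \<mu>(2) LL(9,11))
    have 4: "eL k \<odot> tc TX k = cL k \<odot> \<rho> (k - 1)" "qL k \<odot> cL k = tc TZ k \<odot> \<mu> (k - 1)"
      using True \<rho>(2)[of "k - 1"] \<mu>(2)[of "k - 1"] LL(8,10) by simp_all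
    show ?thesis using l LL(2,4,5)[of k] 1 2 3 4 by blast
  next
    case False
    then have k: "0 < k" "0 \<le> k - 1" by simp_all
    from link_ge[OF k(1)] obtain al d where l: "tlink (a k) (f k) (b k) (a (k - 1)) (f (k - 1)) (b (k - 1)) al (beG k) (yG k \<odot> f (k - 1)) d (yG k)"
      "xG k = \<ominus> (f k \<odot> d)" by blast
    then have l': "\<guillemotleft>yG k :\<^bsub>C\<^esub> tgt (f (k - 1)) \<rightarrow> tgt (yG k)\<guillemotright>" "\<guillemotleft>d :\<^bsub>C\<^esub> tgt (yG k) \<rightarrow> tgt (a k)\<guillemotright>" "d \<odot> yG k = a k \<odot> b (k - 1)"
      unfolding tlink_def by simp_all
    have yG: "arr C (yG k)" "src (yG k) = tgt (f (k - 1))" "tgt (yG k) \<in> Obj C" using l'(1) by auto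
    have p: "tgt (f (k - 1)) = tgt (iG k)" "b (k - 1) \<odot> iG k = ash C k F \<odot> tb TX (k - 1)"
      "tb TZ (k - 1) \<odot> pG k = ash C k G \<odot> b (k - 1)" using PGk[OF k(2)] by (simp_all add: PG)
    have p': "tgt (f k) = tgt (iG (k + 1))" using PGk[of k] k(1) by (simp add: PG)
    have r: "iG (k + 1) \<odot> tf TX k = f k \<odot> \<rho> k" "pG (k + 1) \<odot> f k = tf TZ k \<odot> \<mu> k"
      "iG k \<odot> tf TX (k - 1) = f (k - 1) \<odot> \<rho> (k - 1)" "pG k \<odot> f (k - 1) = tf TZ (k - 1) \<odot> \<mu> (k - 1)"
      using \<rho>(3)[of k] \<mu>(3)[of k] \<rho>(3)[of "k - 1"] \<mu>(3)[of "k - 1"] k by simp_all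
    note [simp] = LG(4,5) l'(2) yG
    have 1: "eG k \<odot> tc TX k = (yG k \<odot> f (k - 1)) \<odot> \<rho> (k - 1)"
      using acomp_eq[OF LG(8)[of k], of "tf TX (k - 1)"] r(3) p(1) by (simp add: gtower_eq(3)[OF X])
    have 2: "qG k \<odot> yG k \<odot> f (k - 1) = tc TZ k \<odot> \<mu> (k - 1)"
      using acomp_eq[OF LG(10)[of k], of "f (k - 1)"] r(4) p(1) by (simp add: gtower_eq(3)[OF Z])
    have "\<ominus> (f k \<odot> d \<odot> eG k) = \<ominus> (iG (k + 1) \<odot> tf TX k \<odot> td TX k)" using LG(9)[of k] l(2) p' by simp
    then have 3: "f k \<odot> d \<odot> eG k = f k \<odot> \<rho> k \<odot> td TX k"
      using acomp_eq[OF r(1), of "td TX k"] p' by (simp add: aneg_eq_iff)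
    have "\<ominus> (tf TZ k \<odot> td TZ k \<odot> qG k) = \<ominus> (pG (k + 1) \<odot> f k \<odot> d)" using LG(11)[of k] l(2) p' by simp
    then have 4: "tf TZ k \<odot> td TZ k \<odot> qG k = tf TZ k \<odot> \<mu> k \<odot> d"
      using acomp_eq[OF r(2), of d] p' by (simp add: aneg_eq_iff)
    have 5: "d \<odot> eG k \<odot> ty TX k = a k \<odot> ash C k F \<odot> tb TX (k - 1)"
      using acomp_eq[OF l'(3), of "iG k"] p by (simp add: LG(8))
    have 6: "td TZ k \<odot> qG k \<odot> yG k = ta TZ k \<odot> ash C k G \<odot> b (k - 1)"
      using acomp_eq[OF gtower_eq(4)[OF Z, of k], of "pG k"] p by (simp add: LG(10))
    have 7: "\<guillemotleft>eG k :\<^bsub>C\<^esub> tH TX k \<rightarrow> tgt (yG k \<odot> f (k - 1))\<guillemotright>" "\<guillemotleft>qG k :\<^bsub>C\<^esub> tgt (yG k \<odot> f (k - 1)) \<rightarrow> tH TZ k\<guillemotright>" by simp_all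
    show ?thesis using l(1) LG(2)[of k] 7 1 2 3 4 5 6 by blast
  qed
  then obtain al be c d y e q t where R: "\<And>k. tlink (a k) (f k) (b k) (a (k - 1)) (f (k - 1)) (b (k - 1)) (al k) (be k) (c k) (d k) (y k)"
    "\<And>k. \<guillemotleft>e k :\<^bsub>C\<^esub> tH TX k \<rightarrow> tgt (c k)\<guillemotright>" "\<And>k. \<guillemotleft>q k :\<^bsub>C\<^esub> tgt (c k) \<rightarrow> tH TZ k\<guillemotright>" "\<And>k. tri (e k) (q k) (t k)"
    "\<And>k. e k \<odot> tc TX k = c k \<odot> \<rho> (k - 1)" "\<And>k. f k \<odot> d k \<odot> e k = f k \<odot> \<rho> k \<odot> td TX k"
    "\<And>k. q k \<odot> c k = tc TZ k \<odot> \<mu> (k - 1)" "\<And>k. tf TZ k \<odot> td TZ k \<odot> q k = tf TZ k \<odot> \<mu> k \<odot> d k"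
    "\<And>k. d k \<odot> e k \<odot> ty TX k = a k \<odot> ash C k F \<odot> tb TX (k - 1)" "\<And>k. td TZ k \<odot> q k \<odot> y k = ta TZ k \<odot> ash C k G \<odot> b (k - 1)"
    by metis
  obtain TY where "gtower Y TY" "trel TX TY F e" "trel TY TZ G q"
    by (rule assemble_middle[OF X Z F G level R(1) \<rho>(1) \<mu>(1) R(2-10)])
  then show ?thesis using R(4) unfolding Y_def by (rule that)
qed

end

section \<open>Quotients by ideals of morphisms\<close>

text \<open>Instantiated twice: for null-homotopic maps among chain maps, and for
  \<open>Zideal\<close> in \<open>Kcat\<close>.\<close>

locale mor_quotient = preadditive_category C for C :: "('o, 'm, 'z) shift_cat_scheme" (structure) +
  fixes I :: "'o \<Rightarrow> 'o \<Rightarrow> 'm set"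
  assumes I_subgroup: "\<lbrakk>X \<in> Obj C; Y \<in> Obj C\<rbrakk> \<Longrightarrow> subgroup (I X Y) (hom_group C X Y)"
    and I_comp_left: "\<lbrakk>X \<in> Obj C; Y \<in> Obj C; Z \<in> Obj C; f \<in> I X Y; g \<in> Hom C Y Z\<rbrakk> \<Longrightarrow> g \<cdot> f \<in> I X Z"
    and I_comp_right: "\<lbrakk>X \<in> Obj C; Y \<in> Obj C; Z \<in> Obj C; f \<in> Hom C X Y; g \<in> I Y Z\<rbrakk> \<Longrightarrow> g \<cdot> f \<in> I X Z"
begin

abbreviation "Q \<equiv> quot_cat C I"

definition qa :: "('o, 'm) arrow \<Rightarrow> ('o, 'o \<times> 'o \<times> 'm set) arrow" where
  "qa f = Arrow (src f) (tgt f) (quot_class C I (src f) (tgt f) (mor f))"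

lemma Q_simps [simp]: "Obj Q = Obj C" "Hom Q X Y = quot_class C I X Y ` Hom C X Y" "Ident Q X = quot_class C I X X (Ident C X)"
  "Zer Q X Y = quot_class C I X Y (Zer C X Y)"
  by (simp_all add: quot_cat_def)

lemma normal_I: "\<lbrakk>X \<in> Obj C; Y \<in> Obj C\<rbrakk> \<Longrightarrow> I X Y \<lhd> hom_group C X Y"
  using comm_group.normal_iff_subgroup[OF hom_comm_group] I_subgroup by blast

lemma I_Hom: "\<lbrakk>X \<in> Obj C; Y \<in> Obj C; f \<in> I X Y\<rbrakk> \<Longrightarrow> f \<in> Hom C X Y"
  using subgroup.mem_carrier[OF I_subgroup] by (fastforce simp: hom_group_def)

lemma coset_eq_iff:
  assumes "X \<in> Obj C" "Y \<in> Obj C" "f \<in> Hom C X Y" "g \<in> Hom C X Y"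
  shows "I X Y #>\<^bsub>hom_group C X Y\<^esub> f = I X Y #>\<^bsub>hom_group C X Y\<^esub> g \<longleftrightarrow> (\<exists>n \<in> I X Y. f = n \<boxplus> g)"
proof -
  interpret G: comm_group "hom_group C X Y" using assms by (intro hom_comm_group)
  have sub: "subgroup (I X Y) (hom_group C X Y)" using assms by (intro I_subgroup)
  have c: "f \<in> carrier (hom_group C X Y)" "g \<in> carrier (hom_group C X Y)" using assms by (simp_all add: hom_group_def)
  have "f \<in> I X Y #>\<^bsub>hom_group C X Y\<^esub> g \<longleftrightarrow> (\<exists>n \<in> I X Y. f = n \<boxplus> g)"
    by (auto simp: r_coset_def hom_group_def)
  moreover have "f \<in> I X Y #>\<^bsub>hom_group C X Y\<^esub> g \<longleftrightarrow> I X Y #>\<^bsub>hom_group C X Y\<^esub> f = I X Y #>\<^bsub>hom_group C X Y\<^esub> g"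
    using G.repr_independence[OF _ c(2) sub, of f] G.rcos_self[OF c(1) sub] by auto
  ultimately show ?thesis by simp
qed

lemma qa_selectors [simp]: "src (qa f) = src f" "tgt (qa f) = tgt f"
  by (simp_all add: qa_def)

lemma arr_qa [simp]: "arr C f \<Longrightarrow> arr Q (qa f)"
  by (simp add: arr_def qa_def)

lemma arr_Q_cases: "arr Q x \<Longrightarrow> \<exists>f. arr C f \<and> x = qa f"
proof -
  assume x: "arr Q x"
  then obtain f where "f \<in> Hom C (src x) (tgt x)" "mor x = quot_class C I (src x) (tgt x) f" by (auto simp: arr_def)
  then show ?thesis using x
    by (intro exI[of _ "Arrow (src x) (tgt x) f"]) (auto simp: arr_def qa_def intro: arrow_eqI)
qed

lemma in_hom_Q_cases: "\<guillemotleft>x :\<^bsub>Q\<^esub> X \<rightarrow> Y\<guillemotright> \<Longrightarrow> \<exists>f. \<guillemotleft>f :\<^bsub>C\<^esub> X \<rightarrow> Y\<guillemotright> \<and> x = qa f"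
  using arr_Q_cases[of x] by auto

lemma qa_acomp:
  assumes "arr C f" "arr C g" "src g = tgt f"
  shows "qa g \<odot>\<^bsub>Q\<^esub> qa f = qa (g \<odot> f)"
proof -
  define X Y Z where "X = src f" and "Y = tgt f" and "Z = tgt g"
  have o: "X \<in> Obj C" "Y \<in> Obj C" "Z \<in> Obj C" "mor f \<in> Hom C X Y" "mor g \<in> Hom C Y Z"
    using assms by (auto simp: arr_def X_def Y_def Z_def)
  interpret XZ: comm_group "hom_group C X Z" using o by (intro hom_comm_group)
  have *: "I X Z #>\<^bsub>hom_group C X Z\<^esub> (g' \<cdot> f') = I X Z #>\<^bsub>hom_group C X Z\<^esub> (mor g \<cdot> mor f)"
    if "g' \<in> I Y Z #>\<^bsub>hom_group C Y Z\<^esub> mor g" "f' \<in> I X Y #>\<^bsub>hom_group C X Y\<^esub> mor f" for g' f'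
  proof -
    from that obtain m n where mn: "m \<in> I Y Z" "g' = m \<boxplus> mor g" "n \<in> I X Y" "f' = n \<boxplus> mor f"
      by (auto simp: r_coset_def hom_group_def)
    have h: "m \<in> Hom C Y Z" "n \<in> Hom C X Y" using mn o I_Hom by auto
    define M N where "M = Arrow Y Z m" and "N = Arrow X Y n"
    have MN: "\<guillemotleft>M :\<^bsub>C\<^esub> Y \<rightarrow> Z\<guillemotright>" "\<guillemotleft>N :\<^bsub>C\<^esub> X \<rightarrow> Y\<guillemotright>" using h o by (auto simp: M_def N_def arr_def)
    have fg: "\<guillemotleft>f :\<^bsub>C\<^esub> X \<rightarrow> Y\<guillemotright>" "\<guillemotleft>g :\<^bsub>C\<^esub> Y \<rightarrow> Z\<guillemotright>" using assms by (auto simp: X_def Y_def Z_def arr_def)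
    \<comment> \<open>For other representatives $m + g$ and $n + f$ the composite differs from $g f$
      by $m (n + f) + g n$, an element of the ideal. So the union in the definition of the composite
      is a single coset.\<close>
    have "(M \<oplus> g) \<odot> (N \<oplus> f) = (M \<odot> (N \<oplus> f) \<oplus> g \<odot> N) \<oplus> g \<odot> f"
      using MN fg aplus_left_comm[of "g \<odot> N" "M \<odot> f" "g \<odot> f"] by simp
    from arg_cong[OF this, of mor]
    have eq: "g' \<cdot> f' = ((m \<cdot> f') \<boxplus> (mor g \<cdot> n)) \<boxplus> (mor g \<cdot> mor f)"
      by (simp add: arrow_mor mn M_def N_def)
    have f': "f' \<in> Hom C X Y" using mor_in_Hom[of C "N \<oplus> f" X Y] MN fg o by (simp add: arrow_mor N_def mn)
    have g': "g' \<in> Hom C Y Z" using mor_in_Hom[of C "M \<oplus> g" Y Z] MN fg o by (simp add: arrow_mor M_def mn)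
    have "m \<cdot> f' \<in> I X Z" "mor g \<cdot> n \<in> I X Z" using I_comp_right[OF o(1-3) f' mn(1)] I_comp_left[OF o(1-3) mn(3) o(5)] by auto
    then have "(m \<cdot> f') \<boxplus> (mor g \<cdot> n) \<in> I X Z"
      using subgroup.m_closed[OF I_subgroup[OF o(1,3)]] by (simp add: hom_group_def)
    then show ?thesis
      by (subst coset_eq_iff) (use eq o f' g' comp_in in blast)+
  qed
  have self: "mor g \<in> I Y Z #>\<^bsub>hom_group C Y Z\<^esub> mor g" "mor f \<in> I X Y #>\<^bsub>hom_group C X Y\<^esub> mor f"
    using o group.rcos_self[OF comm_group.axioms(2)[OF hom_comm_group] _ I_subgroup] by (auto simp: hom_group_def)
  have "(\<Union>g'\<in>I Y Z #>\<^bsub>hom_group C Y Z\<^esub> mor g. \<Union>f'\<in>I X Y #>\<^bsub>hom_group C X Y\<^esub> mor f. I X Z #>\<^bsub>hom_group C X Z\<^esub> (g' \<cdot> f'))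
     = I X Z #>\<^bsub>hom_group C X Z\<^esub> (mor g \<cdot> mor f)"
    using * self by blast
  then show ?thesis using assms
    by (simp add: qa_def acomp_def quot_class_def quot_cat_def X_def Y_def Z_def)
qed

lemma qa_aplus:
  assumes "arr C f" "arr C g" "src g = src f" "tgt g = tgt f"
  shows "qa g \<oplus>\<^bsub>Q\<^esub> qa f = qa (g \<oplus> f)"
proof -
  have o: "src f \<in> Obj C" "tgt f \<in> Obj C" "mor f \<in> carrier (hom_group C (src f) (tgt f))" "mor g \<in> carrier (hom_group C (src f) (tgt f))"
    using assms by (auto simp: arr_def hom_group_def)
  show ?thesis using normal.rcos_sum[OF normal_I[OF o(1,2)] o(4,3)] assms
    by (simp add: qa_def aplus_def quot_class_def quot_cat_def hom_group_def)
qed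

lemma qa_aid: "aid Q X = qa (aid C X)"
  by (simp add: aid_def qa_def)

lemma qa_azero: "azero Q X Y = qa (azero C X Y)"
  by (simp add: azero_def qa_def)

lemma qa_eq_iff:
  assumes "arr C f" "arr C g" "src f = src g" "tgt f = tgt g"
  shows "qa f = qa g \<longleftrightarrow> (\<exists>n. arr C n \<and> src n = src g \<and> tgt n = tgt g \<and> mor n \<in> I (src g) (tgt g) \<and> f = n \<oplus> g)"
proof -
  have o: "src g \<in> Obj C" "tgt g \<in> Obj C" "mor f \<in> Hom C (src g) (tgt g)" "mor g \<in> Hom C (src g) (tgt g)"
    using assms by (auto simp: arr_def)
  have "qa f = qa g \<longleftrightarrow> (\<exists>n \<in> I (src g) (tgt g). mor f = n \<boxplus> mor g)"
    using coset_eq_iff[OF o] assms by (simp add: qa_def quot_class_def)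
  also have "\<dots> \<longleftrightarrow> (\<exists>n. arr C n \<and> src n = src g \<and> tgt n = tgt g \<and> mor n \<in> I (src g) (tgt g) \<and> f = n \<oplus> g)" (is "?l \<longleftrightarrow> ?r")
  proof
    assume ?l
    then obtain n where "n \<in> I (src g) (tgt g)" "mor f = n \<boxplus> mor g" by blast
    then show ?r using I_Hom[OF o(1,2)] o assms
      by (intro exI[of _ "Arrow (src g) (tgt g) n"]) (auto simp: arr_def aplus_def intro: arrow_eqI)
  qed (auto simp: arrow_mor)
  finally show ?thesis .
qed

lemma preadditive_Q: "preadditive_category Q"
proof (intro preadditive_category.intro category.intro preadditive_category_axioms.intro)
  show "Ident Q X \<in> Hom Q X X" if "X \<in> Obj Q" for X using that ident_in by auto
  have raw: "Comp Q (mor (qa g)) (mor (qa f)) = mor (qa (g \<odot> f))" if "arr C f" "arr C g" "src g = tgt f" for f g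
    using arg_cong[OF qa_acomp[OF that], of mor] by (simp add: arrow_mor)
  have ex: "\<exists>f'. \<guillemotleft>f' :\<^bsub>C\<^esub> X \<rightarrow> Y\<guillemotright> \<and> f = mor (qa f')" if "X \<in> Obj Q" "Y \<in> Obj Q" "f \<in> Hom Q X Y" for X Y f
    using in_hom_Q_cases[of "Arrow X Y f" X Y] that by (auto simp: arr_def) (metis arrow.sel(3))
  have inn: "mor (qa f) \<in> Hom Q X Y" if "\<guillemotleft>f :\<^bsub>C\<^esub> X \<rightarrow> Y\<guillemotright>" for X Y f using that mor_in_Hom[of Q "qa f" X Y] by simp
  have pl: "Plus Q (mor (qa g)) (mor (qa f)) = mor (qa (g \<oplus> f))" if "arr C f" "arr C g" "src g = src f" "tgt g = tgt f" for f g
    using arg_cong[OF qa_aplus[OF that], of mor] by (simp add: arrow_mor)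
  have idm: "Ident Q X = mor (qa (aid C X))" for X by (simp add: qa_def arrow_mor)
  have zm: "Zer Q X Y = mor (qa (azero C X Y))" for X Y by (simp add: qa_def arrow_mor)
  have cg: "comm_group (hom_group Q X Y)" if XY: "X \<in> Obj Q" "Y \<in> Obj Q" for X Y
  proof (rule comm_groupI)

    fix x y z assume x: "x \<in> carrier (hom_group Q X Y)" and y: "y \<in> carrier (hom_group Q X Y)" and z: "z \<in> carrier (hom_group Q X Y)"
    obtain x1 y1 z1 where e: "\<guillemotleft>x1 :\<^bsub>C\<^esub> X \<rightarrow> Y\<guillemotright>" "x = mor (qa x1)" "\<guillemotleft>y1 :\<^bsub>C\<^esub> X \<rightarrow> Y\<guillemotright>" "y = mor (qa y1)" "\<guillemotleft>z1 :\<^bsub>C\<^esub> X \<rightarrow> Y\<guillemotright>" "z = mor (qa z1)"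
      using ex[OF XY, of x] ex[OF XY, of y] ex[OF XY, of z] x y z by (auto simp: hom_group_def)
    have s: "monoid.mult (hom_group Q X Y) = Plus Q" by (simp add: hom_group_def)
    show "x \<otimes>\<^bsub>hom_group Q X Y\<^esub> y \<in> carrier (hom_group Q X Y)"
      unfolding s e using e(1,3) inn[of "x1 \<oplus> y1" X Y] by (simp add: pl hom_group_def)
    show "x \<otimes>\<^bsub>hom_group Q X Y\<^esub> y \<otimes>\<^bsub>hom_group Q X Y\<^esub> z = x \<otimes>\<^bsub>hom_group Q X Y\<^esub> (y \<otimes>\<^bsub>hom_group Q X Y\<^esub> z)"
      unfolding s e using e(1,3,5) by (simp add: pl)
    show "x \<otimes>\<^bsub>hom_group Q X Y\<^esub> y = y \<otimes>\<^bsub>hom_group Q X Y\<^esub> x"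
      unfolding s e using e(1,3) aplus_comm[of x1 y1] by (simp add: pl)
  next
    have XY': "X \<in> Obj C" "Y \<in> Obj C" using XY by simp_all
    show "\<one>\<^bsub>hom_group Q X Y\<^esub> \<in> carrier (hom_group Q X Y)" using inn[of "azero C X Y" X Y] XY' by (simp add: hom_group_def zm del: Q_simps)
    fix x assume "x \<in> carrier (hom_group Q X Y)"
    then obtain x1 where e: "\<guillemotleft>x1 :\<^bsub>C\<^esub> X \<rightarrow> Y\<guillemotright>" "x = mor (qa x1)" using ex[OF XY, of x] by (auto simp: hom_group_def)
    show "\<one>\<^bsub>hom_group Q X Y\<^esub> \<otimes>\<^bsub>hom_group Q X Y\<^esub> x = x"
      unfolding e(2) using e(1) XY' by (simp add: hom_group_def zm pl del: Q_simps)
    show "\<exists>y\<in>carrier (hom_group Q X Y). y \<otimes>\<^bsub>hom_group Q X Y\<^esub> x = \<one>\<^bsub>hom_group Q X Y\<^esub>"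
    proof
      show "mor (qa (\<ominus> x1)) \<in> carrier (hom_group Q X Y)" using e(1) inn[of "\<ominus> x1" X Y] by (simp add: hom_group_def)
      show "mor (qa (\<ominus> x1)) \<otimes>\<^bsub>hom_group Q X Y\<^esub> x = \<one>\<^bsub>hom_group Q X Y\<^esub>"
        unfolding e(2) using e(1) by (simp add: hom_group_def zm pl del: Q_simps)
    qed
  qed
  fix X Y Z W f g h f' g'
  {
    assume *: "X \<in> Obj Q" "Y \<in> Obj Q" "f \<in> Hom Q X Y"
    obtain f1 where f: "\<guillemotleft>f1 :\<^bsub>C\<^esub> X \<rightarrow> Y\<guillemotright>" "f = mor (qa f1)" using ex * by blast
    show "Comp Q f (Ident Q X) = f" "Comp Q (Ident Q Y) f = f" unfolding f(2) idm using f(1) by (simp_all add: raw)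
    assume *: "Z \<in> Obj Q" "g \<in> Hom Q Y Z"
    obtain g1 where g: "\<guillemotleft>g1 :\<^bsub>C\<^esub> Y \<rightarrow> Z\<guillemotright>" "g = mor (qa g1)" using ex * \<open>Y \<in> Obj Q\<close> by blast
    show "Comp Q g f \<in> Hom Q X Z" unfolding f(2) g(2) using f(1) g(1) inn[of "g1 \<odot> f1" X Z] by (simp add: raw)
    {
      assume *: "W \<in> Obj Q" "h \<in> Hom Q Z W"
      obtain h1 where h: "\<guillemotleft>h1 :\<^bsub>C\<^esub> Z \<rightarrow> W\<guillemotright>" "h = mor (qa h1)" using ex * \<open>Z \<in> Obj Q\<close> by blast
      show "Comp Q (Comp Q h g) f = Comp Q h (Comp Q g f)"
        unfolding f(2) g(2) h(2) using f(1) g(1) h(1) by (simp add: raw)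
    }
    {
      assume *: "f' \<in> Hom Q X Y"
      obtain f2 where f': "\<guillemotleft>f2 :\<^bsub>C\<^esub> X \<rightarrow> Y\<guillemotright>" "f' = mor (qa f2)" using ex[OF _ _ *] \<open>X \<in> Obj Q\<close> \<open>Y \<in> Obj Q\<close> by blast
      show "Comp Q g (Plus Q f f') = Plus Q (Comp Q g f) (Comp Q g f')"
        unfolding f(2) g(2) f'(2) using f(1) g(1) f'(1) by (simp add: raw pl)
    }
    {
      assume *: "g' \<in> Hom Q Y Z"
      obtain g2 where g': "\<guillemotleft>g2 :\<^bsub>C\<^esub> Y \<rightarrow> Z\<guillemotright>" "g' = mor (qa g2)" using ex[OF _ _ *] \<open>Y \<in> Obj Q\<close> \<open>Z \<in> Obj Q\<close> by blast
      show "Comp Q (Plus Q g g') f = Plus Q (Comp Q g f) (Comp Q g' f)"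
        unfolding f(2) g(2) g'(2) using f(1) g(1) g'(1) by (simp add: raw pl)
    }
  }
  show "comm_group (hom_group Q X Y)" if "X \<in> Obj Q" "Y \<in> Obj Q" using cg that .
qed

lemma qa_aneg: "arr C f \<Longrightarrow> \<ominus>\<^bsub>Q\<^esub> (qa f) = qa (\<ominus> f)"
proof -
  assume f: "arr C f"
  interpret q: preadditive_category Q by (rule preadditive_Q)
  show ?thesis using f
    by (intro q.aneg_unique[symmetric]) (simp_all add: qa_aplus qa_azero)
qed

end

lemma preadditive_category_cong:
  assumes "preadditive_category C" and eq: "Obj D = Obj C" "Hom D = Hom C" "Ident D = Ident C" "Comp D = Comp C" "Zer D = Zer C" "Plus D = Plus C"
  shows "preadditive_category D"
proof -
  have "hom_group D X Y = hom_group C X Y" for X Y by (simp add: hom_group_def eq)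
  then show ?thesis
    using assms(1) unfolding preadditive_category_def category_def preadditive_category_axioms_def eq by simp
qed

section \<open>Complexes up to homotopy and up to weak homotopy\<close>

definition dif :: "('o, 'm) cpx \<Rightarrow> int \<Rightarrow> ('o, 'm) arrow" where
  "dif X i = Arrow (cob X i) (cob X (i + 1)) (cdf X i)"

definition cm :: "(('o, 'm) cpx, int \<Rightarrow> 'm) arrow \<Rightarrow> int \<Rightarrow> ('o, 'm) arrow" where
  "cm f i = Arrow (cob (src f) i) (cob (tgt f) i) (mor f i)"

definition mkc :: "('o, 'm) cpx \<Rightarrow> ('o, 'm) cpx \<Rightarrow> (int \<Rightarrow> ('o, 'm) arrow) \<Rightarrow> (('o, 'm) cpx, int \<Rightarrow> 'm) arrow" where
  "mkc X Y u = Arrow X Y (\<lambda>i. mor (u i))"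

lemma dif_selectors [simp]: "src (dif X i) = cob X i" "tgt (dif X i) = cob X (i + 1)"
  by (simp_all add: dif_def)

lemma cm_selectors [simp]: "src (cm f i) = cob (src f) i" "tgt (cm f i) = cob (tgt f) i"
  by (simp_all add: cm_def)

lemma mkc_selectors [simp]: "src (mkc X Y u) = X" "tgt (mkc X Y u) = Y"
  by (simp_all add: mkc_def)

lemma cm_mkc [simp]: "\<lbrakk>src (u i) = cob X i; tgt (u i) = cob Y i\<rbrakk> \<Longrightarrow> cm (mkc X Y u) i = u i"
  by (auto simp: cm_def mkc_def intro: arrow_eqI)

lemma cm_eqI: "\<lbrakk>src f = src g; tgt f = tgt g; \<And>i. cm f i = cm g i\<rbrakk> \<Longrightarrow> f = g"
  by (auto simp: cm_def intro!: arrow_eqI ext)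

lemma complexes_simps [simp]:
  "Ident (complexes A) X i = Ident A (cob X i)" "Comp (complexes A) g f i = Comp A (g i) (f i)"
  "Zer (complexes A) X Y i = Zer A (cob X i) (cob Y i)" "Plus (complexes A) f g i = Plus A (f i) (g i)"
  by (simp_all add: complexes_def)

lemma cm_ops [simp]: "cm (g \<odot>\<^bsub>complexes A\<^esub> f) i = cm g i \<odot>\<^bsub>A\<^esub> cm f i" "cm (f \<oplus>\<^bsub>complexes A\<^esub> g) i = cm f i \<oplus>\<^bsub>A\<^esub> cm g i"
  "cm (aid (complexes A) X) i = aid A (cob X i)" "cm (azero (complexes A) X Y) i = azero A (cob X i) (cob Y i)"
  by (simp_all add: cm_def acomp_def aplus_def aid_def azero_def)

locale cpx_category = additive_category A for A :: "('o, 'm, 'z) cat_scheme" (structure)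
begin

abbreviation "CA \<equiv> complexes A"

lemma cpx_obj_iff: "X \<in> Obj CA \<longleftrightarrow> (\<forall>i. arr A (dif X i) \<and> dif X (i + 1) \<odot> dif X i = azero A (cob X i) (cob X (i + 2)))"
  by (auto simp: complexes_def arr_def dif_def acomp_def azero_def add.commute add.left_commute)

lemma cpxD:
  assumes "X \<in> Obj CA"
  shows "arr A (dif X i)" "dif X (i + 1) \<odot> dif X i = azero A (cob X i) (cob X (i + 2))" "cob X i \<in> Obj A"
  using assms arrD(1)[of A "dif X i"] unfolding cpx_obj_iff by auto

lemma cpx_dif_dif: "X \<in> Obj CA \<Longrightarrow> dif X i \<odot> dif X (i - 1) = azero A (cob X (i - 1)) (cob X (i + 1))"
  using cpxD(2)[of X "i - 1"] by (simp add: add.commute[of 1])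

lemma arr_cpx_iff: "arr CA f \<longleftrightarrow> src f \<in> Obj CA \<and> tgt f \<in> Obj CA \<and>
    (\<forall>i. arr A (cm f i) \<and> cm f (i + 1) \<odot> dif (src f) i = dif (tgt f) i \<odot> cm f i)"
  using cpxD(3) by (auto simp: arr_def cm_def dif_def acomp_def complexes_def)

lemma arr_cpxD:
  assumes "arr CA f"
  shows "src f \<in> Obj CA" "tgt f \<in> Obj CA" "arr A (cm f i)" "cm f (i + 1) \<odot> dif (src f) i = dif (tgt f) i \<odot> cm f i"
  using assms unfolding arr_cpx_iff by auto

lemma cpx_arr_ops:
  "X \<in> Obj CA \<Longrightarrow> arr CA (aid CA X)" "\<lbrakk>X \<in> Obj CA; Y \<in> Obj CA\<rbrakk> \<Longrightarrow> arr CA (azero CA X Y)"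
  "\<lbrakk>arr CA f; arr CA g; src g = tgt f\<rbrakk> \<Longrightarrow> arr CA (g \<odot>\<^bsub>CA\<^esub> f)"
  "\<lbrakk>arr CA f; arr CA g; src g = src f; tgt g = tgt f\<rbrakk> \<Longrightarrow> arr CA (f \<oplus>\<^bsub>CA\<^esub> g)"
  "arr CA f \<Longrightarrow> arr CA (mkc (src f) (tgt f) (\<lambda>i. \<ominus> (cm f i)))"
proof -
  show "arr CA (aid CA X)" if "X \<in> Obj CA"
    using cpxD[OF that] that by (simp add: arr_cpx_iff)
  show "arr CA (azero CA X Y)" if "X \<in> Obj CA" "Y \<in> Obj CA"
    using cpxD[OF that(1)] cpxD[OF that(2)] that by (simp add: arr_cpx_iff)
  show "arr CA (g \<odot>\<^bsub>CA\<^esub> f)" if *: "arr CA f" "arr CA g" "src g = tgt f"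
  proof -
    note [simp] = arr_cpxD[OF *(1)] arr_cpxD(1,2,3)[OF *(2)] cpxD[OF arr_cpxD(1)[OF *(1)]] cpxD[OF arr_cpxD(2)[OF *(1)]] cpxD[OF arr_cpxD(2)[OF *(2)]] *(3)
    have "cm g (i + 1) \<odot> dif (tgt f) i \<odot> cm f i = dif (tgt g) i \<odot> cm g i \<odot> cm f i" for i
      using acomp_eq[OF arr_cpxD(4)[OF *(2), of i], of "cm f i"] by simp
    then show ?thesis by (simp add: arr_cpx_iff[of "g \<odot>\<^bsub>CA\<^esub> f"])
  qed
  show "arr CA (f \<oplus>\<^bsub>CA\<^esub> g)" if *: "arr CA f" "arr CA g" "src g = src f" "tgt g = tgt f"
  proof -
    note [simp] = arr_cpxD[OF *(1)] arr_cpxD[OF *(2), unfolded *(3,4)] cpxD[OF arr_cpxD(1)[OF *(1)]] cpxD[OF arr_cpxD(2)[OF *(1)]] *(3,4)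
    show ?thesis by (simp add: arr_cpx_iff[of "f \<oplus>\<^bsub>CA\<^esub> g"])
  qed
  show "arr CA (mkc (src f) (tgt f) (\<lambda>i. \<ominus> (cm f i)))" if *: "arr CA f"
  proof -
    note [simp] = arr_cpxD[OF *(1)] cpxD[OF arr_cpxD(1)[OF *(1)]] cpxD[OF arr_cpxD(2)[OF *(1)]]
    show ?thesis by (simp add: arr_cpx_iff[of "mkc (src f) (tgt f) (\<lambda>i. \<ominus> (cm f i))"])
  qed
qed

lemma preadditive_CA: "preadditive_category CA"
proof (intro preadditive_category.intro category.intro preadditive_category_axioms.intro)
  note A = arr_Arrow
  have H: "arr CA (Arrow X Y f)" if "X \<in> Obj CA" "Y \<in> Obj CA" "f \<in> Hom CA X Y" for X Y f using that by (simp add: A)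
  have M: "mor f \<in> Hom CA X Y" if "arr CA f" "src f = X" "tgt f = Y" for X Y f using that by (auto simp: arr_def)
  have Nn: "mor (mkc X Y (\<lambda>i. \<ominus> (cm (Arrow X Y f) i))) \<in> Hom CA X Y" if "X \<in> Obj CA" "Y \<in> Obj CA" "f \<in> Hom CA X Y" for X Y f
    using cpx_arr_ops(5)[OF H[OF that]] by (intro M) simp_all
  have cA: "arr A (cm (Arrow X Y f) i)" if "X \<in> Obj CA" "Y \<in> Obj CA" "f \<in> Hom CA X Y" for X Y f i
    using arr_cpxD(3)[OF H[OF that]] .
  have cg: "comm_group (hom_group CA X Y)" if XY: "X \<in> Obj CA" "Y \<in> Obj CA" for X Y
  proof (rule comm_groupI)
    fix x y z assume "x \<in> carrier (hom_group CA X Y)" and "y \<in> carrier (hom_group CA X Y)" and "z \<in> carrier (hom_group CA X Y)"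
    then have x: "x \<in> Hom CA X Y" "y \<in> Hom CA X Y" "z \<in> Hom CA X Y" by (simp_all add: hom_group_def)
    have s: "monoid.mult (hom_group CA X Y) = Plus CA" "carrier (hom_group CA X Y) = Hom CA X Y" by (simp_all add: hom_group_def)
    note h = H[OF XY x(1)] H[OF XY x(2)] H[OF XY x(3)]
    note c = cA[OF XY x(1)] cA[OF XY x(2)] cA[OF XY x(3)]
    show "x \<otimes>\<^bsub>hom_group CA X Y\<^esub> y \<in> carrier (hom_group CA X Y)" unfolding s
      using M[OF cpx_arr_ops(4)[OF h(1,2)]] by (simp add: arrow_mor)
    have "(Arrow X Y x \<oplus>\<^bsub>CA\<^esub> Arrow X Y y) \<oplus>\<^bsub>CA\<^esub> Arrow X Y z = Arrow X Y x \<oplus>\<^bsub>CA\<^esub> (Arrow X Y y \<oplus>\<^bsub>CA\<^esub> Arrow X Y z)"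
      by (rule cm_eqI) (use c in simp_all)
    from arg_cong[OF this, of mor] show "x \<otimes>\<^bsub>hom_group CA X Y\<^esub> y \<otimes>\<^bsub>hom_group CA X Y\<^esub> z = x \<otimes>\<^bsub>hom_group CA X Y\<^esub> (y \<otimes>\<^bsub>hom_group CA X Y\<^esub> z)"
      unfolding s by (simp add: arrow_mor)
    have "Arrow X Y x \<oplus>\<^bsub>CA\<^esub> Arrow X Y y = Arrow X Y y \<oplus>\<^bsub>CA\<^esub> Arrow X Y x"
      by (rule cm_eqI) (use c aplus_comm[OF c(1,2)] in simp_all)
    from arg_cong[OF this, of mor] show "x \<otimes>\<^bsub>hom_group CA X Y\<^esub> y = y \<otimes>\<^bsub>hom_group CA X Y\<^esub> x"
      unfolding s by (simp add: arrow_mor)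
  next
    show "\<one>\<^bsub>hom_group CA X Y\<^esub> \<in> carrier (hom_group CA X Y)"
      using M[OF cpx_arr_ops(2)[OF XY]] by (simp add: hom_group_def arrow_mor)
    fix x assume "x \<in> carrier (hom_group CA X Y)"
    then have x: "x \<in> Hom CA X Y" by (simp_all add: hom_group_def)
    note h = H[OF XY x(1)] and c = cA[OF XY x(1)]
    have "azero CA X Y \<oplus>\<^bsub>CA\<^esub> Arrow X Y x = Arrow X Y x" by (rule cm_eqI) (use c in simp_all)
    from arg_cong[OF this, of mor] show "\<one>\<^bsub>hom_group CA X Y\<^esub> \<otimes>\<^bsub>hom_group CA X Y\<^esub> x = x"
      by (simp add: arrow_mor hom_group_def)
    show "\<exists>y\<in>carrier (hom_group CA X Y). y \<otimes>\<^bsub>hom_group CA X Y\<^esub> x = \<one>\<^bsub>hom_group CA X Y\<^esub>"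
    proof
      show "mor (mkc X Y (\<lambda>i. \<ominus> (cm (Arrow X Y x) i))) \<in> carrier (hom_group CA X Y)" using Nn[OF XY x] by (simp add: hom_group_def)
      have "mkc X Y (\<lambda>i. \<ominus> (cm (Arrow X Y x) i)) \<oplus>\<^bsub>CA\<^esub> Arrow X Y x = azero CA X Y" by (rule cm_eqI) (use c in simp_all)
      from arg_cong[OF this, of mor] show "mor (mkc X Y (\<lambda>i. \<ominus> (cm (Arrow X Y x) i))) \<otimes>\<^bsub>hom_group CA X Y\<^esub> x = \<one>\<^bsub>hom_group CA X Y\<^esub>"
        by (simp add: arrow_mor hom_group_def)
    qed
  qed
  fix X Y Z W f g h f' g'
  show "Ident CA X \<in> Hom CA X X" if "X \<in> Obj CA" using M[OF cpx_arr_ops(1)[OF that]] by (simp add: arrow_mor)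
  show "comm_group (hom_group CA X Y)" if "X \<in> Obj CA" "Y \<in> Obj CA" using cg that .
  {
    assume f: "X \<in> Obj CA" "Y \<in> Obj CA" "f \<in> Hom CA X Y"
    note [simp] = cA[OF f]
    have "Arrow X Y f \<odot>\<^bsub>CA\<^esub> aid CA X = Arrow X Y f" "aid CA Y \<odot>\<^bsub>CA\<^esub> Arrow X Y f = Arrow X Y f" by (rule cm_eqI; simp)+
    from this[THEN arg_cong, of mor] show "Comp CA f (Ident CA X) = f" "Comp CA (Ident CA Y) f = f" by (simp_all add: arrow_mor)
    assume g: "Z \<in> Obj CA" "g \<in> Hom CA Y Z"
    note [simp] = cA[OF f(2) g]
    show "Comp CA g f \<in> Hom CA X Z"
      using M[OF cpx_arr_ops(3)[OF H[OF f] H[OF f(2) g]]] by (simp add: arrow_mor)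
    {
      assume h: "W \<in> Obj CA" "h \<in> Hom CA Z W"
      note [simp] = cA[OF g(1) h]
      have "(Arrow Z W h \<odot>\<^bsub>CA\<^esub> Arrow Y Z g) \<odot>\<^bsub>CA\<^esub> Arrow X Y f = Arrow Z W h \<odot>\<^bsub>CA\<^esub> Arrow Y Z g \<odot>\<^bsub>CA\<^esub> Arrow X Y f" by (rule cm_eqI) simp_all
      from arg_cong[OF this, of mor] show "Comp CA (Comp CA h g) f = Comp CA h (Comp CA g f)" by (simp add: arrow_mor)
    }
    {
      assume f': "f' \<in> Hom CA X Y"
      note [simp] = cA[OF f(1,2) f']
      have "Arrow Y Z g \<odot>\<^bsub>CA\<^esub> (Arrow X Y f \<oplus>\<^bsub>CA\<^esub> Arrow X Y f') = Arrow Y Z g \<odot>\<^bsub>CA\<^esub> Arrow X Y f \<oplus>\<^bsub>CA\<^esub> Arrow Y Z g \<odot>\<^bsub>CA\<^esub> Arrow X Y f'" by (rule cm_eqI) simp_all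
      from arg_cong[OF this, of mor] show "Comp CA g (Plus CA f f') = Plus CA (Comp CA g f) (Comp CA g f')" by (simp add: arrow_mor)
    }
    {
      assume g': "g' \<in> Hom CA Y Z"
      note [simp] = cA[OF f(2) g(1) g']
      have "(Arrow Y Z g \<oplus>\<^bsub>CA\<^esub> Arrow Y Z g') \<odot>\<^bsub>CA\<^esub> Arrow X Y f = Arrow Y Z g \<odot>\<^bsub>CA\<^esub> Arrow X Y f \<oplus>\<^bsub>CA\<^esub> Arrow Y Z g' \<odot>\<^bsub>CA\<^esub> Arrow X Y f" by (rule cm_eqI) simp_all
      from arg_cong[OF this, of mor] show "Comp CA (Plus CA g g') f = Plus CA (Comp CA g f) (Comp CA g' f)" by (simp add: arrow_mor)
    }
  }
qed

sublocale cx: preadditive_category CA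
  by (rule preadditive_CA)

lemma cm_aneg [simp]: "arr CA f \<Longrightarrow> cm (\<ominus>\<^bsub>CA\<^esub> f) i = \<ominus> (cm f i)"
proof -
  assume f: "arr CA f"
  have "mkc (src f) (tgt f) (\<lambda>i. \<ominus> (cm f i)) = \<ominus>\<^bsub>CA\<^esub> f"
  proof (rule cx.aneg_unique)
    show "f \<oplus>\<^bsub>CA\<^esub> mkc (src f) (tgt f) (\<lambda>i. \<ominus> (cm f i)) = azero CA (src f) (tgt f)"
      by (rule cm_eqI) (use arr_cpxD[OF f] in simp_all)
  qed (use cpx_arr_ops(5)[OF f] f in simp_all)
  then have "cm (mkc (src f) (tgt f) (\<lambda>i. \<ominus> (cm f i))) i = cm (\<ominus>\<^bsub>CA\<^esub> f) i" by simp
  then show ?thesis by simp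
qed

definition hmt :: "('o, 'm) cpx \<Rightarrow> ('o, 'm) cpx \<Rightarrow> (int \<Rightarrow> ('o, 'm) arrow) \<Rightarrow> bool" where
  "hmt X Y s \<longleftrightarrow> (\<forall>i. \<guillemotleft>s i :\<^bsub>A\<^esub> cob X i \<rightarrow> cob Y (i - 1)\<guillemotright>)"

text \<open>With $s = t$ this is a null-homotopy, in general it is membership in $Z$; carrying both
  families lets one computation serve both ideals.\<close>

definition zhtp :: "(('o, 'm) cpx, int \<Rightarrow> 'm) arrow \<Rightarrow> (int \<Rightarrow> ('o, 'm) arrow) \<Rightarrow> (int \<Rightarrow> ('o, 'm) arrow) \<Rightarrow> bool" where
  "zhtp f s t \<longleftrightarrow> arr CA f \<and> hmt (src f) (tgt f) s \<and> hmt (src f) (tgt f) t \<and>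
     (\<forall>i. cm f i = s (i + 1) \<odot> dif (src f) i \<oplus> dif (tgt f) (i - 1) \<odot> t i)"

lemma hmtD: "hmt X Y s \<Longrightarrow> \<guillemotleft>s i :\<^bsub>A\<^esub> cob X i \<rightarrow> cob Y (i - 1)\<guillemotright>"
  by (simp add: hmt_def)

lemma zhtpD:
  assumes "zhtp f s t"
  shows "arr CA f" "hmt (src f) (tgt f) s" "hmt (src f) (tgt f) t" "cm f i = s (i + 1) \<odot> dif (src f) i \<oplus> dif (tgt f) (i - 1) \<odot> t i"
  using assms by (auto simp: zhtp_def)

lemma homotopies_iff: "\<lbrakk>X \<in> Obj CA; Y \<in> Obj CA\<rbrakk> \<Longrightarrow> s \<in> homotopies A X Y \<longleftrightarrow> hmt X Y (\<lambda>i. Arrow (cob X i) (cob Y (i - 1)) (s i))"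
  using cpxD(3) by (auto simp: homotopies_def hmt_def arr_def)

lemma st_map_iff:
  assumes f: "arr CA f"
  shows "(\<exists>s \<in> homotopies A (src f) (tgt f). \<exists>t \<in> homotopies A (src f) (tgt f). mor f = st_map A (src f) (tgt f) s t) \<longleftrightarrow> (\<exists>s t. zhtp f s t)"
    "(\<exists>s \<in> homotopies A (src f) (tgt f). mor f = st_map A (src f) (tgt f) s s) \<longleftrightarrow> (\<exists>s. zhtp f s s)"
proof -
  let ?u = "\<lambda>s i. Arrow (cob (src f) i) (cob (tgt f) (i - 1)) (s i)"
  have 1: "mor f = st_map A (src f) (tgt f) s t \<longleftrightarrow> (\<forall>i. cm f i = ?u s (i + 1) \<odot> dif (src f) i \<oplus> dif (tgt f) (i - 1) \<odot> ?u t i)" for s t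
    by (auto simp: st_map_def cm_def dif_def acomp_def aplus_def fun_eq_iff)
  have 2: "\<exists>s'. s = ?u s'" if "hmt (src f) (tgt f) s" for s
    using hmtD[OF that] by (intro exI[of _ "\<lambda>i. mor (s i)"]) (auto intro!: arrow_eqI ext)
  have h: "s \<in> homotopies A (src f) (tgt f) \<longleftrightarrow> hmt (src f) (tgt f) (?u s)" for s
    by (rule homotopies_iff) (use arr_cpxD[OF f] in auto)
  have 3: "zhtp f (?u s) (?u t) \<longleftrightarrow> s \<in> homotopies A (src f) (tgt f) \<and> t \<in> homotopies A (src f) (tgt f) \<and> mor f = st_map A (src f) (tgt f) s t" for s t
    unfolding h 1 zhtp_def using f by blast
  have 4: "\<exists>s' t'. s = ?u s' \<and> t = ?u t'" if "zhtp f s t" for s t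
    using 2 zhtpD(2,3)[OF that] by blast
  show "(\<exists>s \<in> homotopies A (src f) (tgt f). \<exists>t \<in> homotopies A (src f) (tgt f). mor f = st_map A (src f) (tgt f) s t) \<longleftrightarrow> (\<exists>s t. zhtp f s t)"
  proof
    assume "\<exists>s t. zhtp f s t"
    then obtain s t s' t' where "zhtp f s t" "s = ?u s'" "t = ?u t'" using 4 by blast
    then have "zhtp f (?u s') (?u t')" by (simp only:)
    then show "\<exists>s \<in> homotopies A (src f) (tgt f). \<exists>t \<in> homotopies A (src f) (tgt f). mor f = st_map A (src f) (tgt f) s t"
      unfolding 3 by blast
  qed (use 3 in blast)
  show "(\<exists>s \<in> homotopies A (src f) (tgt f). mor f = st_map A (src f) (tgt f) s s) \<longleftrightarrow> (\<exists>s. zhtp f s s)"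
  proof
    assume "\<exists>s. zhtp f s s"
    then obtain s s' where "zhtp f s s" "s = ?u s'" using 4 by blast
    then have "zhtp f (?u s') (?u s')" by (simp only:)
    then show "\<exists>s \<in> homotopies A (src f) (tgt f). mor f = st_map A (src f) (tgt f) s s" unfolding 3 by blast
  qed (use 3 in blast)
qed

lemma null_iff: "arr CA f \<Longrightarrow> mor f \<in> null_homotopic A (src f) (tgt f) \<longleftrightarrow> (\<exists>s. zhtp f s s)"
  using st_map_iff(2)[of f] by (auto simp: null_homotopic_def arr_def)

lemma zhtp_azero:
  assumes "X \<in> Obj CA" "Y \<in> Obj CA"
  shows "zhtp (azero CA X Y) (\<lambda>i. azero A (cob X i) (cob Y (i - 1))) (\<lambda>i. azero A (cob X i) (cob Y (i - 1)))"
  using assms cpxD[OF assms(1)] cpxD[OF assms(2)] cpxD(1)[OF assms(2), of "i - 1" for i] by (simp add: zhtp_def hmt_def)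

lemma zhtp_aplus:
  assumes f: "zhtp f s t" and g: "zhtp g s' t'" and e: "src g = src f" "tgt g = tgt f"
  shows "zhtp (f \<oplus>\<^bsub>CA\<^esub> g) (\<lambda>i. s i \<oplus> s' i) (\<lambda>i. t i \<oplus> t' i)"
proof -
  note D = zhtpD[OF f] zhtpD[OF g, unfolded e]
  note X = cpxD[OF arr_cpxD(1)[OF D(1)]] cpxD[OF arr_cpxD(2)[OF D(1)]]
  note [simp] = D(1) D(5) X hmtD[OF D(2)] hmtD[OF D(3)] hmtD[OF D(6)] hmtD[OF D(7)] e
  have "cm f i \<oplus> cm g i = (s (i + 1) \<oplus> s' (i + 1)) \<odot> dif (src f) i \<oplus> dif (tgt f) (i - 1) \<odot> (t i \<oplus> t' i)" for i
    unfolding D(4) D(8) using X(4)[of "i - 1"] hmtD[OF D(2), of "i + 1"] hmtD[OF D(6), of "i + 1"]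
    by (simp add: aplus_left_comm[of "dif (tgt f) (i - 1) \<odot> t i" "s' (i + 1) \<odot> dif (src f) i"])
  then show ?thesis by (simp add: zhtp_def hmt_def)
qed

lemma zhtp_aneg:
  assumes f: "zhtp f s t"
  shows "zhtp (\<ominus>\<^bsub>CA\<^esub> f) (\<lambda>i. \<ominus> (s i)) (\<lambda>i. \<ominus> (t i))"
proof -
  note D = zhtpD[OF f]
  note X = cpxD[OF arr_cpxD(1)[OF D(1)]] cpxD[OF arr_cpxD(2)[OF D(1)]]
  note [simp] = D(1) X hmtD[OF D(2)] hmtD[OF D(3)]
  have "\<ominus> (cm f i) = \<ominus> (s (i + 1)) \<odot> dif (src f) i \<oplus> dif (tgt f) (i - 1) \<odot> \<ominus> (t i)" for i
    unfolding D(4) using X(4)[of "i - 1"] hmtD[OF D(2), of "i + 1"] by simp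
  then show ?thesis by (simp add: zhtp_def hmt_def)
qed

lemma zhtp_acomp_left:
  assumes f: "zhtp f s t" and g: "arr CA g" "src g = tgt f"
  shows "zhtp (g \<odot>\<^bsub>CA\<^esub> f) (\<lambda>i. cm g (i - 1) \<odot> s i) (\<lambda>i. cm g (i - 1) \<odot> t i)"
proof -
  note D = zhtpD[OF f]
  note X = cpxD[OF arr_cpxD(1)[OF D(1)]] cpxD[OF arr_cpxD(2)[OF D(1)]] cpxD[OF arr_cpxD(2)[OF g(1)]]
  note [simp] = D(1) X hmtD[OF D(2)] hmtD[OF D(3)] g arr_cpxD(1-3)[OF g(1)]
  have c: "cm g i \<odot> dif (tgt f) (i - 1) = dif (tgt g) (i - 1) \<odot> cm g (i - 1)" for i
    using arr_cpxD(4)[OF g(1), of "i - 1"] by simp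
  have "cm g i \<odot> cm f i = (cm g i \<odot> s (i + 1)) \<odot> dif (src f) i \<oplus> dif (tgt g) (i - 1) \<odot> cm g (i - 1) \<odot> t i" for i
    unfolding D(4) using X(4)[of "i - 1"] X(7)[of "i - 1"] hmtD[OF D(2), of "i + 1"] acomp_eq[OF c[of i], of "t i"] by simp
  then show ?thesis by (simp add: zhtp_def hmt_def)
qed

lemma zhtp_acomp_right:
  assumes f: "zhtp f s t" and g: "arr CA g" "tgt g = src f"
  shows "zhtp (f \<odot>\<^bsub>CA\<^esub> g) (\<lambda>i. s i \<odot> cm g i) (\<lambda>i. t i \<odot> cm g i)"
proof -
  note D = zhtpD[OF f]
  note X = cpxD[OF arr_cpxD(1)[OF D(1)]] cpxD[OF arr_cpxD(2)[OF D(1)]] cpxD[OF arr_cpxD(1)[OF g(1)]]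
  note [simp] = D(1) X hmtD[OF D(2)] hmtD[OF D(3)] g arr_cpxD(1-3)[OF g(1)]
  have c: "dif (src f) i \<odot> cm g i = cm g (i + 1) \<odot> dif (src g) i" for i
    using arr_cpxD(4)[OF g(1), of i] by simp
  have "cm f i \<odot> cm g i = (s (i + 1) \<odot> cm g (i + 1)) \<odot> dif (src g) i \<oplus> dif (tgt f) (i - 1) \<odot> t i \<odot> cm g i" for i
    unfolding D(4) using X(4)[of "i - 1"] hmtD[OF D(2), of "i + 1"] by (simp add: c)
  then show ?thesis by (simp add: zhtp_def hmt_def)
qed

text \<open>Morphisms of the form $s d + d t$ compose to null-homotopic ones; this makes the passage from \<open>Kcat\<close> to
  \<open>Kw\<close> reflect isomorphisms.\<close>

lemma zhtp_square:
  assumes f: "zhtp f s t" and g: "zhtp g s' t'" and e: "src g = tgt f"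
  shows "zhtp (g \<odot>\<^bsub>CA\<^esub> f) (\<lambda>i. s' i \<odot> dif (tgt f) (i - 1) \<odot> t i \<oplus> t' (i - 1 + 1) \<odot> s (i + 1) \<odot> dif (src f) i)
    (\<lambda>i. s' i \<odot> dif (tgt f) (i - 1) \<odot> t i \<oplus> t' (i - 1 + 1) \<odot> s (i + 1) \<odot> dif (src f) i)"
proof -
  note D = zhtpD[OF f] zhtpD[OF g, unfolded e]
  note X = cpxD[OF arr_cpxD(1)[OF D(1)]] cpxD[OF arr_cpxD(2)[OF D(1)]] cpxD[OF arr_cpxD(2)[OF D(5)]]
  have Y: "\<guillemotleft>dif (src f) (i - 1) :\<^bsub>A\<^esub> cob (src f) (i - 1) \<rightarrow> cob (src f) i\<guillemotright>" "\<guillemotleft>dif (tgt f) (i - 1) :\<^bsub>A\<^esub> cob (tgt f) (i - 1) \<rightarrow> cob (tgt f) i\<guillemotright>"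
    "\<guillemotleft>dif (tgt g) (i - 1) :\<^bsub>A\<^esub> cob (tgt g) (i - 1) \<rightarrow> cob (tgt g) i\<guillemotright>" 
    "\<guillemotleft>s (i + 1) :\<^bsub>A\<^esub> cob (src f) (i + 1) \<rightarrow> cob (tgt f) i\<guillemotright>" "\<guillemotleft>s' (i + 1) :\<^bsub>A\<^esub> cob (tgt f) (i + 1) \<rightarrow> cob (tgt g) i\<guillemotright>" for i
    using X(1,4,7)[of "i - 1"] X(3,6,9) hmtD[OF D(2), of "i + 1"] hmtD[OF D(6), of "i + 1"] by simp_all
  have Y2: "arr A (s (i + 2))" "src (s (i + 2)) = cob (src f) (i + 2)" "tgt (s (i + 2)) = cob (tgt f) (i + 1)"
    "arr A (t' (i + 1))" "src (t' (i + 1)) = cob (tgt f) (i + 1)" "tgt (t' (i + 1)) = cob (tgt g) i"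
    "dif (src f) (i + 1) \<odot> dif (src f) i = azero A (cob (src f) i) (cob (src f) (i + 2))"
    "arr A (dif (src f) (i + 1))" "tgt (dif (src f) (i + 1)) = cob (src f) (i + 2)" for i
    using hmtD[OF D(2), of "i + 2"] hmtD[OF D(7), of "i + 1"] X(1)[of "i + 1"] X(2)[of i] by (simp_all add: add.commute[of 1] add.commute[of 2])
  note [simp] = D(1,5) X Y Y2 hmtD[OF D(2)] hmtD[OF D(3)] hmtD[OF D(6)] hmtD[OF D(7)] e arr_cpxD(3)[OF D(1)] arr_cpxD(3)[OF D(5)]
  have dd: "dif (src f) i \<odot> dif (src f) (i - 1) = azero A (cob (src f) (i - 1)) (cob (src f) (i + 1))"
    "dif (tgt f) i \<odot> dif (tgt f) (i - 1) = azero A (cob (tgt f) (i - 1)) (cob (tgt f) (i + 1))"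
    "dif (tgt g) i \<odot> dif (tgt g) (i - 1) = azero A (cob (tgt g) (i - 1)) (cob (tgt g) (i + 1))" for i
    using cpx_dif_dif D(1,5) arr_cpxD(1,2) e by metis+
  text \<open>the chain map conditions for $sd + dt$ say $d s d = d t d$\<close>
  have c1: "dif (tgt f) i \<odot> s (i + 1) \<odot> dif (src f) i = dif (tgt f) i \<odot> t (i + 1) \<odot> dif (src f) i" for i
  proof -
    have "cm f (i + 1) \<odot> dif (src f) i = dif (tgt f) i \<odot> t (i + 1) \<odot> dif (src f) i"
      unfolding D(4) using hmtD[OF D(3), of "i + 1"] by (simp add: add.commute[of 1] add.commute[of 2])
    moreover have "dif (tgt f) i \<odot> cm f i = dif (tgt f) i \<odot> s (i + 1) \<odot> dif (src f) i"
      unfolding D(4) using acomp_eq[OF dd(2)[of i], of "t i"] by simp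
    ultimately show ?thesis using arr_cpxD(4)[OF D(1), of i] by simp
  qed
  have c2: "dif (tgt g) (i - 1) \<odot> s' i \<odot> dif (tgt f) (i - 1) = dif (tgt g) (i - 1) \<odot> t' i \<odot> dif (tgt f) (i - 1)" for i
  proof -
    have "cm g i \<odot> dif (tgt f) (i - 1) = dif (tgt g) (i - 1) \<odot> t' i \<odot> dif (tgt f) (i - 1)"
      unfolding D(8) by (simp add: dd)
    moreover have "dif (tgt g) (i - 1) \<odot> cm g (i - 1) = dif (tgt g) (i - 1) \<odot> s' i \<odot> dif (tgt f) (i - 1)"
      unfolding D(8) using acomp_eq[OF dd(3)[of "i - 1"], of "t' (i - 1)"] X(7)[of "i - 2"] hmtD[OF D(7), of "i - 1"] by simp
    ultimately show ?thesis using arr_cpxD(4)[OF D(5), of "i - 1"] by simp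
  qed
  \<comment> \<open>In $(s' d + d t')(s d + d t)$ the term $s' d d t$ vanishes, while
    \<open>c1\<close> turns $s' d s d$ into $s' d t d$ and \<open>c2\<close> turns $d t' d t$ into
    $d s' d t$. What remains is $u d + d u$ for $u = s' d t + t' s d$.\<close>
  have "cm g i \<odot> cm f i = (s' (i + 1) \<odot> dif (tgt f) (i + 1 - 1) \<odot> t (i + 1) \<oplus> t' (i + 1 - 1 + 1) \<odot> s (i + 1 + 1) \<odot> dif (src f) (i + 1)) \<odot> dif (src f) i
     \<oplus> dif (tgt g) (i - 1) \<odot> (s' i \<odot> dif (tgt f) (i - 1) \<odot> t i \<oplus> t' (i - 1 + 1) \<odot> s (i + 1) \<odot> dif (src f) i)" (is "_ = ?R") for i
  proof -
    have "cm g i \<odot> cm f i = s' (i + 1) \<odot> dif (tgt f) i \<odot> s (i + 1) \<odot> dif (src f) i \<oplus> s' (i + 1) \<odot> dif (tgt f) i \<odot> dif (tgt f) (i - 1) \<odot> t i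
      \<oplus> dif (tgt g) (i - 1) \<odot> t' i \<odot> s (i + 1) \<odot> dif (src f) i \<oplus> dif (tgt g) (i - 1) \<odot> t' i \<odot> dif (tgt f) (i - 1) \<odot> t i"
      unfolding D(4) D(8) by (simp add: aplus_left_comm[of "dif (tgt g) (i - 1) \<odot> t' i \<odot> s (i + 1) \<odot> dif (src f) i"])
    also have "\<dots> = s' (i + 1) \<odot> dif (tgt f) i \<odot> t (i + 1) \<odot> dif (src f) i \<oplus> dif (tgt g) (i - 1) \<odot> t' i \<odot> s (i + 1) \<odot> dif (src f) i
      \<oplus> dif (tgt g) (i - 1) \<odot> s' i \<odot> dif (tgt f) (i - 1) \<odot> t i"
      using c1[of i] acomp_eq[OF c2[of i], of "t i"] acomp_eq[OF dd(2)[of i], of "t i"] by simp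
    also have "\<dots> = ?R"
      by (simp add: add.commute[of 1] add.commute[of 2] aplus_comm[of "dif (tgt g) (i - 1) \<odot> t' i \<odot> s (i + 1) \<odot> dif (src f) i"])
    finally show ?thesis .
  qed
  then show ?thesis by (simp add: zhtp_def hmt_def)
qed

end

lemma mor_quotientI:
  fixes C :: "('o, 'm, 'z) shift_cat_scheme" (structure)
  assumes pre: "preadditive_category C" and sub: "\<And>X Y. \<lbrakk>X \<in> Obj C; Y \<in> Obj C\<rbrakk> \<Longrightarrow> I X Y \<subseteq> Hom C X Y"
    and P: "\<And>f. arr C f \<Longrightarrow> mor f \<in> I (src f) (tgt f) \<longleftrightarrow> P f"
    and P0: "\<And>X Y. \<lbrakk>X \<in> Obj C; Y \<in> Obj C\<rbrakk> \<Longrightarrow> P (azero C X Y)"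
    and Pp: "\<And>f g. \<lbrakk>arr C f; arr C g; src g = src f; tgt g = tgt f; P f; P g\<rbrakk> \<Longrightarrow> P (f \<oplus> g)"
    and Pn: "\<And>f. \<lbrakk>arr C f; P f\<rbrakk> \<Longrightarrow> P (\<ominus> f)"
    and Pl: "\<And>f g. \<lbrakk>arr C f; arr C g; src g = tgt f; P f\<rbrakk> \<Longrightarrow> P (g \<odot> f)"
    and Pr: "\<And>f g. \<lbrakk>arr C f; arr C g; src g = tgt f; P g\<rbrakk> \<Longrightarrow> P (g \<odot> f)"
  shows "mor_quotient C I"
proof -
  interpret preadditive_category C by (rule pre)
  have iff: "f \<in> I X Y \<longleftrightarrow> P (Arrow X Y f)" if "X \<in> Obj C" "Y \<in> Obj C" "f \<in> Hom C X Y" for X Y f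
    using P[of "Arrow X Y f"] that by (simp add: arr_Arrow)
  have mem: "mor f \<in> I X Y" if "arr C f" "src f = X" "tgt f = Y" "P f" for X Y f using P[OF that(1)] that by simp
  show ?thesis
  proof (intro mor_quotient.intro mor_quotient_axioms.intro pre)
    fix X Y assume o: "X \<in> Obj C" "Y \<in> Obj C"
    interpret G: comm_group "hom_group C X Y" using o by (rule hom_comm_group)
    show "subgroup (I X Y) (hom_group C X Y)"
    proof (rule G.subgroupI)
      show "I X Y \<subseteq> carrier (hom_group C X Y)" using sub[OF o] by (simp add: hom_group_def)
      have "mor (azero C X Y) \<in> I X Y" by (rule mem) (use o P0 in simp_all)
      then show "I X Y \<noteq> {}" by blast
      fix f assume f: "f \<in> I X Y"
      then have f': "f \<in> Hom C X Y" using sub[OF o] by blast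
      have a: "arr C (Arrow X Y f)" using f' o by (simp add: arr_Arrow)
      have Pf: "P (Arrow X Y f)" using iff[OF o f'] f by blast
      show "inv\<^bsub>hom_group C X Y\<^esub> f \<in> I X Y" using mem[OF arr_aneg[OF a] _ _ Pn[OF a Pf]] by (simp add: arrow_mor neg_def)
      fix g assume g: "g \<in> I X Y"
      then have g': "g \<in> Hom C X Y" using sub[OF o] by blast
      have b: "arr C (Arrow X Y g)" using g' o by (simp add: arr_Arrow)
      have Pg: "P (Arrow X Y g)" using iff[OF o g'] g by blast
      show "f \<otimes>\<^bsub>hom_group C X Y\<^esub> g \<in> I X Y"
        using mem[OF arr_aplus[OF a b] _ _ Pp[OF a b _ _ Pf Pg]] by (simp add: arrow_mor hom_group_def)
    qed
  next
    fix X Y Z f g assume o: "X \<in> Obj C" "Y \<in> Obj C" "Z \<in> Obj C" and f: "f \<in> I X Y" and g: "g \<in> Hom C Y Z"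
    have f': "f \<in> Hom C X Y" using sub[OF o(1,2)] f by blast
    have a: "arr C (Arrow X Y f)" "arr C (Arrow Y Z g)" using f' g o by (simp_all add: arr_Arrow)
    show "g \<cdot> f \<in> I X Z"
      using mem[OF arr_acomp[OF a(2,1)] _ _ Pl[OF a _ iff[OF o(1,2) f', THEN iffD1, OF f]]] by (simp add: arrow_mor)
  next
    fix X Y Z f g assume o: "X \<in> Obj C" "Y \<in> Obj C" "Z \<in> Obj C" and f: "f \<in> Hom C X Y" and g: "g \<in> I Y Z"
    have g': "g \<in> Hom C Y Z" using sub[OF o(2,3)] g by blast
    have a: "arr C (Arrow X Y f)" "arr C (Arrow Y Z g)" using f g' o by (simp_all add: arr_Arrow)
    show "g \<cdot> f \<in> I X Z"
      using mem[OF arr_acomp[OF a(2,1)] _ _ Pr[OF a _ iff[OF o(2,3) g', THEN iffD1, OF g]]] by (simp add: arrow_mor)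
  qed
qed

lemma (in mor_quotient) qa_eq_diff_iff:
  assumes "arr C f" "arr C g" "src f = src g" "tgt f = tgt g"
  shows "qa f = qa g \<longleftrightarrow> mor (f \<oplus> \<ominus> g) \<in> I (src g) (tgt g)"
proof -
  have "f = (f \<oplus> \<ominus> g) \<oplus> g" using assms by simp
  moreover have "n = f \<oplus> \<ominus> g" if "f = n \<oplus> g" "arr C n" "src n = src g" "tgt n = tgt g" for n
    unfolding that(1) using that(2-4) assms(2) by simp
  ultimately show ?thesis unfolding qa_eq_iff[OF assms] using assms
    by (metis arr_aneg arr_aplus arrow_selectors(3-6))
qed

lemma (in mor_quotient) ShM_quot_class:
  assumes o: "X \<in> Obj C" "Y \<in> Obj C" and f: "f \<in> Hom C X Y"
    and im: "ShM C n ` I X Y = I (ShO C n X) (ShO C n Y)"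
    and pl: "\<And>g h. \<lbrakk>g \<in> Hom C X Y; h \<in> Hom C X Y\<rbrakk> \<Longrightarrow> ShM C n (g \<boxplus> h) = ShM C n g \<boxplus> ShM C n h"
  shows "ShM Q n (quot_class C I X Y f) = quot_class C I (ShO C n X) (ShO C n Y) (ShM C n f)"
proof -
  have "ShM C n ` (I X Y #>\<^bsub>hom_group C X Y\<^esub> f) = (\<lambda>m. ShM C n m \<boxplus> ShM C n f) ` I X Y"
    using pl[OF I_Hom[OF o] f] by (auto simp: r_coset_def hom_group_def image_UN)
  also have "\<dots> = I (ShO C n X) (ShO C n Y) #>\<^bsub>hom_group C (ShO C n X) (ShO C n Y)\<^esub> ShM C n f"
    unfolding im[symmetric] by (auto simp: r_coset_def hom_group_def)
  finally show ?thesis by (simp add: quot_class_def quot_cat_def)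
qed

lemma ops_cong:
  assumes "Obj D = Obj C" "Hom D = Hom C" "Ident D = Ident C" "Comp D = Comp C" "Zer D = Zer C" "Plus D = Plus C"
  shows "arr D = arr C" "acomp D = acomp C" "aplus D = aplus C" "aneg D = aneg C" "aid D = aid C" "azero D = azero C"
proof -
  have h: "hom_group D X Y = hom_group C X Y" for X Y using assms by (simp add: hom_group_def)
  show "arr D = arr C" "acomp D = acomp C" "aplus D = aplus C" "aneg D = aneg C" "aid D = aid C" "azero D = azero C"
    by (simp_all add: fun_eq_iff arr_def acomp_def aplus_def aneg_def aid_def azero_def assms neg_def h)
qed

section \<open>The homotopy category, its quotient by $Z$, and reflection of isomorphisms\<close>

context cpx_category
begin

sublocale k: mor_quotient CA "null_homotopic A"
proof (rule mor_quotientI[where P = "\<lambda>f. \<exists>s. zhtp f s s"])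
  show "preadditive_category CA" by (rule preadditive_CA)
  show "null_homotopic A X Y \<subseteq> Hom CA X Y" for X Y by (simp add: null_homotopic_def)
  show "mor f \<in> null_homotopic A (src f) (tgt f) \<longleftrightarrow> (\<exists>s. zhtp f s s)" if "arr CA f" for f by (rule null_iff[OF that])
  show "\<exists>s. zhtp (azero CA X Y) s s" if "X \<in> Obj CA" "Y \<in> Obj CA" for X Y using zhtp_azero[OF that] by blast
  show "\<exists>s. zhtp (f \<oplus>\<^bsub>CA\<^esub> g) s s" if "\<exists>s. zhtp f s s" "\<exists>s. zhtp g s s" "src g = src f" "tgt g = tgt f" for f g
    using that zhtp_aplus by blast
  show "\<exists>s. zhtp (\<ominus>\<^bsub>CA\<^esub> f) s s" if "\<exists>s. zhtp f s s" for f using that zhtp_aneg by blast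
  show "\<exists>s. zhtp (g \<odot>\<^bsub>CA\<^esub> f) s s" if "arr CA g" "src g = tgt f" "\<exists>s. zhtp f s s" for f g
    using that zhtp_acomp_left by blast
  show "\<exists>s. zhtp (g \<odot>\<^bsub>CA\<^esub> f) s s" if "arr CA f" "src g = tgt f" "\<exists>s. zhtp g s s" for f g
    using that zhtp_acomp_right[of g _ _ f] by metis
qed

lemma Kcat_sel:
  "Obj (Kcat A) = Obj k.Q" "Hom (Kcat A) = Hom k.Q" "Ident (Kcat A) = Ident k.Q" "Comp (Kcat A) = Comp k.Q"
  "Zer (Kcat A) = Zer k.Q" "Plus (Kcat A) = Plus k.Q" "ShO (Kcat A) = ShO k.Q" "ShM (Kcat A) = ShM k.Q"
  by (simp_all add: Kcat_def htp_cat_def shift_cat.defs)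

lemmas Kcat_ops = ops_cong[OF Kcat_sel(1-6)]

sublocale kc: preadditive_category "Kcat A"
  by (rule preadditive_category_cong[OF k.preadditive_Q Kcat_sel(1-6)])

definition kq :: "(('o, 'm) cpx, int \<Rightarrow> 'm) arrow \<Rightarrow> (('o, 'm) cpx, ('o, 'm) kmor) arrow" where
  "kq f = k.qa f"

lemma kq_selectors [simp]: "src (kq f) = src f" "tgt (kq f) = tgt f"
  by (simp_all add: kq_def)

lemma Obj_Kcat [simp]: "Obj (Kcat A) = Obj CA"
  by (simp add: Kcat_sel)

lemma mor_kq: "mor (kq f) = hclass A (src f) (tgt f) (mor f)"
  by (simp add: kq_def k.qa_def hclass_def)

lemma arr_kq [simp]: "arr CA f \<Longrightarrow> arr (Kcat A) (kq f)"
  by (simp add: kq_def Kcat_ops)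

lemma arr_Kcat_cases: "arr (Kcat A) x \<Longrightarrow> \<exists>f. arr CA f \<and> x = kq f"
  using k.arr_Q_cases by (simp add: kq_def Kcat_ops)

lemma kq_ops:
  "\<lbrakk>arr CA f; arr CA g; src g = tgt f\<rbrakk> \<Longrightarrow> kq (g \<odot>\<^bsub>CA\<^esub> f) = kq g \<odot>\<^bsub>Kcat A\<^esub> kq f"
  "\<lbrakk>arr CA f; arr CA g; src g = src f; tgt g = tgt f\<rbrakk> \<Longrightarrow> kq (g \<oplus>\<^bsub>CA\<^esub> f) = kq g \<oplus>\<^bsub>Kcat A\<^esub> kq f"
  "arr CA f \<Longrightarrow> kq (\<ominus>\<^bsub>CA\<^esub> f) = \<ominus>\<^bsub>Kcat A\<^esub> (kq f)"
  "kq (aid CA X) = aid (Kcat A) X" "kq (azero CA X Y) = azero (Kcat A) X Y"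
  by (simp_all add: kq_def Kcat_ops k.qa_acomp k.qa_aplus k.qa_aneg k.qa_aid k.qa_azero)

lemma kq_eq_iff:
  assumes "arr CA f" "arr CA g" "src f = src g" "tgt f = tgt g"
  shows "kq f = kq g \<longleftrightarrow> (\<exists>s. zhtp (f \<oplus>\<^bsub>CA\<^esub> \<ominus>\<^bsub>CA\<^esub> g) s s)"
  using k.qa_eq_diff_iff[OF assms] null_iff[of "f \<oplus>\<^bsub>CA\<^esub> \<ominus>\<^bsub>CA\<^esub> g"] assms by (simp add: kq_def)

lemma kq_zero_iff:
  assumes "arr CA f"
  shows "kq f = azero (Kcat A) (src f) (tgt f) \<longleftrightarrow> (\<exists>s. zhtp f s s)"
  using kq_eq_iff[of f "azero CA (src f) (tgt f)"] assms arr_cpxD(1,2)[OF assms] by (simp add: kq_ops)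

definition zk :: "(('o, 'm) cpx, ('o, 'm) kmor) arrow \<Rightarrow> bool" where
  "zk x \<longleftrightarrow> (\<exists>f s t. x = kq f \<and> zhtp f s t)"

text \<open>A homotopy contributes the same family to $s$ and to $t$, so being of the form $s d + d
  t$ depends only on the homotopy class.\<close>

lemma zk_kq: "arr CA f \<Longrightarrow> zk (kq f) \<longleftrightarrow> (\<exists>s t. zhtp f s t)"
proof
  assume f: "arr CA f" "zk (kq f)"
  then obtain g s t where g: "kq f = kq g" "zhtp g s t" by (auto simp: zk_def)
  have g': "arr CA g" "src f = src g" "tgt f = tgt g" using zhtpD[OF g(2)] arg_cong[OF g(1), of src] arg_cong[OF g(1), of tgt] by simp_all
  obtain s' where "zhtp (f \<oplus>\<^bsub>CA\<^esub> \<ominus>\<^bsub>CA\<^esub> g) s' s'" using kq_eq_iff[of f g] g f g' by auto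
  from zhtp_aplus[OF this g(2)] show "\<exists>s t. zhtp f s t" using f(1) g' by auto
qed (auto simp: zk_def)

lemma Zideal_iff: "arr (Kcat A) x \<Longrightarrow> mor x \<in> Zideal A (src x) (tgt x) \<longleftrightarrow> zk x"
proof
  assume x: "arr (Kcat A) x"
  have o: "src x \<in> Obj CA" "tgt x \<in> Obj CA" using x by (auto simp: arr_def)
  show "zk x" if "mor x \<in> Zideal A (src x) (tgt x)"
  proof -
    from that obtain f s t where f: "mor x = hclass A (src x) (tgt x) f" "f \<in> Hom CA (src x) (tgt x)"
      "s \<in> homotopies A (src x) (tgt x)" "t \<in> homotopies A (src x) (tgt x)" "f = st_map A (src x) (tgt x) s t"
      by (auto simp: Zideal_def)
    define g where "g = Arrow (src x) (tgt x) f"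
    have g: "arr CA g" using f(2) o by (simp add: g_def arr_Arrow)
    have "\<exists>s t. zhtp g s t" using st_map_iff(1)[OF g] f(3-5) by (auto simp: g_def)
    moreover have "x = kq g" using f(1) by (intro arrow_eqI) (simp_all add: mor_kq g_def)
    ultimately show ?thesis by (auto simp: zk_def)
  qed
  show "mor x \<in> Zideal A (src x) (tgt x)" if "zk x"
  proof -
    from that obtain f s t where f: "x = kq f" "zhtp f s t" by (auto simp: zk_def)
    have "arr CA f" using zhtpD[OF f(2)] by simp
    with st_map_iff(1)[of f] f show ?thesis
      by (auto simp: Zideal_def mor_kq arr_def)
  qed
qed

sublocale z: mor_quotient "Kcat A" "Zideal A"
proof (rule mor_quotientI[where P = zk])
  show "Zideal A X Y \<subseteq> Hom (Kcat A) X Y" if "X \<in> Obj (Kcat A)" "Y \<in> Obj (Kcat A)" for X Y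
    by (auto simp: Zideal_def Kcat_sel hclass_def)
  show "zk (azero (Kcat A) X Y)" if "X \<in> Obj (Kcat A)" "Y \<in> Obj (Kcat A)" for X Y
    using zhtp_azero[of X Y] that by (auto simp: zk_def kq_ops(5)[symmetric])
next
  fix f g assume "zk f" "zk g" "src g = src f" "tgt g = tgt f"
  then obtain f' s t g' s' t' where *: "f = kq f'" "zhtp f' s t" "g = kq g'" "zhtp g' s' t'" by (auto simp: zk_def)
  with zhtp_aplus[OF *(2,4)] \<open>src g = src f\<close> \<open>tgt g = tgt f\<close> show "zk (f \<oplus>\<^bsub>Kcat A\<^esub> g)"
    using zhtpD(1)[OF *(2)] zhtpD(1)[OF *(4)] by (auto simp: zk_def kq_ops(2)[symmetric])
next
  fix f assume "zk f"
  then obtain f' s t where *: "f = kq f'" "zhtp f' s t" by (auto simp: zk_def)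
  then show "zk (\<ominus>\<^bsub>Kcat A\<^esub> f)" using zhtp_aneg[OF *(2)] zhtpD(1)[OF *(2)] by (auto simp: zk_def kq_ops(3)[symmetric])
next
  fix f g assume a: "arr (Kcat A) f" "arr (Kcat A) g" "src g = tgt f"
  obtain f' g' where *: "f = kq f'" "arr CA f'" "g = kq g'" "arr CA g'" using a arr_Kcat_cases by metis
  then have e: "src g' = tgt f'" "g \<odot>\<^bsub>Kcat A\<^esub> f = kq (g' \<odot>\<^bsub>CA\<^esub> f')" using a(3) by (simp_all add: kq_ops)
  show "zk (g \<odot>\<^bsub>Kcat A\<^esub> f)" if "zk f"
    using that[unfolded *(1) zk_kq[OF *(2)]] zhtp_acomp_left[OF _ *(4) e(1)]
    unfolding e(2) zk_kq[OF cx.arr_acomp[OF *(4,2) e(1)]] by blast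
  show "zk (g \<odot>\<^bsub>Kcat A\<^esub> f)" if "zk g"
    using that[unfolded *(3) zk_kq[OF *(4)]] zhtp_acomp_right[OF _ *(2) e(1)[symmetric]]
    unfolding e(2) zk_kq[OF cx.arr_acomp[OF *(4,2) e(1)]] by blast
qed (use kc.preadditive_category_axioms Zideal_iff in auto)

lemma Kw_sel:
  "Obj (Kw A) = Obj z.Q" "Hom (Kw A) = Hom z.Q" "Ident (Kw A) = Ident z.Q" "Comp (Kw A) = Comp z.Q"
  "Zer (Kw A) = Zer z.Q" "Plus (Kw A) = Plus z.Q" "ShO (Kw A) = ShO z.Q" "ShM (Kw A) = ShM z.Q"
  by (simp_all add: Kw_def shift_cat.defs)

lemmas Kw_ops = ops_cong[OF Kw_sel(1-6)]

sublocale kw: preadditive_category "Kw A"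
  by (rule preadditive_category_cong[OF z.preadditive_Q Kw_sel(1-6)])

definition wk :: "(('o, 'm) cpx, ('o, 'm) kmor) arrow \<Rightarrow> (('o, 'm) cpx, ('o, 'm) kwmor) arrow" where
  "wk x = z.qa x"

lemma wk_selectors [simp]: "src (wk f) = src f" "tgt (wk f) = tgt f"
  by (simp_all add: wk_def)

lemma Obj_Kw [simp]: "Obj (Kw A) = Obj CA"
  by (simp add: Kw_sel)

lemma mor_wk: "mor (wk f) = wclass A (src f) (tgt f) (mor f)"
  by (simp add: wk_def z.qa_def wclass_def)

lemma arr_wk [simp]: "arr (Kcat A) f \<Longrightarrow> arr (Kw A) (wk f)"
  by (simp add: wk_def Kw_ops)

lemma arr_Kw_cases: "arr (Kw A) x \<Longrightarrow> \<exists>f. arr CA f \<and> x = wk (kq f)"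
  using z.arr_Q_cases[of x] arr_Kcat_cases by (auto simp: wk_def Kw_ops)

lemma wk_ops:
  "\<lbrakk>arr (Kcat A) f; arr (Kcat A) g; src g = tgt f\<rbrakk> \<Longrightarrow> wk (g \<odot>\<^bsub>Kcat A\<^esub> f) = wk g \<odot>\<^bsub>Kw A\<^esub> wk f"
  "\<lbrakk>arr (Kcat A) f; arr (Kcat A) g; src g = src f; tgt g = tgt f\<rbrakk> \<Longrightarrow> wk (g \<oplus>\<^bsub>Kcat A\<^esub> f) = wk g \<oplus>\<^bsub>Kw A\<^esub> wk f"
  "arr (Kcat A) f \<Longrightarrow> wk (\<ominus>\<^bsub>Kcat A\<^esub> f) = \<ominus>\<^bsub>Kw A\<^esub> (wk f)"
  "wk (aid (Kcat A) X) = aid (Kw A) X" "wk (azero (Kcat A) X Y) = azero (Kw A) X Y"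
  by (simp_all add: wk_def Kw_ops z.qa_acomp z.qa_aplus z.qa_aneg z.qa_aid z.qa_azero)

lemma wk_eq_iff:
  assumes "arr (Kcat A) f" "arr (Kcat A) g" "src f = src g" "tgt f = tgt g"
  shows "wk f = wk g \<longleftrightarrow> zk (f \<oplus>\<^bsub>Kcat A\<^esub> \<ominus>\<^bsub>Kcat A\<^esub> g)"
  using z.qa_eq_diff_iff[OF assms] Zideal_iff[of "f \<oplus>\<^bsub>Kcat A\<^esub> \<ominus>\<^bsub>Kcat A\<^esub> g"] assms by (simp add: wk_def)

lemma wk_kq_eq_iff:
  assumes "arr CA f" "arr CA g" "src f = src g" "tgt f = tgt g"
  shows "wk (kq f) = wk (kq g) \<longleftrightarrow> (\<exists>s t. zhtp (f \<oplus>\<^bsub>CA\<^esub> \<ominus>\<^bsub>CA\<^esub> g) s t)"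
  using wk_eq_iff[of "kq f" "kq g"] zk_kq[of "f \<oplus>\<^bsub>CA\<^esub> \<ominus>\<^bsub>CA\<^esub> g"] assms by (simp add: kq_ops)

lemma zk_square: "\<lbrakk>zk x; zk y; src y = tgt x\<rbrakk> \<Longrightarrow> y \<odot>\<^bsub>Kcat A\<^esub> x = azero (Kcat A) (src x) (tgt y)"
proof -
  assume *: "zk x" "zk y" "src y = tgt x"
  then obtain f s t g s' t' where f: "x = kq f" "zhtp f s t" "y = kq g" "zhtp g s' t'" by (auto simp: zk_def)
  have a: "arr CA f" "arr CA g" "src g = tgt f" using zhtpD(1)[OF f(2)] zhtpD(1)[OF f(4)] *(3) f by simp_all
  have "kq (g \<odot>\<^bsub>CA\<^esub> f) = azero (Kcat A) (src f) (tgt g)"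
    using kq_zero_iff[of "g \<odot>\<^bsub>CA\<^esub> f"] zhtp_square[OF f(2,4) a(3)] a by auto
  then show ?thesis using a f by (simp add: kq_ops)
qed

text \<open>Here $x = 1 + d$ with $d$ in the ideal, and $d^2 = 0$ by \<open>zk_square\<close>; the
  inverse is $1 - d$.\<close>

lemma kc_inverse_of_zk:
  assumes x: "arr (Kcat A) x" "tgt x = src x" and z: "zk (x \<oplus>\<^bsub>Kcat A\<^esub> \<ominus>\<^bsub>Kcat A\<^esub> (aid (Kcat A) (src x)))"
  obtains y where "arr (Kcat A) y" "src y = src x" "tgt y = src x" "y \<odot>\<^bsub>Kcat A\<^esub> x = aid (Kcat A) (src x)" "x \<odot>\<^bsub>Kcat A\<^esub> y = aid (Kcat A) (src x)"
proof -
  have o: "src x \<in> Obj CA" using x(1) by (auto simp: arr_def)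
  define d where "d = x \<oplus>\<^bsub>Kcat A\<^esub> \<ominus>\<^bsub>Kcat A\<^esub> (aid (Kcat A) (src x))"
  have d: "arr (Kcat A) d" "src d = src x" "tgt d = src x" using x o by (simp_all add: d_def)
  have dd: "d \<odot>\<^bsub>Kcat A\<^esub> d = azero (Kcat A) (src x) (src x)" using zk_square[OF z z] x by (simp add: d_def)
  have xd: "x = d \<oplus>\<^bsub>Kcat A\<^esub> aid (Kcat A) (src x)" unfolding d_def using x o by simp
  define y where "y = aid (Kcat A) (src x) \<oplus>\<^bsub>Kcat A\<^esub> \<ominus>\<^bsub>Kcat A\<^esub> d"
  have "y \<odot>\<^bsub>Kcat A\<^esub> (d \<oplus>\<^bsub>Kcat A\<^esub> aid (Kcat A) (src x)) = aid (Kcat A) (src x)"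
    using d o by (simp add: y_def dd kc.aplus_left_comm[of d] kc.aplus_comm[of "aid (Kcat A) (src x)" "\<ominus>\<^bsub>Kcat A\<^esub> d"])
  moreover have "(d \<oplus>\<^bsub>Kcat A\<^esub> aid (Kcat A) (src x)) \<odot>\<^bsub>Kcat A\<^esub> y = aid (Kcat A) (src x)"
    using d o by (simp add: y_def dd kc.aplus_left_comm[of d] kc.aplus_comm[of "aid (Kcat A) (src x)" "\<ominus>\<^bsub>Kcat A\<^esub> d"])
  moreover have "arr (Kcat A) y" "src y = src x" "tgt y = src x" using d o by (simp_all add: y_def)
  ultimately show ?thesis using that[of y] xd by metis
qed

text \<open>For a lift $y$ of an inverse, $y x$ and $x y$ are identities plus elements of the ideal,
  hence invertible in \<open>Kcat\<close>. So $x$ has a left and a right inverse there.\<close>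

lemma aiso_Kw_Kcat:
  assumes x: "arr (Kcat A) x" and iso: "kw.aiso (wk x)"
  shows "kc.aiso x"
proof -
  have o: "src x \<in> Obj CA" "tgt x \<in> Obj CA" using x by (auto simp: arr_def)
  obtain g where g: "\<guillemotleft>g :\<^bsub>Kw A\<^esub> tgt x \<rightarrow> src x\<guillemotright>" "g \<odot>\<^bsub>Kw A\<^esub> wk x = aid (Kw A) (src x)" "wk x \<odot>\<^bsub>Kw A\<^esub> g = aid (Kw A) (tgt x)"
    using kw.aisoE[OF iso] by auto
  obtain y0 where y0: "arr CA y0" "g = wk (kq y0)" using arr_Kw_cases g(1) by blast
  define y where "y = kq y0"
  have y: "arr (Kcat A) y" "g = wk y" "src y = tgt x" "tgt y = src x" using y0 g(1) by (simp_all add: y_def)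
  have "wk (y \<odot>\<^bsub>Kcat A\<^esub> x) = wk (aid (Kcat A) (src x))" using g(2) y x by (simp add: wk_ops)
  then have 1: "zk (y \<odot>\<^bsub>Kcat A\<^esub> x \<oplus>\<^bsub>Kcat A\<^esub> \<ominus>\<^bsub>Kcat A\<^esub> (aid (Kcat A) (src x)))"
    by (subst (asm) wk_eq_iff) (use x y o in simp_all)
  have "wk (x \<odot>\<^bsub>Kcat A\<^esub> y) = wk (aid (Kcat A) (tgt x))" using g(3) y x by (simp add: wk_ops)
  then have 2: "zk (x \<odot>\<^bsub>Kcat A\<^esub> y \<oplus>\<^bsub>Kcat A\<^esub> \<ominus>\<^bsub>Kcat A\<^esub> (aid (Kcat A) (tgt x)))"
    by (subst (asm) wk_eq_iff) (use x y o in simp_all)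
  have s: "src (y \<odot>\<^bsub>Kcat A\<^esub> x) = src x" "src (x \<odot>\<^bsub>Kcat A\<^esub> y) = tgt x" "tgt (y \<odot>\<^bsub>Kcat A\<^esub> x) = src (y \<odot>\<^bsub>Kcat A\<^esub> x)"
    "tgt (x \<odot>\<^bsub>Kcat A\<^esub> y) = src (x \<odot>\<^bsub>Kcat A\<^esub> y)" "arr (Kcat A) (y \<odot>\<^bsub>Kcat A\<^esub> x)" "arr (Kcat A) (x \<odot>\<^bsub>Kcat A\<^esub> y)" using x y by simp_all
  obtain u where u: "arr (Kcat A) u" "src u = src x" "tgt u = src x" "u \<odot>\<^bsub>Kcat A\<^esub> (y \<odot>\<^bsub>Kcat A\<^esub> x) = aid (Kcat A) (src x)"
    by (rule kc_inverse_of_zk[OF s(5,3), unfolded s(1), OF 1]) blast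
  obtain v where v: "arr (Kcat A) v" "src v = tgt x" "tgt v = tgt x" "(x \<odot>\<^bsub>Kcat A\<^esub> y) \<odot>\<^bsub>Kcat A\<^esub> v = aid (Kcat A) (tgt x)"
    by (rule kc_inverse_of_zk[OF s(6,4), unfolded s(2), OF 2]) blast
  show ?thesis
    by (rule kc.aiso_left_right[of x "u \<odot>\<^bsub>Kcat A\<^esub> y" "y \<odot>\<^bsub>Kcat A\<^esub> v"]) (use u v x y in simp_all)
qed

lemma wk_aiso: "kc.aiso x \<Longrightarrow> kw.aiso (wk x)"
proof -
  assume x: "kc.aiso x"
  then obtain y where y: "\<guillemotleft>y :\<^bsub>Kcat A\<^esub> tgt x \<rightarrow> src x\<guillemotright>" "y \<odot>\<^bsub>Kcat A\<^esub> x = aid (Kcat A) (src x)" "x \<odot>\<^bsub>Kcat A\<^esub> y = aid (Kcat A) (tgt x)"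
    by (rule kc.aisoE)
  have "wk y \<odot>\<^bsub>Kw A\<^esub> wk x = aid (Kw A) (src x)" "wk x \<odot>\<^bsub>Kw A\<^esub> wk y = aid (Kw A) (tgt x)"
    using arg_cong[OF y(2), of wk] arg_cong[OF y(3), of wk] y(1) kc.aiso_arr[OF x] by (simp_all add: wk_ops)
  then show ?thesis using y(1) kc.aiso_arr[OF x] by (intro kw.aisoI[of _ "wk y"]) simp_all
qed

end

section \<open>Shifts of complexes, of homotopy classes and of classes modulo $Z$\<close>

lemma cpx_eqI: "\<lbrakk>\<And>i. cob X i = cob Y i; \<And>i. dif X i = dif Y i\<rbrakk> \<Longrightarrow> X = (Y :: ('o, 'm) cpx)"
  by (intro cpx.equality ext) (simp_all add: dif_def)

lemma cob_ShO [simp]: "cob (ShO (complexes A) n X) i = cob X (i + n)"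
  by (simp add: complexes_def)

lemma cm_ash [simp]: "cm (ash (complexes A) n f) i = cm f (i + n)"
  by (simp add: cm_def ash_def) (simp add: complexes_def)

context cpx_category
begin

lemma dif_ShO: "dif (ShO CA n X) i = (if even n then dif X (i + n) else \<ominus> (dif X (i + n)))"
  by (rule arrow_eqI) (simp_all add: algebra_simps dif_def arrow_mor complexes_def)

lemma ShO_CA [simp]: "X \<in> Obj CA \<Longrightarrow> ShO CA n X \<in> Obj CA"
proof -
  assume X: "X \<in> Obj CA"
  have i: "i + 1 + n = i + n + 1" "i + 2 + n = i + n + 2" for i by simp_all
  show ?thesis
    using cpxD(1,3)[OF X] cpxD(2)[OF X, of "i + n" for i] unfolding cpx_obj_iff by (simp add: dif_ShO i)
qed

lemma ShO_CA_add [simp]: "X \<in> Obj CA \<Longrightarrow> ShO CA m (ShO CA n X) = ShO CA (m + n) X"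
  using cpxD(1)[of X] by (intro cpx_eqI) (auto simp: dif_ShO add.assoc)

lemma ShO_CA_0 [simp]: "X \<in> Obj CA \<Longrightarrow> ShO CA 0 X = X"
  by (intro cpx_eqI) (auto simp: dif_ShO)

lemma arr_ash_CA [simp]: "arr CA f \<Longrightarrow> arr CA (ash CA n f)"
proof -
  assume f: "arr CA f"
  have i: "i + 1 + n = i + n + 1" for i by simp
  note [simp] = arr_cpxD[OF f] cpxD[OF arr_cpxD(1)[OF f]] cpxD[OF arr_cpxD(2)[OF f]]
  show ?thesis unfolding arr_cpx_iff[of "ash CA n f"] by (simp add: dif_ShO i)
qed

lemma ash_CA_ops:
  "ash CA n (g \<odot>\<^bsub>CA\<^esub> f) = ash CA n g \<odot>\<^bsub>CA\<^esub> ash CA n f" "ash CA n (g \<oplus>\<^bsub>CA\<^esub> f) = ash CA n g \<oplus>\<^bsub>CA\<^esub> ash CA n f"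
  "arr CA f \<Longrightarrow> ash CA n (\<ominus>\<^bsub>CA\<^esub> f) = \<ominus>\<^bsub>CA\<^esub> (ash CA n f)" "ash CA n (aid CA X) = aid CA (ShO CA n X)"
  "arr CA f \<Longrightarrow> ash CA m (ash CA n f) = ash CA (m + n) f" "arr CA f \<Longrightarrow> ash CA 0 f = f"
  by (rule cm_eqI; simp add: arr_cpxD add.assoc)+

text \<open>For odd $n$ the differential of the shifted complex changes sign, so the homotopies must
  do the same.\<close>

lemma zhtp_ash:
  assumes f: "zhtp f s t"
  shows "zhtp (ash CA n f) (\<lambda>i. if even n then s (i + n) else \<ominus> (s (i + n))) (\<lambda>i. if even n then t (i + n) else \<ominus> (t (i + n)))"
proof -
  note D = zhtpD[OF f]
  have i: "i + 1 + n = i + n + 1" "i - 1 + n = i + n - 1" for i by simp_all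
  have d: "\<guillemotleft>dif (tgt f) (i - 1) :\<^bsub>A\<^esub> cob (tgt f) (i - 1) \<rightarrow> cob (tgt f) i\<guillemotright>" "\<guillemotleft>s (i + 1) :\<^bsub>A\<^esub> cob (src f) (i + 1) \<rightarrow> cob (tgt f) i\<guillemotright>" for i
    using cpxD(1,3)[OF arr_cpxD(2)[OF D(1)]] hmtD[OF D(2), of "i + 1"] by simp_all
  note [simp] = D(1) hmtD[OF D(2)] hmtD[OF D(3)] cpxD[OF arr_cpxD(1)[OF D(1)]] cpxD[OF arr_cpxD(2)[OF D(1)]] d
  show ?thesis unfolding zhtp_def hmt_def by (simp add: dif_ShO i D(4))
qed

text \<open>The shift acts on a coset elementwise. The image is again a coset because the shift maps
  the null-homotopic maps onto the null-homotopic maps; surjectivity is seen by shifting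
  back.\<close>

lemma ash_kq: "arr CA f \<Longrightarrow> ash (Kcat A) n (kq f) = kq (ash CA n f)"
proof -
  assume f: "arr CA f"
  define X Y where "X = src f" and "Y = tgt f"
  have o: "X \<in> Obj CA" "Y \<in> Obj CA" "mor f \<in> Hom CA X Y" using f by (auto simp: arr_def X_def Y_def)
  have sub: "ShM CA m ` null_homotopic A X Y \<subseteq> null_homotopic A (ShO CA m X) (ShO CA m Y)" if o: "X \<in> Obj CA" "Y \<in> Obj CA" for m X Y
  proof
    fix x assume "x \<in> ShM CA m ` null_homotopic A X Y"
    then obtain y where y: "x = ShM CA m y" "y \<in> null_homotopic A X Y" by blast
    define g where "g = Arrow X Y y"
    have g: "arr CA g" "src g = X" "tgt g = Y" using y(2) o by (simp_all add: g_def arr_Arrow null_homotopic_def)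
    obtain s where "zhtp g s s" using null_iff[OF g(1)] g y(2) by (auto simp: g_def)
    from zhtp_ash[OF this, of m] have "mor (ash CA m g) \<in> null_homotopic A (src (ash CA m g)) (tgt (ash CA m g))"
      using null_iff[of "ash CA m g"] g(1) by auto
    then show "x \<in> null_homotopic A (ShO CA m X) (ShO CA m Y)" using g y(1) by (simp add: g_def ash_def)
  qed
  have im: "ShM CA n ` null_homotopic A X Y = null_homotopic A (ShO CA n X) (ShO CA n Y)"
  proof
    show "null_homotopic A (ShO CA n X) (ShO CA n Y) \<subseteq> ShM CA n ` null_homotopic A X Y"
    proof
      fix x assume "x \<in> null_homotopic A (ShO CA n X) (ShO CA n Y)"
      then have "ShM CA (-n) x \<in> null_homotopic A X Y" using sub[of "ShO CA n X" "ShO CA n Y" "-n"] o by auto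
      moreover have "x = ShM CA n (ShM CA (-n) x)" by (simp add: complexes_def)
      ultimately show "x \<in> ShM CA n ` null_homotopic A X Y" by blast
    qed
  qed (use sub o in blast)
  have "ShM k.Q n (quot_class CA (null_homotopic A) X Y (mor f)) = quot_class CA (null_homotopic A) (ShO CA n X) (ShO CA n Y) (ShM CA n (mor f))"
    by (rule k.ShM_quot_class[OF o im]) (simp add: complexes_def)
  then show ?thesis by (simp add: ash_def kq_def k.qa_def Kcat_sel X_def Y_def) (simp add: quot_cat_def)
qed

lemma ShO_Kcat [simp]: "ShO (Kcat A) = ShO CA"
  by (simp add: Kcat_sel) (simp add: quot_cat_def)

lemma arr_ash_Kcat [simp]: "arr (Kcat A) x \<Longrightarrow> arr (Kcat A) (ash (Kcat A) n x)"
  using arr_Kcat_cases[of x] by (auto simp: ash_kq)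

lemma ash_Kcat_ops:
  "\<lbrakk>arr (Kcat A) f; arr (Kcat A) g; src g = tgt f\<rbrakk> \<Longrightarrow> ash (Kcat A) n (g \<odot>\<^bsub>Kcat A\<^esub> f) = ash (Kcat A) n g \<odot>\<^bsub>Kcat A\<^esub> ash (Kcat A) n f"
  "\<lbrakk>arr (Kcat A) f; arr (Kcat A) g; src g = src f; tgt g = tgt f\<rbrakk> \<Longrightarrow> ash (Kcat A) n (g \<oplus>\<^bsub>Kcat A\<^esub> f) = ash (Kcat A) n g \<oplus>\<^bsub>Kcat A\<^esub> ash (Kcat A) n f"
  "arr (Kcat A) f \<Longrightarrow> ash (Kcat A) n (\<ominus>\<^bsub>Kcat A\<^esub> f) = \<ominus>\<^bsub>Kcat A\<^esub> (ash (Kcat A) n f)"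
  "X \<in> Obj CA \<Longrightarrow> ash (Kcat A) n (aid (Kcat A) X) = aid (Kcat A) (ShO CA n X)"
  "arr (Kcat A) f \<Longrightarrow> ash (Kcat A) m (ash (Kcat A) n f) = ash (Kcat A) (m + n) f" "arr (Kcat A) f \<Longrightarrow> ash (Kcat A) 0 f = f"
proof -
  assume f: "arr (Kcat A) f"
  obtain f' where f': "arr CA f'" "f = kq f'" using arr_Kcat_cases f by blast
  show "ash (Kcat A) n (\<ominus>\<^bsub>Kcat A\<^esub> f) = \<ominus>\<^bsub>Kcat A\<^esub> (ash (Kcat A) n f)" "ash (Kcat A) m (ash (Kcat A) n f) = ash (Kcat A) (m + n) f" "ash (Kcat A) 0 f = f"
    using f' by (simp_all add: ash_kq kq_ops(3)[symmetric] ash_CA_ops)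
  assume g: "arr (Kcat A) g"
  obtain g' where g': "arr CA g'" "g = kq g'" using arr_Kcat_cases g by blast
  show "ash (Kcat A) n (g \<odot>\<^bsub>Kcat A\<^esub> f) = ash (Kcat A) n g \<odot>\<^bsub>Kcat A\<^esub> ash (Kcat A) n f" if "src g = tgt f"
    using f' g' that by (simp add: ash_kq kq_ops(1)[symmetric] ash_CA_ops)
  show "ash (Kcat A) n (g \<oplus>\<^bsub>Kcat A\<^esub> f) = ash (Kcat A) n g \<oplus>\<^bsub>Kcat A\<^esub> ash (Kcat A) n f" if "src g = src f" "tgt g = tgt f"
    using f' g' that by (simp add: ash_kq kq_ops(2)[symmetric] ash_CA_ops)
next
  show "X \<in> Obj CA \<Longrightarrow> ash (Kcat A) n (aid (Kcat A) X) = aid (Kcat A) (ShO CA n X)"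
    by (simp add: kq_ops(4)[symmetric] ash_kq ash_CA_ops)
qed

lemma ash_Kcat_aiso: "kc.aiso x \<Longrightarrow> kc.aiso (ash (Kcat A) n x)"
proof -
  assume x: "kc.aiso x"
  obtain y where y: "\<guillemotleft>y :\<^bsub>Kcat A\<^esub> tgt x \<rightarrow> src x\<guillemotright>" "y \<odot>\<^bsub>Kcat A\<^esub> x = aid (Kcat A) (src x)" "x \<odot>\<^bsub>Kcat A\<^esub> y = aid (Kcat A) (tgt x)"
    using x by (rule kc.aisoE)
  have "ash (Kcat A) n y \<odot>\<^bsub>Kcat A\<^esub> ash (Kcat A) n x = aid (Kcat A) (ShO CA n (src x))"
    "ash (Kcat A) n x \<odot>\<^bsub>Kcat A\<^esub> ash (Kcat A) n y = aid (Kcat A) (ShO CA n (tgt x))"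
    using y kc.aiso_arr[OF x] by (simp_all flip: ash_Kcat_ops(1) add: ash_Kcat_ops(4))
  then show ?thesis using y(1) kc.aiso_arr[OF x] by (intro kc.aisoI[of _ "ash (Kcat A) n y"]) simp_all
qed

lemma ash_wk: "arr (Kcat A) x \<Longrightarrow> ash (Kw A) n (wk x) = wk (ash (Kcat A) n x)"
proof -
  assume x: "arr (Kcat A) x"
  define X Y where "X = src x" and "Y = tgt x"
  have o: "X \<in> Obj CA" "Y \<in> Obj CA" "mor x \<in> Hom (Kcat A) X Y" using x by (auto simp: arr_def X_def Y_def)
  have o': "X \<in> Obj (Kcat A)" "Y \<in> Obj (Kcat A)" using o by simp_all
  have sub: "ShM (Kcat A) m ` Zideal A X Y \<subseteq> Zideal A (ShO CA m X) (ShO CA m Y)" if o: "X \<in> Obj CA" "Y \<in> Obj CA" for m X Y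
  proof
    fix u assume "u \<in> ShM (Kcat A) m ` Zideal A X Y"
    then obtain y where y: "u = ShM (Kcat A) m y" "y \<in> Zideal A X Y" by blast
    define g where "g = Arrow X Y y"
    have g: "arr (Kcat A) g" "src g = X" "tgt g = Y" using y(2) o z.I_Hom[of X Y y] by (simp_all add: g_def arr_Arrow)
    have "zk g" using Zideal_iff[OF g(1)] g y(2) by (simp add: g_def)
    then obtain f s t where f: "g = kq f" "zhtp f s t" by (auto simp: zk_def)
    have "zk (ash (Kcat A) m g)" unfolding f(1) using zhtp_ash[OF f(2), of m] zhtpD(1)[OF f(2)] by (auto simp: zk_def ash_kq)
    then have "mor (ash (Kcat A) m g) \<in> Zideal A (ShO CA m X) (ShO CA m Y)" using Zideal_iff[of "ash (Kcat A) m g"] g by simp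
    then show "u \<in> Zideal A (ShO CA m X) (ShO CA m Y)" using y(1) by (simp add: g_def ash_def)
  qed
  have im: "ShM (Kcat A) n ` Zideal A X Y = Zideal A (ShO (Kcat A) n X) (ShO (Kcat A) n Y)"
  proof
    show "Zideal A (ShO (Kcat A) n X) (ShO (Kcat A) n Y) \<subseteq> ShM (Kcat A) n ` Zideal A X Y"
    proof
      fix u assume u: "u \<in> Zideal A (ShO (Kcat A) n X) (ShO (Kcat A) n Y)"
      then have 1: "ShM (Kcat A) (-n) u \<in> Zideal A X Y" using sub[of "ShO CA n X" "ShO CA n Y" "-n"] o by auto
      have "arr (Kcat A) (Arrow (ShO CA n X) (ShO CA n Y) u)" using z.I_Hom[OF _ _ u] o by (simp add: arr_Arrow)
      from ash_Kcat_ops(5)[OF this, of n "-n"] ash_Kcat_ops(6)[OF this]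
      have "u = ShM (Kcat A) n (ShM (Kcat A) (-n) u)" by (simp add: ash_def)
      then show "u \<in> ShM (Kcat A) n ` Zideal A X Y" using 1 by blast
    qed
  qed (use sub[OF o(1,2)] in simp)
  have pl: "ShM (Kcat A) n (g \<boxplus>\<^bsub>Kcat A\<^esub> h) = ShM (Kcat A) n g \<boxplus>\<^bsub>Kcat A\<^esub> ShM (Kcat A) n h"
    if "g \<in> Hom (Kcat A) X Y" "h \<in> Hom (Kcat A) X Y" for g h
    using arg_cong[OF ash_Kcat_ops(2)[of "Arrow X Y h" "Arrow X Y g" n], of mor] that o by (simp add: arr_Arrow arrow_mor ash_def)
  have "ShM z.Q n (quot_class (Kcat A) (Zideal A) X Y (mor x)) = quot_class (Kcat A) (Zideal A) (ShO (Kcat A) n X) (ShO (Kcat A) n Y) (ShM (Kcat A) n (mor x))"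
    by (rule z.ShM_quot_class[OF o' o(3) im pl])
  moreover have "ShO z.Q = ShO CA" using ShO_Kcat by (simp add: quot_cat_def)
  ultimately show ?thesis by (simp add: ash_def wk_def z.qa_def Kw_sel X_def Y_def)
qed

lemma ShO_Kw [simp]: "ShO (Kw A) = ShO CA"
  using ShO_Kcat by (simp add: Kw_sel quot_cat_def)

end

section \<open>Cones of complexes\<close>

context cpx_category
begin

definition iscone where
  "iscone \<phi> Z e1 e2 p1 p2 \<longleftrightarrow> arr CA \<phi> \<and> Z \<in> Obj CA \<and> (\<forall>i. abiproduct A (e1 i) (e2 i) (p1 i) (p2 i) \<and>
     src (e1 i) = cob (src \<phi>) (i + 1) \<and> src (e2 i) = cob (tgt \<phi>) i \<and> tgt (e2 i) = cob Z i \<and>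
     dif Z i = e1 (i + 1) \<odot> \<ominus> (dif (src \<phi>) (i + 1)) \<odot> p1 i \<oplus> e2 (i + 1) \<odot> cm \<phi> (i + 1) \<odot> p1 i \<oplus> e2 (i + 1) \<odot> dif (tgt \<phi>) i \<odot> p2 i)"

lemma isconeD:
  assumes "iscone \<phi> Z e1 e2 p1 p2"
  shows "arr CA \<phi>" "Z \<in> Obj CA" "arr A (e1 i)" "src (e1 i) = cob (src \<phi>) (i + 1)" "tgt (e1 i) = cob Z i"
    "arr A (e2 i)" "src (e2 i) = cob (tgt \<phi>) i" "tgt (e2 i) = cob Z i"
    "arr A (p1 i)" "src (p1 i) = cob Z i" "tgt (p1 i) = cob (src \<phi>) (i + 1)"
    "arr A (p2 i)" "src (p2 i) = cob Z i" "tgt (p2 i) = cob (tgt \<phi>) i"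
    "p1 i \<odot> e1 i = aid A (cob (src \<phi>) (i + 1))" "p2 i \<odot> e2 i = aid A (cob (tgt \<phi>) i)"
    "p1 i \<odot> e2 i = azero A (cob (tgt \<phi>) i) (cob (src \<phi>) (i + 1))" "p2 i \<odot> e1 i = azero A (cob (src \<phi>) (i + 1)) (cob (tgt \<phi>) i)"
    "e1 i \<odot> p1 i \<oplus> e2 i \<odot> p2 i = aid A (cob Z i)"
    "dif Z i = e1 (i + 1) \<odot> \<ominus> (dif (src \<phi>) (i + 1)) \<odot> p1 i \<oplus> e2 (i + 1) \<odot> cm \<phi> (i + 1) \<odot> p1 i \<oplus> e2 (i + 1) \<odot> dif (tgt \<phi>) i \<odot> p2 i"
  using assms by (auto simp: iscone_def abiproduct_def)

lemma cone_objs: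
  assumes "arr CA \<phi>"
  shows "\<guillemotleft>cm \<phi> i :\<^bsub>A\<^esub> cob (src \<phi>) i \<rightarrow> cob (tgt \<phi>) i\<guillemotright>" "\<guillemotleft>dif (src \<phi>) i :\<^bsub>A\<^esub> cob (src \<phi>) i \<rightarrow> cob (src \<phi>) (i + 1)\<guillemotright>"
   "\<guillemotleft>dif (tgt \<phi>) i :\<^bsub>A\<^esub> cob (tgt \<phi>) i \<rightarrow> cob (tgt \<phi>) (i + 1)\<guillemotright>"
  using arr_cpxD[OF assms] cpxD[OF arr_cpxD(1)[OF assms]] cpxD[OF arr_cpxD(2)[OF assms]] by simp_all

text \<open>The columns and the rows of the differential as a triangular matrix; later computations
  use these instead of the full formula.\<close>

lemma cone_dif:
  assumes "iscone \<phi> Z e1 e2 p1 p2"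
  shows "dif Z i \<odot> e1 i = \<ominus> (e1 (i + 1) \<odot> dif (src \<phi>) (i + 1)) \<oplus> e2 (i + 1) \<odot> cm \<phi> (i + 1)"
    "dif Z i \<odot> e2 i = e2 (i + 1) \<odot> dif (tgt \<phi>) i"
    "p1 (i + 1) \<odot> dif Z i = \<ominus> (dif (src \<phi>) (i + 1) \<odot> p1 i)"
    "p2 (i + 1) \<odot> dif Z i = cm \<phi> (i + 1) \<odot> p1 i \<oplus> dif (tgt \<phi>) i \<odot> p2 i"
proof -
  note D = isconeD[OF assms]
  note [simp] = D(3-14) cone_objs[OF D(1)] acomp_eq[OF D(15)] acomp_eq[OF D(16)] acomp_eq[OF D(17)] acomp_eq[OF D(18)] D(15-18)
    cpxD(3)[OF arr_cpxD(1)[OF D(1)]] cpxD(3)[OF arr_cpxD(2)[OF D(1)]] cpxD(3)[OF D(2)] add.commute[of 1] add.commute[of 2]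
  show "dif Z i \<odot> e1 i = \<ominus> (e1 (i + 1) \<odot> dif (src \<phi>) (i + 1)) \<oplus> e2 (i + 1) \<odot> cm \<phi> (i + 1)"
    "dif Z i \<odot> e2 i = e2 (i + 1) \<odot> dif (tgt \<phi>) i"
    "p1 (i + 1) \<odot> dif Z i = \<ominus> (dif (src \<phi>) (i + 1) \<odot> p1 i)"
    "p2 (i + 1) \<odot> dif Z i = cm \<phi> (i + 1) \<odot> p1 i \<oplus> dif (tgt \<phi>) i \<odot> p2 i"
    unfolding D(20) by simp_all
qed

lemma cone_maps:
  assumes c: "iscone \<phi> Z e1 e2 p1 p2"
  shows "arr CA (mkc (tgt \<phi>) Z e2)" "arr CA (mkc Z (ShO CA 1 (src \<phi>)) p1)"
proof -
  note D = isconeD[OF c]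
  note [simp] = D(2-14) cone_objs[OF D(1)] arr_cpxD(1,2)[OF D(1)] cpxD(1)[OF D(2)]
  show "arr CA (mkc (tgt \<phi>) Z e2)" "arr CA (mkc Z (ShO CA 1 (src \<phi>)) p1)"
    by (simp_all add: arr_cpx_iff[of "mkc X Y u" for X Y u] cone_dif[OF c] dif_ShO)
qed

lemma iscone_exists:
  assumes \<phi>: "arr CA \<phi>"
  obtains Z e1 e2 p1 p2 where "iscone \<phi> Z e1 e2 p1 p2"
proof -
  note [simp] = cone_objs[OF \<phi>]
  have "\<exists>e1 e2 p1 p2. abiproduct A e1 e2 p1 p2 \<and> src e1 = cob (src \<phi>) (i + 1) \<and> src e2 = cob (tgt \<phi>) i" for i
  proof -
    obtain S e1 e2 p1 p2 where b: "biproduct A (cob (src \<phi>) (i + 1)) (cob (tgt \<phi>) i) S e1 e2 p1 p2"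
      using biproduct_exists[of "cob (src \<phi>) (i + 1)" "cob (tgt \<phi>) i"] cone_objs[OF \<phi>] by blast
    have "abiproduct A (Arrow (cob (src \<phi>) (i + 1)) S e1) (Arrow (cob (tgt \<phi>) i) S e2) (Arrow S (cob (src \<phi>) (i + 1)) p1) (Arrow S (cob (tgt \<phi>) i) p2)"
      using b abiproduct_iff[of "cob (src \<phi>) (i + 1)" A "cob (tgt \<phi>) i"] cone_objs[OF \<phi>] by blast
    then show ?thesis by fastforce
  qed
  then obtain e1 where "\<forall>i. \<exists>e2 p1 p2. abiproduct A (e1 i) e2 p1 p2 \<and> src (e1 i) = cob (src \<phi>) (i + 1) \<and> src e2 = cob (tgt \<phi>) i"
    by metis
  then obtain e2 p1 p2 where b: "\<And>i. abiproduct A (e1 i) (e2 i) (p1 i) (p2 i)" "\<And>i. src (e1 i) = cob (src \<phi>) (i + 1)"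
     "\<And>i. src (e2 i) = cob (tgt \<phi>) i" by metis
  define S where "S i = src (p1 i)" for i
  have bS: "S i \<in> Obj A" for i
    using b(1)[of i] arrD(1)[of A "p1 i"] by (simp add: S_def abiproduct_def)
  define d where "d i = e1 (i + 1) \<odot> \<ominus> (dif (src \<phi>) (i + 1)) \<odot> p1 i \<oplus> e2 (i + 1) \<odot> cm \<phi> (i + 1) \<odot> p1 i \<oplus> e2 (i + 1) \<odot> dif (tgt \<phi>) i \<odot> p2 i" for i
  have t: "arr A (e1 i)" "src (e1 i) = cob (src \<phi>) (i + 1)" "tgt (e1 i) = S i"
    "arr A (e2 i)" "src (e2 i) = cob (tgt \<phi>) i" "tgt (e2 i) = S i"
    "arr A (p1 i)" "src (p1 i) = S i" "tgt (p1 i) = cob (src \<phi>) (i + 1)"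
    "arr A (p2 i)" "src (p2 i) = S i" "tgt (p2 i) = cob (tgt \<phi>) i"
    "p1 i \<odot> e1 i = aid A (cob (src \<phi>) (i + 1))" "p2 i \<odot> e2 i = aid A (cob (tgt \<phi>) i)"
    "p1 i \<odot> e2 i = azero A (cob (tgt \<phi>) i) (cob (src \<phi>) (i + 1))" "p2 i \<odot> e1 i = azero A (cob (src \<phi>) (i + 1)) (cob (tgt \<phi>) i)" for i
    using b[of i] by (simp_all add: abiproduct_def S_def)
  note [simp] = t(1-12) bS acomp_eq[OF t(13)] acomp_eq[OF t(14)] acomp_eq[OF t(15)] acomp_eq[OF t(16)]
  have d: "\<guillemotleft>d i :\<^bsub>A\<^esub> S i \<rightarrow> S (i + 1)\<guillemotright>" for i by (simp add: d_def)
  define Z where "Z = \<lparr>cob = S, cdf = \<lambda>i. mor (d i)\<rparr>"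
  have Z: "dif Z i = d i" "cob Z i = S i" for i using d[of i] by (auto simp: dif_def Z_def intro: arrow_eqI)
  have xx: "dif (src \<phi>) (i + 1) \<odot> dif (src \<phi>) i \<odot> x = azero A (src x) (cob (src \<phi>) (i + 2))" if "arr A x" "tgt x = cob (src \<phi>) i" for x i
    using acomp_eq[OF cpxD(2)[OF arr_cpxD(1)[OF \<phi>], of i], of x] that cone_objs[OF \<phi>] by simp
  have yy: "dif (tgt \<phi>) (i + 1) \<odot> dif (tgt \<phi>) i \<odot> x = azero A (src x) (cob (tgt \<phi>) (i + 2))" if "arr A x" "tgt x = cob (tgt \<phi>) i" for x i
    using acomp_eq[OF cpxD(2)[OF arr_cpxD(2)[OF \<phi>], of i], of x] that cone_objs[OF \<phi>] by simp
  have xy: "cm \<phi> (i + 1) \<odot> dif (src \<phi>) i \<odot> x = dif (tgt \<phi>) i \<odot> cm \<phi> i \<odot> x" if "arr A x" "tgt x = cob (src \<phi>) i" for x i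
    using acomp_eq[OF arr_cpxD(4)[OF \<phi>, of i], of x] that by simp
  have "d (i + 1) \<odot> d i = azero A (S i) (S (i + 2))" for i
  proof -
    have 1: "d (i + 1) \<odot> e1 (i + 1) = \<ominus> (e1 (i + 2) \<odot> dif (src \<phi>) (i + 2)) \<oplus> e2 (i + 2) \<odot> cm \<phi> (i + 2)"
      "d (i + 1) \<odot> e2 (i + 1) = e2 (i + 2) \<odot> dif (tgt \<phi>) (i + 1)"
      unfolding d_def by (simp_all add: t add.commute[of 1] add.commute[of 2])
    have t2: "src (e1 (i + 2)) = cob (src \<phi>) (i + 3)" "tgt (dif (src \<phi>) (i + 2)) = cob (src \<phi>) (i + 3)" "tgt (dif (src \<phi>) (i + 1)) = cob (src \<phi>) (i + 2)"
      "tgt (dif (tgt \<phi>) (i + 1)) = cob (tgt \<phi>) (i + 2)"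
      by (simp_all add: add.commute[of 1] add.commute[of 2] add.commute[of 3])
    have zx: "dif (src \<phi>) (i + 2) \<odot> dif (src \<phi>) (i + 1) \<odot> p1 i = azero A (S i) (cob (src \<phi>) (i + 3))"
      using xx[of "p1 i" "i + 1"] by (simp add: add.commute[of 1] add.commute[of 2] add.commute[of 3])
    have zy: "dif (tgt \<phi>) (i + 1) \<odot> dif (tgt \<phi>) i \<odot> p2 i = azero A (S i) (cob (tgt \<phi>) (i + 2))" using yy[of "p2 i" i] by simp
    have zz: "cm \<phi> (i + 2) \<odot> dif (src \<phi>) (i + 1) \<odot> p1 i = dif (tgt \<phi>) (i + 1) \<odot> cm \<phi> (i + 1) \<odot> p1 i"
      using xy[of "p1 i" "i + 1"] by (simp add: add.commute[of 2])
    note [simp] = t2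
    have "d (i + 1) \<odot> d i = (d (i + 1) \<odot> e1 (i + 1)) \<odot> \<ominus> (dif (src \<phi>) (i + 1)) \<odot> p1 i
       \<oplus> (d (i + 1) \<odot> e2 (i + 1)) \<odot> cm \<phi> (i + 1) \<odot> p1 i \<oplus> (d (i + 1) \<odot> e2 (i + 1)) \<odot> dif (tgt \<phi>) i \<odot> p2 i"
      unfolding d_def[of i] using d[of "i + 1"] by simp
    also have "\<dots> = azero A (S i) (S (i + 2))"
      unfolding 1 by (simp add: zx zy zz add.commute[of 1] add.commute[of 2] add.commute[of 3])
    finally show ?thesis .
  qed
  then have "Z \<in> Obj CA" unfolding cpx_obj_iff Z using d by simp
  then have "iscone \<phi> Z e1 e2 p1 p2" unfolding iscone_def Z using \<phi> b t by (simp add: d_def)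
  then show ?thesis by (rule that)
qed

text \<open>Let $X -> W -> Z$ split in each degree, with section $s$ and retraction $r$. In this
  splitting the differential of $W$ is triangular, with those of $Z$ and $X$ on the diagonal and $r
  d s$ off it. The latter is a chain map from $Z[-1]$ to $X$, and $W$ is its cone.\<close>

lemma split_cone:
  assumes e: "arr CA e" and q: "arr CA q" and eq: "src q = tgt e"
    and b: "\<And>i. abiproduct A (s i) (cm e i) (cm q i) (r i)" and s: "\<And>i. src (s i) = cob (tgt q) i"
  obtains \<phi> where "iscone \<phi> (tgt e) s (cm e) (cm q) r" "src \<phi> = ShO CA (-1) (tgt q)" "tgt \<phi> = src e"
proof -
  define X W Z where "X = src e" and "W = tgt e" and "Z = tgt q"
  have o: "src e = X" "tgt e = W" "src q = W" "tgt q = Z" "X \<in> Obj CA" "W \<in> Obj CA" "Z \<in> Obj CA"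
    using eq arr_cpxD(1,2)[OF e] arr_cpxD(1,2)[OF q] by (simp_all add: X_def W_def Z_def)
  note [simp] = cpxD(1,3)[OF o(5)] cpxD(1,3)[OF o(6)] cpxD(1,3)[OF o(7)]
  have t: "arr A (s i)" "src (s i) = cob Z i" "tgt (s i) = cob W i" "arr A (r i)" "src (r i) = cob W i" "tgt (r i) = cob X i"
    "arr A (cm e i)" "arr A (cm q i)"
    "cm q i \<odot> s i = aid A (cob Z i)" "r i \<odot> cm e i = aid A (cob X i)" "r i \<odot> s i = azero A (cob Z i) (cob X i)"
    "cm q i \<odot> cm e i = azero A (cob X i) (cob Z i)" "s i \<odot> cm q i \<oplus> cm e i \<odot> r i = aid A (cob W i)" for i
    using b[of i] s[of i] o by (simp_all add: abiproduct_def)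
  note [simp] = t(1-8) o(1-4)
  have ce: "dif W i \<odot> cm e i = cm e (i + 1) \<odot> dif X i" "cm q (i + 1) \<odot> dif W i = dif Z i \<odot> cm q i" for i
    using arr_cpxD(4)[OF e, of i] arr_cpxD(4)[OF q, of i] by simp_all
  define f where "f i = r i \<odot> dif W (i - 1) \<odot> s (i - 1)" for i
  have f: "\<guillemotleft>f i :\<^bsub>A\<^esub> cob Z (i - 1) \<rightarrow> cob X i\<guillemotright>" for i
    using cpxD(1,3)[OF o(6), of "i - 1"] cpxD(3)[OF o(7), of "i - 1"] by (simp add: f_def)
  define \<phi> where "\<phi> = mkc (ShO CA (-1) Z) X f"
  have cm\<phi>: "cm \<phi> i = f i" for i unfolding \<phi>_def using f by simp
  have id: "x = s i \<odot> cm q i \<odot> x \<oplus> cm e i \<odot> r i \<odot> x" if "arr A x" "tgt x = cob W i" for x i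
    using arg_cong[OF t(13)[of i], of "\<lambda>y. y \<odot> x"] that by simp
  have dW: "dif W i = s (i + 1) \<odot> dif Z i \<odot> cm q i \<oplus> cm e (i + 1) \<odot> f (i + 1) \<odot> cm q i \<oplus> cm e (i + 1) \<odot> dif X i \<odot> r i" for i
  proof -
    have "dif W i = dif W i \<odot> (s i \<odot> cm q i \<oplus> cm e i \<odot> r i)" by (simp add: t)
    also have "\<dots> = dif W i \<odot> s i \<odot> cm q i \<oplus> cm e (i + 1) \<odot> dif X i \<odot> r i"
      using acomp_eq[OF ce(1)[of i], of "r i"] by simp
    also have "dif W i \<odot> s i \<odot> cm q i = s (i + 1) \<odot> dif Z i \<odot> cm q i \<oplus> cm e (i + 1) \<odot> f (i + 1) \<odot> cm q i"
      using id[of "dif W i \<odot> s i \<odot> cm q i" "i + 1"] acomp_eq[OF ce(2)[of i], of "s i \<odot> cm q i"] acomp_eq[OF t(9)[of i], of "cm q i"]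
      by (simp add: f_def)
    finally show ?thesis using f[of "i + 1"] by simp
  qed
  have "f (i + 1) \<odot> dif Z (i - 1) \<oplus> dif X i \<odot> f i = azero A (cob Z (i - 1)) (cob X (i + 1))" for i
  proof -
    have [simp]: "\<guillemotleft>dif W (i - 1) :\<^bsub>A\<^esub> cob W (i - 1) \<rightarrow> cob W i\<guillemotright>" "\<guillemotleft>dif Z (i - 1) :\<^bsub>A\<^esub> cob Z (i - 1) \<rightarrow> cob Z i\<guillemotright>"
      using cpxD(1,3)[OF o(6), of "i - 1"] cpxD(1,3)[OF o(7), of "i - 1"] by simp_all
    have ce': "cm q i \<odot> dif W (i - 1) = dif Z (i - 1) \<odot> cm q (i - 1)" using ce(2)[of "i - 1"] by simp
    \<comment> \<open>The off-diagonal entry of $d d = 0$ on $W$ is the chain map condition for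
      \<open>f\<close>, with the sign carried by the differential of $Z[-1]$.\<close>
    have "r (i + 1) \<odot> dif W i \<odot> dif W (i - 1) \<odot> s (i - 1) = azero A (cob Z (i - 1)) (cob X (i + 1))"
      using acomp_eq[OF cpx_dif_dif[OF o(6), of i], of "s (i - 1)"] by simp
    moreover have "dif W (i - 1) \<odot> s (i - 1) = s i \<odot> dif Z (i - 1) \<oplus> cm e i \<odot> f i"
      using id[of "dif W (i - 1) \<odot> s (i - 1)" i] acomp_eq[OF ce', of "s (i - 1)"] by (simp add: t f_def)
    ultimately have "r (i + 1) \<odot> dif W i \<odot> (s i \<odot> dif Z (i - 1) \<oplus> cm e i \<odot> f i) = azero A (cob Z (i - 1)) (cob X (i + 1))" by simp
    then show ?thesis using acomp_eq[OF ce(1)[of i], of "f i"] acomp_eq[OF t(10)[of "i + 1"], of "dif X i \<odot> f i"] f[of i]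
      by (simp add: f_def[of "i + 1"])
  qed
  then have ch: "f (i + 1) \<odot> \<ominus> (dif Z (i - 1)) = dif X i \<odot> f i" for i
    using aneg_unique[of "f (i + 1) \<odot> dif Z (i - 1)" "dif X i \<odot> f i"] f[of "i + 1"] f[of i] cpxD(1,3)[OF o(7), of "i - 1"] by simp
  have \<phi>: "arr CA \<phi>" "src \<phi> = ShO CA (-1) Z" "tgt \<phi> = X"
    using f ch o(5,7) by (simp_all add: arr_cpx_iff[of \<phi>] cm\<phi>) (simp_all add: \<phi>_def dif_ShO)
  have "iscone \<phi> W s (cm e) (cm q) r"
    unfolding iscone_def using \<phi> b t dW o(6) f[of "i + 1" for i] by (simp add: cm\<phi> dif_ShO)
  then show ?thesis using that[of \<phi>] \<phi> by simp
qed

end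

lemma (in preadditive_category) aplus_cancel_far:
  "\<lbrakk>arr C b; arr C c; src b = src c; tgt b = tgt c\<rbrakk> \<Longrightarrow> b \<oplus> c \<oplus> \<ominus> b = c"
  "\<lbrakk>arr C b; arr C c; src b = src c; tgt b = tgt c\<rbrakk> \<Longrightarrow> \<ominus> b \<oplus> c \<oplus> b = c"
  "\<lbrakk>arr C b; arr C c; arr C d; src b = src c; tgt b = tgt c; src c = src d; tgt c = tgt d\<rbrakk> \<Longrightarrow> b \<oplus> c \<oplus> \<ominus> b \<oplus> d = c \<oplus> d"
  "\<lbrakk>arr C b; arr C c; arr C d; src b = src c; tgt b = tgt c; src c = src d; tgt c = tgt d\<rbrakk> \<Longrightarrow> \<ominus> b \<oplus> c \<oplus> b \<oplus> d = c \<oplus> d"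
  "\<lbrakk>arr C b; arr C c; arr C d; src b = src c; tgt b = tgt c; src c = src d; tgt c = tgt d\<rbrakk> \<Longrightarrow> b \<oplus> c \<oplus> d \<oplus> \<ominus> b = c \<oplus> d"
  "\<lbrakk>arr C b; arr C c; arr C d; src b = src c; tgt b = tgt c; src c = src d; tgt c = tgt d\<rbrakk> \<Longrightarrow> \<ominus> b \<oplus> c \<oplus> d \<oplus> b = c \<oplus> d"
  "\<lbrakk>arr C b; arr C c; arr C d; arr C e; src b = src c; tgt b = tgt c; src c = src d; tgt c = tgt d; src e = src d; tgt e = tgt d\<rbrakk> \<Longrightarrow> b \<oplus> c \<oplus> d \<oplus> \<ominus> b \<oplus> e = c \<oplus> d \<oplus> e"
  "\<lbrakk>arr C b; arr C c; arr C d; arr C e; src b = src c; tgt b = tgt c; src c = src d; tgt c = tgt d; src e = src d; tgt e = tgt d\<rbrakk> \<Longrightarrow> \<ominus> b \<oplus> c \<oplus> d \<oplus> b \<oplus> e = c \<oplus> d \<oplus> e"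
  using aplus_left_comm[of "\<ominus> b" c] aplus_left_comm[of b c] aplus_left_comm[of "\<ominus> b" d] aplus_left_comm[of b d]
    aplus_comm[of b c] aplus_comm[of "\<ominus> b" c] aplus_comm[of b d] aplus_comm[of "\<ominus> b" d] by simp_all

lemma (in preadditive_category) aiso_is_iso: "aiso f \<Longrightarrow> is_iso C (src f) (tgt f) (mor f)"
  using is_iso_iff[of "src f" "tgt f" "mor f"] aiso_arr[of f] arrD(1,2)[of C f] by simp

section \<open>Triangles in the homotopy category\<close>

context cpx_category
begin

abbreviation "KA \<equiv> Kcat A"

lemma kq_eqI:
  assumes "arr CA f" "arr CA g" "src f = src g" "tgt f = tgt g" "hmt (src f) (tgt f) s"
    "\<And>i. cm f i \<oplus> \<ominus> (cm g i) = s (i + 1) \<odot> dif (src f) i \<oplus> dif (tgt f) (i - 1) \<odot> s i"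
  shows "kq f = kq g"
proof -
  have "zhtp (f \<oplus>\<^bsub>CA\<^esub> \<ominus>\<^bsub>CA\<^esub> g) s s"
    unfolding zhtp_def using assms by simp
  then show ?thesis using kq_eq_iff[OF assms(1,2)] assms(3,4) by auto
qed

lemma kq_zero_htp:
  assumes "arr CA f" "kq f = azero KA (src f) (tgt f)"
  obtains s where "hmt (src f) (tgt f) s" "\<And>i. cm f i = s (i + 1) \<odot> dif (src f) i \<oplus> dif (tgt f) (i - 1) \<odot> s i"
  using kq_zero_iff[OF assms(1)] assms(2) unfolding zhtp_def by blast

text \<open>Distinguished triangles of \<open>Kcat A\<close>, in terms of typed arrows.\<close>

definition kd where
  "kd F G H \<longleftrightarrow> arr KA F \<and> arr KA G \<and> arr KA H \<and> src G = tgt F \<and> src H = tgt G \<and> tgt H = ShO CA 1 (src F) \<and>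
     (\<exists>\<phi> Z e1 e2 p1 p2 u v x. iscone \<phi> Z e1 e2 p1 p2 \<and> kc.aiso u \<and> kc.aiso v \<and> kc.aiso x \<and>
       src u = src \<phi> \<and> tgt u = src F \<and> src v = tgt \<phi> \<and> tgt v = tgt F \<and> src x = Z \<and> tgt x = tgt G \<and>
       v \<odot>\<^bsub>KA\<^esub> kq \<phi> = F \<odot>\<^bsub>KA\<^esub> u \<and> x \<odot>\<^bsub>KA\<^esub> kq (mkc (tgt \<phi>) Z e2) = G \<odot>\<^bsub>KA\<^esub> v \<and>
       ash KA 1 u \<odot>\<^bsub>KA\<^esub> kq (mkc Z (ShO CA 1 (src \<phi>)) p1) = H \<odot>\<^bsub>KA\<^esub> x)"

lemma kd_iso:
  assumes k: "kd F G H" and u: "kc.aiso u" "kc.aiso v" "kc.aiso x"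
    and s: "src u = src F" "src v = tgt F" "src x = tgt G" "tgt u = src F'" "tgt v = tgt F'" "tgt x = tgt G'"
    and a: "arr KA F'" "arr KA G'" "arr KA H'" "src G' = tgt F'" "src H' = tgt G'" "tgt H' = ShO CA 1 (src F')"
    and e: "v \<odot>\<^bsub>KA\<^esub> F = F' \<odot>\<^bsub>KA\<^esub> u" "x \<odot>\<^bsub>KA\<^esub> G = G' \<odot>\<^bsub>KA\<^esub> v" "ash KA 1 u \<odot>\<^bsub>KA\<^esub> H = H' \<odot>\<^bsub>KA\<^esub> x"
  shows "kd F' G' H'"
proof -
  obtain \<phi> Z e1 e2 p1 p2 u0 v0 x0 where c: "iscone \<phi> Z e1 e2 p1 p2" and i: "kc.aiso u0" "kc.aiso v0" "kc.aiso x0"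
    and t: "src u0 = src \<phi>" "tgt u0 = src F" "src v0 = tgt \<phi>" "tgt v0 = tgt F" "src x0 = Z" "tgt x0 = tgt G"
    and q: "v0 \<odot>\<^bsub>KA\<^esub> kq \<phi> = F \<odot>\<^bsub>KA\<^esub> u0" "x0 \<odot>\<^bsub>KA\<^esub> kq (mkc (tgt \<phi>) Z e2) = G \<odot>\<^bsub>KA\<^esub> v0"
       "ash KA 1 u0 \<odot>\<^bsub>KA\<^esub> kq (mkc Z (ShO CA 1 (src \<phi>)) p1) = H \<odot>\<^bsub>KA\<^esub> x0"
    using k unfolding kd_def by blast
  have kk: "arr KA F" "arr KA G" "arr KA H" "src G = tgt F" "src H = tgt G" "tgt H = ShO CA 1 (src F)" using k by (auto simp: kd_def)
  note [simp] = kc.aiso_arr[OF u(1)] kc.aiso_arr[OF u(2)] kc.aiso_arr[OF u(3)] kc.aiso_arr[OF i(1)] kc.aiso_arr[OF i(2)] kc.aiso_arr[OF i(3)]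
    s t a kk isconeD(1)[OF c] cone_maps[OF c] arr_kq
  have "(v \<odot>\<^bsub>KA\<^esub> v0) \<odot>\<^bsub>KA\<^esub> kq \<phi> = F' \<odot>\<^bsub>KA\<^esub> u \<odot>\<^bsub>KA\<^esub> u0"
    using kc.acomp_eq[OF e(1), of u0] by (simp add: q)
  moreover have "(x \<odot>\<^bsub>KA\<^esub> x0) \<odot>\<^bsub>KA\<^esub> kq (mkc (tgt \<phi>) Z e2) = G' \<odot>\<^bsub>KA\<^esub> v \<odot>\<^bsub>KA\<^esub> v0"
    using kc.acomp_eq[OF e(2), of v0] by (simp add: q)
  moreover have "ash KA 1 (u \<odot>\<^bsub>KA\<^esub> u0) \<odot>\<^bsub>KA\<^esub> kq (mkc Z (ShO CA 1 (src \<phi>)) p1) = H' \<odot>\<^bsub>KA\<^esub> x \<odot>\<^bsub>KA\<^esub> x0"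
    using kc.acomp_eq[OF e(3), of x0] by (simp add: q ash_Kcat_ops)
  moreover have "kc.aiso (u \<odot>\<^bsub>KA\<^esub> u0)" "kc.aiso (v \<odot>\<^bsub>KA\<^esub> v0)" "kc.aiso (x \<odot>\<^bsub>KA\<^esub> x0)"
    using u i by (auto intro!: kc.aiso_acomp)
  moreover have "src (u \<odot>\<^bsub>KA\<^esub> u0) = src \<phi>" "tgt (u \<odot>\<^bsub>KA\<^esub> u0) = src F'" "src (v \<odot>\<^bsub>KA\<^esub> v0) = tgt \<phi>"
     "tgt (v \<odot>\<^bsub>KA\<^esub> v0) = tgt F'" "src (x \<odot>\<^bsub>KA\<^esub> x0) = Z" "tgt (x \<odot>\<^bsub>KA\<^esub> x0) = tgt G'" by simp_all
  ultimately show ?thesis unfolding kd_def using a c by blast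
qed

lemma iscone_kd:
  assumes c: "iscone \<phi> Z e1 e2 p1 p2"
  shows "kd (kq \<phi>) (kq (mkc (tgt \<phi>) Z e2)) (kq (mkc Z (ShO CA 1 (src \<phi>)) p1))"
proof -
  note [simp] = isconeD(1,2)[OF c] arr_cpxD(1,2)[OF isconeD(1)[OF c]] cone_maps[OF c] arr_kq
  have "kc.aiso (aid KA X)" if "X \<in> Obj CA" for X using that by (intro kc.aisoI[of _ "aid KA X"]) simp_all
  then have "aid KA (tgt \<phi>) \<odot>\<^bsub>KA\<^esub> kq \<phi> = kq \<phi> \<odot>\<^bsub>KA\<^esub> aid KA (src \<phi>) \<and>
    aid KA Z \<odot>\<^bsub>KA\<^esub> kq (mkc (tgt \<phi>) Z e2) = kq (mkc (tgt \<phi>) Z e2) \<odot>\<^bsub>KA\<^esub> aid KA (tgt \<phi>) \<and>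
    ash KA 1 (aid KA (src \<phi>)) \<odot>\<^bsub>KA\<^esub> kq (mkc Z (ShO CA 1 (src \<phi>)) p1) = kq (mkc Z (ShO CA 1 (src \<phi>)) p1) \<odot>\<^bsub>KA\<^esub> aid KA Z"
    "kc.aiso (aid KA (src \<phi>))" "kc.aiso (aid KA (tgt \<phi>))" "kc.aiso (aid KA Z)" by (simp_all add: ash_Kcat_ops)
  moreover have "src (aid KA X) = X" "tgt (aid KA X) = X" for X by simp_all
  ultimately have "\<exists>\<phi>' Z' e1 e2' p1' p2 u v x. iscone \<phi>' Z' e1 e2' p1' p2 \<and> kc.aiso u \<and> kc.aiso v \<and> kc.aiso x \<and>
       src u = src \<phi>' \<and> tgt u = src \<phi> \<and> src v = tgt \<phi>' \<and> tgt v = tgt \<phi> \<and> src x = Z' \<and> tgt x = Z \<and>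
       v \<odot>\<^bsub>KA\<^esub> kq \<phi>' = kq \<phi> \<odot>\<^bsub>KA\<^esub> u \<and> x \<odot>\<^bsub>KA\<^esub> kq (mkc (tgt \<phi>') Z' e2') = kq (mkc (tgt \<phi>) Z e2) \<odot>\<^bsub>KA\<^esub> v \<and>
       ash KA 1 u \<odot>\<^bsub>KA\<^esub> kq (mkc Z' (ShO CA 1 (src \<phi>')) p1') = kq (mkc Z (ShO CA 1 (src \<phi>)) p1) \<odot>\<^bsub>KA\<^esub> x"
    using c by blast
  then show ?thesis unfolding kd_def by simp
qed

text \<open>The cone $E$ of $Y -> Z$ contains the cone of the identity of $Y$, and what is left is
  $X[1]$. The projection \<open>n\<close> and the section \<mu> satisfy $n \<mu> = 1$ on the nose;
  the component $-\<phi>$ of \<mu> makes it a chain map. Only $\<mu> n$ needs a homotopy.\<close>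

lemma cone_rotate:
  assumes c: "iscone \<phi> Z e1 e2 p1 p2"
  shows "kd (kq (mkc (tgt \<phi>) Z e2)) (kq (mkc Z (ShO CA 1 (src \<phi>)) p1)) (\<ominus>\<^bsub>KA\<^esub> (ash KA 1 (kq \<phi>)))"
proof -
  define X Y where "X = src \<phi>" and "Y = tgt \<phi>"
  note D = isconeD[OF c, folded X_def Y_def]
  define \<epsilon> where "\<epsilon> = mkc Y Z e2"
  define \<pi> where "\<pi> = mkc Z (ShO CA 1 X) p1"
  have m: "arr CA \<epsilon>" "arr CA \<pi>" using cone_maps[OF c] by (simp_all add: \<epsilon>_def \<pi>_def X_def Y_def)
  have o: "X \<in> Obj CA" "Y \<in> Obj CA" using arr_cpxD(1,2)[OF D(1)] by (simp_all add: X_def Y_def)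
  have st: "src \<epsilon> = Y" "tgt \<epsilon> = Z" "src \<pi> = Z" "tgt \<pi> = ShO CA 1 X" by (simp_all add: \<epsilon>_def \<pi>_def)
  have cm: "cm \<epsilon> i = e2 i" "cm \<pi> i = p1 i" for i using D(6-11)[of i] by (simp_all add: \<epsilon>_def \<pi>_def)
  obtain E f1 f2 r1 r2 where c2: "iscone \<epsilon> E f1 f2 r1 r2" using iscone_exists[OF m(1)] by blast
  note D2 = isconeD[OF c2, unfolded st]
  note R = cone_dif[OF c, folded X_def Y_def] and R2 = cone_dif[OF c2, unfolded st cm]
  note [simp] = D(2-14) D2(2-14) cpxD(1,3)[OF D(2)] cpxD(1,3)[OF o(1)] cpxD(1,3)[OF o(2)] cpxD(1,3)[OF D2(2)] m o st cm
    D(15-18) D2(15-18) acomp_eq[OF D(15)] acomp_eq[OF D(16)] acomp_eq[OF D(17)] acomp_eq[OF D(18)]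
    acomp_eq[OF D2(15)] acomp_eq[OF D2(16)] acomp_eq[OF D2(17)] acomp_eq[OF D2(18)]
    R R2 acomp_eq[OF R(1)] acomp_eq[OF R(2)] acomp_eq[OF R(3)] acomp_eq[OF R(4)]
    acomp_eq[OF R2(1)] acomp_eq[OF R2(2)] acomp_eq[OF R2(3)] acomp_eq[OF R2(4)]
    X_def[symmetric] Y_def[symmetric]
  have [simp]: "\<guillemotleft>cm \<phi> i :\<^bsub>A\<^esub> cob X i \<rightarrow> cob Y i\<guillemotright>" for i using cone_objs(1)[OF D(1)] by simp
  have [simp]: "cm \<phi> (i + 1) \<odot> dif X i = dif Y i \<odot> cm \<phi> i" "cm \<phi> (i + 2) \<odot> dif X (i + 1) = dif Y (i + 1) \<odot> cm \<phi> (i + 1)" for i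
    using arr_cpxD(4)[OF D(1), of i] arr_cpxD(4)[OF D(1), of "i + 1"] by (simp_all add: add.commute[of 2])
  define n where "n = mkc E (ShO CA 1 X) (\<lambda>i. p1 i \<odot> r2 i)"
  define \<mu> where "\<mu> = mkc (ShO CA 1 X) E (\<lambda>i. f2 i \<odot> e1 i \<oplus> \<ominus> (f1 i \<odot> cm \<phi> (i + 1)))"
  have n: "arr CA n" "src n = E" "tgt n = ShO CA 1 X" "cm n i = p1 i \<odot> r2 i" for i
    by (simp_all add: n_def arr_cpx_iff[of "mkc E (ShO CA 1 X) (\<lambda>i. p1 i \<odot> r2 i)"] dif_ShO)
  have \<mu>: "arr CA \<mu>" "src \<mu> = ShO CA 1 X" "tgt \<mu> = E" "cm \<mu> i = f2 i \<odot> e1 i \<oplus> \<ominus> (f1 i \<odot> cm \<phi> (i + 1))" for i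
    by (simp_all add: \<mu>_def arr_cpx_iff[of "mkc (ShO CA 1 X) E v" for v] dif_ShO add.commute[of 2] aplus_cancel_far)
  have 1: "n \<odot>\<^bsub>CA\<^esub> \<mu> = aid CA (ShO CA 1 X)" by (rule cm_eqI) (simp_all add: n \<mu>)
  have 2: "kq (aid CA E) = kq (\<mu> \<odot>\<^bsub>CA\<^esub> n)"
  proof (rule kq_eqI)
    \<comment> \<open>The contraction takes the summand $Y^i$ of $Z^i$ to the copy of $Y^i$ in
      $E^{i-1}$.\<close>
    show "hmt (src (aid CA E)) (tgt (aid CA E)) (\<lambda>i. f1 (i - 1) \<odot> p2 i \<odot> r2 i)" by (simp add: hmt_def)
    fix i
    have "aid A (cob E i) = f1 i \<odot> r1 i \<oplus> f2 i \<odot> r2 i" by (simp only: D2(19))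
    moreover have "f2 i \<odot> r2 i = f2 i \<odot> e1 i \<odot> p1 i \<odot> r2 i \<oplus> f2 i \<odot> e2 i \<odot> p2 i \<odot> r2 i"
      using arg_cong[OF D(19), of "\<lambda>x. f2 i \<odot> x \<odot> r2 i" i] by simp
    ultimately show "cm (aid CA E) i \<oplus> \<ominus> (cm (\<mu> \<odot>\<^bsub>CA\<^esub> n) i) =
      (f1 (i + 1 - 1) \<odot> p2 (i + 1) \<odot> r2 (i + 1)) \<odot> dif (src (aid CA E)) i \<oplus>
      dif (tgt (aid CA E)) (i - 1) \<odot> f1 (i - 1) \<odot> p2 i \<odot> r2 i"
      by (simp add: n \<mu> aplus_cancel_far aplus_comm[of "f2 i \<odot> e2 i \<odot> p2 i \<odot> r2 i" "f1 i \<odot> cm \<phi> (i + 1) \<odot> p1 i \<odot> r2 i"])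
  qed (simp_all add: n \<mu>)
  \<comment> \<open>The homotopy is the projection of $E$ to $Y$. It exchanges \<open>r1\<close> for
    $-\<phi>[1]$ after \<open>n\<close>, and this is where the sign of the rotated triangle comes
    from.\<close>
  have 3: "kq (mkc E (ShO CA 1 Y) r1) = kq ((\<ominus>\<^bsub>CA\<^esub> (ash CA 1 \<phi>)) \<odot>\<^bsub>CA\<^esub> n)"
  proof (rule kq_eqI)
    show "hmt (src (mkc E (ShO CA 1 Y) r1)) (tgt (mkc E (ShO CA 1 Y) r1)) (\<lambda>i. p2 i \<odot> r2 i)" by (simp add: hmt_def)
  qed (use cone_maps[OF c2] D(1) in \<open>simp_all add: n dif_ShO\<close>)
  have K: "kd (kq \<epsilon>) (kq (mkc Z E f2)) (kq (mkc E (ShO CA 1 Y) r1))" using iscone_kd[OF c2] by simp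
  have a: "arr CA (mkc Z E f2)" "arr CA (mkc E (ShO CA 1 Y) r1)" using cone_maps[OF c2] by simp_all
  have n\<mu>: "kq \<mu> \<odot>\<^bsub>KA\<^esub> kq n = aid KA E" "kq n \<odot>\<^bsub>KA\<^esub> kq \<mu> = aid KA (ShO CA 1 X)"
    using 2 arg_cong[OF 1, of kq] by (simp_all add: n \<mu> kq_ops)
  have iso: "kc.aiso (kq n)" by (rule kc.aisoI[of _ "kq \<mu>"]) (simp_all add: n \<mu> n\<mu>)
  have \<phi>1: "arr CA (ash CA 1 \<phi>)" "arr CA \<phi>" using D(1) by simp_all
  have "kd (kq \<epsilon>) (kq \<pi>) (\<ominus>\<^bsub>KA\<^esub> (ash KA 1 (kq \<phi>)))"
  proof (rule kd_iso[OF K, of "aid KA Y" "aid KA Z" "kq n"])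
    have "n \<odot>\<^bsub>CA\<^esub> mkc Z E f2 = \<pi>" by (rule cm_eqI) (simp_all add: n)
    then have "kq n \<odot>\<^bsub>KA\<^esub> kq (mkc Z E f2) = kq \<pi>" using a by (simp add: n flip: kq_ops)
    then show "kq n \<odot>\<^bsub>KA\<^esub> kq (mkc Z E f2) = kq \<pi> \<odot>\<^bsub>KA\<^esub> aid KA Z" by simp
    show "ash KA 1 (aid KA Y) \<odot>\<^bsub>KA\<^esub> kq (mkc E (ShO CA 1 Y) r1) = \<ominus>\<^bsub>KA\<^esub> (ash KA 1 (kq \<phi>)) \<odot>\<^bsub>KA\<^esub> kq n"
      using a \<phi>1 by (simp add: 3 ash_Kcat_ops ash_kq kq_ops n)
  qed (use a \<phi>1 iso in \<open>simp_all add: n kc.aiso_aid ash_kq\<close>)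
  then show ?thesis unfolding \<epsilon>_def \<pi>_def by simp
qed

lemma kd_rotate:
  assumes k: "kd F G H"
  shows "kd G H (\<ominus>\<^bsub>KA\<^esub> (ash KA 1 F))"
proof -
  obtain \<phi> Z e1 e2 p1 p2 u v x where c: "iscone \<phi> Z e1 e2 p1 p2" and i: "kc.aiso u" "kc.aiso v" "kc.aiso x"
    and t: "src u = src \<phi>" "tgt u = src F" "src v = tgt \<phi>" "tgt v = tgt F" "src x = Z" "tgt x = tgt G"
    and q: "v \<odot>\<^bsub>KA\<^esub> kq \<phi> = F \<odot>\<^bsub>KA\<^esub> u" "x \<odot>\<^bsub>KA\<^esub> kq (mkc (tgt \<phi>) Z e2) = G \<odot>\<^bsub>KA\<^esub> v"
       "ash KA 1 u \<odot>\<^bsub>KA\<^esub> kq (mkc Z (ShO CA 1 (src \<phi>)) p1) = H \<odot>\<^bsub>KA\<^esub> x"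
    using k unfolding kd_def by blast
  have kk: "arr KA F" "arr KA G" "arr KA H" "src G = tgt F" "src H = tgt G" "tgt H = ShO CA 1 (src F)" using k by (auto simp: kd_def)
  note [simp] = kc.aiso_arr[OF i(1)] kc.aiso_arr[OF i(2)] kc.aiso_arr[OF i(3)] t kk isconeD(1)[OF c] cone_maps[OF c] arr_kq
  have "ash KA 1 v \<odot>\<^bsub>KA\<^esub> ash KA 1 (kq \<phi>) = ash KA 1 F \<odot>\<^bsub>KA\<^esub> ash KA 1 u"
    using arg_cong[OF q(1), of "ash KA 1"] by (simp add: ash_Kcat_ops)
  then show ?thesis
    by (intro kd_iso[OF cone_rotate[OF c], of v x "ash KA 1 u"]) (use i q in \<open>simp_all add: ash_Kcat_aiso\<close>)
qed

text \<open>For a cone $Z$ of \<phi>, the map $\<epsilon> \<phi>$ is null-homotopic through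
  \<open>e1\<close> and $\<phi>[1] \<pi>$ through \<open>p2\<close>; as \<phi> is invertible,
  \<epsilon> and \<pi> are zero in \<open>Kcat\<close>. A homotopy \<sigma> for \<pi> makes $\<xi> =
  p_2 - \<phi> \<sigma>$ a chain map, and the identity of $Z$ is homotopic to $\<epsilon> \<xi>$,
  hence to zero.\<close>

lemma kd_zero_cone:
  assumes k: "kd F G H" and F: "kc.aiso F"
  shows "zero_object KA (tgt G)"
proof -
  obtain \<phi> Z e1 e2 p1 p2 u v x where c: "iscone \<phi> Z e1 e2 p1 p2" and i: "kc.aiso u" "kc.aiso v" "kc.aiso x"
    and t: "src u = src \<phi>" "tgt u = src F" "src v = tgt \<phi>" "tgt v = tgt F" "src x = Z" "tgt x = tgt G"
    and q: "v \<odot>\<^bsub>KA\<^esub> kq \<phi> = F \<odot>\<^bsub>KA\<^esub> u"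
    using k unfolding kd_def by blast
  obtain v' where v': "\<guillemotleft>v' :\<^bsub>KA\<^esub> tgt v \<rightarrow> src v\<guillemotright>" "v' \<odot>\<^bsub>KA\<^esub> v = aid KA (src v)" "v \<odot>\<^bsub>KA\<^esub> v' = aid KA (tgt v)"
    using i(2) by (rule kc.aisoE)
  obtain x' where x': "\<guillemotleft>x' :\<^bsub>KA\<^esub> tgt x \<rightarrow> src x\<guillemotright>" "x' \<odot>\<^bsub>KA\<^esub> x = aid KA (src x)" "x \<odot>\<^bsub>KA\<^esub> x' = aid KA (tgt x)"
    using i(3) by (rule kc.aisoE)
  have kk: "arr KA F" "arr KA G" "arr KA H" "src G = tgt F" "src H = tgt G" "tgt H = ShO CA 1 (src F)" using k by (auto simp: kd_def)
  define X Y where "X = src \<phi>" and "Y = tgt \<phi>"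
  define \<epsilon> where "\<epsilon> = mkc Y Z e2"
  define \<pi> where "\<pi> = mkc Z (ShO CA 1 X) p1"
  note D = isconeD[OF c, folded X_def Y_def]
  note R = cone_dif[OF c, folded X_def Y_def]
  have o: "X \<in> Obj CA" "Y \<in> Obj CA" using arr_cpxD(1,2)[OF D(1)] by (simp_all add: X_def Y_def)
  have m: "arr CA \<epsilon>" "arr CA \<pi>" using cone_maps[OF c] by (simp_all add: \<epsilon>_def \<pi>_def X_def Y_def)
  have st: "src \<epsilon> = Y" "tgt \<epsilon> = Z" "src \<pi> = Z" "tgt \<pi> = ShO CA 1 X" by (simp_all add: \<epsilon>_def \<pi>_def)
  have cm: "cm \<epsilon> i = e2 i" "cm \<pi> i = p1 i" for i using D(6-11)[of i] by (simp_all add: \<epsilon>_def \<pi>_def)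
  note [simp] = kc.aiso_arr[OF i(1)] kc.aiso_arr[OF i(2)] kc.aiso_arr[OF i(3)] t kk v'(1) x'(1)
  have "kc.aiso (v' \<odot>\<^bsub>KA\<^esub> F \<odot>\<^bsub>KA\<^esub> u)"
    using i(1) F v' i(2) by (intro kc.aiso_acomp) (auto intro: kc.aisoI[of v' v])
  moreover have "v' \<odot>\<^bsub>KA\<^esub> F \<odot>\<^bsub>KA\<^esub> u = kq \<phi>"
    using q[symmetric] kc.acomp_eq[OF v'(2), of "kq \<phi>"] D(1) by simp
  ultimately have \<phi>: "kc.aiso (kq \<phi>)" by simp
  note [simp] = D(1-14) cpxD(1,3)[OF D(2)] cpxD(1,3)[OF o(1)] cpxD(1,3)[OF o(2)] m o st cm arr_kq
    D(15-18) acomp_eq[OF D(15)] acomp_eq[OF D(16)] acomp_eq[OF D(17)] acomp_eq[OF D(18)]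
    R acomp_eq[OF R(1)] acomp_eq[OF R(2)] acomp_eq[OF R(3)] acomp_eq[OF R(4)]
    X_def[symmetric] Y_def[symmetric]
  have [simp]: "\<guillemotleft>cm \<phi> i :\<^bsub>A\<^esub> cob X i \<rightarrow> cob Y i\<guillemotright>" for i using cone_objs(1)[OF D(1)] by simp
  have [simp]: "cm \<phi> (i + 1) \<odot> dif X i = dif Y i \<odot> cm \<phi> i" for i
    using arr_cpxD(4)[OF D(1), of i] by simp
  obtain \<phi>' where \<phi>': "\<guillemotleft>\<phi>' :\<^bsub>KA\<^esub> Y \<rightarrow> X\<guillemotright>" "\<phi>' \<odot>\<^bsub>KA\<^esub> kq \<phi> = aid KA X" "kq \<phi> \<odot>\<^bsub>KA\<^esub> \<phi>' = aid KA Y"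
    using \<phi> by (rule kc.aisoE) simp
  note [simp] = \<phi>'(1)
  have "kq (\<epsilon> \<odot>\<^bsub>CA\<^esub> \<phi>) = kq (azero CA X Z)"
    by (rule kq_eqI[of _ _ "\<lambda>i. e1 (i - 1)"]) (simp_all add: hmt_def aplus_cancel_far)
  then have "kq \<epsilon> \<odot>\<^bsub>KA\<^esub> kq \<phi> = azero KA X Z" by (simp add: kq_ops)
  then have "kq \<epsilon> = azero KA Y Z" using kc.acomp_eq[of "kq \<epsilon>" "kq \<phi>" "azero KA X Z" \<phi>'] \<phi>'(3) by simp
  note \<epsilon>0 = this
  have "kq (ash CA 1 \<phi> \<odot>\<^bsub>CA\<^esub> \<pi>) = kq (azero CA Z (ShO CA 1 Y))"
    by (rule kq_eqI[of _ _ p2]) (simp_all add: hmt_def aplus_cancel_far dif_ShO)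
  then have "ash KA 1 (kq \<phi>) \<odot>\<^bsub>KA\<^esub> kq \<pi> = azero KA Z (ShO CA 1 Y)" by (simp add: kq_ops ash_kq)
  moreover have "ash KA 1 \<phi>' \<odot>\<^bsub>KA\<^esub> ash KA 1 (kq \<phi>) = aid KA (ShO CA 1 X)" using \<phi>'(2) by (simp flip: ash_Kcat_ops(1) add: ash_Kcat_ops(4))
  ultimately have "kq \<pi> = azero KA Z (ShO CA 1 X)"
    using kc.acomp_eq[of "ash KA 1 \<phi>'" "ash KA 1 (kq \<phi>)" "aid KA (ShO CA 1 X)" "kq \<pi>"] by simp
  then obtain \<sigma> where \<sigma>: "hmt Z (ShO CA 1 X) \<sigma>" "\<And>i. p1 i = \<sigma> (i + 1) \<odot> dif Z i \<oplus> dif (ShO CA 1 X) (i - 1) \<odot> \<sigma> i"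
    using kq_zero_htp[OF m(2)] by auto
  have [simp]: "\<guillemotleft>\<sigma> i :\<^bsub>A\<^esub> cob Z i \<rightarrow> cob X i\<guillemotright>" for i using hmtD[OF \<sigma>(1), of i] by simp
  have sd: "\<sigma> (i + 1) \<odot> dif Z i = p1 i \<oplus> dif X i \<odot> \<sigma> i" for i
    unfolding \<sigma>(2)[of i] by (simp add: dif_ShO)
  have [simp]: "cm \<phi> (i + 1) \<odot> dif X i \<odot> \<sigma> i = dif Y i \<odot> cm \<phi> i \<odot> \<sigma> i" for i
    using acomp_eq[of "cm \<phi> (i + 1)" "dif X i" "dif Y i \<odot> cm \<phi> i" "\<sigma> i"] by simp
  define \<xi> where "\<xi> = mkc Z Y (\<lambda>i. p2 i \<oplus> \<ominus> (cm \<phi> i \<odot> \<sigma> i))"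
  have \<xi>: "arr CA \<xi>" "src \<xi> = Z" "tgt \<xi> = Y" "cm \<xi> i = p2 i \<oplus> \<ominus> (cm \<phi> i \<odot> \<sigma> i)" for i
    by (simp_all add: \<xi>_def arr_cpx_iff[of "mkc Z Y v" for v] sd aplus_cancel_far)
  have "kq (aid CA Z) = kq (\<epsilon> \<odot>\<^bsub>CA\<^esub> \<xi>)"
  proof (rule kq_eqI)
    show "hmt (src (aid CA Z)) (tgt (aid CA Z)) (\<lambda>i. e1 (i - 1) \<odot> \<sigma> i)" by (simp add: hmt_def)
    fix i
    show "cm (aid CA Z) i \<oplus> \<ominus> (cm (\<epsilon> \<odot>\<^bsub>CA\<^esub> \<xi>) i) = (e1 (i + 1 - 1) \<odot> \<sigma> (i + 1)) \<odot> dif (src (aid CA Z)) i \<oplus> dif (tgt (aid CA Z)) (i - 1) \<odot> e1 (i - 1) \<odot> \<sigma> i"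
      using D(19)[of i, symmetric] by (simp add: \<xi> sd aplus_cancel_far)
  qed (simp_all add: \<xi>)
  then have Z0: "aid KA Z = azero KA Z Z" using \<epsilon>0 \<xi> by (simp add: kq_ops)
  have "aid KA (tgt G) = x \<odot>\<^bsub>KA\<^esub> aid KA Z \<odot>\<^bsub>KA\<^esub> x'" using x' by simp
  also have "\<dots> = azero KA (tgt G) (tgt G)" unfolding Z0 using x' by simp
  finally show ?thesis using arrD(2)[OF kk(2)] by (simp add: kc.zero_object_iff)
qed

lemma iscone_cone_triangle:
  assumes c: "iscone \<phi> Z e1 e2 p1 p2"
  shows "cone_triangle A (src \<phi>, tgt \<phi>, Z, mor (kq \<phi>), mor (kq (mkc (tgt \<phi>) Z e2)), mor (kq (mkc Z (ShO CA 1 (src \<phi>)) p1)))"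
proof -
  note D = isconeD[OF c]
  note [simp] = D(3-14) cone_objs[OF D(1)] arr_cpxD(1,2)[OF D(1)] cpxD(1,3)[OF D(2)] add.commute[of 1] add.commute[of 2]
  have o: "cob (src \<phi>) i \<in> Obj A" "cob (tgt \<phi>) i \<in> Obj A" for i using cone_objs[OF D(1), of i] by simp_all
  have A: "x = Arrow (src x) (tgt x) (mor x)" for x :: "('o, 'm) arrow" by simp
  have b: "biproduct A (cob (src \<phi>) (i + 1)) (cob (tgt \<phi>) i) (cob Z i) (mor (e1 i)) (mor (e2 i)) (mor (p1 i)) (mor (p2 i))" for i
  proof -
    have "abiproduct A (e1 i) (e2 i) (p1 i) (p2 i)" using c by (simp add: iscone_def)
    then show ?thesis unfolding abiproduct_iff[OF o] using A[of "e1 i"] A[of "e2 i"] A[of "p1 i"] A[of "p2 i"] by (simp only: D)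
  qed
  have d: "cdf Z i = (mor (e1 (i + 1)) \<cdot> neg A (cob (src \<phi>) (i + 1)) (cob (src \<phi>) (i + 2)) (cdf (src \<phi>) (i + 1)) \<cdot> mor (p1 i)) \<boxplus>
            (mor (e2 (i + 1)) \<cdot> mor \<phi> (i + 1) \<cdot> mor (p1 i)) \<boxplus> (mor (e2 (i + 1)) \<cdot> cdf (tgt \<phi>) i \<cdot> mor (p2 i))" for i
  proof -
    have "dif Z i = ((e1 (i + 1) \<odot> \<ominus> (dif (src \<phi>) (i + 1))) \<odot> p1 i \<oplus> (e2 (i + 1) \<odot> cm \<phi> (i + 1)) \<odot> p1 i) \<oplus> (e2 (i + 1) \<odot> dif (tgt \<phi>) i) \<odot> p2 i"
      by (simp add: D(20))
    from arg_cong[OF this, of mor] show ?thesis by (simp add: arrow_mor dif_def cm_def)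
  qed
  have "mor \<phi> \<in> Hom CA (src \<phi>) (tgt \<phi>)" using D(1) by (simp add: arr_def)
  note f = this arr_cpxD(1,2)[OF D(1)] D(2)
  show ?thesis unfolding cone_triangle_def
    apply (rule exI[of _ "src \<phi>"], rule exI[of _ "tgt \<phi>"], rule exI[of _ Z], rule exI[of _ "mor \<phi>"], rule exI[of _ "\<lambda>i. mor (e1 i)"],
        rule exI[of _ "\<lambda>i. mor (e2 i)"], rule exI[of _ "\<lambda>i. mor (p1 i)"], rule exI[of _ "\<lambda>i. mor (p2 i)"])
    apply (intro conjI allI f b d)
    apply (simp add: mor_kq mkc_def)
    done
qed

lemma htp_cat_triangle_iso: "triangle_iso (htp_cat A) = triangle_iso KA"
proof -
  have s: "Obj (htp_cat A) = Obj KA" "Hom (htp_cat A) = Hom KA" "Ident (htp_cat A) = Ident KA" "Comp (htp_cat A) = Comp KA"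
    "ShO (htp_cat A) = ShO KA" "ShM (htp_cat A) = ShM KA" by (simp_all add: htp_cat_def Kcat_sel del: ShO_Kcat Obj_Kcat)
  show ?thesis unfolding triangle_iso_def is_triangle_def is_iso_def s ..
qed

lemma Dist_Kcat: "Dist KA = {T. \<exists>T'. cone_triangle A T' \<and> triangle_iso KA T' T}"
  unfolding htp_cat_triangle_iso[symmetric] by (simp add: Kcat_def tri_cat.defs shift_cat.defs)

lemma kd_Dist:
  assumes k: "kd F G H"
  shows "(src F, tgt F, tgt G, mor F, mor G, mor H) \<in> Dist KA"
proof -
  obtain \<phi> Z e1 e2 p1 p2 u v x where c: "iscone \<phi> Z e1 e2 p1 p2" and i: "kc.aiso u" "kc.aiso v" "kc.aiso x"
    and t: "src u = src \<phi>" "tgt u = src F" "src v = tgt \<phi>" "tgt v = tgt F" "src x = Z" "tgt x = tgt G"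
    and q: "v \<odot>\<^bsub>KA\<^esub> kq \<phi> = F \<odot>\<^bsub>KA\<^esub> u" "x \<odot>\<^bsub>KA\<^esub> kq (mkc (tgt \<phi>) Z e2) = G \<odot>\<^bsub>KA\<^esub> v"
       "ash KA 1 u \<odot>\<^bsub>KA\<^esub> kq (mkc Z (ShO CA 1 (src \<phi>)) p1) = H \<odot>\<^bsub>KA\<^esub> x"
    using k unfolding kd_def by blast
  have kk: "arr KA F" "arr KA G" "arr KA H" "src G = tgt F" "src H = tgt G" "tgt H = ShO CA 1 (src F)" using k by (auto simp: kd_def)
  note D = isconeD[OF c]
  note a = arrD[OF arr_kq[OF D(1)]] arrD[OF arr_kq[OF cone_maps(1)[OF c]]] arrD[OF arr_kq[OF cone_maps(2)[OF c]]]
    arrD[OF kk(1)] arrD[OF kk(2)] arrD[OF kk(3)]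
  have iso: "is_iso KA (src \<phi>) (src F) (mor u)" "is_iso KA (tgt \<phi>) (tgt F) (mor v)" "is_iso KA Z (tgt G) (mor x)"
    using i[THEN kc.aiso_is_iso] t by simp_all
  have "triangle_iso KA (src \<phi>, tgt \<phi>, Z, mor (kq \<phi>), mor (kq (mkc (tgt \<phi>) Z e2)), mor (kq (mkc Z (ShO CA 1 (src \<phi>)) p1)))
     (src F, tgt F, tgt G, mor F, mor G, mor H)"
    unfolding triangle_iso_def is_triangle_def
    using a kk iso q[THEN arg_cong, of mor] by (simp add: arrow_mor ash_def del: split_paired_Ex) blast
  then show ?thesis using iscone_cone_triangle[OF c] unfolding Dist_Kcat by blast
qed

end

section \<open>The weight complex\<close>

lemma heart_ops [simp]:
  "acomp (heart C w) = acomp C" "aplus (heart C w) = aplus C" "aneg (heart C w) = aneg C" "aid (heart C w) = aid C" "azero (heart C w) = azero C"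
  by (auto simp: heart_def full_subcat_def acomp_def aplus_def aneg_def aid_def azero_def neg_def hom_group_def fun_eq_iff)

lemma heart_sel: "Obj (heart C w) = snd w \<inter> fst w" "Hom (heart C w) = Hom C" "Ident (heart C w) = Ident C" "Comp (heart C w) = Comp C"
  "Zer (heart C w) = Zer C" "Plus (heart C w) = Plus C" "hom_group (heart C w) = hom_group C"
  by (auto simp: heart_def full_subcat_def hom_group_def fun_eq_iff)

context weight_structure
begin

abbreviation "HW \<equiv> heart C w"

definition cx :: "('o, 'm) atower \<Rightarrow> ('o, 'm) cpx" where
  "cx T = \<lparr>cob = tH T, cdf = \<lambda>i. mor (th T i)\<rparr>"

lemma cob_cx [simp]: "cob (cx T) = tH T"
  by (simp add: cx_def)

lemma arr_heart: "arr HW f \<longleftrightarrow> arr C f \<and> src f \<in> fst w \<and> src f \<in> snd w \<and> tgt f \<in> fst w \<and> tgt f \<in> snd w"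
  using fst_w_obj by (auto simp: arr_def heart_sel)

lemma additive_heart: "additive_category HW"
proof (intro additive_category.intro preadditive_category.intro category.intro preadditive_category_axioms.intro additive_category_axioms.intro;
    (unfold heart_sel, elim IntE)?)
  obtain Z where Z: "zero_object C Z" using zero_object_exists by blast
  have "zero_object HW Z" using Z zero_object_weights[OF Z] fst_w_obj unfolding zero_object_def heart_sel by blast
  then show "\<exists>Z. zero_object HW Z" by blast
  fix X Y Z W f f' g g' h
  assume X: "X \<in> fst w" "X \<in> snd w"
  note o = fst_w_obj
  show "Ident C X \<in> Hom C X X" using X(1) o ident_in by blast
  assume Y: "Y \<in> fst w" "Y \<in> snd w"
  show "comm_group (hom_group C X Y)" using X(1) Y(1) o hom_comm_group by blast
  show "\<exists>S e1 e2 p1 p2. biproduct HW X Y S e1 e2 p1 p2"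
  proof -
    obtain S e1 e2 p1 p2 where b: "biproduct C X Y S e1 e2 p1 p2" using biproduct_exists[of X Y] X(1) Y(1) o by blast
    then have "S \<in> fst w" "S \<in> snd w" using X Y le_additive ge_additive unfolding additive_class_def by blast+
    then have "biproduct HW X Y S e1 e2 p1 p2" using b unfolding biproduct_def heart_sel by blast
    then show ?thesis by blast
  qed
  {
    assume f: "f \<in> Hom C X Y"
    show "f \<cdot> Ident C X = f" "Ident C Y \<cdot> f = f" using comp_ident[of X Y f] ident_comp[of X Y f] o X(1) Y(1) f by blast+
    assume Z: "Z \<in> fst w" "Z \<in> snd w" and g: "g \<in> Hom C Y Z"
    show "g \<cdot> f \<in> Hom C X Z" using comp_in[of X Y Z f g] o X(1) Y(1) Z(1) f g by blast
    show "h \<cdot> g \<cdot> f = h \<cdot> (g \<cdot> f)" if "W \<in> fst w" "h \<in> Hom C Z W"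
      using comp_assoc[of X Y Z W f g h] o X(1) Y(1) Z(1) f g that by blast
    show "g \<cdot> (f \<boxplus> f') = (g \<cdot> f) \<boxplus> (g \<cdot> f')" if "f' \<in> Hom C X Y"
      using comp_plus[of X Y Z f f' g] o X(1) Y(1) Z(1) f g that by blast
    show "(g \<boxplus> g') \<cdot> f = (g \<cdot> f) \<boxplus> (g' \<cdot> f)" if "g' \<in> Hom C Y Z"
      using plus_comp[of X Y Z f g g'] o X(1) Y(1) Z(1) f g that by blast
  }
qed

sublocale hw: cpx_category HW
  by (intro cpx_category.intro additive_heart)

lemma dif_cx: "gtower X T \<Longrightarrow> dif (cx T) i = th T i"
  using gtower_comp(5)[of X T i] by (auto simp: dif_def cx_def intro!: arrow_eqI)

lemma cx_obj [simp]: "gtower X T \<Longrightarrow> cx T \<in> Obj hw.CA"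
  using gtower_comp(5,8)[of X T] gtowerD[of X T] by (simp add: hw.cpx_obj_iff dif_cx arr_heart)

lemma arr_cx_iff:
  assumes "gtower X T" "gtower X' T'"
  shows "arr hw.CA f \<and> src f = cx T \<and> tgt f = cx T' \<longleftrightarrow> src f = cx T \<and> tgt f = cx T' \<and>
    (\<forall>k. arr C (cm f k) \<and> cm f (k + 1) \<odot> th T k = th T' k \<odot> cm f k)"
  using assms gtowerD[OF assms(1)] gtowerD[OF assms(2)] by (auto simp: hw.arr_cpx_iff dif_cx arr_heart)

lemma trel_arr:
  assumes T: "gtower X T" and T': "gtower X' T'" and e: "trel T T' g \<phi>"
  shows "\<guillemotleft>mkc (cx T) (cx T') \<phi> :\<^bsub>hw.CA\<^esub> cx T \<rightarrow> cx T'\<guillemotright>" "cm (mkc (cx T) (cx T') \<phi>) k = \<phi> k"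
  using trelD[OF e] arr_cx_iff[OF T T', of "mkc (cx T) (cx T') \<phi>"] T T' by simp_all

lemma znull_iff_zhtp:
  assumes T: "gtower X T" and T': "gtower X' T'" and f: "\<guillemotleft>f :\<^bsub>hw.CA\<^esub> cx T \<rightarrow> cx T'\<guillemotright>"
  shows "znull T T' (cm f) \<longleftrightarrow> (\<exists>s t. hw.zhtp f s t)"
proof -
  note [simp] = gtowerD[OF T] gtowerD[OF T'] dif_cx[OF T] dif_cx[OF T'] arr_heart heart_sel
  have "hw.zhtp f s t \<longleftrightarrow> (\<forall>k. \<guillemotleft>s k :\<^bsub>C\<^esub> tH T k \<rightarrow> tH T' (k - 1)\<guillemotright> \<and> \<guillemotleft>t k :\<^bsub>C\<^esub> tH T k \<rightarrow> tH T' (k - 1)\<guillemotright> \<and>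
     cm f k = s (k + 1) \<odot> th T k \<oplus> th T' (k - 1) \<odot> t k)" for s t
    using f unfolding hw.zhtp_def hw.hmt_def by auto
  then show ?thesis unfolding znull_def by simp
qed

text \<open>The effect of the weight complex functor on \<open>g\<close>, relative to a choice of towers of its source and target.\<close>

definition wm :: "('o, 'm) atower \<Rightarrow> ('o, 'm) atower \<Rightarrow> ('o, 'm) arrow \<Rightarrow> (('o, 'm) cpx, ('o, 'm) kwmor) arrow" where
  "wm T T' g = hw.wk (hw.kq (mkc (cx T) (cx T') (SOME \<phi>. trel T T' g \<phi>)))"

lemma wm_selectors [simp]: "src (wm T T' g) = cx T" "tgt (wm T T' g) = cx T'"
  by (simp_all add: wm_def)

lemma wk_kq_cx_eq_iff:
  assumes T: "gtower X T" and T': "gtower X' T'" and f: "\<guillemotleft>f :\<^bsub>hw.CA\<^esub> cx T \<rightarrow> cx T'\<guillemotright>" "\<guillemotleft>f' :\<^bsub>hw.CA\<^esub> cx T \<rightarrow> cx T'\<guillemotright>"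
  shows "hw.wk (hw.kq f) = hw.wk (hw.kq f') \<longleftrightarrow> znull T T' (\<lambda>k. cm f k \<oplus> \<ominus> (cm f' k))"
proof -
  have "\<guillemotleft>f \<oplus>\<^bsub>hw.CA\<^esub> \<ominus>\<^bsub>hw.CA\<^esub> f' :\<^bsub>hw.CA\<^esub> cx T \<rightarrow> cx T'\<guillemotright>" using f by simp
  moreover have "cm (f \<oplus>\<^bsub>hw.CA\<^esub> \<ominus>\<^bsub>hw.CA\<^esub> f') = (\<lambda>k. cm f k \<oplus> \<ominus> (cm f' k))" using f by (intro ext) simp
  ultimately show ?thesis
    using znull_iff_zhtp[OF T T', of "f \<oplus>\<^bsub>hw.CA\<^esub> \<ominus>\<^bsub>hw.CA\<^esub> f'"] hw.wk_kq_eq_iff[of f f'] f by simp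
qed

text \<open>Two chain maps related to the same $g$ differ by some $s d + d t$, so the choice hidden
  in \<open>wm\<close> has no effect and any convenient \<phi> may be used.\<close>

lemma wm_eq:
  assumes T: "gtower X T" and T': "gtower X' T'" and g: "\<guillemotleft>g :\<^bsub>C\<^esub> X \<rightarrow> X'\<guillemotright>" and e: "trel T T' g \<phi>"
  shows "wm T T' g = hw.wk (hw.kq (mkc (cx T) (cx T') \<phi>))"
proof -
  define \<psi> where "\<psi> = (SOME \<phi>. trel T T' g \<phi>)"
  have e': "trel T T' g \<psi>" unfolding \<psi>_def using e by (rule someI[of "trel T T' g"])
  show ?thesis unfolding wm_def \<psi>_def[symmetric]
    using wk_kq_cx_eq_iff[OF T T' trel_arr(1)[OF T T' e'] trel_arr(1)[OF T T' e]] trel_diff_znull[OF T T' e' e g]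
    by (simp add: trel_arr(2)[OF T T' e] trel_arr(2)[OF T T' e'])
qed

lemma arr_wm [simp]: "\<lbrakk>gtower X T; gtower X' T'; \<guillemotleft>g :\<^bsub>C\<^esub> X \<rightarrow> X'\<guillemotright>\<rbrakk> \<Longrightarrow> arr (Kw HW) (wm T T' g)"
  using trel_exists[of X T X' T' g] wm_eq[of X T X' T' g] trel_arr(1)[of X T X' T' g] by (metis hw.arr_kq hw.arr_wk)

lemma mkc_ops:
  assumes T: "gtower X T" and T': "gtower X' T'" and T'': "gtower X'' T''"
    and p: "trel T T' g \<phi>" "trel T' T'' g' \<psi>" "trel T T' g'' \<chi>"
  shows "mkc (cx T) (cx T'') (\<lambda>k. \<psi> k \<odot> \<phi> k) = mkc (cx T') (cx T'') \<psi> \<odot>\<^bsub>hw.CA\<^esub> mkc (cx T) (cx T') \<phi>"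
    "mkc (cx T) (cx T') (\<lambda>k. \<phi> k \<oplus> \<chi> k) = mkc (cx T) (cx T') \<phi> \<oplus>\<^bsub>hw.CA\<^esub> mkc (cx T) (cx T') \<chi>"
    "mkc (cx T) (cx T') (\<lambda>k. \<ominus> (\<phi> k)) = \<ominus>\<^bsub>hw.CA\<^esub> (mkc (cx T) (cx T') \<phi>)"
    "mkc (cx T) (cx T) (\<lambda>k. aid C (tH T k)) = aid hw.CA (cx T)"
  by (rule cm_eqI; simp add: trelD(1)[OF p(1)] trelD(1)[OF p(2)] trelD(1)[OF p(3)] trel_arr[OF T T' p(1)] trel_arr[OF T' T'' p(2)] trel_arr[OF T T' p(3)])+

lemma wm_acomp:
  assumes T: "gtower X T" and T': "gtower X' T'" and T'': "gtower X'' T''" and g: "\<guillemotleft>g :\<^bsub>C\<^esub> X \<rightarrow> X'\<guillemotright>" "\<guillemotleft>g' :\<^bsub>C\<^esub> X' \<rightarrow> X''\<guillemotright>"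
  shows "wm T T'' (g' \<odot> g) = wm T' T'' g' \<odot>\<^bsub>Kw HW\<^esub> wm T T' g"
proof -
  obtain \<phi> where p: "trel T T' g \<phi>" using trel_exists[OF T T' g(1)] .
  obtain \<psi> where q: "trel T' T'' g' \<psi>" using trel_exists[OF T' T'' g(2)] .
  have gg: "\<guillemotleft>g' \<odot> g :\<^bsub>C\<^esub> X \<rightarrow> X''\<guillemotright>" using g by simp
  show ?thesis
    unfolding wm_eq[OF T T' g(1) p] wm_eq[OF T' T'' g(2) q] wm_eq[OF T T'' gg trel_acomp[OF T T' T'' p q g]] mkc_ops(1)[OF T T' T'' p q p]
    using trel_arr(1)[OF T T' p] trel_arr(1)[OF T' T'' q] by (simp add: hw.kq_ops hw.wk_ops)
qed

lemma wm_aplus: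
  assumes T: "gtower X T" and T': "gtower X' T'" and g: "\<guillemotleft>g :\<^bsub>C\<^esub> X \<rightarrow> X'\<guillemotright>" "\<guillemotleft>g' :\<^bsub>C\<^esub> X \<rightarrow> X'\<guillemotright>"
  shows "wm T T' (g \<oplus> g') = wm T T' g \<oplus>\<^bsub>Kw HW\<^esub> wm T T' g'"
proof -
  obtain \<phi> where p: "trel T T' g \<phi>" using trel_exists[OF T T' g(1)] .
  obtain \<psi> where q: "trel T T' g' \<psi>" using trel_exists[OF T T' g(2)] .
  have gg: "\<guillemotleft>g \<oplus> g' :\<^bsub>C\<^esub> X \<rightarrow> X'\<guillemotright>" using g by simp
  have "trel T' T' (aid C X') (\<lambda>k. aid C (tH T' k))" by (rule trel_aid[OF T'])
  note m = mkc_ops(2)[OF T T' T' p this q]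
  show ?thesis
    unfolding wm_eq[OF T T' g(1) p] wm_eq[OF T T' g(2) q] wm_eq[OF T T' gg trel_aplus[OF T T' p q g]] m
    using trel_arr(1)[OF T T' p] trel_arr(1)[OF T T' q] by (simp add: hw.kq_ops hw.wk_ops)
qed

lemma wm_aneg:
  assumes T: "gtower X T" and T': "gtower X' T'" and g: "\<guillemotleft>g :\<^bsub>C\<^esub> X \<rightarrow> X'\<guillemotright>"
  shows "wm T T' (\<ominus> g) = \<ominus>\<^bsub>Kw HW\<^esub> (wm T T' g)"
proof -
  obtain \<phi> where p: "trel T T' g \<phi>" using trel_exists[OF T T' g] .
  have gg: "\<guillemotleft>\<ominus> g :\<^bsub>C\<^esub> X \<rightarrow> X'\<guillemotright>" using g by simp
  have "trel T' T' (aid C X') (\<lambda>k. aid C (tH T' k))" by (rule trel_aid[OF T'])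
  note m = mkc_ops(3)[OF T T' T' p this p]
  show ?thesis
    unfolding wm_eq[OF T T' g p] wm_eq[OF T T' gg trel_aneg[OF T T' p g]] m
    using trel_arr(1)[OF T T' p] by (simp add: hw.kq_ops hw.wk_ops)
qed

lemma wm_aid:
  assumes T: "gtower X T"
  shows "wm T T (aid C X) = aid (Kw HW) (cx T)"
proof -
  note e = trel_aid[OF T]
  have g: "\<guillemotleft>aid C X :\<^bsub>C\<^esub> X \<rightarrow> X\<guillemotright>" using gtowerD[OF T] by simp
  show ?thesis unfolding wm_eq[OF T T g e] mkc_ops(4)[OF T T T e e e] using T by (simp add: hw.kq_ops hw.wk_ops)
qed

text \<open>If all the composites vanish, then \<phi> is also related to the zero morphism, hence of
  the form $s h + h' t$. Conversely such a map disappears between $d'$ and $y$, and that composite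
  is the one in question.\<close>

lemma wm_zero_iff:
  assumes T: "gtower X T" and T': "gtower X' T'" and g: "\<guillemotleft>g :\<^bsub>C\<^esub> X \<rightarrow> X'\<guillemotright>"
  shows "wm T T' g = azero (Kw HW) (cx T) (cx T') \<longleftrightarrow> (\<forall>k. ta T' k \<odot> ash C k g \<odot> tb T (k - 1) = azero C (tG T k) (tL T' k))"
proof -
  obtain \<phi> where p: "trel T T' g \<phi>" using trel_exists[OF T T' g] .
  note a = trel_arr[OF T T' p] and c = trelD(1)[OF p]
  note [simp] = gtowerD[OF T] gtowerD[OF T'] gtower_hom[OF T] gtower_hom[OF T'] g
  have 0: "\<guillemotleft>azero hw.CA (cx T) (cx T') :\<^bsub>hw.CA\<^esub> cx T \<rightarrow> cx T'\<guillemotright>" using T T' by simp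
  have az: "azero (Kw HW) (cx T) (cx T') = hw.wk (hw.kq (azero hw.CA (cx T) (cx T')))" using T T' by (simp add: hw.kq_ops hw.wk_ops)
  have "wm T T' g = azero (Kw HW) (cx T) (cx T') \<longleftrightarrow> znull T T' \<phi>"
    unfolding wm_eq[OF T T' g p] az wk_kq_cx_eq_iff[OF T T' a(1) 0] by (simp add: a(2) c cong: if_cong)
  also have "\<dots> \<longleftrightarrow> (\<forall>k. ta T' k \<odot> ash C k g \<odot> tb T (k - 1) = azero C (tG T k) (tL T' k))"
  proof
    assume "znull T T' \<phi>"
    then show "\<forall>k. ta T' k \<odot> ash C k g \<odot> tb T (k - 1) = azero C (tG T k) (tL T' k)"
      using znull_annihilates(2)[OF T T'] p unfolding trel_def by metis
  next
    assume "\<forall>k. ta T' k \<odot> ash C k g \<odot> tb T (k - 1) = azero C (tG T k) (tL T' k)"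
    then have "trel T T' (azero C X X') \<phi>" using p unfolding trel_def by (simp add: gtower_hom(3)[OF T, of "k - 1" for k])
    then show "znull T T' \<phi>" by (rule trel_zero_znull[OF T T'])
  qed
  finally show ?thesis .
qed

text \<open>The identity induces mutually inverse maps between two towers of $X$. Because of this,
  towers adapted to a given problem may replace the chosen ones.\<close>

lemma wm_aiso_aid:
  assumes T: "gtower X T" and T': "gtower X T'"
  shows "hw.kw.aiso (wm T T' (aid C X))"
proof -
  have g: "\<guillemotleft>aid C X :\<^bsub>C\<^esub> X \<rightarrow> X\<guillemotright>" using gtowerD[OF T] by simp
  show ?thesis
    by (rule hw.kw.aisoI[of _ "wm T' T (aid C X)"])
      (use wm_acomp[OF T T' T g g] wm_acomp[OF T' T T' g g] wm_aid[OF T] wm_aid[OF T'] arr_wm[OF T T' g] arr_wm[OF T' T g] g in \<open>simp_all\<close>)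
qed

end

section \<open>Comparison of the given weight towers with typed towers\<close>

context weight_structure
begin

text \<open>The typed tower with the data of \<open>Q\<close>; only $y^k$ may be a different one.\<close>

definition tower_match :: "'o \<Rightarrow> ('o, 'm) tower \<Rightarrow> ('o, 'm) atower \<Rightarrow> bool" where
  "tower_match X Q T \<longleftrightarrow> gtower X T \<and> tL T = t_le Q \<and> tG T = t_ge Q \<and> tH T = t_gr Q \<and>
     (\<forall>k. ta T k = Arrow (ShO C k X) (t_le Q k) (t_a Q k) \<and> tf T k = Arrow (t_le Q k) (t_ge Q (k + 1)) (t_f Q k) \<and>
       tb T k = Arrow (t_ge Q (k + 1)) (ShO C (k + 1) X) (t_b Q k) \<and>
       tal T k = Arrow (ShO C (-1) (t_le Q k)) (t_le Q (k - 1)) (t_alpha Q k) \<and>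
       tbe T k = Arrow (ShO C (-1) (t_ge Q (k + 1))) (t_ge Q k) (t_beta Q k) \<and>
       tc T k = Arrow (t_le Q (k - 1)) (t_gr Q k) (t_c Q k) \<and> td T k = Arrow (t_gr Q k) (t_le Q k) (t_d Q k) \<and>
       t_x Q k = ShM C (-1) (t_f Q k \<cdot> t_d Q k))"

text \<open>The octahedron on the given \<alpha>, $c$ and $d$ produces some \<beta> and some $y$.
  The former is the given one by orthogonality. The latter may differ from the given one, but it
  satisfies the same $c^k = y^k f^{k-1}$ and in addition $d^k y^k = a^k b^{k-1}$.\<close>

lemma tower_match_exists:
  assumes Q: "weight_tower C w X Q" and X: "X \<in> Obj C"
  obtains T where "tower_match X Q T"
proof -
  define a f b al be c d where "a k = Arrow (ShO C k X) (t_le Q k) (t_a Q k)" and "f k = Arrow (t_le Q k) (t_ge Q (k + 1)) (t_f Q k)"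
    and "b k = Arrow (t_ge Q (k + 1)) (ShO C (k + 1) X) (t_b Q k)"
    and "al k = Arrow (ShO C (-1) (t_le Q k)) (t_le Q (k - 1)) (t_alpha Q k)"
    and "be k = Arrow (ShO C (-1) (t_ge Q (k + 1))) (t_ge Q k) (t_beta Q k)"
    and "c k = Arrow (t_le Q (k - 1)) (t_gr Q k) (t_c Q k)" and "d k = Arrow (t_gr Q k) (t_le Q k) (t_d Q k)" for k
  note defs = a_def f_def b_def al_def be_def c_def d_def
  have o: "t_le Q k \<in> fst w" "t_ge Q k \<in> snd w" "t_gr Q k \<in> fst w" "t_gr Q k \<in> snd w"
    "t_le Q k \<in> Obj C" "t_ge Q k \<in> Obj C" "t_gr Q k \<in> Obj C" for k
    using Q fst_w_obj snd_w_obj unfolding weight_tower_def heart_sel by blast+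
  have t1: "tri (a k) (f k) (b k)" for k
  proof -
    have "(ShO C k X, t_le Q k, t_ge Q (k + 1), t_a Q k, t_f Q k, t_b Q k) \<in> Dist C" using Q unfolding weight_tower_def by blast
    from tri_Dist[OF this] show ?thesis using X by (simp add: defs add.commute[of 1])
  qed
  have t2: "tri (al k) (c k) (d k)" for k
  proof -
    have "(ShO C (- 1) (t_le Q k), t_le Q (k - 1), t_gr Q k, t_alpha Q k, t_c Q k, t_d Q k) \<in> Dist C" using Q unfolding weight_tower_def by blast
    from tri_Dist[OF this] show ?thesis using o by (simp add: defs)
  qed
  have bet: "\<guillemotleft>be k :\<^bsub>C\<^esub> ShO C (-1) (t_ge Q (k + 1)) \<rightarrow> t_ge Q k\<guillemotright>" for k
    using Q o unfolding weight_tower_def by (simp add: be_def arr_Arrow)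
  have ala: "al k \<odot> ash C (-1) (a k) = a (k - 1)" "b (k - 1) \<odot> be k = ash C (-1) (b k)" for k
    using Q X unfolding weight_tower_def by (auto intro!: arrow_eqI simp: arrow_mor defs ash_def)
  have s: "src (a k) = ShO C k X" "tgt (a k) = t_le Q k" "tgt (f k) = t_ge Q (k + 1)" "src (al k) = ShO C (-1) (t_le Q k)" "tgt (al k) = t_le Q (k - 1)"
    "tgt (c k) = t_gr Q k" "src (f k) = t_le Q k" "src (b k) = t_ge Q (k + 1)" "tgt (b k) = ShO C (k + 1) X" "src (c k) = t_le Q (k - 1)" "src (d k) = t_gr Q k" "tgt (d k) = t_le Q k" for k
    by (simp_all add: defs)
  have "\<exists>y. tri (be k) y (\<ominus> (f k \<odot> d k)) \<and> \<guillemotleft>y :\<^bsub>C\<^esub> t_ge Q k \<rightarrow> t_gr Q k\<guillemotright> \<and> c k = y \<odot> f (k - 1) \<and> d k \<odot> y = a k \<odot> b (k - 1)" for k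
  proof -
    have s': "src (al k) = ShO C (-1) (tgt (a k))" "tgt (al k) = tgt (a (k - 1))" "src (a (k - 1)) = ShO C (-1) (src (a k))" using X by (simp_all add: s)
    obtain be' y where y: "tri be' y (\<ominus> (f k \<odot> d k))" "\<guillemotleft>be' :\<^bsub>C\<^esub> ShO C (-1) (tgt (f k)) \<rightarrow> tgt (f (k - 1))\<guillemotright>" "\<guillemotleft>y :\<^bsub>C\<^esub> tgt (f (k - 1)) \<rightarrow> tgt (c k)\<guillemotright>"
       "b (k - 1) \<odot> be' = ash C (-1) (b k)" "c k = y \<odot> f (k - 1)" "d k \<odot> y = a k \<odot> b (k - 1)"
      by (rule octahedron_le[OF t1[of k] t1[of "k - 1"] t2[of k] s' ala(1)])
    have "be' = be k"
    proof (rule tri_lift_unique[OF t1[of "k - 1"]])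
      show "v = azero C (src be') (tgt (a (k - 1)))" if "\<guillemotleft>v :\<^bsub>C\<^esub> src be' \<rightarrow> tgt (a (k - 1))\<guillemotright>" for v
        by (rule orth[OF that, of 1 0]) (use y(2) o in \<open>simp_all add: s\<close>)
    qed (use y bet ala(2)[of k] in \<open>simp_all add: s\<close>)
    moreover have "\<guillemotleft>y :\<^bsub>C\<^esub> t_ge Q k \<rightarrow> t_gr Q k\<guillemotright>" using y(3) o by (simp add: s)
    ultimately show ?thesis using y(1,5,6) by blast
  qed
  then obtain y where y: "\<And>k. tri (be k) (y k) (\<ominus> (f k \<odot> d k))" "\<And>k. \<guillemotleft>y k :\<^bsub>C\<^esub> t_ge Q k \<rightarrow> t_gr Q k\<guillemotright>"
    "\<And>k. c k = y k \<odot> f (k - 1)" "\<And>k. d k \<odot> y k = a k \<odot> b (k - 1)" by metis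
  define T where "T = \<lparr>tL = t_le Q, tG = t_ge Q, tH = t_gr Q, ta = a, tf = f, tb = b, tal = al, tbe = be, tc = c, td = d, ty = y\<rparr>"
  have "gtower X T" unfolding gtower_def
    using y(1,2,4) y(3)[symmetric] t1 t2 triD[OF t1] triD[OF t2] X bet ala o by (simp add: T_def s)
  moreover have "t_x Q k = ShM C (-1) (t_f Q k \<cdot> t_d Q k)" for k using Q unfolding weight_tower_def by blast
  ultimately have "tower_match X Q T" unfolding tower_match_def by (simp add: T_def defs)
  then show ?thesis by (rule that)
qed

lemma tower_match_cx: "tower_match X Q T \<Longrightarrow> cx T = tower_complex C Q"
  by (simp add: tower_match_def cx_def tower_complex_def th_def arrow_mor)

lemma tower_extension_trel:
  assumes T: "tower_match X Q T" and T': "tower_match X' Q' T'" and e: "tower_extension C X X' Q Q' g gl gr gg"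
  shows "trel T T' (Arrow X X' g) (\<lambda>k. Arrow (tH T k) (tH T' k) (gg k))"
proof -
  have G: "gtower X T" "gtower X' T'" using T T' by (simp_all add: tower_match_def)
  note [simp] = gtowerD[OF G(1)] gtowerD[OF G(2)]
  have g: "\<guillemotleft>Arrow X X' g :\<^bsub>C\<^esub> X \<rightarrow> X'\<guillemotright>" using e by (simp add: arr_Arrow tower_extension_def)
  have "tmap T T' (Arrow X X' g) (\<lambda>k. Arrow (tL T k) (tL T' k) (gl k)) (\<lambda>k. Arrow (tG T k) (tG T' k) (gr k)) (\<lambda>k. Arrow (tH T k) (tH T' k) (gg k))"
    using e T T' gtowerD[OF G(1)] gtowerD[OF G(2)] unfolding tmap_def tower_extension_def tower_match_def
    by (auto simp: arr_Arrow acomp_def ash_def)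
  then show ?thesis by (rule tmap_trel[OF G g])
qed

text \<open>A morphism of typed towers lacks only two of the conditions: that on \<beta> is
  \<open>tmap_beta\<close>, and that on $x^k = (f^k d^k)[-1]$ is the shift of the compatibility with
  $f$ and $d$.\<close>

lemma tower_extension_exists:
  assumes T: "tower_match X Q T" and T': "tower_match X' Q' T'" and g: "g \<in> Hom C X X'"
  obtains gl gr gg where "tower_extension C X X' Q Q' g gl gr gg"
proof -
  have G: "gtower X T" "gtower X' T'" using T T' by (simp_all add: tower_match_def)
  note o = gtowerD[OF G(1)] gtowerD[OF G(2)]
  have g': "\<guillemotleft>Arrow X X' g :\<^bsub>C\<^esub> X \<rightarrow> X'\<guillemotright>" using g o by (simp add: arr_Arrow)
  obtain l r \<phi> where e: "tmap T T' (Arrow X X' g) l r \<phi>" using tmap_exists[OF G g'] .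
  note h = tmap_hom[OF e]
  have x: "ash C (-1) (r (k + 1)) \<odot> ash C (-1) (tf T k \<odot> td T k) = ash C (-1) (tf T' k \<odot> td T' k) \<odot> ash C (-1) (\<phi> k)" for k
  proof -
    note [simp] = h gtower_hom[OF G(1)] gtower_hom[OF G(2)] o
    have dl: "l k \<odot> td T k = td T' k \<odot> \<phi> k" using e unfolding tmap_def by blast
    have "r (k + 1) \<odot> tf T k \<odot> td T k = tf T' k \<odot> td T' k \<odot> \<phi> k"
      using acomp_eq[OF tmap_eq(2)[OF e, of k], of "td T k"] dl by simp
    then have "ash C (-1) (r (k + 1) \<odot> tf T k \<odot> td T k) = ash C (-1) (tf T' k \<odot> td T' k \<odot> \<phi> k)" by simp
    then show ?thesis by (simp del: acomp_assoc flip: acomp_assoc)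
  qed
  have "tower_extension C X X' Q Q' g (\<lambda>k. mor (l k)) (\<lambda>k. mor (r k)) (\<lambda>k. mor (\<phi> k))"
    unfolding tower_extension_def
  proof (intro conjI allI g)
    fix k
    have m: "tL T = t_le Q" "tG T = t_ge Q" "tH T = t_gr Q" "tL T' = t_le Q'" "tG T' = t_ge Q'" "tH T' = t_gr Q'"
      using T T' by (simp_all add: tower_match_def)
    show "mor (l k) \<in> Hom C (t_le Q k) (t_le Q' k)" "mor (r k) \<in> Hom C (t_ge Q k) (t_ge Q' k)" "mor (\<phi> k) \<in> Hom C (t_gr Q k) (t_gr Q' k)"
      using mor_in_Hom[OF h(1)[of k]] mor_in_Hom[OF h(2)[of k]] mor_in_Hom[OF h(3)[of k]] by (simp_all only: m)
    note T = T[unfolded tower_match_def] and T' = T'[unfolded tower_match_def]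
    have n: "mor (ta T k) = t_a Q k" "mor (tf T k) = t_f Q k" "mor (tb T k) = t_b Q k" "mor (tal T k) = t_alpha Q k" "mor (tbe T k) = t_beta Q k"
      "mor (tc T k) = t_c Q k" "mor (td T k) = t_d Q k" "mor (ta T' k) = t_a Q' k" "mor (tf T' k) = t_f Q' k" "mor (tb T' k) = t_b Q' k" "mor (tal T' k) = t_alpha Q' k"
      "mor (tbe T' k) = t_beta Q' k" "mor (tc T' k) = t_c Q' k" "mor (td T' k) = t_d Q' k" using T T' by simp_all
    have ma: "mor (ash C n u) = ShM C n (mor u)" for n and u :: "('o, 'm) arrow" by (simp add: ash_def)
    note E = e[unfolded tmap_def, rule_format, of k]
    show "mor (l k) \<cdot> t_a Q k = t_a Q' k \<cdot> ShM C k g" "mor (r (k + 1)) \<cdot> t_f Q k = t_f Q' k \<cdot> mor (l k)"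
      "ShM C (k + 1) g \<cdot> t_b Q k = t_b Q' k \<cdot> mor (r (k + 1))" "mor (l (k - 1)) \<cdot> t_alpha Q k = t_alpha Q' k \<cdot> ShM C (- 1) (mor (l k))"
      "mor (\<phi> k) \<cdot> t_c Q k = t_c Q' k \<cdot> mor (l (k - 1))" "mor (l k) \<cdot> t_d Q k = t_d Q' k \<cdot> mor (\<phi> k)"
      using E by (auto dest!: arg_cong[of _ _ mor] simp: arrow_mor n ma)
    show "mor (r k) \<cdot> t_beta Q k = t_beta Q' k \<cdot> ShM C (- 1) (mor (r (k + 1)))"
      using arg_cong[OF tmap_beta[OF G g' e, of k], of mor] by (simp add: arrow_mor n ma)
    show "ShM C (- 1) (mor (r (k + 1))) \<cdot> t_x Q k = t_x Q' k \<cdot> ShM C (- 1) (mor (\<phi> k))"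
      using arg_cong[OF x, of mor k] T T' by (simp add: arrow_mor n ma)
  qed
  then show ?thesis by (rule that)
qed

text \<open>Every extension of $g$ gives a chain map related to $g$, so all extensions have the same
  class; since one exists, the definite description denotes it.\<close>

lemma wc_mor_eq:
  assumes T: "tower_match X (P X) T" and T': "tower_match X' (P X') T'" and g: "g \<in> Hom C X X'"
  shows "wc_mor C w P X X' g = mor (wm T T' (Arrow X X' g))"
proof -
  have G: "gtower X T" "gtower X' T'" using T T' by (simp_all add: tower_match_def)
  have g': "\<guillemotleft>Arrow X X' g :\<^bsub>C\<^esub> X \<rightarrow> X'\<guillemotright>" using g gtowerD(1) G by (simp add: arr_Arrow)
  have c: "wc_obj C P X = cx T" "wc_obj C P X' = cx T'" using tower_match_cx[OF T] tower_match_cx[OF T'] by (simp_all add: wc_obj_def)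
  have 1: "wclass HW (wc_obj C P X) (wc_obj C P X') (hclass HW (wc_obj C P X) (wc_obj C P X') gg) = mor (wm T T' (Arrow X X' g))"
    if "tower_extension C X X' (P X) (P X') g gl gr gg" for gl gr gg
    unfolding wm_eq[OF G g' tower_extension_trel[OF T T' that]] hw.mor_wk hw.kq_selectors hw.mor_kq mkc_selectors c
    by (simp add: mkc_def)
  obtain gl gr gg where e: "tower_extension C X X' (P X) (P X') g gl gr gg" using tower_extension_exists[OF T T' g] .
  show ?thesis unfolding wc_mor_def
  proof (rule the_equality)
    show "\<exists>gl gr gg. tower_extension C X X' (P X) (P X') g gl gr gg \<and> mor (wm T T' (Arrow X X' g)) =
      wclass HW (wc_obj C P X) (wc_obj C P X') (hclass HW (wc_obj C P X) (wc_obj C P X') gg)" using e 1[OF e] by metis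
  qed (use 1 in blast)
qed

end

section \<open>Weak exactness\<close>

context weight_structure
begin

abbreviation "KH \<equiv> Kcat HW"
abbreviation "KWH \<equiv> Kw HW"

definition tshift :: "('o, 'm) atower \<Rightarrow> ('o, 'm) atower" where
  "tshift T = \<lparr>tL = \<lambda>k. tL T (k + 1), tG = \<lambda>k. tG T (k + 1), tH = \<lambda>k. tH T (k + 1), ta = \<lambda>k. ta T (k + 1), tf = \<lambda>k. tf T (k + 1),
     tb = \<lambda>k. tb T (k + 1), tal = \<lambda>k. tal T (k + 1), tbe = \<lambda>k. tbe T (k + 1), tc = \<lambda>k. tc T (k + 1), td = \<lambda>k. td T (k + 1), ty = \<lambda>k. ty T (k + 1)\<rparr>"

lemma tshift_sel [simp]: "tL (tshift T) k = tL T (k + 1)" "tG (tshift T) k = tG T (k + 1)" "tH (tshift T) k = tH T (k + 1)"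
  "ta (tshift T) k = ta T (k + 1)" "tf (tshift T) k = tf T (k + 1)" "tb (tshift T) k = tb T (k + 1)" "tal (tshift T) k = tal T (k + 1)"
  "tbe (tshift T) k = tbe T (k + 1)" "tc (tshift T) k = tc T (k + 1)" "td (tshift T) k = td T (k + 1)" "ty (tshift T) k = ty T (k + 1)"
  "th (tshift T) k = th T (k + 1)"
  by (simp_all add: tshift_def th_def)

lemma gtower_tshift:
  assumes T: "gtower X T"
  shows "gtower (ShO C 1 X) (tshift T)"
proof -
  note [simp] = gtowerD[OF T]
  have e: "k + 1 - 1 = k - 1 + 1" for k :: int by simp
  show ?thesis unfolding gtower_def
    using gtower_hom[OF T, of "k + 1" for k] gtower_tri[OF T, of "k + 1" for k] gtower_eq(1,2,3,4)[OF T, of "k + 1" for k]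
    by (simp add: add.assoc)
qed

lemma trel_tshift:
  assumes T: "gtower X T" and T': "gtower X' T'" and g: "\<guillemotleft>g :\<^bsub>C\<^esub> X \<rightarrow> X'\<guillemotright>" and e: "trel T T' g \<phi>"
  shows "trel (tshift T) (tshift T') (ash C 1 g) (\<lambda>k. \<phi> (k + 1))"
proof -
  have "\<phi> (k + 1 + 1) \<odot> th T (k + 1) = th T' (k + 1) \<odot> \<phi> (k + 1)" for k using e unfolding trel_def by blast
  then show ?thesis using e g unfolding trel_def by simp
qed

text \<open>The signs compensate for the sign of the differential of a shifted complex.\<close>

definition sg :: "('o, 'm) atower \<Rightarrow> (('o, 'm) cpx, int \<Rightarrow> 'm) arrow" where
  "sg T = mkc (cx (tshift T)) (ShO hw.CA 1 (cx T)) (\<lambda>i. sgn_arr i (aid C (tH T (i + 1))))"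

lemma sg_selectors [simp]: "src (sg T) = cx (tshift T)" "tgt (sg T) = ShO hw.CA 1 (cx T)" "cm (sg T) i = sgn_arr i (aid C (tH T (i + 1)))"
  by (simp_all add: sg_def)

lemma arr_sg [simp]:
  assumes T: "gtower X T"
  shows "arr hw.CA (sg T)"
proof -
  note [simp] = gtowerD[OF T] gtower_comp(5)[OF T] dif_cx[OF T] dif_cx[OF gtower_tshift[OF T]] sgn_arr_suc
  have h: "arr C (th T (k + 1))" "src (th T (k + 1)) = tH T (k + 1)" "tgt (th T (k + 1)) = tH T (k + 2)" for k
    using gtower_comp(5)[OF T, of "k + 1"] by (simp_all add: add.commute[of 1] add.commute[of 2])
  show ?thesis
    using T gtower_tshift[OF T] unfolding hw.arr_cpx_iff[of "sg T"]
    by (simp add: hw.dif_ShO arr_heart h add.commute[of 1] add.commute[of 2] sgn_arr_def)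
qed

lemma sg_aiso:
  assumes T: "gtower X T"
  shows "hw.kc.aiso (hw.kq (sg T))"
proof -
  define s' where "s' = mkc (ShO hw.CA 1 (cx T)) (cx (tshift T)) (\<lambda>i. sgn_arr i (aid C (tH T (i + 1))))"
  have c: "cm s' i = sgn_arr i (aid C (tH T (i + 1)))" "src s' = ShO hw.CA 1 (cx T)" "tgt s' = cx (tshift T)" for i
    by (simp_all add: s'_def)
  note [simp] = gtowerD[OF T] gtower_comp(5)[OF T] dif_cx[OF T] dif_cx[OF gtower_tshift[OF T]]
  have h: "arr C (th T (k + 1))" "src (th T (k + 1)) = tH T (k + 1)" "tgt (th T (k + 1)) = tH T (k + 2)" for k
    using gtower_comp(5)[OF T, of "k + 1"] by (simp_all add: add.commute[of 1] add.commute[of 2])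
  have a: "arr hw.CA s'"
    using T gtower_tshift[OF T] unfolding hw.arr_cpx_iff[of s']
    by (simp add: hw.dif_ShO arr_heart h c add.commute[of 1] add.commute[of 2] sgn_arr_def)
  have "s' \<odot>\<^bsub>hw.CA\<^esub> sg T = aid hw.CA (cx (tshift T))" "sg T \<odot>\<^bsub>hw.CA\<^esub> s' = aid hw.CA (ShO hw.CA 1 (cx T))"
    by (rule cm_eqI; simp add: c sgn_arr_def)+
  from this[THEN arg_cong, of hw.kq] show ?thesis
    by (intro hw.kc.aisoI[of _ "hw.kq s'"]) (use a T in \<open>simp_all add: hw.kq_ops c\<close>)
qed

lemma sg_natural:
  assumes T: "gtower X T" and T': "gtower X' T'" and g: "\<guillemotleft>g :\<^bsub>C\<^esub> X \<rightarrow> X'\<guillemotright>"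
  shows "hw.wk (hw.kq (sg T')) \<odot>\<^bsub>KWH\<^esub> wm (tshift T) (tshift T') (ash C 1 g) = ash KWH 1 (wm T T' g) \<odot>\<^bsub>KWH\<^esub> hw.wk (hw.kq (sg T))"
proof -
  obtain \<phi> where p: "trel T T' g \<phi>" using trel_exists[OF T T' g] .
  note S = gtower_tshift[OF T] gtower_tshift[OF T']
  have g1: "\<guillemotleft>ash C 1 g :\<^bsub>C\<^esub> ShO C 1 X \<rightarrow> ShO C 1 X'\<guillemotright>" using g by simp
  note p1 = trel_tshift[OF T T' g p]
  note a = trel_arr[OF T T' p] and a1 = trel_arr[OF S p1]
  have "sg T' \<odot>\<^bsub>hw.CA\<^esub> mkc (cx (tshift T)) (cx (tshift T')) (\<lambda>k. \<phi> (k + 1)) = ash hw.CA 1 (mkc (cx T) (cx T') \<phi>) \<odot>\<^bsub>hw.CA\<^esub> sg T"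
    by (rule cm_eqI) (use trelD(1)[OF p] in \<open>simp_all add: sgn_arr_def\<close>)
  from arg_cong[OF this, of "\<lambda>x. hw.wk (hw.kq x)"] show ?thesis
    unfolding wm_eq[OF T T' g p] wm_eq[OF S g1 p1] using a(1) a1(1) T T' by (simp add: hw.kq_ops hw.wk_ops hw.ash_wk hw.ash_kq)
qed

text \<open>Two corrections are composed: the comparison of the tower chosen for $X[1]$ with the
  re-indexed tower of $X$, and the isomorphism \<open>sg\<close> that adjusts the sign of the
  differential.\<close>

definition theta :: "'o \<Rightarrow> ('o, 'm) atower \<Rightarrow> ('o, 'm) atower \<Rightarrow> (('o, 'm) cpx, ('o, 'm) kwmor) arrow" where
  "theta X S T = hw.wk (hw.kq (sg T)) \<odot>\<^bsub>KWH\<^esub> wm S (tshift T) (aid C (ShO C 1 X))"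

lemma theta:
  assumes T: "gtower X T" and S: "gtower (ShO C 1 X) S"
  shows "hw.kw.aiso (theta X S T)" "\<guillemotleft>theta X S T :\<^bsub>KWH\<^esub> cx S \<rightarrow> ShO hw.CA 1 (cx T)\<guillemotright>"
proof -
  show a: "hw.kw.aiso (theta X S T)" unfolding theta_def
    by (intro hw.kw.aiso_acomp hw.wk_aiso sg_aiso[OF T] wm_aiso_aid[OF S gtower_tshift[OF T]]) simp
  show "\<guillemotleft>theta X S T :\<^bsub>KWH\<^esub> cx S \<rightarrow> ShO hw.CA 1 (cx T)\<guillemotright>"
    using hw.kw.aiso_arr[OF a] S T by (simp add: theta_def)
qed

lemma theta_natural:
  assumes T: "gtower X T" and S: "gtower (ShO C 1 X) S" and T': "gtower X' T'" and S': "gtower (ShO C 1 X') S'" and g: "\<guillemotleft>g :\<^bsub>C\<^esub> X \<rightarrow> X'\<guillemotright>"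
  shows "theta X' S' T' \<odot>\<^bsub>KWH\<^esub> wm S S' (ash C 1 g) = ash KWH 1 (wm T T' g) \<odot>\<^bsub>KWH\<^esub> theta X S T"
proof -
  note R = gtower_tshift[OF T] gtower_tshift[OF T']
  have g1: "\<guillemotleft>ash C 1 g :\<^bsub>C\<^esub> ShO C 1 X \<rightarrow> ShO C 1 X'\<guillemotright>" "\<guillemotleft>aid C (ShO C 1 X) :\<^bsub>C\<^esub> ShO C 1 X \<rightarrow> ShO C 1 X\<guillemotright>"
    "\<guillemotleft>aid C (ShO C 1 X') :\<^bsub>C\<^esub> ShO C 1 X' \<rightarrow> ShO C 1 X'\<guillemotright>" using g by simp_all
  have e: "wm S' (tshift T') (aid C (ShO C 1 X')) \<odot>\<^bsub>KWH\<^esub> wm S S' (ash C 1 g) = wm (tshift T) (tshift T') (ash C 1 g) \<odot>\<^bsub>KWH\<^esub> wm S (tshift T) (aid C (ShO C 1 X))"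
    using wm_acomp[OF S S' R(2) g1(1,3)] wm_acomp[OF S R g1(2,1)] g by simp
  have A: "arr KWH (hw.wk (hw.kq (sg T')))" "arr KWH (hw.wk (hw.kq (sg T)))" using T T' by simp_all
  have B: "arr KWH (ash KWH 1 (wm T T' g))"
  proof -
    obtain f where "arr hw.CA f" "wm T T' g = hw.wk (hw.kq f)" using hw.arr_Kw_cases[OF arr_wm[OF T T' g]] by blast
    then show ?thesis by (simp add: hw.ash_wk)
  qed
  note [simp] = A B arr_wm[OF S S' g1(1)] arr_wm[OF S R(1) g1(2)] arr_wm[OF S' R(2) g1(3)] arr_wm[OF R g1(1)]
  show ?thesis
    using e hw.kw.acomp_eq[OF sg_natural[OF T T' g], of "wm S (tshift T) (aid C (ShO C 1 X))"] by (simp add: theta_def)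
qed

text \<open>As the third map is zero, the identity of the third term lifts to a section $s$, and $1
  - s q$ factors through $e$ by some $r$. The remaining identities follow because $e$ is now a
  monomorphism.\<close>

lemma split_middle:
  assumes t: "tri e q t" and t0: "t = azero C (tgt q) (ShO C 1 (src e))"
  obtains s r where "abiproduct C s e q r" "src s = tgt q"
proof -
  note d = triD[OF t]
  note [simp] = d
  have "t \<odot> aid C (tgt q) = azero C (tgt q) (ShO C 1 (src e))" using t0 d by simp
  then obtain s where s: "\<guillemotleft>s :\<^bsub>C\<^esub> tgt q \<rightarrow> tgt e\<guillemotright>" "aid C (tgt q) = q \<odot> s"
    using tri_lift3[OF t, of "aid C (tgt q)"] d by (simp del: acomp_aid) blast
  note [simp] = s(1) s(2)[symmetric]
  have qe: "q \<odot> e = azero C (src e) (tgt q)" by (rule tri_comp_zero(1)[OF t])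
  have "q \<odot> (aid C (tgt e) \<oplus> \<ominus> (s \<odot> q)) = azero C (tgt e) (tgt q)"
    using acomp_eq[OF s(2)[symmetric], of q] by simp
  then obtain r where r: "\<guillemotleft>r :\<^bsub>C\<^esub> tgt e \<rightarrow> src e\<guillemotright>" "aid C (tgt e) \<oplus> \<ominus> (s \<odot> q) = e \<odot> r"
    using tri_lift2[OF t, of "aid C (tgt e) \<oplus> \<ominus> (s \<odot> q)"] by auto
  note [simp] = r(1)
  have mono: "x = azero C (src x) (src e)" if x: "arr C x" "tgt x = src e" "e \<odot> x = azero C (src x) (tgt e)" for x
  proof -
    obtain v where v: "\<guillemotleft>v :\<^bsub>C\<^esub> src x \<rightarrow> ShO C (-1) (tgt q)\<guillemotright>" "x = ash C (-1) t \<odot> v" using tri_lift1[OF t x] by blast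
    have "ash C (-1) t = azero C (ShO C (-1) (tgt q)) (src e)" using arg_cong[OF t0, of "ash C (-1)"] d by simp
    then show ?thesis using v(1) v(2) d by simp
  qed
  have "e \<odot> r \<odot> e = e"
    using arg_cong[OF r(2), of "\<lambda>x. x \<odot> e"] qe by simp
  then have "r \<odot> e \<oplus> \<ominus> (aid C (src e)) = azero C (src e) (src e)"
    using mono[of "r \<odot> e \<oplus> \<ominus> (aid C (src e))"] by simp
  then have re: "r \<odot> e = aid C (src e)" using diff_eq_zero_iff[of "r \<odot> e" "aid C (src e)"] by simp
  have "e \<odot> r \<odot> s = azero C (tgt q) (tgt e)"
    using arg_cong[OF r(2), of "\<lambda>x. x \<odot> s"] by simp
  then have rs: "r \<odot> s = azero C (tgt q) (src e)" using mono[of "r \<odot> s"] by simp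
  have "s \<odot> q \<oplus> e \<odot> r = aid C (tgt e)"
    unfolding r(2)[symmetric] using aplus_left_comm[of "s \<odot> q" "aid C (tgt e)" "\<ominus> (s \<odot> q)"] by simp
  then have "abiproduct C s e q r" using qe re rs unfolding abiproduct_def by simp
  then show ?thesis by (rule that) simp
qed

text \<open>The heart triangles of the middle tower split, so its complex is a cone and the two maps
  lift together. Nothing is claimed about the class of \<open>K1\<close>; this is why only two sides
  are controlled at a time.\<close>

lemma middle_kd:
  assumes t: "tri F G H" and X: "gtower (src F) TX" and Y: "gtower (tgt F) TY" and Z: "gtower (tgt G) TZ"
  obtains K1 K2 K3 where "hw.kd K1 K2 K3" "src K1 = ShO hw.CA (-1) (cx TZ)" "tgt K1 = cx TX" "tgt K2 = cx TY" "tgt K3 = cx TZ"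
    "hw.wk K2 = wm TX TY F" "hw.wk K3 = wm TY TZ G"
proof -
  note d = triD[OF t]
  have FG: "\<guillemotleft>F :\<^bsub>C\<^esub> src F \<rightarrow> tgt F\<guillemotright>" "\<guillemotleft>G :\<^bsub>C\<^esub> tgt F \<rightarrow> tgt G\<guillemotright>" "\<guillemotleft>aid C (tgt F) :\<^bsub>C\<^esub> tgt F \<rightarrow> tgt F\<guillemotright>" using d by simp_all
  obtain TM e q t' where M: "gtower (tgt F) TM" "trel TX TM F e" "trel TM TZ G q" "\<And>k. tri (e k) (q k) (t' k)"
    using middle_tower[OF t X Z] by blast
  define \<epsilon> \<pi> where "\<epsilon> = mkc (cx TX) (cx TM) e" and "\<pi> = mkc (cx TM) (cx TZ) q"
  have a: "arr hw.CA \<epsilon>" "src \<epsilon> = cx TX" "tgt \<epsilon> = cx TM" "arr hw.CA \<pi>" "src \<pi> = cx TM" "tgt \<pi> = cx TZ"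
    "cm \<epsilon> k = e k" "cm \<pi> k = q k" for k
    using trel_arr[OF X M(1,2)] trel_arr[OF M(1) Z M(3)] by (simp_all add: \<epsilon>_def \<pi>_def)
  have "\<exists>s r. abiproduct C s (e k) (q k) r \<and> src s = tH TZ k" for k
  proof -
    note h = trelD(1)[OF M(2), of k] trelD(1)[OF M(3), of k]
    \<comment> \<open>A map from an object of the heart to the shift by 1 of another one: the
      weights are 0 and $-1$.\<close>
    have "t' k = azero C (tgt (q k)) (ShO C 1 (src (e k)))"
      by (rule orth[of _ _ _ 0 "-1"]) (use h triD[OF M(4), of k] gtowerD[OF X] gtowerD[OF Z] in simp_all)
    from split_middle[OF M(4) this] show ?thesis using h by metis
  qed
  then obtain s r where sr: "\<And>k. abiproduct C (s k) (e k) (q k) (r k)" "\<And>k. src (s k) = tH TZ k" by metis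
  have b: "abiproduct HW (s k) (cm \<epsilon> k) (cm \<pi> k) (r k)" for k
    using sr[of k] trelD(1)[OF M(2), of k] trelD(1)[OF M(3), of k] gtowerD(4,5)[OF X, of k] gtowerD(4,5)[OF Z, of k] gtowerD(4,5)[OF M(1), of k]
    unfolding abiproduct_def by (simp add: arr_heart a)
  obtain \<phi> where \<phi>: "hw.iscone \<phi> (tgt \<epsilon>) s (cm \<epsilon>) (cm \<pi>) r" "src \<phi> = ShO hw.CA (-1) (tgt \<pi>)" "tgt \<phi> = src \<epsilon>"
    by (rule hw.split_cone[OF a(1,4) _ b]) (use a sr(2) in simp_all)
  have m: "mkc (cx TX) (cx TM) (cm \<epsilon>) = \<epsilon>" "mkc (cx TM) (cx TZ) (cm \<pi>) = \<pi>" 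
    by (rule cm_eqI; simp add: a trelD(1)[OF M(2)] trelD(1)[OF M(3)])+
  have k: "hw.kd (hw.kq \<phi>) (hw.kq \<epsilon>) (hw.kq \<pi>)"
    using hw.iscone_kd[OF \<phi>(1)] X Z by (simp add: \<phi> a m)
  note \<phi>a = hw.isconeD(1)[OF \<phi>(1)]
  have w: "hw.wk (hw.kq \<epsilon>) = wm TX TM F" "hw.wk (hw.kq \<pi>) = wm TM TZ G"
    unfolding \<epsilon>_def \<pi>_def by (rule wm_eq[symmetric, OF X M(1) FG(1) M(2)], rule wm_eq[symmetric, OF M(1) Z FG(2) M(3)])
  \<comment> \<open>The tower just built need not be the prescribed tower of the middle object; a
    homotopy equivalence lifting their comparison transports the triangle.\<close>
  obtain i0 where i0: "arr hw.CA i0" "wm TM TY (aid C (tgt F)) = hw.wk (hw.kq i0)" using hw.arr_Kw_cases[OF arr_wm[OF M(1) Y FG(3)]] by blast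
  define i where "i = hw.kq i0"
  have i: "arr KH i" "hw.wk i = wm TM TY (aid C (tgt F))" using i0 by (simp_all add: i_def)
  have ist: "src i = cx TM" "tgt i = cx TY" using arg_cong[OF i(2), of src] arg_cong[OF i(2), of tgt] by simp_all
  have ai: "hw.kc.aiso i" using hw.aiso_Kw_Kcat[OF i(1)] wm_aiso_aid[OF M(1) Y] i(2) by simp
  obtain j where j: "\<guillemotleft>j :\<^bsub>KH\<^esub> tgt i \<rightarrow> src i\<guillemotright>" "j \<odot>\<^bsub>KH\<^esub> i = aid KH (src i)" "i \<odot>\<^bsub>KH\<^esub> j = aid KH (tgt i)" using hw.kc.aisoE[OF ai] by auto
  note [simp] = i(1) ist a(1-6) hw.arr_kq \<phi>a \<phi>(2,3) j(1)
  have "hw.kd (hw.kq \<phi>) (i \<odot>\<^bsub>KH\<^esub> hw.kq \<epsilon>) (hw.kq \<pi> \<odot>\<^bsub>KH\<^esub> j)"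
    by (rule hw.kd_iso[OF k, of "aid KH (src \<phi>)" "aid KH (tgt \<phi>)" i])
      (use ai j(2) X Y Z in \<open>simp_all add: hw.kc.aiso_aid hw.ash_Kcat_ops\<close>)
  moreover have "hw.wk (i \<odot>\<^bsub>KH\<^esub> hw.kq \<epsilon>) = wm TX TY F"
    using wm_acomp[OF X M(1) Y FG(1,3)] FG by (simp add: hw.wk_ops i(2) w)
  moreover have "hw.wk (hw.kq \<pi> \<odot>\<^bsub>KH\<^esub> j) = wm TY TZ G"
  proof -
    have "wm TY TZ G \<odot>\<^bsub>KWH\<^esub> hw.wk i = hw.wk (hw.kq \<pi>)"
      using wm_acomp[OF M(1) Y Z FG(3,2)] FG by (simp add: i(2) w)
    moreover have "hw.wk i \<odot>\<^bsub>KWH\<^esub> hw.wk j = aid KWH (cx TY)" using arg_cong[OF j(3), of hw.wk] by (simp add: hw.wk_ops)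
    ultimately show ?thesis
      using hw.kw.acomp_eq[of "wm TY TZ G" "hw.wk i" "hw.wk (hw.kq \<pi>)" "hw.wk j"] arr_wm[OF Y Z FG(2)] by (simp add: hw.wk_ops)
  qed
  moreover have "src (hw.kq \<phi>) = ShO hw.CA (-1) (cx TZ)" "tgt (hw.kq \<phi>) = cx TX"
    "tgt (i \<odot>\<^bsub>KH\<^esub> hw.kq \<epsilon>) = cx TY" "tgt (hw.kq \<pi> \<odot>\<^bsub>KH\<^esub> j) = cx TZ" by (simp_all only: hw.kq_selectors \<phi> a arrow_selectors ist)
  ultimately show ?thesis using that by blast
qed

lemma gtower_exists_plain:
  assumes "X \<in> Obj C"
  obtains T where "gtower X T"
proof -
  have "\<exists>a f b. tri a f b \<and> src a = ShO C k X \<and> tgt a \<in> fst w \<and> tgt f \<in> snd w" for k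
    using weight_dec[of "ShO C k X"] assms by auto
  then obtain a f b where *: "\<And>k. tri (a k) (f k) (b k)" "\<And>k. src (a k) = ShO C k X" "\<And>k. tgt (a k) \<in> fst w" "\<And>k. tgt (f k) \<in> snd w"
    by metis
  show ?thesis using gtower_exists[OF assms *] that by metis
qed

lemma kd_lift:
  assumes "arr KWH x" "hw.kw.aiso x"
  obtains y where "arr KH y" "hw.wk y = x" "hw.kc.aiso y" "src y = src x" "tgt y = tgt x"
proof -
  obtain y0 where y: "arr hw.CA y0" "x = hw.wk (hw.kq y0)" using hw.arr_Kw_cases[OF assms(1)] by blast
  show ?thesis by (rule that[of "hw.kq y0"]) (use y assms(2) hw.aiso_Kw_Kcat[of "hw.kq y0"] in simp_all)
qed

lemma arr_ash_Kw: "arr KWH x \<Longrightarrow> arr KWH (ash KWH n x)"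
  using hw.arr_Kw_cases[of x] by (auto simp: hw.ash_wk)

lemma weak_exact:
  assumes t: "tri f g h" and X: "gtower (src f) TX" and Y: "gtower (tgt f) TY" and Z: "gtower (tgt g) TZ"
    and S: "gtower (ShO C 1 (src f)) SX"
  defines "T3 \<equiv> theta (src f) SX TX \<odot>\<^bsub>KWH\<^esub> wm TZ SX h"
  shows "\<exists>F G H. hw.kd F G H \<and> src F = cx TX \<and> tgt F = cx TY \<and> tgt G = cx TZ \<and> hw.wk F = wm TX TY f \<and> hw.wk G = wm TY TZ g" (is ?A)
    "\<exists>F G H. hw.kd F G H \<and> src F = cx TX \<and> tgt F = cx TY \<and> tgt G = cx TZ \<and> hw.wk G = wm TY TZ g \<and> hw.wk H = T3" (is ?B)
    "\<exists>F G H. hw.kd F G H \<and> src F = cx TX \<and> tgt F = cx TY \<and> tgt G = cx TZ \<and> hw.wk F = wm TX TY f \<and> hw.wk H = T3" (is ?C)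
proof -
  note d = triD[OF t]
  have fgh: "\<guillemotleft>f :\<^bsub>C\<^esub> src f \<rightarrow> tgt f\<guillemotright>" "\<guillemotleft>g :\<^bsub>C\<^esub> tgt f \<rightarrow> tgt g\<guillemotright>" "\<guillemotleft>h :\<^bsub>C\<^esub> tgt g \<rightarrow> ShO C 1 (src f)\<guillemotright>" using d by simp_all
  note th = theta[OF X S]
  obtain \<theta> where \<theta>: "arr KH \<theta>" "hw.wk \<theta> = theta (src f) SX TX" "hw.kc.aiso \<theta>" "src \<theta> = cx SX" "tgt \<theta> = ShO hw.CA 1 (cx TX)"
    using kd_lift[of "theta (src f) SX TX"] th by metis
  show ?A
  proof -
    obtain K1 K2 K3 where k: "hw.kd K1 K2 K3" "src K1 = ShO hw.CA (-1) (cx TZ)" "tgt K1 = cx TX" "tgt K2 = cx TY" "tgt K3 = cx TZ"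
      "hw.wk K2 = wm TX TY f" "hw.wk K3 = wm TY TZ g" by (rule middle_kd[OF t X Y Z])
    have "src K2 = cx TX" using k(1,3) by (simp add: hw.kd_def)
    then show ?A using hw.kd_rotate[OF k(1)] k by blast
  qed
  show ?B
  proof -
    have X': "gtower (src g) TY" "gtower (tgt g) TZ" "gtower (tgt h) SX" using Y Z S d by simp_all
    obtain K1 K2 K3 where k: "hw.kd K1 K2 K3" "src K1 = ShO hw.CA (-1) (cx SX)" "tgt K1 = cx TY" "tgt K2 = cx TZ" "tgt K3 = cx SX"
      "hw.wk K2 = wm TY TZ g" "hw.wk K3 = wm TZ SX h" by (rule middle_kd[OF tri_rotate[OF t] X'])
    have kk: "arr KH K1" "arr KH K2" "arr KH K3" "src K2 = cx TY" "src K3 = cx TZ" using k by (auto simp: hw.kd_def)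
    have c: "cx TX \<in> Obj hw.CA" "cx SX \<in> Obj hw.CA" "cx TY \<in> Obj hw.CA" "cx TZ \<in> Obj hw.CA" using X S Y Z by simp_all
    \<comment> \<open>The triangle lifting $g$ and $h$ starts at the complex of $X[1]$ shifted by
      $-1$. The equivalence \<theta>, shifted back, replaces it by the complex of $X$.\<close>
    define u where "u = ash KH (-1) \<theta>"
    have u: "hw.kc.aiso u" "arr KH u" "src u = ShO hw.CA (-1) (cx SX)" "tgt u = cx TX" "ash KH 1 u = \<theta>"
      using hw.ash_Kcat_aiso[OF \<theta>(3)] \<theta> c by (simp_all add: u_def hw.ash_Kcat_ops)
    obtain v where v: "\<guillemotleft>v :\<^bsub>KH\<^esub> tgt u \<rightarrow> src u\<guillemotright>" "v \<odot>\<^bsub>KH\<^esub> u = aid KH (src u)" using hw.kc.aisoE[OF u(1)] by auto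
    note [simp] = kk k(2-5) u(2-5) v(1) \<theta>(1,4,5) c
    have "hw.kd (K1 \<odot>\<^bsub>KH\<^esub> v) K2 (\<theta> \<odot>\<^bsub>KH\<^esub> K3)"
      by (rule hw.kd_iso[OF k(1), of u "aid KH (cx TY)" "aid KH (cx TZ)"]) (use u(1) v(2) in \<open>simp_all add: hw.kc.aiso_aid\<close>)
    moreover have "hw.wk (\<theta> \<odot>\<^bsub>KH\<^esub> K3) = T3" by (simp add: hw.wk_ops \<theta>(2) k(7) T3_def)
    moreover have "src (K1 \<odot>\<^bsub>KH\<^esub> v) = cx TX" "tgt (K1 \<odot>\<^bsub>KH\<^esub> v) = cx TY" by simp_all
    ultimately show ?B using k(4,6) by blast
  qed
  show ?C
  proof -
    define h' where "h' = \<ominus> (ash C (-1) h)"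
    have t': "tri h' f g" unfolding h'_def by (rule tri_rotate_back[OF t])
    have h': "\<guillemotleft>h' :\<^bsub>C\<^esub> ShO C (-1) (tgt g) \<rightarrow> src f\<guillemotright>" using d by (simp add: h'_def)
    obtain S' where S': "gtower (ShO C (-1) (tgt g)) S'" using gtower_exists_plain[of "ShO C (-1) (tgt g)"] d by auto
    have X': "gtower (src h') S'" "gtower (tgt h') TX" "gtower (tgt f) TY" using S' X Y h' by simp_all
    obtain K1 K2 K3 where k: "hw.kd K1 K2 K3" "src K1 = ShO hw.CA (-1) (cx TY)" "tgt K1 = cx S'" "tgt K2 = cx TX" "tgt K3 = cx TY"
      "hw.wk K2 = wm S' TX h'" "hw.wk K3 = wm TX TY f" by (rule middle_kd[OF t' X'])
    have kk: "arr KH K1" "arr KH K2" "arr KH K3" "src K2 = cx S'" "src K3 = cx TX" using k by (auto simp: hw.kd_def)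
    have c: "cx TX \<in> Obj hw.CA" "cx S' \<in> Obj hw.CA" "cx TY \<in> Obj hw.CA" "cx TZ \<in> Obj hw.CA" using X S' Y Z by simp_all
    \<comment> \<open>Two rotations make the lift of $f$ the first map. The third is minus the
      shifted lift of $-h[-1]$, and the two signs cancel.\<close>
    note k2 = hw.kd_rotate[OF hw.kd_rotate[OF k(1)]]
    have Z': "gtower (ShO C 1 (ShO C (-1) (tgt g))) TZ" using Z d by simp
    note th' = theta[OF S' Z']
    obtain \<eta> where \<eta>: "arr KH \<eta>" "hw.wk \<eta> = theta (ShO C (-1) (tgt g)) TZ S'" "hw.kc.aiso \<eta>" "src \<eta> = cx TZ" "tgt \<eta> = ShO hw.CA 1 (cx S')"
      using kd_lift[of "theta (ShO C (-1) (tgt g)) TZ S'"] th' by metis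
    obtain x where x: "\<guillemotleft>x :\<^bsub>KH\<^esub> tgt \<eta> \<rightarrow> src \<eta>\<guillemotright>" "x \<odot>\<^bsub>KH\<^esub> \<eta> = aid KH (src \<eta>)" "\<eta> \<odot>\<^bsub>KH\<^esub> x = aid KH (tgt \<eta>)" using hw.kc.aisoE[OF \<eta>(3)] by auto
    have ax: "hw.kc.aiso x" using x \<eta>(1) by (intro hw.kc.aisoI[of x \<eta>]) simp_all
    note [simp] = kk k(2-5) \<eta>(1,4,5) x(1) c
    have "hw.kd K3 (x \<odot>\<^bsub>KH\<^esub> \<ominus>\<^bsub>KH\<^esub> (ash KH 1 K1)) (\<ominus>\<^bsub>KH\<^esub> (ash KH 1 K2) \<odot>\<^bsub>KH\<^esub> \<eta>)"
      by (rule hw.kd_iso[OF k2, of "aid KH (cx TX)" "aid KH (cx TY)" x])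
        (use ax x(3) in \<open>simp_all add: hw.kc.aiso_aid hw.ash_Kcat_ops\<close>)
    moreover have "hw.wk (\<ominus>\<^bsub>KH\<^esub> (ash KH 1 K2) \<odot>\<^bsub>KH\<^esub> \<eta>) = T3"
    proof -
      define h2 where "h2 = ash C (-1) h"
      have h2: "\<guillemotleft>h2 :\<^bsub>C\<^esub> ShO C (-1) (tgt g) \<rightarrow> src f\<guillemotright>" "ash C 1 h2 = h" using d by (simp_all add: h2_def)
      have a2: "arr KWH (wm S' TX h2)" by (rule arr_wm[OF S' X h2(1)])
      have K2: "hw.wk K2 = \<ominus>\<^bsub>KWH\<^esub> (wm S' TX h2)"
        unfolding k(6) h'_def h2_def[symmetric] by (rule wm_aneg[OF S' X h2(1)])
      have as: "ash KWH 1 (hw.wk K2) = \<ominus>\<^bsub>KWH\<^esub> (ash KWH 1 (wm S' TX h2))"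
      proof -
        obtain m0 where m: "arr hw.CA m0" "wm S' TX h2 = hw.wk (hw.kq m0)" using hw.arr_Kw_cases[OF a2] by blast
        then show ?thesis unfolding K2 by (simp add: hw.ash_wk hw.ash_Kcat_ops flip: hw.wk_ops)
      qed
      have "hw.wk (\<ominus>\<^bsub>KH\<^esub> (ash KH 1 K2) \<odot>\<^bsub>KH\<^esub> \<eta>) = \<ominus>\<^bsub>KWH\<^esub> (ash KWH 1 (hw.wk K2)) \<odot>\<^bsub>KWH\<^esub> hw.wk \<eta>"
        by (simp add: hw.wk_ops hw.ash_wk)
      also have "\<dots> = ash KWH 1 (wm S' TX h2) \<odot>\<^bsub>KWH\<^esub> hw.wk \<eta>" unfolding as using arr_ash_Kw[OF a2, of 1] by simp
      also have "\<dots> = T3" unfolding T3_def \<eta>(2) using theta_natural[OF S' Z' X S h2(1)] h2(2) by simp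
      finally show ?thesis .
    qed
    moreover have "src (x \<odot>\<^bsub>KH\<^esub> \<ominus>\<^bsub>KH\<^esub> (ash KH 1 K1)) = cx TY" "tgt (x \<odot>\<^bsub>KH\<^esub> \<ominus>\<^bsub>KH\<^esub> (ash KH 1 K1)) = cx TZ" by simp_all
    ultimately show ?C using kk(5) k(5,7) by blast
  qed
qed

end

section \<open>Morphisms killed by the weight complex\<close>

context weight_structure
begin

text \<open>The map $b^n[-1]$ goes from $X^{w>=n+1}[-1]$ to $X[n]$ and vanishes by orthogonality, so
  $a^n$ is a monomorphism.\<close>

lemma ta_cancel:
  assumes X: "X \<in> w_le C w n" and T: "gtower X T" and u: "arr C u" "tgt u = ShO C n X" "ta T n \<odot> u = azero C (src u) (tL T n)"
  shows "u = azero C (src u) (ShO C n X)"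
proof -
  note [simp] = gtower_hom[OF T] gtowerD[OF T] u(1,2)
  have uf: "tgt u = src (ta T n)" "ta T n \<odot> u = azero C (src u) (tgt (ta T n))" using u by simp_all
  obtain v where v: "\<guillemotleft>v :\<^bsub>C\<^esub> src u \<rightarrow> ShO C (-1) (tgt (tf T n))\<guillemotright>" "u = ash C (-1) (tb T n) \<odot> v"
    using tri_lift1[OF gtower_tri(1)[OF T, of n] u(1) uf] by blast
  have "ash C (-1) (tb T n) = azero C (ShO C (-1) (tG T (n + 1))) (ShO C n X)"
    by (rule orth[of _ _ _ 1 0]) (use X in \<open>simp_all add: w_le_iff\<close>)
  then have "ash C (-1) (tb T n) \<odot> v = azero C (src u) (ShO C n X)" using v(1) by simp
  then show ?thesis using v(2) by metis
qed

text \<open>Dually, $a^{n-1}[1]$ goes from $X[n]$ to $X^{w<=n-1}[1]$ and vanishes, so $b^{n-1}$ is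
  an epimorphism.\<close>

lemma tb_cancel:
  assumes X: "X \<in> w_ge C w n" and T: "gtower X T" and u: "arr C u" "src u = ShO C n X" "u \<odot> tb T (n - 1) = azero C (tG T n) (tgt u)"
  shows "u = azero C (ShO C n X) (tgt u)"
proof -
  note [simp] = gtower_hom[OF T] gtowerD[OF T] u(1,2)
  have b: "\<guillemotleft>tb T (n - 1) :\<^bsub>C\<^esub> tG T n \<rightarrow> ShO C n X\<guillemotright>" using gtower_hom(3)[OF T, of "n - 1"] by simp
  have uf: "src u = tgt (tb T (n - 1))" "u \<odot> tb T (n - 1) = azero C (tgt (tf T (n - 1))) (tgt u)" using u b by simp_all
  obtain v where v: "\<guillemotleft>v :\<^bsub>C\<^esub> ShO C 1 (src (tf T (n - 1))) \<rightarrow> tgt u\<guillemotright>" "u = v \<odot> \<ominus> (ash C 1 (ta T (n - 1)))"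
    using tri_ext3[OF tri_rotate[OF gtower_tri(1)[OF T, of "n - 1"]] u(1) uf] by blast
  have "ash C 1 (ta T (n - 1)) = azero C (ShO C n X) (ShO C 1 (tL T (n - 1)))"
    by (rule orth[of _ _ _ 0 "-1"]) (use X in \<open>simp_all add: w_ge_iff\<close>)
  then have "v \<odot> \<ominus> (ash C 1 (ta T (n - 1))) = azero C (ShO C n X) (tgt u)" using v(1) by simp
  then show ?thesis using v(2) by metis
qed

lemma ash_azero_iff:
  assumes "\<guillemotleft>g :\<^bsub>C\<^esub> X \<rightarrow> Y\<guillemotright>" "ash C n g = azero C (ShO C n X) (ShO C n Y)"
  shows "g = azero C X Y"
  using ash_eq_zero_iff assms by auto

text \<open>In degree $a$ the criterion of \<open>wm_zero_iff\<close> reads $a'^a g[a] b^{a-1} = 0$,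
  where the left factor is monic and the right factor epic.\<close>

lemma wm_inj:
  assumes X: "X \<in> w_ge C w a" "X' \<in> w_le C w a" and T: "gtower X T" and T': "gtower X' T'" and g: "\<guillemotleft>g :\<^bsub>C\<^esub> X \<rightarrow> X'\<guillemotright>"
    and z: "wm T T' g = azero KWH (cx T) (cx T')"
  shows "g = azero C X X'"
proof -
  note [simp] = gtower_hom[OF T] gtowerD[OF T] gtower_hom[OF T'] gtowerD[OF T'] g
  have b: "\<guillemotleft>tb T (a - 1) :\<^bsub>C\<^esub> tG T a \<rightarrow> ShO C a X\<guillemotright>" using gtower_hom(3)[OF T, of "a - 1"] by simp
  have "ta T' a \<odot> ash C a g \<odot> tb T (a - 1) = azero C (tG T a) (tL T' a)" using z wm_zero_iff[OF T T' g] by blast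
  then have "ash C a g \<odot> tb T (a - 1) = azero C (tG T a) (ShO C a X')"
    using ta_cancel[OF X(2) T', of "ash C a g \<odot> tb T (a - 1)"] b by simp
  then have "ash C a g = azero C (ShO C a X) (ShO C a X')" using tb_cancel[OF X(1) T, of "ash C a g"] by simp
  then show ?thesis by (rule ash_azero_iff[OF g])
qed

text \<open>Equivalently $\<gamma>[k+1]$ factors through $b^k$ for all $k \<le> m$, so \<gamma>
  comes from increasingly positive weights as $m$ grows.\<close>

definition fil :: "int \<Rightarrow> ('o, 'm) atower \<Rightarrow> ('o, 'm) arrow \<Rightarrow> bool" where
  "fil m T \<gamma> \<longleftrightarrow> (\<forall>k \<le> m. ta T k \<odot> ash C k \<gamma> = azero C (ShO C k (src \<gamma>)) (tL T k))"

text \<open>For $k < i$ the object $X[k]$ has positive weights, so no map from it to $Z^{w<=k}$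
  survives.\<close>

lemma fil_start:
  assumes X: "X \<in> w_ge C w i" and T: "gtower Z T" and g: "\<guillemotleft>\<gamma> :\<^bsub>C\<^esub> X \<rightarrow> Z\<guillemotright>"
  shows "fil (i - 1) T \<gamma>"
  unfolding fil_def
proof (intro allI impI)
  fix k assume k: "k \<le> i - 1"
  note [simp] = gtower_hom[OF T] gtowerD[OF T] g
  show "ta T k \<odot> ash C k \<gamma> = azero C (ShO C k (src \<gamma>)) (tL T k)"
    by (rule orth[of _ _ _ "i - k" 0]) (use X k in \<open>simp_all add: w_ge_iff\<close>)
qed

text \<open>From $a^{k-1} \<gamma>[k-1] = 0$ one gets a factorisation of $\<gamma>[k]$ through
  $b^{k-1}$, and $a'^k g[k] b^{k-1} = 0$ because $t(g) = 0$. The shift between the two indices is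
  the gain of one.\<close>

lemma fil_step:
  assumes T: "gtower Z T" and T': "gtower Z' T'" and g: "\<guillemotleft>\<gamma> :\<^bsub>C\<^esub> X \<rightarrow> Z\<guillemotright>" "\<guillemotleft>g :\<^bsub>C\<^esub> Z \<rightarrow> Z'\<guillemotright>"
    and f: "fil m T \<gamma>" and z: "wm T T' g = azero KWH (cx T) (cx T')"
  shows "fil (m + 1) T' (g \<odot> \<gamma>)"
  unfolding fil_def
proof (intro allI impI)
  fix k assume k: "k \<le> m + 1"
  note [simp] = gtower_hom[OF T] gtowerD[OF T] gtower_hom[OF T'] gtowerD[OF T'] g
  have b: "\<guillemotleft>tb T (k - 1) :\<^bsub>C\<^esub> tG T k \<rightarrow> ShO C k Z\<guillemotright>" using gtower_hom(3)[OF T, of "k - 1"] by simp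
  have "ta T (k - 1) \<odot> ash C (k - 1) \<gamma> = azero C (ShO C (k - 1) X) (tL T (k - 1))" using f k by (simp add: fil_def)
  from arg_cong[OF this, of "ash C 1"] have "ash C 1 (ta T (k - 1)) \<odot> ash C k \<gamma> = azero C (ShO C k X) (ShO C 1 (tL T (k - 1)))" by simp
  then obtain \<rho> where \<rho>: "\<guillemotleft>\<rho> :\<^bsub>C\<^esub> ShO C k X \<rightarrow> tG T k\<guillemotright>" "ash C k \<gamma> = tb T (k - 1) \<odot> \<rho>"
    using tri_lift3[OF tri_rotate[OF gtower_tri(1)[OF T, of "k - 1"]], of "ash C k \<gamma>"] b by auto
  have "ta T' k \<odot> ash C k g \<odot> tb T (k - 1) = azero C (tG T k) (tL T' k)" using z wm_zero_iff[OF T T' g(2)] by blast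
  from acomp_eq[OF this, of \<rho>] show "ta T' k \<odot> ash C k (g \<odot> \<gamma>) = azero C (ShO C k (src (g \<odot> \<gamma>))) (tL T' k)"
    using \<rho> b by simp
qed

lemma fil_end:
  assumes Z: "Z \<in> w_le C w j" and T: "gtower Z T" and g: "\<guillemotleft>\<gamma> :\<^bsub>C\<^esub> X \<rightarrow> Z\<guillemotright>" and f: "fil j T \<gamma>"
  shows "\<gamma> = azero C X Z"
proof -
  have "ash C j \<gamma> = azero C (ShO C j X) (ShO C j Z)"
    using ta_cancel[OF Z T, of "ash C j \<gamma>"] f g by (simp add: fil_def)
  then show ?thesis by (rule ash_azero_iff[OF g])
qed

lemma fil_acomp:
  assumes T: "gtower Z T" and g: "\<guillemotleft>\<gamma> :\<^bsub>C\<^esub> X \<rightarrow> Z\<guillemotright>" "\<guillemotleft>u :\<^bsub>C\<^esub> Y \<rightarrow> X\<guillemotright>" and f: "fil m T \<gamma>"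
  shows "fil m T (\<gamma> \<odot> u)"
  unfolding fil_def
proof (intro allI impI)
  fix k assume k: "k \<le> m"
  note [simp] = gtower_hom[OF T] gtowerD[OF T] g
  have "ta T k \<odot> ash C k \<gamma> = azero C (ShO C k X) (tL T k)" using f k by (simp add: fil_def)
  from acomp_eq[OF this, of "ash C k u"] show "ta T k \<odot> ash C k (\<gamma> \<odot> u) = azero C (ShO C k (src (\<gamma> \<odot> u))) (tL T k)" by simp
qed

text \<open>The Newton step $p' = 3 p^2 - 2 p^3$ for the equation $p^2 = p$, written as $p - n c$ with
  $n = p^2 - p$, $c = 2 p - 1$. Since $c^2 = 1 + 4 n$, one has $p'^2 - p' = n^2 (c^2 - 4)$.\<close>

lemma idempotent_improve:
  assumes p: "\<guillemotleft>p :\<^bsub>C\<^esub> X \<rightarrow> X\<guillemotright>"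
  defines "n \<equiv> p \<odot> p \<oplus> \<ominus> p" and "c \<equiv> p \<oplus> p \<oplus> \<ominus> (aid C X)"
  defines "p' \<equiv> p \<oplus> \<ominus> (n \<odot> c)"
  shows "\<exists>z. \<guillemotleft>z :\<^bsub>C\<^esub> X \<rightarrow> X\<guillemotright> \<and> p' \<odot> p' \<oplus> \<ominus> p' = n \<odot> n \<odot> z" "\<guillemotleft>n :\<^bsub>C\<^esub> X \<rightarrow> X\<guillemotright>" "\<guillemotleft>c :\<^bsub>C\<^esub> X \<rightarrow> X\<guillemotright>"
proof -
  note [simp] = p
  show n: "\<guillemotleft>n :\<^bsub>C\<^esub> X \<rightarrow> X\<guillemotright>" and c: "\<guillemotleft>c :\<^bsub>C\<^esub> X \<rightarrow> X\<guillemotright>" by (simp_all add: n_def c_def)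
  note [simp] = n c
  have pn: "p \<odot> n = n \<odot> p" by (simp add: n_def)
  have cn: "c \<odot> n = n \<odot> c" by (simp add: c_def pn)
  have cc: "c \<odot> c = aid C X \<oplus> n \<oplus> n \<oplus> n \<oplus> n" by (simp add: c_def n_def aplus_ac)
  have pnc: "p \<odot> n \<odot> c = n \<odot> p \<odot> c" using acomp_eq[OF pn, of c] by simp
  have pc: "p \<odot> c = c \<odot> p" by (simp add: c_def)
  have cnc: "c \<odot> n \<odot> c = n \<odot> c \<odot> c" using acomp_eq[OF cn, of c] by simp
  define m where "m = n \<odot> n"
  have m [simp]: "\<guillemotleft>m :\<^bsub>C\<^esub> X \<rightarrow> X\<guillemotright>" by (simp add: m_def)
  have ncc: "n \<odot> c \<odot> c = n \<oplus> m \<oplus> m \<oplus> m \<oplus> m" by (simp add: cc m_def)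
  \<comment> \<open>Two values of $n c^2$ are compared: one in powers of $n$, the other through $q =
    n c p$, the mixed term in the expansion of $p'^2$.\<close>
  have ncc': "n \<odot> c \<odot> c = n \<odot> c \<odot> p \<oplus> n \<odot> c \<odot> p \<oplus> \<ominus> (n \<odot> c)" by (subst (2) c_def) simp
  define q where "q = n \<odot> c \<odot> p"
  have q [simp]: "\<guillemotleft>q :\<^bsub>C\<^esub> X \<rightarrow> X\<guillemotright>" by (simp add: q_def)
  have "p' \<odot> p' \<oplus> \<ominus> p' = p \<odot> p \<oplus> \<ominus> q \<oplus> \<ominus> q \<oplus> m \<odot> c \<odot> c \<oplus> \<ominus> p \<oplus> n \<odot> c"
    by (simp add: p'_def cnc m_def q_def pnc pc)
  also have "\<dots> = n \<oplus> \<ominus> (q \<oplus> q \<oplus> \<ominus> (n \<odot> c)) \<oplus> m \<odot> c \<odot> c"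
    by (simp add: n_def[symmetric]) (simp add: n_def aplus_ac)
  also have "\<dots> = n \<oplus> \<ominus> (n \<oplus> m \<oplus> m \<oplus> m \<oplus> m) \<oplus> m \<odot> c \<odot> c"
    unfolding ncc[symmetric] ncc' q_def ..
  also have "\<dots> = \<ominus> m \<oplus> \<ominus> m \<oplus> \<ominus> m \<oplus> \<ominus> m \<oplus> m \<odot> c \<odot> c" by simp
  also have "\<dots> = m \<odot> (c \<odot> c \<oplus> \<ominus> (aid C X) \<oplus> \<ominus> (aid C X) \<oplus> \<ominus> (aid C X) \<oplus> \<ominus> (aid C X))"
    by (simp add: aplus_ac)
  finally have "p' \<odot> p' \<oplus> \<ominus> p' = n \<odot> n \<odot> (c \<odot> c \<oplus> \<ominus> (aid C X) \<oplus> \<ominus> (aid C X) \<oplus> \<ominus> (aid C X) \<oplus> \<ominus> (aid C X))"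
    by (simp add: m_def)
  moreover have "\<guillemotleft>c \<odot> c \<oplus> \<ominus> (aid C X) \<oplus> \<ominus> (aid C X) \<oplus> \<ominus> (aid C X) \<oplus> \<ominus> (aid C X) :\<^bsub>C\<^esub> X \<rightarrow> X\<guillemotright>" by simp
  ultimately show "\<exists>z. \<guillemotleft>z :\<^bsub>C\<^esub> X \<rightarrow> X\<guillemotright> \<and> p' \<odot> p' \<oplus> \<ominus> p' = n \<odot> n \<odot> z" by blast
qed

text \<open>A Newton step turns the error $n$ into $n^2 z$. Since $t(n) = 0$, the additional factor
  raises the filtration by one. The correction of $p$ is a multiple of $n$, so $t(p)$ does not
  change along the way.\<close>

lemma idempotent_lift:
  assumes X: "X \<in> w_ge C w i" "X \<in> w_le C w j" and T: "gtower X T" and g: "\<guillemotleft>g :\<^bsub>C\<^esub> X \<rightarrow> X\<guillemotright>"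
    and e: "wm T T g = wm T T (g \<odot> g)"
  obtains g' where "\<guillemotleft>g' :\<^bsub>C\<^esub> X \<rightarrow> X\<guillemotright>" "g' \<odot> g' = g'" "wm T T g' = wm T T g"
proof -
  have e: "wm T T g \<odot>\<^bsub>KWH\<^esub> wm T T g = wm T T g" using wm_acomp[OF T T T g g] e by simp
  have o: "X \<in> Obj C" using g by blast
  have z: "wm T T (p \<odot> p \<oplus> \<ominus> p) = azero KWH (cx T) (cx T)" if p: "\<guillemotleft>p :\<^bsub>C\<^esub> X \<rightarrow> X\<guillemotright>" "wm T T p = wm T T g" for p
  proof -
    have a: "\<guillemotleft>p \<odot> p :\<^bsub>C\<^esub> X \<rightarrow> X\<guillemotright>" "\<guillemotleft>\<ominus> p :\<^bsub>C\<^esub> X \<rightarrow> X\<guillemotright>" using p(1) by simp_all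
    show ?thesis using wm_aplus[OF T T a] wm_aneg[OF T T p(1)] wm_acomp[OF T T T p(1) p(1)] p(2) e arr_wm[OF T T g] by simp
  qed
  have "\<exists>p. \<guillemotleft>p :\<^bsub>C\<^esub> X \<rightarrow> X\<guillemotright> \<and> wm T T p = wm T T g \<and> fil (i - 1 + int m) T (p \<odot> p \<oplus> \<ominus> p)" for m
  proof (induction m)
    case 0
    show ?case using g by (intro exI[of _ g] conjI fil_start[OF X(1) T, simplified]) (simp_all add: fil_start[OF X(1) T])
  next
    case (Suc m)
    then obtain p where p: "\<guillemotleft>p :\<^bsub>C\<^esub> X \<rightarrow> X\<guillemotright>" "wm T T p = wm T T g" "fil (i - 1 + int m) T (p \<odot> p \<oplus> \<ominus> p)" by blast
    define n c p' where "n = p \<odot> p \<oplus> \<ominus> p" and "c = p \<oplus> p \<oplus> \<ominus> (aid C X)" and "p' = p \<oplus> \<ominus> (n \<odot> c)"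
    note I = idempotent_improve[OF p(1), folded n_def c_def, folded p'_def]
    obtain y where y: "\<guillemotleft>y :\<^bsub>C\<^esub> X \<rightarrow> X\<guillemotright>" "p' \<odot> p' \<oplus> \<ominus> p' = n \<odot> n \<odot> y" using I(1) by blast
    note n = I(2) and c = I(3)
    have zn: "wm T T n = azero KWH (cx T) (cx T)" unfolding n_def by (rule z[OF p(1,2)])
    have "fil (i - 1 + int m + 1) T (n \<odot> n)" by (rule fil_step[OF T T n n p(3)[folded n_def] zn])
    then have "fil (i - 1 + int m + 1) T ((n \<odot> n) \<odot> y)" by (rule fil_acomp[OF T _ y(1), rotated]) (use n in simp)
    then have f: "fil (i - 1 + int (Suc m)) T (p' \<odot> p' \<oplus> \<ominus> p')" unfolding y(2) using n y(1) by (simp add: algebra_simps)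
    have nc: "\<guillemotleft>n \<odot> c :\<^bsub>C\<^esub> X \<rightarrow> X\<guillemotright>" "\<guillemotleft>\<ominus> (n \<odot> c) :\<^bsub>C\<^esub> X \<rightarrow> X\<guillemotright>" using n c by simp_all
    have "wm T T (n \<odot> c) = azero KWH (cx T) (cx T)" using wm_acomp[OF T T T c n] zn arr_wm[OF T T c] T by simp
    then have "wm T T p' = wm T T g"
      unfolding p'_def using wm_aplus[OF T T p(1) nc(2)] wm_aneg[OF T T nc(1)] p(2) arr_wm[OF T T g] T by simp
    moreover have "\<guillemotleft>p' :\<^bsub>C\<^esub> X \<rightarrow> X\<guillemotright>" using p(1) nc by (simp add: p'_def)
    ultimately show ?case using f by blast
  qed
  \<comment> \<open>The filtration starts at $i-1$, so $j-i+1$ steps reach $j$. The truncation by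
    \<open>nat\<close> covers $j < i$, where the start is already high enough.\<close>
  from this[of "nat (j - i + 1)"] obtain p where p: "\<guillemotleft>p :\<^bsub>C\<^esub> X \<rightarrow> X\<guillemotright>" "wm T T p = wm T T g" "fil (i - 1 + int (nat (j - i + 1))) T (p \<odot> p \<oplus> \<ominus> p)" by blast
  have "fil j T (p \<odot> p \<oplus> \<ominus> p)" using p(3) by (auto simp: fil_def)
  then have "p \<odot> p \<oplus> \<ominus> p = azero C X X" using p(1) by (intro fil_end[OF X(2) T]) simp_all
  then have "p \<odot> p = p" using diff_eq_zero_iff[of "p \<odot> p" p] p(1) by simp
  then show ?thesis using p(1,2) that by blast
qed

end

section \<open>Weight bounds and lifting of morphisms\<close>

context weight_structure
begin

text \<open>With $b^{n-1} = 0$ the identity of $X[n-1]$ extends along $a^{n-1}$, so $X[n-1]$ is a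
  retract of $X^{w<=n-1}$.\<close>

lemma w_le_of_tb_zero:
  assumes T: "gtower X T" and z: "tb T (n - 1) = azero C (tG T n) (ShO C n X)"
  shows "X \<in> w_le C w (n - 1)"
proof -
  note [simp] = gtower_hom[OF T] gtowerD[OF T]
  have b: "\<guillemotleft>tb T (n - 1) :\<^bsub>C\<^esub> tG T n \<rightarrow> ShO C n X\<guillemotright>" using gtower_hom(3)[OF T, of "n - 1"] by simp
  have "ash C (-1) (tb T (n - 1)) = azero C (ShO C (-1) (tG T n)) (ShO C (n - 1) X)" using arg_cong[OF z, of "ash C (-1)"] by simp
  then have "aid C (ShO C (n - 1) X) \<odot> ash C (-1) (tb T (n - 1)) = azero C (ShO C (-1) (tgt (tf T (n - 1)))) (tgt (aid C (ShO C (n - 1) X)))" using b by simp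
  note z' = this
  have a: "arr C (aid C (ShO C (n - 1) X))" "src (aid C (ShO C (n - 1) X)) = src (ta T (n - 1))" by simp_all
  obtain v where v: "\<guillemotleft>v :\<^bsub>C\<^esub> tgt (ta T (n - 1)) \<rightarrow> tgt (aid C (ShO C (n - 1) X))\<guillemotright>" "aid C (ShO C (n - 1) X) = v \<odot> ta T (n - 1)"
    using tri_ext1[OF gtower_tri(1)[OF T] a z'] by blast
  have v': "\<guillemotleft>v :\<^bsub>C\<^esub> tL T (n - 1) \<rightarrow> ShO C (n - 1) X\<guillemotright>" using v(1) by simp
  have "ShO C (n - 1) X \<in> fst w"
    by (rule fst_w_retract[OF gtower_hom(1)[OF T] v' v(2)[symmetric] gtowerD(2)[OF T]])
  then show ?thesis by (simp add: w_le_iff)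
qed

text \<open>With $a^n = 0$ the identity of $X[n+1]$ lifts along $b^n$, so $X[n+1]$ is a retract of
  $X^{w>=n+1}$.\<close>

lemma w_ge_of_ta_zero:
  assumes T: "gtower X T" and z: "ta T n = azero C (ShO C n X) (tL T n)"
  shows "X \<in> w_ge C w (n + 1)"
proof -
  note [simp] = gtower_hom[OF T] gtowerD[OF T]
  have "ash C 1 (ta T n) = azero C (ShO C (n + 1) X) (ShO C 1 (tL T n))" using arg_cong[OF z, of "ash C 1"] by (simp add: add.commute[of 1])
  then have "\<ominus> (ash C 1 (ta T n)) \<odot> aid C (ShO C (n + 1) X) = azero C (src (aid C (ShO C (n + 1) X))) (ShO C 1 (src (tf T n)))" by simp
  note z' = this
  have a: "arr C (aid C (ShO C (n + 1) X))" "tgt (aid C (ShO C (n + 1) X)) = tgt (tb T n)" by simp_all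
  obtain v where v: "\<guillemotleft>v :\<^bsub>C\<^esub> src (aid C (ShO C (n + 1) X)) \<rightarrow> tgt (tf T n)\<guillemotright>" "aid C (ShO C (n + 1) X) = tb T n \<odot> v"
    using tri_lift3[OF tri_rotate[OF gtower_tri(1)[OF T]] a z'] by blast
  have v': "\<guillemotleft>v :\<^bsub>C\<^esub> ShO C (n + 1) X \<rightarrow> tG T (n + 1)\<guillemotright>" using v(1) by simp
  have "ShO C (n + 1) X \<in> snd w"
    by (rule snd_w_retract[OF v' gtower_hom(3)[OF T] v(2)[symmetric] gtowerD(3)[OF T]])
  then show ?thesis by (simp add: w_ge_iff)
qed

text \<open>If the identity of the weight complex is null-homotopic in degree $n$, then $a^n b^{n-1} = d^n y^n = 0$.\<close>

lemma ab_zero: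
  assumes T: "gtower X T" and f: "\<guillemotleft>f :\<^bsub>hw.CA\<^esub> cx T \<rightarrow> cx T\<guillemotright>" "hw.kq f = aid KH (cx T)" and z: "cm f n = azero C (tH T n) (tH T n)"
  shows "ta T n \<odot> tb T (n - 1) = azero C (tG T n) (tL T n)"
proof -
  note [simp] = gtower_hom[OF T] gtowerD[OF T] gtower_comp(5)[OF T] dif_cx[OF T]
  have h: "\<guillemotleft>th T (n - 1) :\<^bsub>C\<^esub> tH T (n - 1) \<rightarrow> tH T n\<guillemotright>" using gtower_comp(5)[OF T, of "n - 1"] by simp
  have "hw.kq f = hw.kq (aid hw.CA (cx T))" using f(2) by (simp add: hw.kq_ops)
  then obtain s where s: "hw.zhtp (f \<oplus>\<^bsub>hw.CA\<^esub> \<ominus>\<^bsub>hw.CA\<^esub> (aid hw.CA (cx T))) s s"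
    using hw.kq_eq_iff[of f "aid hw.CA (cx T)"] f(1) by auto
  have sm: "\<guillemotleft>s k :\<^bsub>C\<^esub> tH T k \<rightarrow> tH T (k - 1)\<guillemotright>" for k using hw.hmtD[OF hw.zhtpD(2)[OF s], of k] f(1) by (simp add: arr_heart)
  have "cm f n \<oplus> \<ominus> (aid C (tH T n)) = s (n + 1) \<odot> th T n \<oplus> th T (n - 1) \<odot> s n"
    using hw.zhtpD(4)[OF s, of n] f(1) by simp
  then have e: "\<ominus> (aid C (tH T n)) = s (n + 1) \<odot> th T n \<oplus> th T (n - 1) \<odot> s n" using z by simp
  have hy: "th T n \<odot> ty T n = azero C (tG T n) (tH T (n + 1))" by (rule gtower_comp(7)[OF T])
  have dh: "td T n \<odot> th T (n - 1) = azero C (tH T (n - 1)) (tL T n)" using gtower_comp(6)[OF T, of "n - 1"] by simp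
  have s1: "\<guillemotleft>s (n + 1) :\<^bsub>C\<^esub> tH T (n + 1) \<rightarrow> tH T n\<guillemotright>" using sm[of "n + 1"] by simp
  have "td T n \<odot> (s (n + 1) \<odot> th T n \<oplus> th T (n - 1) \<odot> s n) \<odot> ty T n = azero C (tG T n) (tL T n)"
    using sm[of n] s1 h hy acomp_eq[OF dh, of "s n \<odot> ty T n"] by simp
  then have "\<ominus> (td T n \<odot> ty T n) = azero C (tG T n) (tL T n)" unfolding e[symmetric] by simp
  then have "td T n \<odot> ty T n = azero C (tG T n) (tL T n)" by simp
  then show ?thesis by (simp add: gtower_eq(4)[OF T])
qed

text \<open>A bound $n > i$ can be lowered by one: $a^n$ is monic by \<open>ta_cancel\<close>, so
  $a^n b^{n-1} = 0$ forces $b^{n-1} = 0$. Boundedness from above gives a place to start.\<close>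

lemma w_le_of_complex:
  assumes T: "gtower X T" and f: "\<guillemotleft>f :\<^bsub>hw.CA\<^esub> cx T \<rightarrow> cx T\<guillemotright>" "hw.kq f = aid KH (cx T)" and z: "\<And>k. k > i \<Longrightarrow> cm f k = azero C (tH T k) (tH T k)"
    and X: "X \<in> w_minus C w"
  shows "X \<in> w_le C w i"
proof -
  obtain j where j: "X \<in> w_le C w j" using X by (auto simp: w_minus_def)
  have "X \<in> w_le C w (i + int m) \<Longrightarrow> X \<in> w_le C w i" for m
  proof (induction m)
    case (Suc m)
    define n where "n = i + int (Suc m)"
    have n: "n > i" "n - 1 = i + int m" by (simp_all add: n_def)
    note [simp] = gtower_hom[OF T] gtowerD[OF T]
    have b: "\<guillemotleft>tb T (n - 1) :\<^bsub>C\<^esub> tG T n \<rightarrow> ShO C n X\<guillemotright>" using gtower_hom(3)[OF T, of "n - 1"] by simp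
    have "tb T (n - 1) = azero C (tG T n) (ShO C n X)"
      using ta_cancel[OF Suc.prems[folded n_def] T, of "tb T (n - 1)"] b ab_zero[OF T f z[OF n(1)]] by simp
    from w_le_of_tb_zero[OF T this] show ?case using Suc.IH n(2) by simp
  qed simp
  from this[of "nat (j - i)"] show ?thesis using w_le_mono[OF j, of "i + int (nat (j - i))"] by simp
qed

lemma w_ge_of_complex:
  assumes T: "gtower X T" and f: "\<guillemotleft>f :\<^bsub>hw.CA\<^esub> cx T \<rightarrow> cx T\<guillemotright>" "hw.kq f = aid KH (cx T)" and z: "\<And>k. k < i \<Longrightarrow> cm f k = azero C (tH T k) (tH T k)"
    and X: "X \<in> w_plus C w"
  shows "X \<in> w_ge C w i"
proof -
  obtain j where j: "X \<in> w_ge C w j" using X by (auto simp: w_plus_def)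
  have "X \<in> w_ge C w (i - int m) \<Longrightarrow> X \<in> w_ge C w i" for m
  proof (induction m)
    case (Suc m)
    define n where "n = i - int (Suc m)"
    have n: "n < i" "n + 1 = i - int m" by (simp_all add: n_def)
    note [simp] = gtower_hom[OF T] gtowerD[OF T]
    have "ta T n = azero C (ShO C n X) (tL T n)"
      using tb_cancel[OF Suc.prems[folded n_def] T, of "ta T n"] ab_zero[OF T f z[OF n(1)]] by simp
    from w_ge_of_ta_zero[OF T this] show ?case using Suc.IH n(2) by simp
  qed simp
  from this[of "nat (i - j)"] show ?thesis using w_ge_antimono[OF j, of "i - int (nat (i - j))"] by simp
qed

text \<open>The composite through $Y$ represents the identity up to homotopy and is zero in every
  degree in which $Y$ is.\<close>

lemma iso_complex:
  assumes T: "gtower X T" and Y: "isomorphic KH (cx T) Y" and z: "\<And>k. k \<in> K \<Longrightarrow> zero_object HW (cob Y k)"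
  obtains f where "\<guillemotleft>f :\<^bsub>hw.CA\<^esub> cx T \<rightarrow> cx T\<guillemotright>" "hw.kq f = aid KH (cx T)" "\<And>k. k \<in> K \<Longrightarrow> cm f k = azero C (tH T k) (tH T k)"
proof -
  obtain u where o: "cx T \<in> Obj hw.CA" "Y \<in> Obj hw.CA" "is_iso KH (cx T) Y u" using Y by (auto simp: isomorphic_def)
  have "hw.kc.aiso (Arrow (cx T) Y u)" using o hw.kc.is_iso_iff[of "cx T" Y u] by simp
  then obtain v where v: "\<guillemotleft>v :\<^bsub>KH\<^esub> Y \<rightarrow> cx T\<guillemotright>" "v \<odot>\<^bsub>KH\<^esub> Arrow (cx T) Y u = aid KH (cx T)" "arr KH (Arrow (cx T) Y u)"
    using hw.kc.aisoE[of "Arrow (cx T) Y u"] hw.kc.aiso_arr by (metis arrow.sel(1,2))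
  obtain u' where u': "arr hw.CA u'" "Arrow (cx T) Y u = hw.kq u'" using hw.arr_Kcat_cases v(3) by blast
  obtain v' where v': "arr hw.CA v'" "v = hw.kq v'" using hw.arr_Kcat_cases v(1) by blast
  have s: "src u' = cx T" "tgt u' = Y" "src v' = Y" "tgt v' = cx T"
    using arg_cong[OF u'(2), of src] arg_cong[OF u'(2), of tgt] v(1) v'(2) by simp_all
  show ?thesis
  proof (rule that[of "v' \<odot>\<^bsub>hw.CA\<^esub> u'"])
    show "\<guillemotleft>v' \<odot>\<^bsub>hw.CA\<^esub> u' :\<^bsub>hw.CA\<^esub> cx T \<rightarrow> cx T\<guillemotright>" using u'(1) v'(1) s o by simp
    show "hw.kq (v' \<odot>\<^bsub>hw.CA\<^esub> u') = aid KH (cx T)" using v(2) u' v' s by (simp add: hw.kq_ops)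
    fix k assume "k \<in> K"
    then have "zero_object HW (cob Y k)" by (rule z)
    then have y: "\<guillemotleft>cm u' k :\<^bsub>C\<^esub> tH T k \<rightarrow> cob Y k\<guillemotright>" "\<guillemotleft>cm v' k :\<^bsub>C\<^esub> cob Y k \<rightarrow> tH T k\<guillemotright>" "aid C (cob Y k) = azero C (cob Y k) (cob Y k)"
      using hw.arr_cpxD(3)[OF u'(1), of k] hw.arr_cpxD(3)[OF v'(1), of k] s gtowerD[OF T] by (auto simp: arr_heart hw.zero_object_iff heart_sel dest: fst_w_obj)
    have "cm v' k \<odot> aid C (cob Y k) \<odot> cm u' k = azero C (tH T k) (tH T k)" unfolding y(3) using y(1,2) by simp
    then show "cm (v' \<odot>\<^bsub>hw.CA\<^esub> u') k = azero C (tH T k) (tH T k)" using y(1,2) by simp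
  qed
qed

lemma isomorphic_towers:
  assumes T: "gtower X T" and T': "gtower X T'"
  shows "isomorphic KH (cx T) (cx T')"
proof -
  have g: "\<guillemotleft>aid C X :\<^bsub>C\<^esub> X \<rightarrow> X\<guillemotright>" using gtowerD[OF T] by simp
  obtain y where y: "hw.kc.aiso y" "src y = cx T" "tgt y = cx T'"
    using kd_lift[OF arr_wm[OF T T' g] wm_aiso_aid[OF T T']] by auto
  from hw.kc.aiso_is_iso[OF y(1)] show ?thesis unfolding isomorphic_def using y T T' by (intro conjI exI[of _ "mor y"]) simp_all
qed

text \<open>A tower adapted to the bound has zero heart terms outside the range, and its complex is
  homotopy equivalent to the one at hand.\<close>

lemma complex_bounds:
  assumes T: "gtower X T"
  shows "X \<in> w_le C w i \<Longrightarrow> cx T \<in> Kw_le HW i" "X \<in> w_ge C w i \<Longrightarrow> cx T \<in> Kw_ge HW i"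
proof -
  have zH: "zero_object HW (tH S k)" if "gtower X S" "zero_object C (tH S k)" for S k
    using that gtowerD(4,5)[OF that(1), of k] by (simp add: hw.zero_object_iff zero_object_iff heart_sel)
  show "cx T \<in> Kw_le HW i" if X: "X \<in> w_le C w i"
  proof -
    obtain S where S: "gtower X S" "\<And>k. k > i \<Longrightarrow> zero_object C (tG S k)" using gtower_ge_exists[OF X] by blast
    have "zero_object HW (cob (cx S) k)" if "k > i" for k
      using zH[OF S(1)] gtower_zero_H(2)[OF S(1) S(2)[of k] S(2)[of "k + 1"]] that by simp
    then show ?thesis using isomorphic_towers[OF T S(1)] unfolding Kw_le_def by blast
  qed
  show "cx T \<in> Kw_ge HW i" if X: "X \<in> w_ge C w i"
  proof -
    obtain S where S: "gtower X S" "\<And>k. k < i \<Longrightarrow> zero_object C (tL S k)" using gtower_le_exists[OF X] by blast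
    have "zero_object HW (cob (cx S) k)" if "k < i" for k
      using zH[OF S(1)] gtower_zero_H(1)[OF S(1) S(2)[of k] S(2)[of "k - 1"]] that by simp
    then show ?thesis using isomorphic_towers[OF T S(1)] unfolding Kw_ge_def by blast
  qed
qed

lemma complex_bounds_converse:
  assumes T: "gtower X T"
  shows "\<lbrakk>X \<in> w_minus C w; cx T \<in> Kw_le HW i\<rbrakk> \<Longrightarrow> X \<in> w_le C w i" "\<lbrakk>X \<in> w_plus C w; cx T \<in> Kw_ge HW i\<rbrakk> \<Longrightarrow> X \<in> w_ge C w i"
proof -
  assume X: "X \<in> w_minus C w" "cx T \<in> Kw_le HW i"
  then obtain Y where Y: "isomorphic KH (cx T) Y" "\<And>k. k \<in> {k. k > i} \<Longrightarrow> zero_object HW (cob Y k)" by (auto simp: Kw_le_def)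
  obtain f where f: "\<guillemotleft>f :\<^bsub>hw.CA\<^esub> cx T \<rightarrow> cx T\<guillemotright>" "hw.kq f = aid KH (cx T)" "\<And>k. k \<in> {k. k > i} \<Longrightarrow> cm f k = azero C (tH T k) (tH T k)"
    using iso_complex[OF T Y] by blast
  show "X \<in> w_le C w i" by (rule w_le_of_complex[OF T f(1,2) f(3) X(1)]) simp
next
  assume X: "X \<in> w_plus C w" "cx T \<in> Kw_ge HW i"
  then obtain Y where Y: "isomorphic KH (cx T) Y" "\<And>k. k \<in> {k. k < i} \<Longrightarrow> zero_object HW (cob Y k)" by (auto simp: Kw_ge_def)
  obtain f where f: "\<guillemotleft>f :\<^bsub>hw.CA\<^esub> cx T \<rightarrow> cx T\<guillemotright>" "hw.kq f = aid KH (cx T)" "\<And>k. k \<in> {k. k < i} \<Longrightarrow> cm f k = azero C (tH T k) (tH T k)"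
    using iso_complex[OF T Y] by blast
  show "X \<in> w_ge C w i" by (rule w_ge_of_complex[OF T f(1,2) f(3) X(1)]) simp
qed

lemma cone_bounds:
  assumes t: "tri f g h"
  shows "\<lbrakk>src f \<in> w_plus C w; tgt f \<in> w_plus C w\<rbrakk> \<Longrightarrow> tgt g \<in> w_plus C w" "\<lbrakk>src f \<in> w_minus C w; tgt f \<in> w_minus C w\<rbrakk> \<Longrightarrow> tgt g \<in> w_minus C w"
proof -
  note d = triD[OF t]
  note t' = tri_shift[OF tri_rotate[OF t]]
  assume "src f \<in> w_plus C w" "tgt f \<in> w_plus C w"
  then obtain a b where ab: "src f \<in> w_ge C w a" "tgt f \<in> w_ge C w b" by (auto simp: w_plus_def)
  \<comment> \<open>The cone of a map $X -> Y$ is an extension of $X[1]$ by $Y$, and $X[1]$ has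
    weights at least $a - 1$.\<close>
  define m where "m = min b (a - 1)"
  have "src f \<in> w_ge C w (m + 1)" "tgt f \<in> w_ge C w m" using w_ge_antimono ab unfolding m_def by auto
  then have "ShO C (m + 1) (src f) \<in> snd w" "ShO C m (tgt f) \<in> snd w" by (simp_all add: w_ge_iff)
  then have "ShO C m (tgt g) \<in> snd w" using snd_w_extension[OF t'[of m]] d by simp
  then have "tgt g \<in> w_ge C w m" using d by (simp add: w_ge_iff)
  then show "tgt g \<in> w_plus C w" by (auto simp: w_plus_def)
next
  note d = triD[OF t]
  note t' = tri_shift[OF tri_rotate[OF t]]
  assume "src f \<in> w_minus C w" "tgt f \<in> w_minus C w"
  then obtain a b where ab: "src f \<in> w_le C w a" "tgt f \<in> w_le C w b" by (auto simp: w_minus_def)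
  define m where "m = max b a"
  have "src f \<in> w_le C w (m + 1)" "tgt f \<in> w_le C w m" using w_le_mono ab unfolding m_def by auto
  then have "ShO C (m + 1) (src f) \<in> fst w" "ShO C m (tgt f) \<in> fst w" by (simp_all add: w_le_iff)
  then have "ShO C m (tgt g) \<in> fst w" using fst_w_extension[OF t'[of m]] d by simp
  then have "tgt g \<in> w_le C w m" using d by (simp add: w_le_iff)
  then show "tgt g \<in> w_minus C w" by (auto simp: w_minus_def)
qed

text \<open>By weak exactness and reflection of isomorphisms, the complex of the cone of $f$ is a
  cone of a homotopy equivalence, hence contractible. Then the bounded cone satisfies every weight
  bound on its side, and non-degeneracy makes it zero.\<close>

lemma conservative:
  assumes nd: "non_degenerate C w" and f: "\<guillemotleft>f :\<^bsub>C\<^esub> X \<rightarrow> Y\<guillemotright>" and T: "gtower X T" and T': "gtower Y T'"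
    and iso: "hw.kw.aiso (wm T T' f)" and b: "X \<in> w_plus C w \<and> Y \<in> w_plus C w \<or> X \<in> w_minus C w \<and> Y \<in> w_minus C w"
  shows "aiso f"
proof -
  obtain g h where t: "tri f g h" using tri_cone[of f] f by auto
  note d = triD[OF t]
  obtain TZ where TZ: "gtower (tgt g) TZ" using gtower_exists_plain[OF d(9)] by blast
  obtain S where S: "gtower (ShO C 1 X) S" using gtower_exists_plain[of "ShO C 1 X"] f by auto
  have e: "gtower (src f) T" "gtower (tgt f) T'" "gtower (ShO C 1 (src f)) S" using T T' S f by simp_all
  obtain F G H where k: "hw.kd F G H" "src F = cx T" "tgt F = cx T'" "tgt G = cx TZ" "hw.wk F = wm T T' f"
    using weak_exact(1)[OF t e(1,2) TZ e(3)] by blast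
  have "hw.kc.aiso F" using hw.aiso_Kw_Kcat[of F] k iso by (simp add: hw.kd_def)
  then have "zero_object KH (cx TZ)" using hw.kd_zero_cone[OF k(1)] k(4) by simp
  then have z: "aid KH (cx TZ) = azero KH (cx TZ) (cx TZ)" by (simp add: hw.kc.zero_object_iff)
  have f0: "\<guillemotleft>azero hw.CA (cx TZ) (cx TZ) :\<^bsub>hw.CA\<^esub> cx TZ \<rightarrow> cx TZ\<guillemotright>" "hw.kq (azero hw.CA (cx TZ) (cx TZ)) = aid KH (cx TZ)"
    "cm (azero hw.CA (cx TZ) (cx TZ)) k = azero C (tH TZ k) (tH TZ k)" for k
    using z TZ by (simp_all add: hw.kq_ops)
  have "zero_object C (tgt g)"
    using b
  proof
    assume "X \<in> w_plus C w \<and> Y \<in> w_plus C w"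
    then have "tgt g \<in> w_plus C w" using cone_bounds(1)[OF t] f by simp
    then have "tgt g \<in> (\<Inter>l. w_ge C w l)" using w_ge_of_complex[OF TZ f0] by blast
    then show ?thesis using nd unfolding non_degenerate_def by blast
  next
    assume "X \<in> w_minus C w \<and> Y \<in> w_minus C w"
    then have "tgt g \<in> w_minus C w" using cone_bounds(2)[OF t] f by simp
    then have "tgt g \<in> (\<Inter>l. w_le C w l)" using w_le_of_complex[OF TZ f0] by blast
    then show ?thesis using nd unfolding non_degenerate_def by blast
  qed
  then show ?thesis by (rule tri_zero_iso[OF t])
qed

end

section \<open>Lifting morphisms of weight complexes between adjacent weights\<close>

context weight_structure
begin

lemma zero_object_shift: "zero_object C Z \<Longrightarrow> zero_object C (ShO C n Z)"
proof -
  assume Z: "zero_object C Z"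
  then have o: "Z \<in> Obj C" and e: "aid C Z = azero C Z Z" by (simp_all add: zero_object_iff)
  have "ash C n (aid C Z) = ash C n (azero C Z Z)" by (simp only: e)
  then show ?thesis using o by (simp add: zero_object_iff)
qed

lemma cone_zero_iso:
  assumes t: "tri f g h" and z: "zero_object C (src f)"
  shows "aiso g"
proof -
  have "zero_object C (ShO C 1 (src f))" using z by (rule zero_object_shift)
  then show ?thesis using tri_zero_iso[OF tri_rotate[OF t]] triD[OF t] by simp
qed

lemma iso_of_third_zero:
  assumes t: "tri f g h" and z: "zero_object C (tgt f)"
  shows "aiso h"
  using cone_zero_iso[OF tri_rotate[OF t]] z triD[OF t] by simp

text \<open>Because $X^{w<=a-1} = 0$, the map $d^a$ identifies $X^a$ with $X^{w<=a}$; because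
  $X'^{w>=a+2} = 0$, the map $y'^{a+1}$ identifies $X'^{w>=a+1}$ with $X'^{a+1}$. So \<phi>^a and
  \<phi>^{a+1} yield maps between the outer terms of the decompositions of $X[a]$ and $X'[a]$. The
  chain map condition makes their square commute, and completing the morphism of triangles gives
  $g[a]$.\<close>

lemma wm_surj_nice:
  assumes X: "X \<in> w_ge C w a" "X' \<in> w_le C w (a + 1)" and T: "gtower X T" and T': "gtower X' T'"
    and zT: "\<And>k. k < a \<Longrightarrow> zero_object C (tL T k)" and zT': "\<And>k. k > a + 1 \<Longrightarrow> zero_object C (tG T' k)"
    and f: "\<guillemotleft>f :\<^bsub>hw.CA\<^esub> cx T \<rightarrow> cx T'\<guillemotright>"
  obtains g where "\<guillemotleft>g :\<^bsub>C\<^esub> X \<rightarrow> X'\<guillemotright>" "wm T T' g = hw.wk (hw.kq f)"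
proof -
  define \<phi> where "\<phi> = cm f"
  have F: "\<guillemotleft>\<phi> k :\<^bsub>C\<^esub> tH T k \<rightarrow> tH T' k\<guillemotright>" "\<phi> (k + 1) \<odot> th T k = th T' k \<odot> \<phi> k" for k
    using arr_cx_iff[OF T T', of f] f gtowerD[OF T] gtowerD[OF T'] by (simp_all add: \<phi>_def)
  note [simp] = gtower_hom[OF T] gtowerD[OF T] gtower_hom[OF T'] gtowerD[OF T'] F(1) gtower_comp(5)[OF T] gtower_comp(5)[OF T']
  have "aiso (td T a)"
    by (rule iso_of_third_zero[OF gtower_tri(2)[OF T, of a]]) (use zT[of "a - 1"] in simp)
  then obtain di where di: "\<guillemotleft>di :\<^bsub>C\<^esub> tL T a \<rightarrow> tH T a\<guillemotright>" "di \<odot> td T a = aid C (tH T a)" "td T a \<odot> di = aid C (tL T a)"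
    by (rule aisoE) simp
  have "zero_object C (ShO C (-1) (tG T' (a + 1 + 1)))"
    by (rule zero_object_shift[OF zT']) simp
  then have "aiso (ty T' (a + 1))" by (intro cone_zero_iso[OF gtower_tri(3)[OF T', of "a + 1"]]) simp
  then obtain yi where yi: "\<guillemotleft>yi :\<^bsub>C\<^esub> tH T' (a + 1) \<rightarrow> tG T' (a + 1)\<guillemotright>" "yi \<odot> ty T' (a + 1) = aid C (tG T' (a + 1))" "ty T' (a + 1) \<odot> yi = aid C (tH T' (a + 1))"
    by (rule aisoE) simp
  note [simp] = di(1) yi(1)
  define l r where "l = td T' a \<odot> \<phi> a \<odot> di" and "r = yi \<odot> \<phi> (a + 1) \<odot> ty T (a + 1)"
  have lr: "\<guillemotleft>l :\<^bsub>C\<^esub> tL T a \<rightarrow> tL T' a\<guillemotright>" "\<guillemotleft>r :\<^bsub>C\<^esub> tG T (a + 1) \<rightarrow> tG T' (a + 1)\<guillemotright>" by (simp_all add: l_def r_def)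
  have ld: "l \<odot> td T a = td T' a \<odot> \<phi> a" using di(2) by (simp add: l_def)
  have yr: "ty T' (a + 1) \<odot> r = \<phi> (a + 1) \<odot> ty T (a + 1)" using acomp_eq[OF yi(3), of "\<phi> (a + 1) \<odot> ty T (a + 1)"] by (simp add: r_def)
  note [simp] = lr
  have cf: "ty T (a + 1) \<odot> tf T a = tc T (a + 1)" "ty T' (a + 1) \<odot> tf T' a = tc T' (a + 1)"
    using gtower_eq(3)[OF T, of "a + 1"] gtower_eq(3)[OF T', of "a + 1"] by simp_all
  have c1: "\<guillemotleft>tc T (a + 1) :\<^bsub>C\<^esub> tL T a \<rightarrow> tH T (a + 1)\<guillemotright>" "\<guillemotleft>tc T' (a + 1) :\<^bsub>C\<^esub> tL T' a \<rightarrow> tH T' (a + 1)\<guillemotright>"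
    using gtower_hom(5)[OF T, of "a + 1"] gtower_hom(5)[OF T', of "a + 1"] by simp_all
  note [simp] = c1
  have "r \<odot> tf T a = tf T' a \<odot> l"
  proof -
    have "r \<odot> tf T a = yi \<odot> \<phi> (a + 1) \<odot> tc T (a + 1)" by (simp add: r_def cf)
    also have "\<dots> = yi \<odot> \<phi> (a + 1) \<odot> tc T (a + 1) \<odot> td T a \<odot> di" using di(3) by simp
    also have "\<dots> = yi \<odot> (\<phi> (a + 1) \<odot> th T a) \<odot> di" by (simp add: th_def)
    also have "\<dots> = yi \<odot> tc T' (a + 1) \<odot> l" unfolding F(2) by (simp add: th_def l_def)
    also have "\<dots> = (yi \<odot> ty T' (a + 1)) \<odot> tf T' a \<odot> l" by (simp add: cf(2)[symmetric])
    finally show ?thesis unfolding yi(2) by simp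
  qed
  then have "\<exists>u. \<guillemotleft>u :\<^bsub>C\<^esub> src (ta T a) \<rightarrow> src (ta T' a)\<guillemotright> \<and> l \<odot> ta T a = ta T' a \<odot> u \<and> ash C 1 u \<odot> tb T a = tb T' a \<odot> r"
    by (intro tri_fill1[OF gtower_tri(1)[OF T, of a] gtower_tri(1)[OF T', of a]]) simp_all
  then obtain \<gamma> where \<gamma>: "\<guillemotleft>\<gamma> :\<^bsub>C\<^esub> ShO C a X \<rightarrow> ShO C a X'\<guillemotright>" "l \<odot> ta T a = ta T' a \<odot> \<gamma>" "ash C 1 \<gamma> \<odot> tb T a = tb T' a \<odot> r" by auto
  define g where "g = ash C (-a) \<gamma>"
  have g: "\<guillemotleft>g :\<^bsub>C\<^esub> X \<rightarrow> X'\<guillemotright>" "ash C a g = \<gamma>" "ash C (a + 1) g = ash C 1 \<gamma>" using \<gamma>(1) by (simp_all add: g_def)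
  have b: "\<guillemotleft>tb T (k - 1) :\<^bsub>C\<^esub> tG T k \<rightarrow> ShO C k X\<guillemotright>" for k using gtower_hom(3)[OF T, of "k - 1"] by simp
  have "td T' k \<odot> \<phi> k \<odot> ty T k = ta T' k \<odot> ash C k g \<odot> tb T (k - 1)" for k
  proof -
    \<comment> \<open>In degrees $a$ and $a+1$ the equation follows from the two squares satisfied
      by \<gamma>. Elsewhere both sides vanish: one because a heart term is zero, the other by
      orthogonality.\<close>
    consider "k < a" | "k = a" | "k = a + 1" | "k > a + 1" by linarith
    then show ?thesis
    proof cases
      case 1
      have "zero_object C (tH T k)" using gtower_zero_H(1)[OF T zT[of k] zT[of "k - 1"]] 1 by simp
      then have "ty T k = azero C (tG T k) (tH T k)" by (intro in_hom_to_zero) simp_all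
      then have L: "td T' k \<odot> \<phi> k \<odot> ty T k = azero C (tG T k) (tL T' k)" by simp
      have "ta T' k \<odot> ash C k g = azero C (ShO C k X) (tL T' k)"
        by (rule orth[of _ _ _ "a - k" 0]) (use X(1) 1 g(1) in \<open>simp_all add: w_ge_iff\<close>)
      from acomp_eq[OF this, of "tb T (k - 1)"] show ?thesis using L b[of k] g(1) by simp
    next
      case 2
      have "td T' a \<odot> \<phi> a \<odot> ty T a = l \<odot> td T a \<odot> ty T a" using acomp_eq[OF ld, of "ty T a"] by simp
      also have "\<dots> = (l \<odot> ta T a) \<odot> tb T (a - 1)" using b[of a] by (simp add: gtower_eq(4)[OF T])
      also have "\<dots> = ta T' a \<odot> \<gamma> \<odot> tb T (a - 1)" unfolding \<gamma>(2) using b[of a] \<gamma>(1) by simp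
      finally show ?thesis using 2 g(2) by simp
    next
      case 3
      have "td T' (a + 1) \<odot> \<phi> (a + 1) \<odot> ty T (a + 1) = td T' (a + 1) \<odot> ty T' (a + 1) \<odot> r" by (simp add: yr)
      also have "\<dots> = ta T' (a + 1) \<odot> tb T' a \<odot> r" using acomp_eq[OF gtower_eq(4)[OF T', of "a + 1"], of r] by simp
      also have "\<dots> = ta T' (a + 1) \<odot> ash C (a + 1) g \<odot> tb T a" unfolding \<gamma>(3)[symmetric] g(3) ..
      finally show ?thesis using 3 by simp
    next
      case 4
      have "zero_object C (tH T' k)" using gtower_zero_H(2)[OF T' zT'[of k] zT'[of "k + 1"]] 4 by simp
      then have "\<phi> k = azero C (tH T k) (tH T' k)" by (intro in_hom_to_zero) simp_all
      then have L: "td T' k \<odot> \<phi> k \<odot> ty T k = azero C (tG T k) (tL T' k)" by simp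
      have "ash C k g \<odot> tb T (k - 1) = azero C (tG T k) (ShO C k X')"
        by (rule orth[of _ _ _ 0 "a + 1 - k"]) (use X(2) 4 g(1) b[of k] in \<open>simp_all add: w_le_iff\<close>)
      then show ?thesis using L b[of k] g(1) by simp
    qed
  qed
  then have "trel T T' g \<phi>" unfolding trel_def using F by simp
  from wm_eq[OF T T' g(1) this] have "wm T T' g = hw.wk (hw.kq (mkc (cx T) (cx T') \<phi>))" .
  moreover have "mkc (cx T) (cx T') \<phi> = f" by (rule cm_eqI) (use f F(1) in \<open>simp_all add: \<phi>_def\<close>)
  ultimately show ?thesis using that g(1) by simp
qed

text \<open>The comparison isomorphisms move the problem to towers having the zero terms that
  \<open>wm_surj_nice\<close> asks for.\<close>

lemma wm_surj:
  assumes X: "X \<in> w_ge C w a" "X' \<in> w_le C w (a + 1)" and T: "gtower X T" and T': "gtower X' T'"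
    and x: "\<guillemotleft>x :\<^bsub>KWH\<^esub> cx T \<rightarrow> cx T'\<guillemotright>"
  obtains g where "\<guillemotleft>g :\<^bsub>C\<^esub> X \<rightarrow> X'\<guillemotright>" "wm T T' g = x"
proof -
  obtain S where S: "gtower X S" "\<And>k. k < a \<Longrightarrow> zero_object C (tL S k)" using gtower_le_exists[OF X(1)] by blast
  obtain S' where S': "gtower X' S'" "\<And>k. k > a + 1 \<Longrightarrow> zero_object C (tG S' k)" using gtower_ge_exists[OF X(2)] by blast
  have i: "\<guillemotleft>aid C X :\<^bsub>C\<^esub> X \<rightarrow> X\<guillemotright>" "\<guillemotleft>aid C X' :\<^bsub>C\<^esub> X' \<rightarrow> X'\<guillemotright>" using gtowerD(1)[OF T] gtowerD(1)[OF T'] by simp_all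
  define p p' q q' where "p = wm T S (aid C X)" and "p' = wm S T (aid C X)" and "q = wm T' S' (aid C X')" and "q' = wm S' T' (aid C X')"
  have pq: "\<guillemotleft>p :\<^bsub>KWH\<^esub> cx T \<rightarrow> cx S\<guillemotright>" "\<guillemotleft>p' :\<^bsub>KWH\<^esub> cx S \<rightarrow> cx T\<guillemotright>" "\<guillemotleft>q :\<^bsub>KWH\<^esub> cx T' \<rightarrow> cx S'\<guillemotright>" "\<guillemotleft>q' :\<^bsub>KWH\<^esub> cx S' \<rightarrow> cx T'\<guillemotright>"
    using arr_wm i T T' S(1) S'(1) by (simp_all add: p_def p'_def q_def q'_def)
  note [simp] = pq x
  have pp: "p' \<odot>\<^bsub>KWH\<^esub> p = aid KWH (cx T)" using wm_acomp[OF T S(1) T i(1) i(1)] wm_aid[OF T] i by (simp add: p_def p'_def)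
  have qq: "q' \<odot>\<^bsub>KWH\<^esub> q = aid KWH (cx T')" using wm_acomp[OF T' S'(1) T' i(2) i(2)] wm_aid[OF T'] i by (simp add: q_def q'_def)
  obtain f where f: "arr hw.CA f" "q \<odot>\<^bsub>KWH\<^esub> x \<odot>\<^bsub>KWH\<^esub> p' = hw.wk (hw.kq f)" using hw.arr_Kw_cases[of "q \<odot>\<^bsub>KWH\<^esub> x \<odot>\<^bsub>KWH\<^esub> p'"] by auto
  have f': "\<guillemotleft>f :\<^bsub>hw.CA\<^esub> cx S \<rightarrow> cx S'\<guillemotright>" 
  proof -
    have "src f = cx S" "tgt f = cx S'" using arg_cong[OF f(2), of src] arg_cong[OF f(2), of tgt] by simp_all
    then show ?thesis using f(1) cx_obj[OF S(1)] cx_obj[OF S'(1)] by blast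
  qed
  obtain g where g: "\<guillemotleft>g :\<^bsub>C\<^esub> X \<rightarrow> X'\<guillemotright>" "wm S S' g = hw.wk (hw.kq f)" using wm_surj_nice[OF X S(1) S'(1) S(2) S'(2) f'] by blast
  have "wm T T' g = q' \<odot>\<^bsub>KWH\<^esub> wm S S' g \<odot>\<^bsub>KWH\<^esub> p"
    using wm_acomp[OF T S(1) S'(1) i(1) g(1)] wm_acomp[OF T S'(1) T' g(1) i(2)] g(1) by (simp add: p_def q'_def)
  also have "\<dots> = x" unfolding g(2) f(2)[symmetric]
    using pp hw.kw.acomp_eq[OF qq, of x] by simp
  finally show ?thesis using that g(1) by blast
qed

text \<open>Put $n = g - 1$, so $t(n) = 0$. On weights in $[0,1]$ two such factors compose to zero,
  hence $n^2 = 0$ and $1 - n$ inverts $g$.\<close>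

lemma wm_one_inverse:
  assumes X: "X \<in> w_interval C w 0 1" and T: "gtower X T" and g: "\<guillemotleft>g :\<^bsub>C\<^esub> X \<rightarrow> X\<guillemotright>" and e: "wm T T g = aid KWH (cx T)"
  obtains k where "\<guillemotleft>k :\<^bsub>C\<^esub> X \<rightarrow> X\<guillemotright>" "k \<odot> g = aid C X" "g \<odot> k = aid C X"
proof -
  have o: "X \<in> Obj C" using g by blast
  note [simp] = g o
  define n where "n = g \<oplus> \<ominus> (aid C X)"
  have n: "\<guillemotleft>n :\<^bsub>C\<^esub> X \<rightarrow> X\<guillemotright>" by (simp add: n_def)
  have i: "\<guillemotleft>aid C X :\<^bsub>C\<^esub> X \<rightarrow> X\<guillemotright>" "\<guillemotleft>\<ominus> (aid C X) :\<^bsub>C\<^esub> X \<rightarrow> X\<guillemotright>" by simp_all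
  have z: "wm T T n = azero KWH (cx T) (cx T)"
    using wm_aplus[OF T T g i(2)] wm_aneg[OF T T i(1)] wm_aid[OF T] e T by (simp add: n_def)
  have X': "X \<in> w_ge C w 0" "X \<in> w_le C w 1" using X by (auto simp: w_interval_def)
  have "fil (0 - 1 + 1) T (n \<odot> aid C X)" by (rule fil_step[OF T T i(1) n fil_start[OF X'(1) T i(1)] z])
  then have "fil 0 T n" using n by simp
  then have "fil (0 + 1) T (n \<odot> n)" by (rule fil_step[OF T T n n _ z])
  then have nn: "n \<odot> n = azero C X X" using n by (intro fil_end[OF X'(2) T]) simp_all
  have gn: "g = aid C X \<oplus> n" using eq_plus_diff[of g "aid C X"] by (simp add: n_def)
  note [simp] = n
  show ?thesis
  proof (rule that[of "aid C X \<oplus> \<ominus> n"])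
    show "(aid C X \<oplus> \<ominus> n) \<odot> g = aid C X" "g \<odot> (aid C X \<oplus> \<ominus> n) = aid C X"
      unfolding gn by (simp_all add: nn)
  qed simp
qed

text \<open>Surjectivity with $a = 0$ lifts an isomorphism and its inverse. The lifts need not be
  mutually inverse, but both composites are sent to identities and are therefore invertible.\<close>

lemma isomorphic_of_complexes:
  assumes X: "X \<in> w_interval C w 0 1" and Y: "Y \<in> w_interval C w 0 1" and T: "gtower X T" and T': "gtower Y T'"
    and i: "isomorphic KWH (cx T) (cx T')"
  shows "isomorphic C X Y"
proof -
  obtain u where u: "is_iso KWH (cx T) (cx T') u" using i unfolding isomorphic_def by blast
  define x where "x = Arrow (cx T) (cx T') u"
  have "hw.kw.aiso x" using u T T' hw.kw.is_iso_iff[of "cx T" "cx T'" u] by (simp add: x_def)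
  then obtain y where xy: "\<guillemotleft>x :\<^bsub>KWH\<^esub> cx T \<rightarrow> cx T'\<guillemotright>" "\<guillemotleft>y :\<^bsub>KWH\<^esub> cx T' \<rightarrow> cx T\<guillemotright>" "y \<odot>\<^bsub>KWH\<^esub> x = aid KWH (cx T)" "x \<odot>\<^bsub>KWH\<^esub> y = aid KWH (cx T')"
    using hw.kw.aisoE[of x] hw.kw.aiso_arr[of x] by (auto simp: x_def)
  have XY: "X \<in> w_ge C w 0" "X \<in> w_le C w (0 + 1)" "Y \<in> w_ge C w 0" "Y \<in> w_le C w (0 + 1)" using X Y by (auto simp: w_interval_def)
  obtain f where f: "\<guillemotleft>f :\<^bsub>C\<^esub> X \<rightarrow> Y\<guillemotright>" "wm T T' f = x" using wm_surj[OF XY(1,4) T T' xy(1)] .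
  obtain g where g: "\<guillemotleft>g :\<^bsub>C\<^esub> Y \<rightarrow> X\<guillemotright>" "wm T' T g = y" using wm_surj[OF XY(3,2) T' T xy(2)] .
  note [simp] = f(1) g(1)
  have "\<guillemotleft>g \<odot> f :\<^bsub>C\<^esub> X \<rightarrow> X\<guillemotright>" "wm T T (g \<odot> f) = aid KWH (cx T)" using wm_acomp[OF T T' T f(1) g(1)] f(2) g(2) xy(3) by simp_all
  then obtain k where k: "\<guillemotleft>k :\<^bsub>C\<^esub> X \<rightarrow> X\<guillemotright>" "k \<odot> (g \<odot> f) = aid C X" using wm_one_inverse[OF X T] by blast
  have "\<guillemotleft>f \<odot> g :\<^bsub>C\<^esub> Y \<rightarrow> Y\<guillemotright>" "wm T' T' (f \<odot> g) = aid KWH (cx T')" using wm_acomp[OF T' T T' g(1) f(1)] f(2) g(2) xy(4) by simp_all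
  then obtain m where m: "\<guillemotleft>m :\<^bsub>C\<^esub> Y \<rightarrow> Y\<guillemotright>" "(f \<odot> g) \<odot> m = aid C Y" using wm_one_inverse[OF Y T'] by blast
  have "aiso f" by (rule aiso_left_right[of f "k \<odot> g" "g \<odot> m"]) (use k m in simp_all)
  from aiso_is_iso[OF this] show ?thesis unfolding isomorphic_def using f(1) by auto
qed

end

section \<open>The weight complex functor\<close>

lemma additive_functor_kernel_ideal:
  assumes C: "preadditive_category C" and D: "preadditive_category D" and F: "additive_functor C D FO FM"
  shows "mor_ideal C (\<lambda>X Y. kernel (hom_group C X Y) (hom_group D (FO X) (FO Y)) (FM X Y))" (is "mor_ideal C ?I")
proof -
  interpret C: preadditive_category C by (rule C)
  interpret D: preadditive_category D by (rule D)
  have o: "FO X \<in> Obj D" if "X \<in> Obj C" for X using F that unfolding additive_functor_def by blast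
  have gh: "group_hom (hom_group C X Y) (hom_group D (FO X) (FO Y)) (FM X Y)" if "X \<in> Obj C" "Y \<in> Obj C" for X Y
    using F that C.hom_comm_group[OF that] D.hom_comm_group[OF o[OF that(1)] o[OF that(2)]]
    unfolding additive_functor_def by (intro group_hom.intro group_hom_axioms.intro) (auto intro: comm_group.axioms(2))
  have sub: "subgroup (?I X Y) (hom_group C X Y)" if "X \<in> Obj C" "Y \<in> Obj C" for X Y
    by (rule group_hom.subgroup_kernel[OF gh[OF that]])
  have mem: "f \<in> ?I X Y \<longleftrightarrow> f \<in> Hom C X Y \<and> FM X Y f = Zer D (FO X) (FO Y)" for f X Y
    by (auto simp: kernel_def hom_group_def)
  have fm: "FM X Y f \<in> Hom D (FO X) (FO Y)" if "X \<in> Obj C" "Y \<in> Obj C" "f \<in> Hom C X Y" for X Y f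
  proof -
    have "FM X Y \<in> hom (hom_group C X Y) (hom_group D (FO X) (FO Y))" using F that unfolding additive_functor_def by blast
    then show ?thesis using that(3) by (auto simp: hom_def hom_group_def)
  qed
  have comp: "FM X Z (g \<cdot>\<^bsub>C\<^esub> f) = FM Y Z g \<cdot>\<^bsub>D\<^esub> FM X Y f" if "X \<in> Obj C" "Y \<in> Obj C" "Z \<in> Obj C" "f \<in> Hom C X Y" "g \<in> Hom C Y Z" for X Y Z f g
    using F that unfolding additive_functor_def by blast
  have zl: "Zer D Y' Z' \<cdot>\<^bsub>D\<^esub> f = Zer D X' Z'" "f' \<cdot>\<^bsub>D\<^esub> Zer D X' Y' = Zer D X' Z'"
    if "X' \<in> Obj D" "Y' \<in> Obj D" "Z' \<in> Obj D" "f \<in> Hom D X' Y'" "f' \<in> Hom D Y' Z'" for X' Y' Z' f f'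
  proof -
    have "azero D Y' Z' \<odot>\<^bsub>D\<^esub> Arrow X' Y' f = azero D X' Z'" "Arrow Y' Z' f' \<odot>\<^bsub>D\<^esub> azero D X' Y' = azero D X' Z'"
      using that by (simp_all add: arr_Arrow)
    from this[THEN arg_cong, of mor] show "Zer D Y' Z' \<cdot>\<^bsub>D\<^esub> f = Zer D X' Z'" "f' \<cdot>\<^bsub>D\<^esub> Zer D X' Y' = Zer D X' Z'"
      by (simp_all only: arrow_mor arrow.sel)
  qed
  have l: "g \<cdot>\<^bsub>C\<^esub> f \<in> ?I X Z" if "X \<in> Obj C" "Y \<in> Obj C" "Z \<in> Obj C" "f \<in> ?I X Y" "g \<in> Hom C Y Z" for X Y Z f g
    using that C.comp_in[of X Y Z f g] comp[of X Y Z f g] zl(2)[of "FO X" "FO Y" "FO Z" _ "FM Y Z g"] o fm unfolding mem by metis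
  have r: "g \<cdot>\<^bsub>C\<^esub> f \<in> ?I X Z" if "X \<in> Obj C" "Y \<in> Obj C" "Z \<in> Obj C" "f \<in> Hom C X Y" "g \<in> ?I Y Z" for X Y Z f g
    using that C.comp_in[of X Y Z f g] comp[of X Y Z f g] zl(1)[of "FO X" "FO Y" "FO Z" "FM X Y f"] o fm unfolding mem by metis
  have plus: "f \<boxplus>\<^bsub>C\<^esub> g \<in> ?I X Y" if "X \<in> Obj C" "Y \<in> Obj C" "f \<in> ?I X Y" "g \<in> ?I X Y" for X Y f g
    using subgroup.m_closed[OF sub[OF that(1,2)] that(3,4)] by (simp add: hom_group_def)
  show ?thesis unfolding mor_ideal_def
  proof (intro conjI ballI allI impI)
    fix X Y X' Y' f f' S e1 e2 p1 p2 S' e1' e2' p1' p2'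
    assume o: "X \<in> Obj C" "Y \<in> Obj C" "X' \<in> Obj C" "Y' \<in> Obj C" and f: "f \<in> ?I X Y" "f' \<in> ?I X' Y'"
      and b: "biproduct C X X' S e1 e2 p1 p2" "biproduct C Y Y' S' e1' e2' p1' p2'"
    have b': "S \<in> Obj C" "S' \<in> Obj C" "p1 \<in> Hom C S X" "p2 \<in> Hom C S X'" "e1' \<in> Hom C Y S'" "e2' \<in> Hom C Y' S'"
      using b by (simp_all add: biproduct_def)
    \<comment> \<open>A direct sum of two morphisms is the sum of their composites with injections
      and projections.\<close>
    show "(e1' \<cdot>\<^bsub>C\<^esub> f \<cdot>\<^bsub>C\<^esub> p1) \<boxplus>\<^bsub>C\<^esub> (e2' \<cdot>\<^bsub>C\<^esub> f' \<cdot>\<^bsub>C\<^esub> p2) \<in> ?I S S'"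
      by (rule plus[OF b'(1,2) r[OF b'(1) o(1) b'(2,3) l[OF o(1,2) b'(2) f(1) b'(5)]] r[OF b'(1) o(3) b'(2,4) l[OF o(3,4) b'(2) f(2) b'(6)]]])
  qed (use sub l r in blast)+
qed

lemma (in cpx_category) weak_distI:
  assumes f: "\<guillemotleft>f :\<^bsub>Kw A\<^esub> X \<rightarrow> Y\<guillemotright>" "\<guillemotleft>g :\<^bsub>Kw A\<^esub> Y \<rightarrow> Z\<guillemotright>" "\<guillemotleft>h :\<^bsub>Kw A\<^esub> Z \<rightarrow> ShO CA 1 X\<guillemotright>"
    and 1: "\<exists>F G H. kd F G H \<and> src F = X \<and> tgt F = Y \<and> tgt G = Z \<and> wk F = f \<and> wk G = g"
    and 2: "\<exists>F G H. kd F G H \<and> src F = X \<and> tgt F = Y \<and> tgt G = Z \<and> wk G = g \<and> wk H = h"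
    and 3: "\<exists>F G H. kd F G H \<and> src F = X \<and> tgt F = Y \<and> tgt G = Z \<and> wk F = f \<and> wk H = h"
  shows "(X, Y, Z, mor f, mor g, mor h) \<in> Dist (Kw A)"
proof -
  have D: "Dist (Kw A) = weak_dist A" by (simp add: Kw_def tri_cat.defs shift_cat.defs)
  have t: "is_triangle z.Q (X, Y, Z, mor f, mor g, mor h)"
    using f unfolding is_triangle_def Kw_sel(1,2,7)[symmetric] by (auto simp: arr_def)
  have K: "(X, Y, Z, mor F, mor G, mor H) \<in> Dist KA \<and> wclass A X Y (mor F) = mor (wk F) \<and> wclass A Y Z (mor G) = mor (wk G) \<and>
      wclass A Z (ShO KA 1 X) (mor H) = mor (wk H)" if "kd F G H" "src F = X" "tgt F = Y" "tgt G = Z" for F G H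
    using kd_Dist[OF that(1)] that unfolding kd_def by (auto simp: mor_wk)
  have "\<exists>F G H. (X, Y, Z, F, G, H) \<in> Dist KA \<and> wclass A X Y F = mor f \<and> wclass A Y Z G = mor g"
  proof -
    obtain F G H where k: "kd F G H" "src F = X" "tgt F = Y" "tgt G = Z" "wk F = f" "wk G = g" using 1 by blast
    show ?thesis using K[OF k(1-4)] unfolding k(5,6) by blast
  qed
  moreover have "\<exists>F G H. (X, Y, Z, F, G, H) \<in> Dist KA \<and> wclass A Y Z G = mor g \<and> wclass A Z (ShO KA 1 X) H = mor h"
  proof -
    obtain F G H where k: "kd F G H" "src F = X" "tgt F = Y" "tgt G = Z" "wk G = g" "wk H = h" using 2 by blast
    show ?thesis using K[OF k(1-4)] unfolding k(5,6) by blast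
  qed
  moreover have "\<exists>F G H. (X, Y, Z, F, G, H) \<in> Dist KA \<and> wclass A X Y F = mor f \<and> wclass A Z (ShO KA 1 X) H = mor h"
  proof -
    obtain F G H where k: "kd F G H" "src F = X" "tgt F = Y" "tgt G = Z" "wk F = f" "wk H = h" using 3 by blast
    show ?thesis using K[OF k(1-4)] unfolding k(5,6) by blast
  qed
  ultimately show ?thesis unfolding D weak_dist_def mem_Collect_eq prod.case using t by blast
qed

section \<open>The functor for a fixed choice of towers, with each part of the theorem restated for
  it\<close>

locale weight_complex = weight_structure C w
  for C :: "('o, 'm, 'z) tri_cat_scheme" (structure) and w :: "'o set \<times> 'o set" +
  fixes P :: "'o \<Rightarrow> ('o, 'm) tower" and N :: "'o \<Rightarrow> ('o, 'm) atower"
  assumes match: "X \<in> Obj C \<Longrightarrow> tower_match X (P X) (N X)"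
begin

abbreviation "tt \<equiv> wc_obj C P"
abbreviation "tm \<equiv> wc_mor C w P"

lemma gt: "X \<in> Obj C \<Longrightarrow> gtower X (N X)"
  using match by (auto simp: tower_match_def)

lemma tt_eq: "X \<in> Obj C \<Longrightarrow> tt X = cx (N X)"
  using tower_match_cx[OF match, of X] by (simp add: wc_obj_def)

lemma cx_N [simp]: "X \<in> Obj C \<Longrightarrow> cx (N X) \<in> Obj hw.CA"
  using cx_obj gt by blast

lemma tm_eq: "\<lbrakk>X \<in> Obj C; Y \<in> Obj C; g \<in> Hom C X Y\<rbrakk> \<Longrightarrow> tm X Y g = mor (wm (N X) (N Y) (Arrow X Y g))"
  using wc_mor_eq match by blast

lemma wm_typed: "\<lbrakk>X \<in> Obj C; Y \<in> Obj C; g \<in> Hom C X Y\<rbrakk> \<Longrightarrow> \<guillemotleft>wm (N X) (N Y) (Arrow X Y g) :\<^bsub>KWH\<^esub> tt X \<rightarrow> tt Y\<guillemotright>"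
  using arr_wm[OF gt gt, of X Y "Arrow X Y g"] gt by (simp add: tt_eq arr_Arrow)

lemma wm_Arrow: "\<lbrakk>X \<in> Obj C; Y \<in> Obj C; g \<in> Hom C X Y\<rbrakk> \<Longrightarrow> wm (N X) (N Y) (Arrow X Y g) = Arrow (tt X) (tt Y) (tm X Y g)"
  by (rule arrow_eqI) (simp_all add: tm_eq tt_eq)

lemma tm_eq_iff: "\<lbrakk>X \<in> Obj C; Y \<in> Obj C; g \<in> Hom C X Y; h \<in> Hom C X Y\<rbrakk> \<Longrightarrow>
    tm X Y g = tm X Y h \<longleftrightarrow> wm (N X) (N Y) (Arrow X Y g) = wm (N X) (N Y) (Arrow X Y h)"
  by (simp add: wm_Arrow)

lemma tm_functor: "additive_functor C KWH tt tm"
  unfolding additive_functor_def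
proof (intro conjI ballI homI)
  fix X Y Z f g assume X: "X \<in> Obj C"
  show "tt X \<in> Obj KWH" using X gt tt_eq by simp
  show "tm X X (Ident C X) = Ident KWH (tt X)"
    using X arg_cong[OF wm_aid[OF gt[OF X]], of mor] by (simp add: tm_eq ident_in tt_eq aid_def)
  assume Y: "Y \<in> Obj C"
  {
    assume f: "f \<in> carrier (hom_group C X Y)"
    then have f': "f \<in> Hom C X Y" by (simp add: hom_group_def)
    show "tm X Y f \<in> carrier (hom_group KWH (tt X) (tt Y))" using wm_typed[OF X Y f'] X Y f' by (auto simp: hom_group_def tm_eq arr_def)
    assume g: "g \<in> carrier (hom_group C X Y)"
    then have g': "g \<in> Hom C X Y" by (simp add: hom_group_def)
    have t: "\<guillemotleft>Arrow X Y f :\<^bsub>C\<^esub> X \<rightarrow> Y\<guillemotright>" "\<guillemotleft>Arrow X Y g :\<^bsub>C\<^esub> X \<rightarrow> Y\<guillemotright>" using X Y f' g' by (simp_all add: arr_Arrow)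
    then have fg: "f \<boxplus> g \<in> Hom C X Y" using arr_aplus[of "Arrow X Y f" "Arrow X Y g"] by (simp add: arr_Arrow aplus_def)
    show "tm X Y (f \<otimes>\<^bsub>hom_group C X Y\<^esub> g) = tm X Y f \<otimes>\<^bsub>hom_group KWH (tt X) (tt Y)\<^esub> tm X Y g"
      using arg_cong[OF wm_aplus[OF gt[OF X] gt[OF Y] t], of mor] X Y f' g' fg by (simp add: hom_group_def tm_eq arrow_mor) (simp add: aplus_def)
  }
  assume Z: "Z \<in> Obj C" and f: "f \<in> Hom C X Y" and g: "g \<in> Hom C Y Z"
  have t: "\<guillemotleft>Arrow X Y f :\<^bsub>C\<^esub> X \<rightarrow> Y\<guillemotright>" "\<guillemotleft>Arrow Y Z g :\<^bsub>C\<^esub> Y \<rightarrow> Z\<guillemotright>" using X Y Z f g by (simp_all add: arr_Arrow)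
  show "tm X Z (g \<cdot> f) = tm Y Z g \<cdot>\<^bsub>KWH\<^esub> tm X Y f"
    using arg_cong[OF wm_acomp[OF gt[OF X] gt[OF Y] gt[OF Z] t], of mor] X Y Z f g comp_in[OF X Y Z f g]
    by (simp add: tm_eq arrow_mor) (simp add: acomp_def)
qed

lemma tm_exact: "exact_functor C KWH tt tm"
  unfolding exact_functor_def
proof (intro conjI tm_functor exI[of _ "\<lambda>X. mor (theta X (N (ShO C 1 X)) (N X))"] ballI allI impI)
  have S: "gtower (ShO C 1 X) (N (ShO C 1 X))" if "X \<in> Obj C" for X using gt that by simp
  have th: "hw.kw.aiso (theta X (N (ShO C 1 X)) (N X))" "\<guillemotleft>theta X (N (ShO C 1 X)) (N X) :\<^bsub>KWH\<^esub> tt (ShO C 1 X) \<rightarrow> ShO hw.CA 1 (tt X)\<guillemotright>" if "X \<in> Obj C" for X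
    using theta[OF gt[OF that] S[OF that]] that by (simp_all add: tt_eq)
  have ma: "mor (ash KWH 1 x) = ShM KWH 1 (mor x)" for x by (simp add: ash_def)
  show "is_iso KWH (tt (ShO C 1 X)) (ShO KWH 1 (tt X)) (mor (theta X (N (ShO C 1 X)) (N X)))" if X: "X \<in> Obj C" for X
    using hw.kw.aiso_is_iso[OF th(1)[OF X]] th(2)[OF X] by simp
  show "mor (theta Y (N (ShO C 1 Y)) (N Y)) \<cdot>\<^bsub>KWH\<^esub> tm (ShO C 1 X) (ShO C 1 Y) (ShM C 1 f) = ShM KWH 1 (tm X Y f) \<cdot>\<^bsub>KWH\<^esub> mor (theta X (N (ShO C 1 X)) (N X))"
    if o: "X \<in> Obj C" "Y \<in> Obj C" "f \<in> Hom C X Y" for X Y f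
  proof -
    have f: "\<guillemotleft>Arrow X Y f :\<^bsub>C\<^esub> X \<rightarrow> Y\<guillemotright>" using o by (simp add: arr_Arrow)
    have e: "ash C 1 (Arrow X Y f) = Arrow (ShO C 1 X) (ShO C 1 Y) (ShM C 1 f)" by (simp add: ash_def)
    show ?thesis
      using arg_cong[OF theta_natural[OF gt[OF o(1)] S[OF o(1)] gt[OF o(2)] S[OF o(2)] f], of mor] o shM_in[OF o]
      by (simp add: arrow_mor ma tm_eq e)
  qed
  fix X Y Z f g h assume "(X, Y, Z, f, g, h) \<in> Dist C"
  then have t: "tri (Arrow X Y f) (Arrow Y Z g) (Arrow Z (ShO C 1 X) h)" by (rule tri_Dist)
  have o: "X \<in> Obj C" "Y \<in> Obj C" "Z \<in> Obj C" "f \<in> Hom C X Y" "g \<in> Hom C Y Z" "h \<in> Hom C Z (ShO C 1 X)" "ShO C 1 X \<in> Obj C"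
    using triD[OF t] by (simp_all add: arr_Arrow)
  have G: "gtower (src (Arrow X Y f)) (N X)" "gtower (tgt (Arrow X Y f)) (N Y)" "gtower (tgt (Arrow Y Z g)) (N Z)"
    "gtower (ShO C 1 (src (Arrow X Y f))) (N (ShO C 1 X))" using gt o by simp_all
  note W = weak_exact[OF t G]
  have "(tt X, tt Y, tt Z, mor (wm (N X) (N Y) (Arrow X Y f)), mor (wm (N Y) (N Z) (Arrow Y Z g)),
      mor (theta X (N (ShO C 1 X)) (N X) \<odot>\<^bsub>KWH\<^esub> wm (N Z) (N (ShO C 1 X)) (Arrow Z (ShO C 1 X) h))) \<in> Dist KWH"
  proof (rule hw.weak_distI)
    show "\<guillemotleft>wm (N X) (N Y) (Arrow X Y f) :\<^bsub>KWH\<^esub> tt X \<rightarrow> tt Y\<guillemotright>" "\<guillemotleft>wm (N Y) (N Z) (Arrow Y Z g) :\<^bsub>KWH\<^esub> tt Y \<rightarrow> tt Z\<guillemotright>"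
      using wm_typed o by blast+
    show "\<guillemotleft>theta X (N (ShO C 1 X)) (N X) \<odot>\<^bsub>KWH\<^esub> wm (N Z) (N (ShO C 1 X)) (Arrow Z (ShO C 1 X) h) :\<^bsub>KWH\<^esub> tt Z \<rightarrow> ShO hw.CA 1 (tt X)\<guillemotright>"
      using wm_typed[OF o(3,7,6)] th(2)[OF o(1)] by simp
  qed (use W o in \<open>simp_all only: tt_eq arrow.sel\<close>)
  then show "(tt X, tt Y, tt Z, tm X Y f, tm Y Z g, mor (theta X (N (ShO C 1 X)) (N X)) \<cdot>\<^bsub>KWH\<^esub> tm Z (ShO C 1 X) h) \<in> Dist KWH"
    using o by (simp add: tm_eq arrow_mor)
qed

lemma kernel_iff: "\<lbrakk>X \<in> Obj C; Y \<in> Obj C\<rbrakk> \<Longrightarrow> g \<in> wc_kernel C w P X Y \<longleftrightarrow>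
    g \<in> Hom C X Y \<and> wm (N X) (N Y) (Arrow X Y g) = azero KWH (cx (N X)) (cx (N Y))"
  using wm_Arrow[of X Y g] by (cases "g \<in> Hom C X Y") (simp_all add: wc_kernel_def kernel_def hom_group_def tt_eq azero_def)

lemma kernel_ideal: "mor_ideal C (wc_kernel C w P)"
proof -
  have "wc_kernel C w P = (\<lambda>X Y. kernel (hom_group C X Y) (hom_group KWH (tt X) (tt Y)) (tm X Y))"
    by (intro ext) (simp add: wc_kernel_def)
  then show ?thesis
    using additive_functor_kernel_ideal[OF preadditive_category_axioms hw.kw.preadditive_category_axioms tm_functor] by simp
qed

lemma interval_obj: "X \<in> w_interval C w i j \<Longrightarrow> X \<in> Obj C"
  by (simp add: w_interval_def w_le_iff)

lemma full_subcat_sel: "Obj (full_subcat C S) = S" "Comp (full_subcat C S) = Comp C" "Ident (full_subcat C S) = Ident C"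
  by (simp_all add: full_subcat_def)

text \<open>The identity of $X$ has filtration $i-1$ because $X$ has weights at least $i$, and each
  factor from the kernel adds one.\<close>

lemma power_fil:
  assumes X: "X \<in> w_interval C w i j" and Z: "Z \<in> w_interval C w i j"
    and g: "g \<in> mor_power (full_subcat C (w_interval C w i j)) (wc_kernel C w P) n X Z"
  shows "g \<in> Hom C X Z \<and> fil (i - 1 + int n) (N Z) (Arrow X Z g)"
  using Z g
proof (induction n arbitrary: Z g)
  case 0
  then have Z: "Z = X" "g = Ident C X" by (simp_all add: full_subcat_sel split: if_splits)
  have o: "X \<in> Obj C" "X \<in> w_ge C w i" using X by (auto simp: w_interval_def w_ge_iff)
  have "\<guillemotleft>Arrow X X (Ident C X) :\<^bsub>C\<^esub> X \<rightarrow> X\<guillemotright>" using o ident_in by (simp add: arr_Arrow)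
  from fil_start[OF o(2) gt[OF o(1)] this] show ?case using Z o ident_in by simp
next
  case (Suc n)
  then obtain f h Y where Y: "Y \<in> w_interval C w i j" "f \<in> mor_power (full_subcat C (w_interval C w i j)) (wc_kernel C w P) n X Y"
    "h \<in> wc_kernel C w P Y Z" "g = h \<cdot> f" by (auto simp: full_subcat_sel)
  note IH = Suc.IH[OF Y(1,2)]
  have o: "X \<in> Obj C" "Y \<in> Obj C" "Z \<in> Obj C" using interval_obj X Y(1) Suc.prems(1) by blast+
  have h: "h \<in> Hom C Y Z" "wm (N Y) (N Z) (Arrow Y Z h) = azero KWH (cx (N Y)) (cx (N Z))" using Y(3) kernel_iff o by blast+
  have t: "\<guillemotleft>Arrow X Y f :\<^bsub>C\<^esub> X \<rightarrow> Y\<guillemotright>" "\<guillemotleft>Arrow Y Z h :\<^bsub>C\<^esub> Y \<rightarrow> Z\<guillemotright>" using IH h o by (simp_all add: arr_Arrow)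
  have "fil (i - 1 + int n + 1) (N Z) (Arrow Y Z h \<odot> Arrow X Y f)" by (rule fil_step[OF gt[OF o(2)] gt[OF o(3)] t _ h(2)]) (use IH in blast)
  then show ?case using comp_in[OF o _ h(1)] IH Y(4) by (simp add: acomp_def algebra_simps)
qed

lemma kernel_nilpotent:
  assumes ij: "i \<le> j" and X: "X \<in> w_interval C w i j" and Y: "Y \<in> w_interval C w i j"
  shows "mor_power (full_subcat C (w_interval C w i j)) (wc_kernel C w P) (nat (j - i + 1)) X Y = {Zer C X Y}"
proof
  have o: "X \<in> Obj C" "Y \<in> Obj C" using X Y interval_obj by blast+
  show "mor_power (full_subcat C (w_interval C w i j)) (wc_kernel C w P) (nat (j - i + 1)) X Y \<subseteq> {Zer C X Y}"
  proof
    fix g assume "g \<in> mor_power (full_subcat C (w_interval C w i j)) (wc_kernel C w P) (nat (j - i + 1)) X Y"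
    from power_fil[OF X Y this] ij have g: "g \<in> Hom C X Y" "fil j (N Y) (Arrow X Y g)" by simp_all
    have "Arrow X Y g = azero C X Y"
      by (rule fil_end[OF _ gt[OF o(2)] _ g(2)]) (use Y g(1) o in \<open>simp_all add: w_interval_def arr_Arrow\<close>)
    then show "g \<in> {Zer C X Y}" by (simp add: azero_def)
  qed
  \<comment> \<open>For the reverse inclusion zero itself must be exhibited as a composite of the
    right length; zero endomorphisms of $X$ serve as the factors before the last one.\<close>
  have z: "Zer C X Y \<in> wc_kernel C w P X Y" if "X \<in> Obj C" "Y \<in> Obj C" for X Y
    using kernel_ideal that subgroup.one_closed[of "wc_kernel C w P X Y" "hom_group C X Y"] unfolding mor_ideal_def hom_group_def by simp
  have zc: "Zer C X Y \<cdot> Zer C X X = Zer C X Y" "Zer C X Y \<cdot> Ident C X = Zer C X Y" if "X \<in> Obj C" "Y \<in> Obj C" for X Y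
  proof -
    have "azero C X Y \<odot> azero C X X = azero C X Y" "azero C X Y \<odot> aid C X = azero C X Y" using that by simp_all
    from this[THEN arg_cong, of mor] show "Zer C X Y \<cdot> Zer C X X = Zer C X Y" "Zer C X Y \<cdot> Ident C X = Zer C X Y"
      by (simp_all only: arrow_mor arrow.sel)
  qed
  have memI: "h \<cdot> f \<in> mor_power (full_subcat C (w_interval C w i j)) (wc_kernel C w P) (Suc n) X Y"
    if "f \<in> mor_power (full_subcat C (w_interval C w i j)) (wc_kernel C w P) n X X" "h \<in> wc_kernel C w P X Y" for n Y f h
    unfolding mor_power.simps(2) full_subcat_sel using that X by blast
  have "Zer C X Y \<in> mor_power (full_subcat C (w_interval C w i j)) (wc_kernel C w P) (Suc n) X Y" if "Y \<in> w_interval C w i j" for n Y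
    using that
  proof (induction n arbitrary: Y)
    case 0
    have "Y \<in> Obj C" using 0 interval_obj by blast
    then show ?case using memI[of "Ident C X" 0 "Zer C X Y" Y] z[of X Y] zc(2)[of X Y] o(1) by (simp add: full_subcat_sel del: mor_power.simps(2))
  next
    case (Suc n)
    have "Y \<in> Obj C" using Suc.prems interval_obj by blast
    then show ?case using memI[OF Suc.IH[OF X], of "Zer C X Y" Y] z[of X Y] zc(1)[of X Y] o(1) by (simp del: mor_power.simps)
  qed
  from this[OF Y, of "nat (j - i)"] show "{Zer C X Y} \<subseteq> mor_power (full_subcat C (w_interval C w i j)) (wc_kernel C w P) (nat (j - i + 1)) X Y"
    using ij by (simp add: nat_add_distrib del: mor_power.simps)
qed

lemma tm_idempotent:
  assumes X: "X \<in> w_bounded C w" and g: "g \<in> Hom C X X" and e: "tm X X g = tm X X (g \<cdot> g)"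
  shows "\<exists>g' \<in> Hom C X X. g' \<cdot> g' = g' \<and> tm X X g' = tm X X g"
proof -
  obtain i j where ij: "X \<in> w_ge C w i" "X \<in> w_le C w j" using X by (auto simp: w_bounded_def w_plus_def w_minus_def)
  have o: "X \<in> Obj C" using ij by (simp add: w_ge_iff)
  have t: "\<guillemotleft>Arrow X X g :\<^bsub>C\<^esub> X \<rightarrow> X\<guillemotright>" using g o by (simp add: arr_Arrow)
  have "wm (N X) (N X) (Arrow X X g) = wm (N X) (N X) (Arrow X X g \<odot> Arrow X X g)"
    using e tm_eq_iff[OF o o g comp_in[OF o o o g g]] by (simp add: acomp_def)
  from idempotent_lift[OF ij gt[OF o] t this] obtain g' where g': "\<guillemotleft>g' :\<^bsub>C\<^esub> X \<rightarrow> X\<guillemotright>" "g' \<odot> g' = g'" "wm (N X) (N X) g' = wm (N X) (N X) (Arrow X X g)"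
    by blast
  have a: "Arrow X X (mor g') = g'" by (rule arrow_eqI) (use g'(1) in simp_all)
  have m: "mor g' \<in> Hom C X X" using g'(1) by (auto simp: arr_def)
  have "mor g' \<cdot> mor g' = mor g'" using arg_cong[OF g'(2), of mor] by (simp only: arrow_mor)
  then show ?thesis
    by (intro bexI[OF _ m]) (simp add: tm_eq[OF o o m] tm_eq[OF o o g] a g'(3))
qed

lemma tm_conservative:
  assumes nd: "non_degenerate C w" and S: "S = w_plus C w \<or> S = w_minus C w"
  shows "conservative_on C KWH tt tm S"
  unfolding conservative_on_def
proof (intro ballI impI)
  fix X Y f assume XY: "X \<in> S" "Y \<in> S" and f: "f \<in> Hom C X Y" and i: "is_iso KWH (tt X) (tt Y) (tm X Y f)"
  have o: "X \<in> Obj C" "Y \<in> Obj C" using XY S by (auto simp: w_plus_def w_minus_def w_ge_iff w_le_iff)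
  have t: "\<guillemotleft>Arrow X Y f :\<^bsub>C\<^esub> X \<rightarrow> Y\<guillemotright>" using f o by (simp add: arr_Arrow)
  have "hw.kw.aiso (wm (N X) (N Y) (Arrow X Y f))"
    using i hw.kw.is_iso_iff[of "tt X" "tt Y" "tm X Y f"] wm_Arrow[OF o f] wm_typed[OF o f] by simp
  then have "aiso (Arrow X Y f)" using conservative[OF nd t gt[OF o(1)] gt[OF o(2)]] XY S by blast
  from aiso_is_iso[OF this] show "is_iso C X Y f" by simp
qed

lemma tm_inj:
  assumes X: "X \<in> w_ge C w a" and X': "X' \<in> w_le C w a"
  shows "inj_on (tm X X') (Hom C X X')"
proof (rule inj_onI)
  fix g h assume gh: "g \<in> Hom C X X'" "h \<in> Hom C X X'" "tm X X' g = tm X X' h"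
  have o: "X \<in> Obj C" "X' \<in> Obj C" using X X' by (simp_all add: w_ge_iff w_le_iff)
  define G H where "G = Arrow X X' g" and "H = Arrow X X' h"
  have t: "\<guillemotleft>G :\<^bsub>C\<^esub> X \<rightarrow> X'\<guillemotright>" "\<guillemotleft>H :\<^bsub>C\<^esub> X \<rightarrow> X'\<guillemotright>" "\<guillemotleft>\<ominus> H :\<^bsub>C\<^esub> X \<rightarrow> X'\<guillemotright>" using gh o by (simp_all add: arr_Arrow G_def H_def)
  have e: "wm (N X) (N X') G = wm (N X) (N X') H" using gh tm_eq_iff[OF o gh(1,2)] by (simp add: G_def H_def)
  note T = gt[OF o(1)] gt[OF o(2)]
  have "wm (N X) (N X') (G \<oplus> \<ominus> H) = azero KWH (cx (N X)) (cx (N X'))"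
    using wm_aplus[OF T t(1,3)] wm_aneg[OF T t(2)] e arr_wm[OF T t(2)] by simp
  then have "G \<oplus> \<ominus> H = azero C X X'" using t by (intro wm_inj[OF X X' T]) simp_all
  then have "G = H" using diff_eq_zero_iff[of G H] t by simp
  then show "g = h" by (simp add: G_def H_def)
qed

lemma tm_surj:
  assumes X: "X \<in> w_ge C w a" and X': "X' \<in> w_le C w (a + 1)"
  shows "tm X X' ` Hom C X X' = Hom KWH (tt X) (tt X')"
proof
  have o: "X \<in> Obj C" "X' \<in> Obj C" using X X' by (simp_all add: w_ge_iff w_le_iff)
  show "tm X X' ` Hom C X X' \<subseteq> Hom KWH (tt X) (tt X')" 
  proof
    fix x assume "x \<in> tm X X' ` Hom C X X'"
    then obtain g where g: "g \<in> Hom C X X'" "x = mor (wm (N X) (N X') (Arrow X X' g))" using tm_eq[OF o] by blast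
    then show "x \<in> Hom KWH (tt X) (tt X')" using mor_in_Hom[OF wm_typed[OF o g(1)]] by simp
  qed
  show "Hom KWH (tt X) (tt X') \<subseteq> tm X X' ` Hom C X X'"
  proof
    fix x assume x: "x \<in> Hom KWH (tt X) (tt X')"
    have "\<guillemotleft>Arrow (tt X) (tt X') x :\<^bsub>KWH\<^esub> cx (N X) \<rightarrow> cx (N X')\<guillemotright>" using x o gt by (simp add: arr_Arrow tt_eq)
    from wm_surj[OF X X' gt[OF o(1)] gt[OF o(2)] this] obtain g where g: "\<guillemotleft>g :\<^bsub>C\<^esub> X \<rightarrow> X'\<guillemotright>" "wm (N X) (N X') g = Arrow (tt X) (tt X') x" by blast
    have a: "Arrow X X' (mor g) = g" "mor g \<in> Hom C X X'" 
      by (rule arrow_eqI) (use g(1) mor_in_Hom[OF g(1)] in simp_all)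
    then have "tm X X' (mor g) = x" using tm_eq[OF o a(2)] g(2) by simp
    then show "x \<in> tm X X' ` Hom C X X'" using a(2) by blast
  qed
qed

end

theorem theorem3p3p1:
  fixes C :: "('o, 'm) tri_cat"
    and w :: "'o set \<times> 'o set"
    and P :: "'o \<Rightarrow> ('o, 'm) tower"
  assumes "triangulated_category C"
    and "weight_structure C w"
    and "\<And>X. X \<in> Obj C \<Longrightarrow> weight_tower C w X (P X)"
  shows "let Hw = heart C w; t = wc_obj C P; tm = wc_mor C w P; I = wc_kernel C w P in
    exact_functor C (Kw Hw) t tm \<and>

    (mor_ideal C I \<and>
     (\<forall>i j. i \<le> j \<longrightarrow> (\<forall>X \<in> w_interval C w i j. \<forall>Y \<in> w_interval C w i j.
        mor_power (full_subcat C (w_interval C w i j)) I (nat (j - i + 1)) X Y = {Zer C X Y}))) \<and>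

    (\<forall>X \<in> w_bounded C w. \<forall>g \<in> Hom C X X. tm X X g = tm X X (g \<cdot>\<^bsub>C\<^esub> g) \<longrightarrow>
       (\<exists>g' \<in> Hom C X X. g' \<cdot>\<^bsub>C\<^esub> g' = g' \<and> tm X X g' = tm X X g)) \<and>

    ((\<forall>i. \<forall>X \<in> w_le C w i. t X \<in> Kw_le Hw i) \<and>
     (\<forall>i. \<forall>X \<in> w_ge C w i. t X \<in> Kw_ge Hw i) \<and>
     (\<forall>i. \<forall>X \<in> w_minus C w. t X \<in> Kw_le Hw i \<longrightarrow> X \<in> w_le C w i) \<and>
     (\<forall>i. \<forall>X \<in> w_plus C w. t X \<in> Kw_ge Hw i \<longrightarrow> X \<in> w_ge C w i)) \<and>

    (non_degenerate C w \<longrightarrow>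
       conservative_on C (Kw Hw) t tm (w_plus C w) \<and>
       conservative_on C (Kw Hw) t tm (w_minus C w)) \<and>

    (\<forall>X \<in> w_interval C w 0 1. \<forall>Y \<in> w_interval C w 0 1.
       isomorphic (Kw Hw) (t X) (t Y) \<longrightarrow> isomorphic C X Y) \<and>

    (\<forall>a. \<forall>X \<in> w_ge C w a.
       (\<forall>X' \<in> w_le C w a. bij_betw (tm X X') (Hom C X X') (Hom (Kw Hw) (t X) (t X'))) \<and>
       (\<forall>X' \<in> w_le C w (a + 1). tm X X' ` Hom C X X' = Hom (Kw Hw) (t X) (t X')))"
proof -
  interpret weight_structure C w by (rule assms(2))
  have "\<exists>T. tower_match X (P X) T" if "X \<in> Obj C" for X
    using tower_match_exists[OF assms(3)[OF that] that] by blast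
  then obtain N where "\<And>X. X \<in> Obj C \<Longrightarrow> tower_match X (P X) (N X)" by metis
  then interpret weight_complex C w P N by unfold_locales
  \<comment> \<open>Surjectivity is available for weights up to $a+1$, and $C^{w<=a}$ is contained
    in $C^{w<=a+1}$.\<close>
  have bij: "bij_betw (tm X X') (Hom C X X') (Hom KWH (tt X) (tt X'))" if "X \<in> w_ge C w a" "X' \<in> w_le C w a" for X X' a
    using tm_inj[OF that] tm_surj[OF that(1) w_le_mono[OF that(2)]] by (simp add: bij_betw_def)
  have o: "X \<in> Obj C" if "X \<in> w_le C w i \<or> X \<in> w_ge C w i \<or> X \<in> w_minus C w \<or> X \<in> w_plus C w" for X i
    using that by (auto simp: w_minus_def w_plus_def w_ge_iff w_le_iff)
  have le: "tt X \<in> Kw_le HW i" if "X \<in> w_le C w i" for X i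
    using complex_bounds(1)[OF gt that] that by (simp add: w_le_iff tt_eq)
  have ge: "tt X \<in> Kw_ge HW i" if "X \<in> w_ge C w i" for X i
    using complex_bounds(2)[OF gt that] that by (simp add: w_ge_iff tt_eq)
  have lec: "X \<in> w_le C w i" if "X \<in> w_minus C w" "tt X \<in> Kw_le HW i" for X i
    using complex_bounds_converse(1)[OF gt that(1)] that o by (simp add: tt_eq)
  have gec: "X \<in> w_ge C w i" if "X \<in> w_plus C w" "tt X \<in> Kw_ge HW i" for X i
    using complex_bounds_converse(2)[OF gt that(1)] that o by (simp add: tt_eq)
  have iso: "isomorphic C X Y" if "X \<in> w_interval C w 0 1" "Y \<in> w_interval C w 0 1" "isomorphic KWH (tt X) (tt Y)" for X Y
    using isomorphic_of_complexes[OF that(1,2) gt gt] that interval_obj[of X] interval_obj[of Y] by (simp add: tt_eq)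
  show ?thesis
    unfolding Let_def
    by (intro conjI allI ballI impI;
        rule tm_exact kernel_ideal kernel_nilpotent tm_idempotent tm_conservative bij le ge lec gec iso tm_surj; (assumption | simp))
qed

end
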